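(* Let $a>0$ and $S=\{(x_1,x_2)\in\mathbb{R}^2 : x_1\in\mathbb{R},\ 0<x_2<a\}$. There exist constants $c,C>0$ such that for every $V\ge 0$ that is integrable on bounded subsets of $S$, $$N_-(q_{V,S})\le 1+C\left(\sum_{\{n\in\mathbb{Z}:\ \mathcal{G}_n>c\}}\sqrt{\mathcal{G}_n}+\sum_{\{n\in\mathbb{Z}:\ \mathcal{D}_n>c\}}\mathcal{D}_n\right).$$
   Context: The number $a>0$ is fixed. For $V\ge 0$ integrable on bounded subsets of $S$, define the quadratic form $$q_{V,S}[u]=\int_S|\nabla u(x)|^2\,dx-\int_S V(x)|u(x)|^2\,dx,\qquad \mathrm{Dom}(q_{V,S})=W^1_2(S)\cap L^2(S,V\,dx),$$ where $W^1_2(S)=H^1(S)$ is the standard Sobolev space (this is the form of the operator $-\Delta-V$ on $L^2(S)$ with Neumann boundary conditions). The number of negative eigenvalues is $$N_-(q_{V,S})=\sup\{\dim L : L\text{ a linear subspace of }\mathrm{Dom}(q_{V,S}),\ q_{V,S}[u]<0\ \forall u\in L\setminus\{0\}\}.$$ Let $I_n=[2^{n-1},2^n]$ for $n>0$, $I_0=[-1,1]$, $I_n=[-2^{|n|},-2^{|n|-1}]$ for $n<0$, and $$\mathcal{G}_n=\int_{I_n}\int_0^a|x_1|V(x)\,dx_2\,dx_1\ (n\ne0),\qquad \mathcal{G}_0=\int_{I_0}\int_0^aV(x)\,dx_2\,dx_1 .$$ Let $\mathcal{A}(s)=e^{|s|}-1-|s|$ and $\mathcal{B}(s)=(1+|s|)\ln(1+|s|)-|s|$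 (mutually complementary $N$-functions). For a measurable function $f$ on an interval $I\subset\mathbb{R}$ (with Lebesgue measure) put $$\|f\|_{\mathcal{B},I}=\sup\left\{\left|\int_I fg\,dx\right| : \int_I\mathcal{A}(|g|)\,dx\le1\right\},$$ and for intervals $J,I$ and measurable $f$ on $J\times I$ put $\|f\|_{L_1(J,L_{\mathcal{B}}(I))}=\int_J\|f(x_1,\cdot)\|_{\mathcal{B},I}\,dx_1$. With $J_n=(n,n+1)$, $n\in\mathbb{Z}$, and $I=(0,a)$, set $\mathcal{D}_n=\|V\|_{L_1(J_n,L_{\mathcal{B}}(I))}$ (possibly $+\infty$). *)

theory Defs
  imports "HOL-Analysis.Analysis" "HOL-Library.Function_Algebras"
begin

primrec C_k :: "nat \<Rightarrow> ('a::euclidean_space \<Rightarrow> real) \<Rightarrow> bool" where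
  "C_k 0 f \<longleftrightarrow> continuous_on UNIV f"
| "C_k (Suc k) f \<longleftrightarrow>
     (\<forall>x. f differentiable (at x)) \<and> (\<forall>e\<in>Basis. C_k k (\<lambda>x. frechet_derivative f (at x) e))"

definition test_functions :: "'a::euclidean_space set \<Rightarrow> ('a \<Rightarrow> real) set" where
  "test_functions S =
     {\<phi>. (\<forall>k. C_k k \<phi>) \<and> (\<exists>K. compact K \<and> K \<subseteq> S \<and> (\<forall>x. x \<notin> K \<longrightarrow> \<phi> x = 0))}"

text \<open>Elements of \<open>L\<^sup>2\<close> are represented by functions on the whole space; only the values
  on \<open>S\<close> matter, and functions that agree almost everywhere on \<open>S\<close> represent the same element.\<close>

definition L2 :: "'a::euclidean_space set \<Rightarrow> ('a \<Rightarrow> complex) set" where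
  "L2 S = {u \<in> borel_measurable (lebesgue_on S). integrable (lebesgue_on S) (\<lambda>x. (cmod (u x))\<^sup>2)}"

definition has_weak_partial ::
    "'a::euclidean_space set \<Rightarrow> 'a \<Rightarrow> ('a \<Rightarrow> complex) \<Rightarrow> ('a \<Rightarrow> complex) \<Rightarrow> bool" where
  "has_weak_partial S e u g \<longleftrightarrow>
     (\<forall>\<phi>\<in>test_functions S.
        (\<integral>x. u x * of_real (frechet_derivative \<phi> (at x) e) \<partial>lebesgue_on S) =
        - (\<integral>x. g x * of_real (\<phi> x) \<partial>lebesgue_on S))"

definition W12 :: "'a::euclidean_space set \<Rightarrow> ('a \<Rightarrow> complex) set" where
  "W12 S = {u \<in> L2 S. \<forall>e\<in>Basis. \<exists>g\<in>L2 S. has_weak_partial S e u g}"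

text \<open>For \<open>u\<close> in \<open>W12 S\<close> with \<open>S\<close> open, the chosen function is unique up to null sets.\<close>

definition weak_partial :: "'a::euclidean_space set \<Rightarrow> 'a \<Rightarrow> ('a \<Rightarrow> complex) \<Rightarrow> 'a \<Rightarrow> complex" where
  "weak_partial S e u = (SOME g. g \<in> L2 S \<and> has_weak_partial S e u g)"

definition q_form :: "('a::euclidean_space \<Rightarrow> real) \<Rightarrow> 'a set \<Rightarrow> ('a \<Rightarrow> complex) \<Rightarrow> real" where
  "q_form V S u =
     (\<integral>x. (\<Sum>e\<in>Basis. (cmod (weak_partial S e u x))\<^sup>2) \<partial>lebesgue_on S)
     - (\<integral>x. V x * (cmod (u x))\<^sup>2 \<partial>lebesgue_on S)"

definition q_dom :: "('a::euclidean_space \<Rightarrow> real) \<Rightarrow> 'a set \<Rightarrow> ('a \<Rightarrow> complex) set" where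
  "q_dom V S = {u \<in> W12 S. integrable (lebesgue_on S) (\<lambda>x. V x * (cmod (u x))\<^sup>2)}"

global_interpretation cfun: vector_space "\<lambda>(c::complex) (u::'a \<Rightarrow> complex) x. c * u x"
  by unfold_locales (auto simp: fun_eq_iff algebra_simps)

definition ae_independent :: "'a::euclidean_space set \<Rightarrow> ('a \<Rightarrow> complex) set \<Rightarrow> bool" where
  "ae_independent S F \<longleftrightarrow>
     (\<forall>c. (AE x in lebesgue_on S. (\<Sum>u\<in>F. c u * u x) = 0) \<longrightarrow> (\<forall>u\<in>F. c u = 0))"

text \<open>The complex dimension of the space of classes modulo equality almost everywhere on \<open>S\<close>.\<close>

definition ae_dim :: "'a::euclidean_space set \<Rightarrow> ('a \<Rightarrow> complex) set \<Rightarrow> enat" where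
  "ae_dim S L = (SUP F \<in> {F. finite F \<and> F \<subseteq> L \<and> ae_independent S F}. enat (card F))"

definition N_minus :: "('a::euclidean_space \<Rightarrow> real) \<Rightarrow> 'a set \<Rightarrow> enat" where
  "N_minus V S =
     (SUP L \<in> {L. cfun.subspace L \<and> L \<subseteq> q_dom V S \<and>
                 (\<forall>u\<in>L. \<not> (AE x in lebesgue_on S. u x = 0) \<longrightarrow> q_form V S u < 0)}. ae_dim S L)"

definition strip :: "real \<Rightarrow> (real \<times> real) set" where
  "strip a = {x. 0 < snd x \<and> snd x < a}"

definition integrable_on_bounded_subsets :: "'a::euclidean_space set \<Rightarrow> ('a \<Rightarrow> real) \<Rightarrow> bool" where
  "integrable_on_bounded_subsets S V \<longleftrightarrow>
     (\<forall>B \<in> sets lebesgue. B \<subseteq> S \<longrightarrow> bounded B \<longrightarrow> integrable (lebesgue_on B) V)"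

definition I_int :: "int \<Rightarrow> real set" where
  "I_int n = (if n > 0 then {2 powi (n - 1)..2 powi n}
              else if n = 0 then {-1..1}
              else {- (2 powi \<bar>n\<bar>)..- (2 powi (\<bar>n\<bar> - 1))})"

definition G :: "real \<Rightarrow> (real \<times> real \<Rightarrow> real) \<Rightarrow> int \<Rightarrow> real" where
  "G a V n =
     (if n \<noteq> 0
      then \<integral>x1. (\<integral>x2. \<bar>x1\<bar> * V (x1, x2) \<partial>lebesgue_on {0<..<a}) \<partial>lebesgue_on (I_int n)
      else \<integral>x1. (\<integral>x2. V (x1, x2) \<partial>lebesgue_on {0<..<a}) \<partial>lebesgue_on (I_int 0))"

definition N_fun_A :: "real \<Rightarrow> real" where
  "N_fun_A s = exp \<bar>s\<bar> - 1 - \<bar>s\<bar>"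

text \<open>The Orlicz norm of \<open>L\<^sub>B\<close>, where \<open>B s = (1 + \<bar>s\<bar>) * ln (1 + \<bar>s\<bar>) - \<bar>s\<bar>\<close> is
  complementary to \<open>N_fun_A\<close>; only the latter enters the norm. If \<open>f * g\<close> is not integrable, the
  inner integral is \<open>0\<close> by convention. This does not change the supremum: replacing
  \<open>g\<close> by \<open>\<bar>g\<bar> * sgn f\<close> cut off to \<open>{x. \<bar>f x * g x\<bar> \<le> k}\<close>, with \<open>k\<close> tending to
  infinity, shows that it is then infinite.\<close>

definition norm_B :: "real set \<Rightarrow> (real \<Rightarrow> real) \<Rightarrow> ennreal" where
  "norm_B I f =
     (SUP g \<in> {g \<in> borel_measurable (lebesgue_on I).
               (\<integral>\<^sup>+x. ennreal (N_fun_A \<bar>g x\<bar>) \<partial>lebesgue_on I) \<le> 1}.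
        ennreal \<bar>\<integral>x. f x * g x \<partial>lebesgue_on I\<bar>)"

definition norm_L1_B :: "real set \<Rightarrow> real set \<Rightarrow> (real \<times> real \<Rightarrow> real) \<Rightarrow> ennreal" where
  "norm_L1_B J I f = (\<integral>\<^sup>+x1. norm_B I (\<lambda>x2. f (x1, x2)) \<partial>lebesgue_on J)"

definition D :: "real \<Rightarrow> (real \<times> real \<Rightarrow> real) \<Rightarrow> int \<Rightarrow> ennreal" where
  "D a V n = norm_L1_B {real_of_int n<..<real_of_int n + 1} {0<..<a} V"

end

theory Submission
  imports Defs
begin

text \<open>If the form is nonnegative on all functions whose integrals over \<open>k\<close> given bounded sets vanish,
  then it has at most \<open>k\<close> negative directions. Split \<open>u\<close> into its mean over the cross section
  and an oscillating remainder; their gradients are orthogonal, so each part may be treated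
  separately.

  The mean is a function of \<open>x\<^sub>1\<close> alone. Once its integral over \<open>[-1, 1]\<close> vanishes, a Hardy inequality
  absorbs all dyadic intervals with small \<open>G\<^sub>n\<close>; each of the others is cut into about \<open>\<surd>G\<^sub>n\<close> pieces that
  balance length and mass of the potential, and the mean is made to vanish on every piece.

  For the remainder, a mean zero function on a rectangle \<open>R\<close> of bounded eccentricity satisfies
  \<open>\<integral>\<^sub>R V \<bar>u\<bar>\<^sup>2 \<le> C \<mu>(R) \<integral>\<^sub>R \<bar>\<nabla>u\<bar>\<^sup>2\<close>, where \<open>\<mu>\<close> has density \<open>V ln\<^sub>+ (V / \<phi>) + \<phi>\<close> and \<open>\<phi>\<close> may be any
  positive function of \<open>x\<^sub>1\<close>. This follows from Young's inequality, because a potential estimate with the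
  weight \<open>\<bar>z\<bar>\<^sup>-\<^sup>1\<^sup>/\<^sup>2\<close> makes \<open>exp (\<lambda> \<bar>u\<bar>\<^sup>2)\<close> integrable uniformly over vertical segments. With \<open>\<phi>\<close> close to the
  column mean of \<open>V\<close>, \<open>\<mu>\<close> of a unit cell is controlled by \<open>D\<^sub>n\<close>. A cell with large \<open>D\<^sub>n\<close> is covered, with
  bounded overlap, by about \<open>D\<^sub>n\<close> squares on which \<open>\<mu>\<close> is a small constant.\<close>

text \<open>\<open>D\<close> uses an Orlicz norm in \<open>x2\<close> only, integrated in
  \<open>x1\<close>. Hence \<open>\<phi>\<close> varies with \<open>x1\<close>, and Young's
  inequality needs an exponential integral bounded on every vertical segment. Plain Cauchy-Schwarz
  for the kernel \<open>1/|z|\<close> fails, as its square is not integrable in the plane; the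
  weight bounds the kernel by the logarithm of a potential whose own kernel is still integrable
  along lines. Weak derivatives are tested on the open strip only, whereas the rectangles reach its
  boundary. They are therefore traded for identities between integrals over shifted rectangles,
  which are stable under column means and differences and make Steklov averages continuously
  differentiable. The 1 in the bound is the functional on \<open>[-1, 1]\<close>. Cells with small
  \<open>D\<close> cost no functional, since the oscillating part has mean zero on every full-height
  rectangle. A condition on the oscillating part over a smaller rectangle costs two conditions on
  \<open>u\<close>: one on the rectangle and one on the full-height rectangle over the same
  base.\<close>

type_synonym plane = "real \<times> real"

abbreviation "ind \<equiv> indicator"

abbreviation "BM \<equiv> borel_measurable borel"

abbreviation nn_integral_lborel (binder "NN " 10) where
  "nn_integral_lborel f \<equiv> nn_integral lborel f"

abbreviation sint :: "'a::euclidean_space set \<Rightarrow> ('a \<Rightarrow> 'b::{banach, second_countable_topology}) \<Rightarrow> 'b" where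
  "sint E f \<equiv> (LINT x|lborel. indicator E x *\<^sub>R f x)"

abbreviation nsq :: "complex \<Rightarrow> real" where
  "nsq z \<equiv> (cmod z)\<^sup>2"

abbreviation esq :: "complex \<Rightarrow> ennreal" where
  "esq z \<equiv> ennreal (nsq z)"

abbreviation sq_int :: "('a::euclidean_space \<Rightarrow> complex) \<Rightarrow> bool" where
  "sq_int u \<equiv> integrable lborel (\<lambda>z. nsq (u z))"

abbreviation cell :: "real \<Rightarrow> int \<Rightarrow> plane set" where
  "cell a n \<equiv> {real_of_int n..real_of_int n + 1} \<times> {0..a}"

subsection \<open>Homogeneous systems and smooth functions of one variable\<close>

text \<open>Gaussian elimination, one equation at a time. This is the linear algebra behind the
  count of negative directions: more independent functions than functionals leave a nonzero
  combination on which all functionals vanish.\<close>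

lemma homogeneous_solution:
  fixes l :: "'i \<Rightarrow> 'u \<Rightarrow> complex"
  assumes "finite E" "finite F" "card E < card F"
  shows "\<exists>c. (\<exists>u\<in>F. c u \<noteq> 0) \<and> (\<forall>e\<in>E. (\<Sum>u\<in>F. c u * l e u) = 0)"
  using assms
proof (induction E arbitrary: F l rule: finite_induct)
  case empty
  then obtain u where "u \<in> F" by fastforce
  then show ?case by (intro exI[of _ "\<lambda>_. 1"]) auto
next
  case (insert e E)
  show ?case
  proof (cases "\<forall>u\<in>F. l e u = 0")
    case True
    have "card E < card F" using insert by simp
    from insert.IH[OF insert.prems(1) this, of l] True show ?thesis by force
  next
    case False
    then obtain v where v: "v \<in> F" "l e v \<noteq> 0" by blast
    \<comment> \<open>The remaining equations after \<open>c v\<close> has been expressed by the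
      other coefficients through equation \<open>e\<close>.\<close>
    define l' where "l' e' u = l e' u - l e u / l e v * l e' v" for e' u
    have "card E < card (F - {v})" using insert v by (simp add: card_Diff_singleton)
    from insert.IH[OF _ this, of l'] insert.prems(1)
    obtain c where c: "\<exists>u\<in>F - {v}. c u \<noteq> 0" "\<forall>e\<in>E. (\<Sum>u\<in>F - {v}. c u * l' e u) = 0" by auto
    define c' where "c' = c(v := - (\<Sum>u\<in>F - {v}. c u * l e u) / l e v)"
    have s: "(\<Sum>u\<in>F. c' u * l e' u) =
        (\<Sum>u\<in>F - {v}. c u * l e' u) - (\<Sum>u\<in>F - {v}. c u * l e u) / l e v * l e' v" for e'
    proof -
      have "(\<Sum>u\<in>F - {v}. c' u * l e' u) = (\<Sum>u\<in>F - {v}. c u * l e' u)"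
        by (intro sum.cong) (auto simp: c'_def)
      then show ?thesis
        using v(1) insert.prems(1) by (subst sum.remove[of F v]) (auto simp: c'_def)
    qed
    have "(\<Sum>u\<in>F. c' u * l e' u) = 0" if "e' \<in> E" for e'
    proof -
      have "(\<Sum>u\<in>F - {v}. c u * l' e' u) =
          (\<Sum>u\<in>F - {v}. c u * l e' u) - (\<Sum>u\<in>F - {v}. c u * l e u) / l e v * l e' v"
        by (simp add: l'_def right_diff_distrib sum_subtractf sum_divide_distrib sum_distrib_right mult.assoc)
      with c(2) that s show ?thesis by simp
    qed
    moreover have "(\<Sum>u\<in>F. c' u * l e u) = 0" using v(2) by (simp add: s)
    moreover have "\<exists>u\<in>F. c' u \<noteq> 0" using c(1) by (auto simp: c'_def)
    ultimately show ?thesis by auto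
  qed
qed

section \<open>Smooth functions of one variable and their products\<close>

primrec smooth_k :: "nat \<Rightarrow> (real \<Rightarrow> real) \<Rightarrow> bool" where
  "smooth_k 0 f \<longleftrightarrow> continuous_on UNIV f"
| "smooth_k (Suc k) f \<longleftrightarrow> (\<exists>f'. (\<forall>x. (f has_real_derivative f' x) (at x)) \<and> smooth_k k f')"

lemma smooth_k_continuous: "smooth_k k f \<Longrightarrow> continuous_on UNIV f"
  by (cases k) (auto simp: continuous_on_eq_continuous_at intro: DERIV_isCont)

lemma smooth_k_SucD: "smooth_k (Suc k) f \<Longrightarrow> smooth_k k f"
proof (induction k arbitrary: f)
  case 0 then show ?case using smooth_k_continuous[of "Suc 0"] by simp
next
  case (Suc k)
  then show ?case by (metis smooth_k.simps(2))
qed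

lemma smooth_k_add: "smooth_k k f \<Longrightarrow> smooth_k k g \<Longrightarrow> smooth_k k (\<lambda>x. f x + g x)"
proof (induction k arbitrary: f g)
  case 0 then show ?case by (auto intro: continuous_intros)
next
  case (Suc k)
  from Suc.prems obtain f' g' where
    "\<forall>x. (f has_real_derivative f' x) (at x)" "smooth_k k f'"
    "\<forall>x. (g has_real_derivative g' x) (at x)" "smooth_k k g'" by auto
  then show ?case using Suc.IH
    by (auto intro!: exI[of _ "\<lambda>x. f' x + g' x"] derivative_intros)
qed

lemma smooth_k_mult: "smooth_k k f \<Longrightarrow> smooth_k k g \<Longrightarrow> smooth_k k (\<lambda>x. f x * g x)"
proof (induction k arbitrary: f g)
  case 0 then show ?case by (auto intro: continuous_intros)
next
  case (Suc k)
  from Suc.prems obtain f' g' where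
    *: "\<forall>x. (f has_real_derivative f' x) (at x)" "smooth_k k f'"
    "\<forall>x. (g has_real_derivative g' x) (at x)" "smooth_k k g'" by auto
  have "smooth_k k f" "smooth_k k g" using Suc.prems smooth_k_SucD by blast+
  then have "smooth_k k (\<lambda>x. f' x * g x + g' x * f x)"
    using * by (intro smooth_k_add Suc.IH)
  then show ?case using * 
    by (auto intro!: exI[of _ "\<lambda>x. f' x * g x + g' x * f x"] DERIV_mult)
qed

lemma smooth_k_const: "smooth_k k (\<lambda>x. c)"
  by (induction k arbitrary: c) (auto intro!: exI[of _ "\<lambda>x. 0"])

lemma smooth_k_affine: "smooth_k k f \<Longrightarrow> smooth_k k (\<lambda>x. f (m * x + c))"
proof (induction k arbitrary: f)
  case 0 then show ?case
    by (auto intro!: continuous_intros continuous_on_compose2[of UNIV f])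
next
  case (Suc k)
  from Suc.prems obtain f' where
    *: "\<And>x. (f has_real_derivative f' x) (at x)" "smooth_k k f'" by auto
  have "((\<lambda>x. f (m * x + c)) has_real_derivative f' (m * x + c) * m) (at x)" for x
    by (rule DERIV_chain2[OF *(1)]) (auto intro!: derivative_eq_intros)
  moreover have "smooth_k k (\<lambda>x. f' (m * x + c) * m)"
    by (intro smooth_k_mult Suc.IH[OF *(2)] smooth_k_const)
  ultimately show ?case by (auto intro!: exI[of _ "\<lambda>x. f' (m * x + c) * m"])
qed

text \<open>The powers of \<open>1 / x\<close> make the family closed under differentiation, so
  smoothness of \<open>exp (- (1 / x))\<close>, continued by 0, follows by induction for all
  \<open>n\<close> at once.\<close>

definition flat_exp :: "nat \<Rightarrow> real \<Rightarrow> real" where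
  "flat_exp n x = (if x \<le> 0 then 0 else (1 / x) ^ n * exp (- (1 / x)))"

lemma flat_exp_nonneg: "0 \<le> flat_exp n x"
  by (simp add: flat_exp_def)

text \<open>One term of the exponential series bounds \<open>exp (1 / x)\<close> from below. The
  quadratic decay makes every member of the family differentiable at 0 with derivative 0.\<close>

lemma flat_exp_le: "flat_exp n x \<le> fact (n + 2) * x\<^sup>2"
proof (cases "x \<le> 0")
  case False
  define y where "y = 1 / x"
  have y: "y > 0" using False by (simp add: y_def)
  have "y ^ (n + 2) / fact (n + 2) \<le> exp y"
  proof -
    have "(\<Sum>k\<in>{n+2}. y ^ k /\<^sub>R fact k) \<le> (\<Sum>k. y ^ k /\<^sub>R fact k)"
      by (rule sum_le_suminf) (use y summable_exp_generic[of y] in auto)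
    then show ?thesis by (simp add: exp_def divide_inverse mult.commute)
  qed
  then have "y ^ n * exp (- y) \<le> fact (n + 2) / y\<^sup>2"
    using y by (simp add: exp_minus divide_simps power_add power2_eq_square mult.commute del: fact_Suc add_2_eq_Suc')
  then show ?thesis using False by (simp add: flat_exp_def y_def power_divide)
qed (simp add: flat_exp_def)

lemma flat_exp_deriv:
  "(flat_exp n has_real_derivative flat_exp (n + 2) x - real n * flat_exp (n + 1) x) (at x)"
proof -
  consider "x < 0" | "x = 0" | "x > 0" by linarith
  then show ?thesis
  proof cases
    case 1
    have "(flat_exp n has_real_derivative 0) (at x)"
      by (rule has_field_derivative_transform_within_open[of "\<lambda>_. 0" _ _ "{..<0}"])
        (use 1 in \<open>auto simp: flat_exp_def\<close>)
    then show ?thesis using 1 by (simp add: flat_exp_def)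
  next
    case 2
    have "(\<lambda>h. (flat_exp n (0 + h) - flat_exp n 0) / h) \<midarrow>0\<rightarrow> 0"
    proof (rule Lim_null_comparison[where g = "\<lambda>h. fact (n + 2) * \<bar>h\<bar>"])
      show "\<forall>\<^sub>F h in at 0. norm ((flat_exp n (0 + h) - flat_exp n 0) / h) \<le> fact (n + 2) * \<bar>h\<bar>"
      proof (rule always_eventually, rule allI)
        fix h :: real
        define K :: real where "K = fact (n + 2)"
        have "\<bar>flat_exp n h\<bar> \<le> K * h\<^sup>2"
          using flat_exp_le[of n h] flat_exp_nonneg[of n h] by (simp add: K_def)
        then show "norm ((flat_exp n (0 + h) - flat_exp n 0) / h) \<le> fact (n + 2) * \<bar>h\<bar>"
          unfolding K_def[symmetric]
          by (cases "h = 0") (auto simp: flat_exp_def[of n 0] divide_le_eq power2_eq_square mult.assoc)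
      qed
      show "(\<lambda>h. fact (n + 2) * \<bar>h\<bar>) \<midarrow>(0::real)\<rightarrow> 0"
        using tendsto_mult_right_zero[OF tendsto_rabs_zero[OF tendsto_ident_at]] .
    qed
    then show ?thesis using 2 by (simp add: DERIV_def flat_exp_def)
  next
    case 3
    have "((\<lambda>x. (1 / x) ^ n * exp (- (1 / x))) has_real_derivative
        flat_exp (n + 2) x - real n * flat_exp (n + 1) x) (at x)"
    proof -
      have "((\<lambda>x. 1 / x) has_real_derivative - ((1 / x) ^ 2)) (at x)"
        using 3 by (auto intro!: derivative_eq_intros simp: power2_eq_square)
      then have "((\<lambda>x. (1 / x) ^ n * exp (- (1 / x))) has_real_derivative
          real n * (- ((1 / x) ^ 2) * (1 / x) ^ (n - Suc 0)) * exp (- (1 / x)) +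
          exp (- (1 / x)) * (- (- ((1 / x) ^ 2))) * (1 / x) ^ n) (at x)"
        by (intro DERIV_mult DERIV_power DERIV_fun_exp DERIV_minus)
      moreover have "real n * (- ((1 / x) ^ 2) * (1 / x) ^ (n - Suc 0)) = - (real n * (1 / x) ^ (n + 1))"
        by (cases n) (auto simp: power2_eq_square)
      moreover have "- (real n * (1 / x) ^ (n + 1)) * exp (- (1 / x)) +
          exp (- (1 / x)) * (- (- ((1 / x) ^ 2))) * (1 / x) ^ n =
          flat_exp (n + 2) x - real n * flat_exp (n + 1) x"
        using 3 by (simp add: flat_exp_def power_add power2_eq_square mult_ac)
      ultimately show ?thesis by simp
    qed
    then show ?thesis
      by (rule has_field_derivative_transform_within_open[of _ _ _ "{0<..}"])
        (use 3 in \<open>auto simp: flat_exp_def\<close>)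
  qed
qed

lemma smooth_k_flat_exp: "smooth_k k (flat_exp n)"
proof (induction k arbitrary: n)
  case 0
  show ?case using DERIV_isCont[OF flat_exp_deriv] by (simp add: continuous_on_eq_continuous_at)
next
  case (Suc k)
  have "smooth_k k (\<lambda>x. flat_exp (n + 2) x + (- real n) * flat_exp (n + 1) x)"
    by (intro smooth_k_add smooth_k_mult smooth_k_const Suc)
  then show ?case using flat_exp_deriv[of n]
    by (auto intro!: exI[of _ "\<lambda>x. flat_exp (n + 2) x - real n * flat_exp (n + 1) x"])
qed

text \<open>Links \<open>smooth_k\<close>, whose existential derivative suits induction, to the
  \<open>frechet_derivative\<close> in \<open>C_k\<close>. Both partial derivatives are again
  products, so the induction closes. Products are the only test functions inserted into the weak
  derivatives.\<close>

lemma C_k_product: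
  "smooth_k k f \<Longrightarrow> smooth_k k g \<Longrightarrow> C_k k (\<lambda>x::plane. f (fst x) * g (snd x))"
proof (induction k arbitrary: f g)
  case 0 then show ?case
    by (auto intro!: continuous_intros continuous_on_compose2[of UNIV f] continuous_on_compose2[of UNIV g])
next
  case (Suc k)
  from Suc.prems obtain f' g' where
    *: "\<And>x. (f has_real_derivative f' x) (at x)" "smooth_k k f'"
    "\<And>x. (g has_real_derivative g' x) (at x)" "smooth_k k g'" by auto
  have "smooth_k k f" "smooth_k k g" using Suc.prems smooth_k_SucD by blast+
  have D: "((\<lambda>x::plane. f (fst x) * g (snd x)) has_derivative
      (\<lambda>h. fst h * (f' (fst x) * g (snd x)) + snd h * (f (fst x) * g' (snd x)))) (at x)" for x
  proof -
    have "((\<lambda>x. f (fst x)) has_derivative (\<lambda>h. f' (fst x) * fst h)) (at x)"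
      by (rule has_derivative_compose[OF has_derivative_fst[OF has_derivative_ident] *(1)[THEN has_field_derivative_imp_has_derivative]])
    moreover have "((\<lambda>x. g (snd x)) has_derivative (\<lambda>h. g' (snd x) * snd h)) (at x)"
      by (rule has_derivative_compose[OF has_derivative_snd[OF has_derivative_ident] *(3)[THEN has_field_derivative_imp_has_derivative]])
    ultimately show ?thesis
      by (rule has_derivative_eq_rhs[OF has_derivative_mult]) (auto simp: fun_eq_iff algebra_simps)
  qed
  have F: "frechet_derivative (\<lambda>x::plane. f (fst x) * g (snd x)) (at x) =
      (\<lambda>h. fst h * (f' (fst x) * g (snd x)) + snd h * (f (fst x) * g' (snd x)))" for x
    using frechet_derivative_at[OF D] by simp
  have "C_k k (\<lambda>x::plane. f' (fst x) * g (snd x))" "C_k k (\<lambda>x::plane. f (fst x) * g' (snd x))"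
    by (intro Suc.IH * \<open>smooth_k k f\<close> \<open>smooth_k k g\<close>)+
  then show ?case using D unfolding C_k.simps F
    by (auto simp: Basis_prod_def differentiable_def)
qed

subsection \<open>Weak derivatives integrated over rectangles\<close>

lemma fst_borel_measurable [measurable]: "fst \<in> borel_measurable (borel :: plane measure)"
  by (intro borel_measurable_continuous_onI continuous_intros)

lemma snd_borel_measurable [measurable]: "snd \<in> borel_measurable (borel :: plane measure)"
  by (intro borel_measurable_continuous_onI continuous_intros)

text \<open>Smooth cut-offs between 0 and 1, supported in the compact interval from
  \<open>p + 1 / Suc k\<close> to \<open>q - 1 / Suc k\<close> and tending pointwise to the
  indicator of the open interval.\<close>

definition bump :: "real \<Rightarrow> real \<Rightarrow> nat \<Rightarrow> real \<Rightarrow> real" where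
  "bump p q k x = flat_exp 0 (real (Suc k) * (x - p) - 1) * flat_exp 0 (real (Suc k) * (q - x) - 1)"

lemma smooth_k_bump: "smooth_k n (bump p q k)"
proof -
  have "smooth_k n (\<lambda>x. flat_exp 0 (real (Suc k) * x + (- (real (Suc k) * p + 1))) *
      flat_exp 0 ((- real (Suc k)) * x + (real (Suc k) * q - 1)))"
    by (intro smooth_k_mult smooth_k_affine smooth_k_flat_exp)
  also have "(\<lambda>x. flat_exp 0 (real (Suc k) * x + (- (real (Suc k) * p + 1))) *
      flat_exp 0 ((- real (Suc k)) * x + (real (Suc k) * q - 1))) = bump p q k"
    unfolding bump_def by (auto simp: fun_eq_iff algebra_simps)
  finally show ?thesis .
qed

lemma flat_exp_0_le_1: "flat_exp 0 x \<le> 1"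
  by (simp add: flat_exp_def)

lemma bump_bounds: "0 \<le> bump p q k x" "bump p q k x \<le> 1"
  by (auto simp: bump_def intro!: mult_le_one flat_exp_nonneg flat_exp_0_le_1 mult_nonneg_nonneg)

lemma bump_eq_0: "x \<notin> {p + 1 / Suc k..q - 1 / Suc k} \<Longrightarrow> bump p q k x = 0"
proof -
  assume "x \<notin> {p + 1 / Suc k..q - 1 / Suc k}"
  then have "x - p < 1 / Suc k \<or> q - x < 1 / Suc k" by auto
  then have "real (Suc k) * (x - p) - 1 \<le> 0 \<or> real (Suc k) * (q - x) - 1 \<le> 0"
    by (auto simp: field_simps simp del: of_nat_Suc)
  then show ?thesis unfolding bump_def by (auto simp: flat_exp_def)
qed

lemma flat_exp_0_tendsto: "x > 0 \<Longrightarrow> (\<lambda>k. flat_exp 0 (real (Suc k) * x - 1)) \<longlonglongrightarrow> 1"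
proof -
  assume x: "x > 0"
  have "filterlim (\<lambda>k. x * real (Suc k)) at_top sequentially"
    by (rule filterlim_tendsto_pos_mult_at_top[OF tendsto_const x])
      (use filterlim_compose[OF filterlim_real_sequentially filterlim_Suc] in simp)
  then have "filterlim (\<lambda>k. (- 1) + x * real (Suc k)) at_top sequentially"
    by (rule filterlim_tendsto_add_at_top[OF tendsto_const])
  then have lim: "filterlim (\<lambda>k. real (Suc k) * x - 1) at_top sequentially"
    by (simp add: algebra_simps)
  have "(\<lambda>k. exp (- (1 / (real (Suc k) * x - 1)))) \<longlonglongrightarrow> exp (- 0)"
    by (intro tendsto_exp tendsto_minus tendsto_divide_0[OF tendsto_const] filterlim_at_top_imp_at_infinity lim)
  then have "(\<lambda>k. exp (- (1 / (real (Suc k) * x - 1)))) \<longlonglongrightarrow> 1" by simp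
  moreover have "\<forall>\<^sub>F k in sequentially. exp (- (1 / (real (Suc k) * x - 1))) = flat_exp 0 (real (Suc k) * x - 1)"
    using filterlim_at_top_dense[THEN iffD1, OF lim, rule_format, of 0]
    by eventually_elim (simp add: flat_exp_def)
  ultimately show ?thesis by (rule Lim_transform_eventually)
qed

lemma bump_outside: "x \<notin> {p<..<q} \<Longrightarrow> bump p q k x = 0"
proof (rule bump_eq_0)
  assume "x \<notin> {p<..<q}"
  moreover have "1 / real (Suc k) > 0" by simp
  ultimately show "x \<notin> {p + 1 / Suc k..q - 1 / Suc k}"
    unfolding atLeastAtMost_iff greaterThanLessThan_iff by linarith
qed

lemma bump_tendsto: "(\<lambda>k. bump p q k x) \<longlonglongrightarrow> ind {p<..<q} x"
proof (cases "x \<in> {p<..<q}")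
  case True
  then have "(\<lambda>k. flat_exp 0 (real (Suc k) * (x - p) - 1) * flat_exp 0 (real (Suc k) * (q - x) - 1)) \<longlonglongrightarrow> 1 * 1"
    by (intro tendsto_mult flat_exp_0_tendsto) auto
  then show ?thesis using True by (simp add: bump_def)
next
  case False
  then have "bump p q k x = 0" for k by (rule bump_outside)
  then show ?thesis using False by simp
qed

lemma bump_measurable [measurable]: "bump p q k \<in> BM"
  using smooth_k_bump[of 0] by (simp add: borel_measurable_continuous_onI)

text \<open>A convolution of the indicator of \<open>(s, t)\<close> with a bump. Its derivative is
  the difference of the bumps shifted by \<open>s\<close> and \<open>t\<close>, so testing with it
  compares the integrals of \<open>u\<close> over two translates of one rectangle.\<close>

definition bump_step :: "real \<Rightarrow> real \<Rightarrow> real \<Rightarrow> nat \<Rightarrow> real \<Rightarrow> real" where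
  "bump_step s t h k x = (sint {s<..<t} (\<lambda>r. bump 0 h k (x - r)))"

lemma bump_step_deriv:
  assumes "s \<le> t"
  shows "(bump_step s t h k has_real_derivative bump 0 h k (x - s) - bump 0 h k (x - t)) (at x)"
proof -
  let ?b = "bump 0 h k"
  \<comment> \<open>A primitive of the bump. As a function of \<open>r\<close>,
    \<open>- P (x - r)\<close> is a primitive of \<open>bump 0 h k (x - r)\<close>, so the step is a
    difference of two shifts of \<open>P\<close>.\<close>
  define P where "P x = (LBINT y=0..x. ?b y)" for x :: real
  have cont: "continuous_on S ?b" for S
    using smooth_k_bump[of 0 0 h k] continuous_on_subset by auto
  have P: "(P has_real_derivative ?b x) (at x)" for x
  proof -
    have "(P has_vector_derivative ?b x) (at x within {-\<bar>x\<bar>-1..\<bar>x\<bar>+1})"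
      unfolding P_def zero_ereal_def by (rule interval_integral_FTC2) (auto simp: cont)
    then have "(P has_vector_derivative ?b x) (at x)"
      by (subst (asm) at_within_interior) (auto simp: abs_if)
    then show ?thesis by (simp add: has_real_derivative_iff_has_vector_derivative)
  qed
  have eq: "bump_step s t h k x = P (x - s) - P (x - t)" for x
  proof -
    have "(\<integral>r. ?b (x - r) * ind {s..t} r \<partial>lborel) = (- P (x - t)) - (- P (x - s))"
    proof (rule integral_FTC_Icc_real[OF assms])
      show "((\<lambda>r. - P (x - r)) has_real_derivative ?b (x - r)) (at r)" for r
        by (rule DERIV_cong[OF DERIV_minus[OF DERIV_chain2[OF P]]]) (auto intro!: derivative_eq_intros)
      have "isCont ?b y" for y
        using cont[of UNIV] by (simp add: continuous_on_eq_continuous_at)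
      then show "isCont (\<lambda>r. ?b (x - r)) r" for r
        by (intro isCont_o2[where f = "\<lambda>r. x - r" and g = ?b] continuous_intros)
    qed
    moreover have "(\<integral>r. ?b (x - r) * ind {s..t} r \<partial>lborel) = bump_step s t h k x"
      unfolding bump_step_def
    proof (rule integral_cong_AE)
      show "AE r in lborel. ?b (x - r) * ind {s..t} r = ind {s<..<t} r *\<^sub>R ?b (x - r)"
        using AE_lborel_singleton[of s] AE_lborel_singleton[of t]
        by eventually_elim (auto simp: indicator_def)
    qed simp_all
    ultimately show ?thesis by simp
  qed
  then have *: "bump_step s t h k = (\<lambda>x. P (x - s) - P (x - t))" by blast
  have "((\<lambda>x. P (x - r)) has_real_derivative ?b (x - r)) (at x)" for r
    by (rule DERIV_cong[OF DERIV_chain2[OF P]]) (auto intro!: derivative_eq_intros)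
  then show ?thesis unfolding * by (intro DERIV_diff)
qed

lemma bump_step_smooth: "s \<le> t \<Longrightarrow> smooth_k n (bump_step s t h k)"
proof (rule smooth_k_SucD)
  assume "s \<le> t"
  moreover have "smooth_k n (\<lambda>x. bump 0 h k (1 * x + - s) + (-1) * bump 0 h k (1 * x + - t))"
    by (intro smooth_k_add smooth_k_mult smooth_k_const smooth_k_affine smooth_k_bump)
  ultimately show "smooth_k (Suc n) (bump_step s t h k)"
    using bump_step_deriv[of s t h k] by (auto intro!: exI[of _ "\<lambda>x. bump 0 h k (x - s) - bump 0 h k (x - t)"])
qed

lemma bump_step_eq_0:
  assumes "x \<notin> {s + 1 / Suc k..t + h - 1 / Suc k}"
  shows "bump_step s t h k x = 0"
proof -
  have "ind {s<..<t} r *\<^sub>R bump 0 h k (x - r) = 0" for r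
  proof (cases "r \<in> {s<..<t}")
    case True
    then have "x - r \<notin> {0 + 1 / Suc k..h - 1 / Suc k}" using assms by (auto simp del: of_nat_Suc)
    from bump_eq_0[OF this] show ?thesis by simp
  qed simp
  then have "(\<lambda>r. ind {s<..<t} r *\<^sub>R bump 0 h k (x - r)) = (\<lambda>r. 0)" by blast
  then show ?thesis unfolding bump_step_def by simp
qed

lemma bump_step_bound: "s \<le> t \<Longrightarrow> \<bar>bump_step s t h k x\<bar> \<le> t - s"
proof -
  assume st: "s \<le> t"
  have i: "integrable lborel (ind {s<..<t} :: real \<Rightarrow> real)" using st by simp
  have "norm (bump_step s t h k x) \<le> (LINT r|lborel. ind {s<..<t} r)"
    unfolding bump_step_def
  proof (rule Bochner_Integration.integral_norm_bound_integral[OF _ i])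
    have "norm (ind {s<..<t} r *\<^sub>R bump 0 h k (x - r)) \<le> ind {s<..<t} r" for r
      using bump_bounds[of 0 h k "x - r"] by (simp add: indicator_def)
    then show "integrable lborel (\<lambda>r. ind {s<..<t} r *\<^sub>R bump 0 h k (x - r))"
      "\<And>r. norm (ind {s<..<t} r *\<^sub>R bump 0 h k (x - r)) \<le> ind {s<..<t} r"
      by (auto intro!: Bochner_Integration.integrable_bound[OF i])
  qed
  then show ?thesis using st by simp
qed

text \<open>The limit is the length of the set of shifts \<open>r\<close> in \<open>(s, t)\<close>
  for which \<open>x\<close> lies in \<open>(r, r + h)\<close>; it is kept as an integral so that
  Fubini applies to it directly.\<close>

lemma bump_step_tendsto:
  "(\<lambda>k. bump_step s t h k x) \<longlonglongrightarrow> (LINT r|lborel. ind {s<..<t} r *\<^sub>R ind {r<..<r + h} x)"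
  unfolding bump_step_def
proof (rule integral_dominated_convergence[where w = "ind {s<..<t}"])
  show "integrable lborel (ind {s<..<t} :: real \<Rightarrow> real)"
    by (cases "s \<le> t") auto
  have "(\<lambda>k. ind {s<..<t} r *\<^sub>R bump 0 h k (x - r)) \<longlonglongrightarrow> ind {s<..<t} r *\<^sub>R ind {0<..<h} (x - r)" for r
    by (intro tendsto_scaleR tendsto_const bump_tendsto)
  moreover have "ind {0<..<h} (x - r) = (ind {r<..<r + h} x :: real)" for r
    by (auto simp: indicator_def)
  ultimately show "AE r in lborel. (\<lambda>k. ind {s<..<t} r *\<^sub>R bump 0 h k (x - r)) \<longlonglongrightarrow>
      ind {s<..<t} r *\<^sub>R (ind {r<..<r + h} x :: real)" by simp
  show "(\<lambda>r. ind {s<..<t} r *\<^sub>R (ind {r<..<r + h} x::real)) \<in> borel_measurable lborel"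
  proof -
    have eq: "ind {r<..<r + h} x = (ind {x - h<..<x} r :: real)" for r
      by (auto simp: indicator_def)
    show ?thesis unfolding eq by simp
  qed
qed (use bump_bounds in \<open>auto simp: indicator_def\<close>)

definition rint :: "(plane \<Rightarrow> complex) \<Rightarrow> real \<Rightarrow> real \<Rightarrow> real \<Rightarrow> real \<Rightarrow> complex" where
  "rint u p q c d = (sint ({p<..<q} \<times> {c<..<d}) u)"

text \<open>The weight on \<open>g\<close> is the pointwise limit of \<open>bump_step\<close> times
  a bump; interchanging the order of integration turns the overlap length into an integral of
  \<open>rint\<close> over the shifts.\<close>

lemma Fubini_rint:
  fixes g :: "plane \<Rightarrow> complex"
  assumes meas [measurable]: "g \<in> BM"
    and int: "integrable lborel (\<lambda>x. ind ({s<..<t + h} \<times> {c<..<d}) x *\<^sub>R g x)"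
    and st: "s \<le> t" "0 < h"
  shows "(LINT x|lborel. g x * of_real ((sint {s<..<t} (\<lambda>r. (ind {r<..<r + h} (fst x) :: real))) * ind {c<..<d} (snd x))) =
      (sint {s<..<t} (\<lambda>r. rint g r (r + h) c d))"
proof -
  let ?B = "{s<..<t + h} \<times> {c<..<d}"
  define F where "F x r = ind {s<..<t} r *\<^sub>R (ind ({r<..<r + h} \<times> {c<..<d}) x *\<^sub>R g x)" for x r
  have F_eq: "F x r = (ind {s<..<t} r *\<^sub>R (ind {r<..<r + h} (fst x) :: real)) *\<^sub>R (ind {c<..<d} (snd x) *\<^sub>R g x)" for x r
    unfolding F_def indicator_def mem_Times_iff by simp
  \<comment> \<open>In terms of \<open>fst x - r\<close> the moving interval becomes a fixed set,
    which gives joint measurability in \<open>x\<close> and \<open>r\<close>.\<close>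
  have F_eq2: "F x r = (ind {s<..<t} r *\<^sub>R (ind {0<..<h} (fst x - r) :: real)) *\<^sub>R (ind {c<..<d} (snd x) *\<^sub>R g x)" for x r
  proof -
    have "ind {r<..<r + h} (fst x) = (ind {0<..<h} (fst x - r) :: real)"
      by (auto simp: indicator_def)
    then show ?thesis unfolding F_eq by simp
  qed
  have mF: "(\<lambda>(x, r). F x r) \<in> borel_measurable (lborel \<Otimes>\<^sub>M lborel)"
  proof -
    have [measurable]: "(\<lambda>z::(plane) \<times> real. fst (fst z)) \<in> borel_measurable (lborel \<Otimes>\<^sub>M lborel)"
      "(\<lambda>z::(plane) \<times> real. snd (fst z)) \<in> borel_measurable (lborel \<Otimes>\<^sub>M lborel)"
      "(\<lambda>z::(plane) \<times> real. g (fst z)) \<in> borel_measurable (lborel \<Otimes>\<^sub>M lborel)"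
      by (rule measurable_compose[OF measurable_fst], simp)+
    have [measurable]: "(\<lambda>z::(plane) \<times> real. snd z) \<in> borel_measurable (lborel \<Otimes>\<^sub>M lborel)"
      using measurable_snd by auto
    show ?thesis unfolding F_eq2 split_beta' real_scaleR_def
      by (intro borel_measurable_scaleR borel_measurable_times
          measurable_compose[OF _ borel_measurable_indicator[of _ borel]] borel_measurable_diff) (fact | simp)+
  qed
  have intF: "integrable (lborel \<Otimes>\<^sub>M lborel) (\<lambda>(x, r). F x r)"
  proof (rule lborel_pair.Fubini_integrable[OF mF])
    have B: "norm (F x r) \<le> ind {s<..<t} r *\<^sub>R norm (ind ?B x *\<^sub>R g x)" for x r
    proof (cases "r \<in> {s<..<t} \<and> x \<in> {r<..<r + h} \<times> {c<..<d}")
      case True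
      then have "x \<in> ?B" by (auto simp: mem_Times_iff)
      then show ?thesis using True by (simp add: F_def)
    next
      case False then show ?thesis by (auto simp: F_def)
    qed
    have mx: "(\<lambda>r. F x r) \<in> borel_measurable lborel" for x
      unfolding F_eq2 by measurable
    have i1: "integrable lborel (\<lambda>r. ind {s<..<t} r *\<^sub>R norm (ind ?B x *\<^sub>R g x))" for x
      using st by (intro integrable_scaleR_left) auto
    have i2: "integrable lborel (\<lambda>r. F x r)" for x
      by (rule Bochner_Integration.integrable_bound[OF i1[of x] mx]) (use B[of x] in auto)
    then show "AE x in lborel. integrable lborel (\<lambda>r. case (x, r) of (x, r) \<Rightarrow> F x r)" by simp
    have "(LINT r|lborel. norm (F x r)) \<le> (sint {s<..<t} (\<lambda>r. norm (ind ?B x *\<^sub>R g x)))" for x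
      by (rule integral_mono[OF integrable_norm[OF i2] i1 B])
    also have "(sint {s<..<t} (\<lambda>r. norm (ind ?B x *\<^sub>R g x))) = (t - s) * norm (ind ?B x *\<^sub>R g x)" for x
      using st by (subst integral_scaleR_left) auto
    finally have B2: "(LINT r|lborel. norm (F x r)) \<le> (t - s) * norm (ind ?B x *\<^sub>R g x)" for x .
    have "integrable lborel (\<lambda>x. LINT r|lborel. norm (F x r))"
    proof (rule Bochner_Integration.integrable_bound)
      show "integrable lborel (\<lambda>x. (t - s) * norm (ind ?B x *\<^sub>R g x))"
        using int by (intro integrable_mult_right integrable_norm)
      show "(\<lambda>x. LINT r|lborel. norm (F x r)) \<in> borel_measurable lborel"
        using mF by (intro lborel.borel_measurable_lebesgue_integral) (simp add: split_beta')
      show "AE x in lborel. norm (LINT r|lborel. norm (F x r)) \<le> norm ((t - s) * norm (ind ?B x *\<^sub>R g x))"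
        using B2 st by (intro AE_I2) (auto intro!: order_trans[OF _ abs_ge_self])
    qed
    then show "integrable lborel (\<lambda>x. LINT r|lborel. norm (case (x, r) of (x, r) \<Rightarrow> F x r))" by simp
  qed
  have "(sint {s<..<t} (\<lambda>r. rint g r (r + h) c d)) = (LINT r|lborel. LINT x|lborel. F x r)"
    unfolding rint_def F_def by (simp only: integral_scaleR_right)
  also have "\<dots> = (LINT x|lborel. LINT r|lborel. F x r)"
    by (rule lborel_pair.Fubini_integral[OF intF])
  also have "\<dots> = (LINT x|lborel. g x * of_real ((sint {s<..<t} (\<lambda>r. (ind {r<..<r + h} (fst x) :: real))) * ind {c<..<d} (snd x)))"
  proof (rule Bochner_Integration.integral_cong[OF refl])
    fix x :: "plane"
    have "integrable lborel (ind ({s<..<t} \<inter> {fst x - h<..<fst x}) :: real \<Rightarrow> real)"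
    proof (rule integrable_real_indicator)
      have "emeasure lborel ({s<..<t} \<inter> {fst x - h<..<fst x}) \<le> emeasure lborel {s<..<t}"
        by (rule emeasure_mono) auto
      also have "\<dots> < \<infinity>" using st by simp
      finally show "emeasure lborel ({s<..<t} \<inter> {fst x - h<..<fst x}) < \<infinity>" .
    qed simp
    moreover have "(\<lambda>r. ind {s<..<t} r *\<^sub>R (ind {r<..<r + h} (fst x) :: real)) = ind ({s<..<t} \<inter> {fst x - h<..<fst x})"
      by (auto simp: indicator_def fun_eq_iff)
    ultimately have "integrable lborel (\<lambda>r. ind {s<..<t} r *\<^sub>R (ind {r<..<r + h} (fst x) :: real))" by simp
    then show "(LINT r|lborel. F x r) = g x * of_real ((sint {s<..<t} (\<lambda>r. (ind {r<..<r + h} (fst x) :: real))) * ind {c<..<d} (snd x))"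
      unfolding F_eq by (simp only: integral_scaleR_left) (simp add: scaleR_conv_of_real mult_ac del: real_scaleR_def)
  qed
  finally show ?thesis by (rule sym)
qed

text \<open>The hypothesis \<open>weak\<close> tests only with products supported at a positive
  distance from the boundary of the rectangle. A bump step for \<open>\<alpha>\<close> and a bump
  for \<open>\<beta>\<close>, with \<open>k\<close> tending to infinity, give an identity on the
  full open rectangle, hence up to the boundary of the strip. In this abstract form it serves both
  coordinates after a swap.\<close>

lemma weak_derivative_rint:
  fixes u g :: "plane \<Rightarrow> complex"
  assumes meas [measurable]: "u \<in> BM" "g \<in> BM"
    and int: "integrable lborel (\<lambda>x. ind ({s<..<t + h} \<times> {c<..<d}) x *\<^sub>R u x)"
      "integrable lborel (\<lambda>x. ind ({s<..<t + h} \<times> {c<..<d}) x *\<^sub>R g x)"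
    and st: "s \<le> t" "0 < h"
    and weak: "\<And>\<alpha> \<alpha>' \<beta> \<epsilon>. (\<And>n. smooth_k n \<alpha>) \<Longrightarrow> (\<And>n. smooth_k n \<beta>) \<Longrightarrow> \<epsilon> > 0 \<Longrightarrow>
      (\<And>x. (\<alpha> has_real_derivative \<alpha>' x) (at x)) \<Longrightarrow>
      (\<And>x. x \<notin> {s + \<epsilon>..t + h - \<epsilon>} \<Longrightarrow> \<alpha> x = 0) \<Longrightarrow> (\<And>x. x \<notin> {c + \<epsilon>..d - \<epsilon>} \<Longrightarrow> \<beta> x = 0) \<Longrightarrow>
      (LINT x|lborel. u x * of_real (\<alpha>' (fst x) * \<beta> (snd x))) =
      - (LINT x|lborel. g x * of_real (\<alpha> (fst x) * \<beta> (snd x)))"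
  shows "rint u t (t + h) c d - rint u s (s + h) c d =
    (sint {s<..<t} (\<lambda>r. rint g r (r + h) c d))"
proof -
  let ?B = "{s<..<t + h} \<times> {c<..<d}"
  let ?l = "\<lambda>x1. LINT r|lborel. ind {s<..<t} r *\<^sub>R (ind {r<..<r + h} x1 :: real)"
  have B [measurable]: "?B \<in> sets borel" by (intro borel_open open_Times) auto
  \<comment> \<open>The supports of step and bump leave a margin of
    \<open>1 / Suc k\<close>.\<close>
  have eq: "(LINT x|lborel. u x * of_real ((bump 0 h k (fst x - s) - bump 0 h k (fst x - t)) * bump c d k (snd x))) =
      - (LINT x|lborel. g x * of_real (bump_step s t h k (fst x) * bump c d k (snd x)))" for k
    by (rule weak[where \<epsilon> = "1 / Suc k"])
      (simp_all only: bump_step_smooth smooth_k_bump bump_step_deriv st, simp, erule bump_step_eq_0, erule bump_eq_0)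
  have off: "bump c d k y = 0" if "y \<notin> {c<..<d}" for y k
    using that by (rule bump_outside)
  \<comment> \<open>Off \<open>(s, t + h)\<close> both the step and its derivative vanish, so
    integrability on the rectangle that covers all translates provides the dominating functions
    below.\<close>
  have off1: "bump 0 h k (x - s) - bump 0 h k (x - t) = 0 \<and> bump_step s t h k x = 0"
    if "x \<notin> {s<..<t+h}" for x k
  proof
    have "x - s \<notin> {0<..<h}" "x - t \<notin> {0<..<h}" using that st by auto
    then show "bump 0 h k (x - s) - bump 0 h k (x - t) = 0" by (simp add: bump_outside)
    have "1 / real (Suc k) > 0" by simp
    then show "bump_step s t h k x = 0" using that
      by (intro bump_step_eq_0) (unfold atLeastAtMost_iff greaterThanLessThan_iff, linarith)
  qed
  have [measurable]: "bump_step s t h k \<in> BM" for k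
    using bump_step_smooth[OF st(1), of 0] by (simp add: borel_measurable_continuous_onI)
  have l [measurable]: "?l \<in> BM"
    by (rule borel_measurable_LIMSEQ_real[OF bump_step_tendsto]) simp
  have lim1: "(\<lambda>k. LINT x|lborel. u x * of_real ((bump 0 h k (fst x - s) - bump 0 h k (fst x - t)) * bump c d k (snd x)))
      \<longlonglongrightarrow> (LINT x|lborel. u x * of_real ((ind {0<..<h} (fst x - s) - ind {0<..<h} (fst x - t)) * ind {c<..<d} (snd x)))"
  proof (rule integral_dominated_convergence[where w = "\<lambda>x. norm (ind ?B x *\<^sub>R u x)"])
    show "integrable lborel (\<lambda>x. norm (ind ?B x *\<^sub>R u x))" using int(1) by (rule integrable_norm)
    show "AE x in lborel. norm (u x * of_real ((bump 0 h k (fst x - s) - bump 0 h k (fst x - t)) * bump c d k (snd x)))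
        \<le> norm (ind ?B x *\<^sub>R u x)" for k
    proof (intro AE_I2)
      fix x :: "plane"
      have "\<bar>bump 0 h k (fst x - s) - bump 0 h k (fst x - t)\<bar> * \<bar>bump c d k (snd x)\<bar> \<le> 1"
        using bump_bounds[of 0 h k "fst x - s"] bump_bounds[of 0 h k "fst x - t"] bump_bounds[of c d k "snd x"]
        by (intro mult_le_one) auto
      then have "norm (u x) * (\<bar>bump 0 h k (fst x - s) - bump 0 h k (fst x - t)\<bar> * \<bar>bump c d k (snd x)\<bar>) \<le> norm (u x)"
        by (rule mult_left_le) simp
      then show "norm (u x * of_real ((bump 0 h k (fst x - s) - bump 0 h k (fst x - t)) * bump c d k (snd x)))
        \<le> norm (ind ?B x *\<^sub>R u x)"
        using off[of "snd x" k] off1[of "fst x" k] by (cases x) (auto simp: norm_mult abs_mult indicator_def simp del: of_real_mult of_real_diff)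
    qed
    show "AE x in lborel. (\<lambda>k. u x * of_real ((bump 0 h k (fst x - s) - bump 0 h k (fst x - t)) * bump c d k (snd x)))
        \<longlonglongrightarrow> u x * of_real ((ind {0<..<h} (fst x - s) - ind {0<..<h} (fst x - t)) * ind {c<..<d} (snd x))"
      by (intro AE_I2 tendsto_mult tendsto_const tendsto_of_real tendsto_diff bump_tendsto)
    have [measurable]: "(\<lambda>x::plane. fst x - c) \<in> BM" for c
      by (intro borel_measurable_diff fst_borel_measurable borel_measurable_const)
    have m: "(\<lambda>x::plane. ind {p<..<q} (fst x - c) :: real) \<in> BM" 
      "(\<lambda>x::plane. bump p q k (fst x - c)) \<in> BM"
      "(\<lambda>x::plane. ind {p<..<q} (snd x) :: real) \<in> BM" 
      "(\<lambda>x::plane. bump p q k (snd x)) \<in> BM" for p q k c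
      by (rule measurable_compose[of _ _ borel]; simp)+
    show "(\<lambda>x. u x * of_real ((ind {0<..<h} (fst x - s) - ind {0<..<h} (fst x - t)) * ind {c<..<d} (snd x)))
      \<in> borel_measurable lborel"
      unfolding measurable_lborel2
      by (intro borel_measurable_times measurable_compose[OF _ borel_measurable_of_real] borel_measurable_diff meas m)
    show "\<And>k. (\<lambda>x. u x * of_real ((bump 0 h k (fst x - s) - bump 0 h k (fst x - t)) * bump c d k (snd x))) \<in> borel_measurable lborel"
      unfolding measurable_lborel2
      by (intro borel_measurable_times measurable_compose[OF _ borel_measurable_of_real] borel_measurable_diff meas m)
  qed
  have lim2: "(\<lambda>k. LINT x|lborel. g x * of_real (bump_step s t h k (fst x) * bump c d k (snd x)))
      \<longlonglongrightarrow> (LINT x|lborel. g x * of_real (?l (fst x) * ind {c<..<d} (snd x)))"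
  proof (rule integral_dominated_convergence[where w = "\<lambda>x. (t - s) * norm (ind ?B x *\<^sub>R g x)"])
    show "integrable lborel (\<lambda>x. (t - s) * norm (ind ?B x *\<^sub>R g x))" using int(2) by (intro integrable_mult_right integrable_norm)
    show "AE x in lborel. norm (g x * of_real (bump_step s t h k (fst x) * bump c d k (snd x)))
        \<le> (t - s) * norm (ind ?B x *\<^sub>R g x)" for k
    proof (intro AE_I2)
      fix x :: "plane"
      have "\<bar>bump_step s t h k (fst x)\<bar> * \<bar>bump c d k (snd x)\<bar> \<le> (t - s) * 1"
        using bump_step_bound[OF st(1), of h k "fst x"] bump_bounds[of c d k "snd x"] st
        by (intro mult_mono) auto
      then have "norm (g x) * (\<bar>bump_step s t h k (fst x)\<bar> * \<bar>bump c d k (snd x)\<bar>) \<le> norm (g x) * (t - s)"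
        by (intro mult_left_mono) auto
      then show "norm (g x * of_real (bump_step s t h k (fst x) * bump c d k (snd x)))
        \<le> (t - s) * norm (ind ?B x *\<^sub>R g x)"
        using off[of "snd x" k] off1[of "fst x" k] by (cases x) (auto simp: norm_mult abs_mult indicator_def mult.commute simp del: of_real_mult of_real_diff)
    qed
    show "AE x in lborel. (\<lambda>k. g x * of_real (bump_step s t h k (fst x) * bump c d k (snd x)))
        \<longlonglongrightarrow> g x * of_real (?l (fst x) * ind {c<..<d} (snd x))"
      by (intro AE_I2 tendsto_mult tendsto_const tendsto_of_real bump_tendsto bump_step_tendsto)
    have m: "(\<lambda>x::plane. ind {p<..<q} (snd x) :: real) \<in> BM" 
      "(\<lambda>x::plane. bump p q k (snd x)) \<in> BM"
      "(\<lambda>x::plane. bump_step s t h k (fst x)) \<in> BM" for p q k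
      by (rule measurable_compose[of _ _ borel]; simp)+
    have ml: "(\<lambda>x::plane. ?l (fst x)) \<in> BM"
      by (rule measurable_compose[OF fst_borel_measurable l])
    show "(\<lambda>x. g x * of_real (?l (fst x) * ind {c<..<d} (snd x))) \<in> borel_measurable lborel"
      unfolding measurable_lborel2
      by (intro borel_measurable_times measurable_compose[OF _ borel_measurable_of_real] meas m ml)
    show "\<And>k. (\<lambda>x. g x * of_real (bump_step s t h k (fst x) * bump c d k (snd x))) \<in> borel_measurable lborel"
      unfolding measurable_lborel2
      by (intro borel_measurable_times measurable_compose[OF _ borel_measurable_of_real] meas m ml)
  qed
  have lim: "(LINT x|lborel. u x * of_real ((ind {0<..<h} (fst x - s) - ind {0<..<h} (fst x - t)) * ind {c<..<d} (snd x)))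
      = - (LINT x|lborel. g x * of_real (?l (fst x) * ind {c<..<d} (snd x)))"
    by (rule LIMSEQ_unique[OF lim1[unfolded eq] tendsto_minus[OF lim2]])
  have iu: "integrable lborel (\<lambda>x. ind ({r<..<r+h} \<times> {c<..<d}) x *\<^sub>R u x)" if "s \<le> r" "r \<le> t" for r
  proof (rule Bochner_Integration.integrable_bound[OF int(1)])
    have [measurable]: "{r<..<r+h} \<times> {c<..<d} \<in> sets borel" by (intro borel_open open_Times) auto
    show "(\<lambda>x. ind ({r<..<r+h} \<times> {c<..<d}) x *\<^sub>R u x) \<in> borel_measurable lborel" by measurable
    have "{r<..<r+h} \<times> {c<..<d} \<subseteq> ?B" using that by auto
    then show "AE x in lborel. norm (ind ({r<..<r+h} \<times> {c<..<d}) x *\<^sub>R u x) \<le> norm (ind ?B x *\<^sub>R u x)"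
      by (intro AE_I2) (auto simp: indicator_def simp del: mem_Times_iff)
  qed
  have "rint u s (s + h) c d - rint u t (t + h) c d =
      (LINT x|lborel. ind ({s<..<s+h} \<times> {c<..<d}) x *\<^sub>R u x - ind ({t<..<t+h} \<times> {c<..<d}) x *\<^sub>R u x)"
    unfolding rint_def using st by (intro Bochner_Integration.integral_diff[symmetric] iu) auto
  also have "\<dots> = (LINT x|lborel. u x * of_real ((ind {0<..<h} (fst x - s) - ind {0<..<h} (fst x - t)) * ind {c<..<d} (snd x)))"
  proof (rule Bochner_Integration.integral_cong[OF refl])
    fix x :: "plane"
    obtain x1 x2 where x: "x = (x1, x2)" by force
    have "ind {r<..<r + h} x1 = (ind {0<..<h} (x1 - r) :: real)" for r
      by (auto simp: indicator_def)
    then show "ind ({s<..<s+h} \<times> {c<..<d}) x *\<^sub>R u x - ind ({t<..<t+h} \<times> {c<..<d}) x *\<^sub>R u x =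
        u x * of_real ((ind {0<..<h} (fst x - s) - ind {0<..<h} (fst x - t)) * ind {c<..<d} (snd x))"
      unfolding x indicator_times fst_conv snd_conv by (simp only:) (simp add: scaleR_conv_of_real algebra_simps)
  qed
  finally have e: "rint u s (s + h) c d - rint u t (t + h) c d = \<dots>" .
  have "rint u s (s + h) c d - rint u t (t + h) c d = - (LINT x|lborel. g x * of_real (?l (fst x) * ind {c<..<d} (snd x)))"
    by (rule trans[OF e lim])
  also have "(LINT x|lborel. g x * of_real (?l (fst x) * ind {c<..<d} (snd x))) =
      (sint {s<..<t} (\<lambda>r. rint g r (r + h) c d))"
    by (rule Fubini_rint[OF meas(2) int(2) st])
  finally show ?thesis by (metis minus_diff_eq minus_minus)
qed

subsection \<open>A logarithmic potential estimate\<close>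

lemma nn_integral_lborel2:
  assumes "f \<in> borel_measurable (borel :: plane measure)"
  shows "(NN z. f z) = (NN x. NN y. f (x, y))"
    and "(NN z. f z) = (NN y. NN x. f (x, y))"
proof -
  have m: "f \<in> borel_measurable (lborel \<Otimes>\<^sub>M lborel)"
    using assms by (simp add: lborel_prod)
  show "(NN z. f z) = (NN x. NN y. f (x, y))"
    using lborel.nn_integral_fst[OF m] by (simp add: lborel_prod)
  show "(NN z. f z) = (NN y. NN x. f (x, y))"
    using lborel_pair.nn_integral_snd[OF m] by (simp add: lborel_prod)
qed

text \<open>The maximum norm: its balls are squares, which suit both the rectangles and the later
  covering.\<close>

definition supn :: "plane \<Rightarrow> real" where
  "supn z = max \<bar>fst z\<bar> \<bar>snd z\<bar>"

lemma supn_measurable [measurable]: "supn \<in> BM"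
  unfolding supn_def by (intro borel_measurable_continuous_onI continuous_intros)

lemma supn_nonneg [simp]: "0 \<le> supn z"
  by (simp add: supn_def)

lemma nn_integral_lborel_reflect:
  fixes h :: "real \<Rightarrow> ennreal"
  assumes [measurable]: "h \<in> BM"
  shows "(NN t. h \<bar>t\<bar>) = 2 * (NN t. h t * ind {0..} t)"
proof -
  have "(NN t. h \<bar>t\<bar>) = (NN t. h t * ind {0..} t + h (- t) * ind {0..} (- t))"
  proof (rule nn_integral_cong_AE)
    show "AE t in lborel. h \<bar>t\<bar> = h t * ind {0..} t + h (- t) * ind {0..} (- t)"
      using AE_lborel_singleton[of 0] by eventually_elim (auto simp: indicator_def)
  qed
  also have "\<dots> = (NN t. h t * ind {0..} t) + (NN t. h (- t) * ind {0..} (- t))"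
    by (rule nn_integral_add) auto
  also have "(NN t. h (- t) * ind {0..} (- t)) = (NN t. h t * ind {0..} t)"
    using nn_integral_real_affine[of "\<lambda>t. h t * ind {0..} t" "-1" 0] by simp
  finally show ?thesis by (simp add: mult_2)
qed

text \<open>Polar coordinates for the maximum norm. The plane is split by which coordinate
  difference is larger; there the other coordinate runs over a segment of length
  \<open>2 * \<bar>t\<bar>\<close>. The two parts, this 2 and the two signs of \<open>t\<close> give
  the factor 8.\<close>

lemma nn_integral_supn_le:
  fixes \<psi> :: "real \<Rightarrow> ennreal"
  assumes [measurable]: "\<psi> \<in> BM"
  shows "(NN z. \<psi> (supn (z - x))) \<le> 8 * (NN t. ennreal t * \<psi> t * ind {0..} t)"
proof -
  define A where "A u = (NN t. ennreal \<bar>t - u\<bar> * \<psi> \<bar>t - u\<bar>)" for u :: real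
  have A: "A u = 2 * (NN t. ennreal t * \<psi> t * ind {0..} t)" for u
  proof -
    have "A u = (NN t. ennreal \<bar>t\<bar> * \<psi> \<bar>t\<bar>)"
      unfolding A_def using nn_integral_real_affine[of "\<lambda>t. ennreal \<bar>t - u\<bar> * \<psi> \<bar>t - u\<bar>" 1 u] by simp
    also have "\<dots> = 2 * (NN t. ennreal t * \<psi> t * ind {0..} t)"
      by (rule nn_integral_lborel_reflect) simp
    finally show ?thesis .
  qed
  define B1 where "B1 z = \<psi> \<bar>fst z - fst x\<bar> * ind {y. \<bar>y - snd x\<bar> \<le> \<bar>fst z - fst x\<bar>} (snd z)" for z
  define B2 where "B2 z = \<psi> \<bar>snd z - snd x\<bar> * ind {y. \<bar>y - fst x\<bar> \<le> \<bar>snd z - snd x\<bar>} (fst z)" for z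
  have closed_set: "closed {z::plane. \<bar>snd z - snd x\<bar> \<le> \<bar>fst z - fst x\<bar>}" "closed {z::plane. \<bar>fst z - fst x\<bar> \<le> \<bar>snd z - snd x\<bar>}"
    by (intro closed_Collect_le continuous_intros)+
  have B1_eq: "B1 = (\<lambda>z. \<psi> \<bar>fst z - fst x\<bar> * ind {z. \<bar>snd z - snd x\<bar> \<le> \<bar>fst z - fst x\<bar>} z)"
    and B2_eq: "B2 = (\<lambda>z. \<psi> \<bar>snd z - snd x\<bar> * ind {z. \<bar>fst z - fst x\<bar> \<le> \<bar>snd z - snd x\<bar>} z)"
    by (auto simp: B1_def B2_def fun_eq_iff indicator_def)
  have d: "(\<lambda>z::plane. \<bar>fst z - fst x\<bar>) \<in> BM" "(\<lambda>z::plane. \<bar>snd z - snd x\<bar>) \<in> BM"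
    by (intro borel_measurable_continuous_onI continuous_intros)+
  have m: "B1 \<in> BM" "B2 \<in> BM"
    unfolding B1_eq B2_eq
    by (intro borel_measurable_times_ennreal measurable_compose[OF _ assms] d borel_measurable_indicator borel_closed closed_set)+
  have len: "emeasure lborel {y. \<bar>y - u\<bar> \<le> \<bar>t\<bar>} = ennreal (2 * \<bar>t\<bar>)" for u t :: real
  proof -
    have "{y. \<bar>y - u\<bar> \<le> \<bar>t\<bar>} = {u - \<bar>t\<bar>..u + \<bar>t\<bar>}" by auto
    then show ?thesis by simp
  qed
  have setm: "{y. \<bar>y - u\<bar> \<le> \<bar>t\<bar>} \<in> sets borel" for u t :: real
  proof -
    have "{y. \<bar>y - u\<bar> \<le> \<bar>t\<bar>} = {u - \<bar>t\<bar>..u + \<bar>t\<bar>}" by auto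
    then show ?thesis by simp
  qed
  have "(NN z. \<psi> (supn (z - x))) \<le> (NN z. B1 z + B2 z)"
  proof (rule nn_integral_mono)
    fix z :: "plane"
    show "\<psi> (supn (z - x)) \<le> B1 z + B2 z"
      by (cases "\<bar>snd z - snd x\<bar> \<le> \<bar>fst z - fst x\<bar>")
        (auto simp: B1_eq B2_eq supn_def max_def indicator_def)
  qed
  also have "\<dots> = (NN z. B1 z) + (NN z. B2 z)"
    by (rule nn_integral_add) (use m in simp_all)
  also have "(NN z. B1 z) = (NN t. 2 * (ennreal \<bar>t - fst x\<bar> * \<psi> \<bar>t - fst x\<bar>))"
    unfolding nn_integral_lborel2(1)[OF m(1)]
    by (intro nn_integral_cong) (simp add: B1_def nn_integral_cmult setm len ennreal_mult' mult_ac)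
  also have "\<dots> = 2 * A (fst x)" unfolding A_def by (rule nn_integral_cmult) simp
  also have "(NN z. B2 z) = (NN t. 2 * (ennreal \<bar>t - snd x\<bar> * \<psi> \<bar>t - snd x\<bar>))"
    unfolding nn_integral_lborel2(2)[OF m(2)]
    by (intro nn_integral_cong) (simp add: B2_def nn_integral_cmult setm len ennreal_mult' mult_ac)
  also have "\<dots> = 2 * A (snd x)" unfolding A_def by (rule nn_integral_cmult) simp
  also have "2 * A (fst x) + 2 * A (snd x) = 8 * (NN t. ennreal t * \<psi> t * ind {0..} t)"
    unfolding A by (simp flip: mult.assoc distrib_right)
  finally show ?thesis .
qed

section \<open>Explicit one-dimensional integrals and the logarithmic kernel estimate\<close>

lemma nn_integral_FTC_interior:
  fixes F f :: "real \<Rightarrow> real"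
  assumes [measurable]: "f \<in> BM" and "a \<le> b"
    and cont: "continuous_on {a..b} F"
    and der: "\<And>x. x \<in> {a<..<b} \<Longrightarrow> (F has_real_derivative f x) (at x)"
    and nonneg: "\<And>x. x \<in> {a..b} \<Longrightarrow> 0 \<le> f x"
  shows "(NN x. ennreal (f x) * ind {a..b} x) = ennreal (F b - F a)"
proof -
  have "(f has_integral (F b - F a)) {a..b}"
    using assms by (intro fundamental_theorem_of_calculus_interior) (auto simp: has_real_derivative_iff_has_vector_derivative)
  then have "((\<lambda>x. if x \<in> {a..b} then f x else 0) has_integral (F b - F a)) UNIV"
    by (simp only: has_integral_restrict_UNIV)
  from nn_integral_has_integral_lborel[OF _ _ this] nonneg
  have "(NN x. ennreal (if x \<in> {a..b} then f x else 0)) = ennreal (F b - F a)" by simp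
  also have "(NN x. ennreal (if x \<in> {a..b} then f x else 0)) = (NN x. ennreal (f x) * ind {a..b} x)"
    by (intro nn_integral_cong) (auto simp: indicator_def)
  finally show ?thesis .
qed

text \<open>Integrability of the inverse square root on a line is what bounds the auxiliary
  potential in mean on vertical segments; it is used again in the Hardy inequality.\<close>

lemma nn_integral_inverse_sqrt:
  assumes "0 \<le> d"
  shows "(NN t. ennreal (1 / sqrt \<bar>t - u\<bar>) * ind {u - d..u + d} t) = ennreal (4 * sqrt d)"
proof -
  have "(NN t. ennreal (1 / sqrt \<bar>t - u\<bar>) * ind {u - d..u + d} t) =
      (NN t. ennreal (1 / sqrt \<bar>t\<bar>) * ind {0..d} \<bar>t\<bar>)"
    using nn_integral_real_affine[of "\<lambda>t. ennreal (1 / sqrt \<bar>t - u\<bar>) * ind {u - d..u + d} t" 1 u]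
    by (simp add: indicator_def abs_le_iff) (intro nn_integral_cong, auto)
  also have "\<dots> = 2 * (NN t. (ennreal (1 / sqrt t) * ind {0..d} t) * ind {0..} t)"
    by (rule nn_integral_lborel_reflect) simp
  also have "(NN t. (ennreal (1 / sqrt t) * ind {0..d} t) * ind {0..} t) =
      (NN t. ennreal (1 / sqrt t) * ind {0..d} t)"
    by (intro nn_integral_cong) (auto simp: indicator_def)
  also have "\<dots> = ennreal (2 * sqrt d - 2 * sqrt 0)"
    by (rule nn_integral_FTC_interior[OF _ assms])
      (auto intro!: continuous_intros derivative_eq_intros simp: field_simps)
  also have "2 * ennreal (2 * sqrt d - 2 * sqrt 0) = ennreal (4 * sqrt d)"
    using assms ennreal_mult'[of 2 "2 * sqrt d"] by simp
  finally show ?thesis .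
qed

text \<open>Near 0 the term \<open>\<sigma> * sqrt t\<close> dominates and makes the singularity
  integrable, whereas \<open>1 / t\<close> alone would diverge; the price is the logarithm of
  \<open>sqrt d / \<sigma>\<close>.\<close>

lemma nn_integral_log_kernel:
  assumes "0 \<le> d" "0 < \<sigma>"
  shows "(NN t. ennreal (1 / (t + \<sigma> * sqrt t)) * ind {0..d} t) = ennreal (2 * ln (1 + sqrt d / \<sigma>))"
proof -
  have "(NN t. ennreal (1 / (t + \<sigma> * sqrt t)) * ind {0..d} t) =
      ennreal (2 * ln (1 + sqrt d / \<sigma>) - 2 * ln (1 + sqrt 0 / \<sigma>))"
  proof (rule nn_integral_FTC_interior[OF _ assms(1)])
    show "continuous_on {0..d} (\<lambda>t. 2 * ln (1 + sqrt t / \<sigma>))"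
      using assms by (intro continuous_intros) (auto simp: add_nonneg_eq_0_iff)
    fix t assume "t \<in> {0<..<d}"
    then have t: "t > 0" by simp
    then have "1 + sqrt t / \<sigma> > 0" using assms by (simp add: add_pos_nonneg)
    moreover have "(1 / (2 * sqrt t) / \<sigma>) * (1 / (1 + sqrt t / \<sigma>)) * 2 = 1 / (t + \<sigma> * sqrt t)"
    proof -
      have "sqrt t * sqrt t = t" using t by simp
      then have "t + \<sigma> * sqrt t = sqrt t * (\<sigma> + sqrt t)" by (simp add: algebra_simps)
      moreover have "\<sigma> * (1 + sqrt t / \<sigma>) = \<sigma> + sqrt t" using assms by (simp add: field_simps)
      moreover have "(1 / (2 * sqrt t) / \<sigma>) * (1 / X) * 2 = 1 / (sqrt t * (\<sigma> * X))" for X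
        by simp
      ultimately show ?thesis by simp
    qed
    ultimately show "((\<lambda>t. 2 * ln (1 + sqrt t / \<sigma>)) has_real_derivative 1 / (t + \<sigma> * sqrt t)) (at t)"
      using t assms by (auto intro!: derivative_eq_intros simp: field_simps)
  qed (use assms in auto)
  then show ?thesis by simp
qed

text \<open>Cauchy-Schwarz for \<open>f / s = (f * sqrt w) * (1 / (s * sqrt w))\<close> with
  \<open>w = 1 + \<sigma> / sqrt s\<close>. Without the weight the second factor would be the
  divergent integral of \<open>1 / s^2\<close> over the plane. With it the first factor also
  contains the potential bounded by \<open>H\<close>, which enters the result only through a
  logarithm.\<close>

lemma log_kernel_bound:
  fixes f :: "plane \<Rightarrow> real"
  assumes [measurable]: "f \<in> BM" and f: "\<And>z. 0 \<le> f z"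
    and supp: "\<And>z. f z \<noteq> 0 \<Longrightarrow> supn (z - x) \<le> d"
    and d: "0 \<le> d" and N: "0 < N" "(NN z. ennreal ((f z)\<^sup>2)) \<le> ennreal N"
    and H: "0 < H" "(NN z. ennreal ((f z)\<^sup>2 / sqrt (supn (z - x)))) \<le> ennreal H"
  shows "(NN z. ennreal (f z / supn (z - x)))\<^sup>2 \<le> ennreal (32 * N * ln (1 + sqrt d * H / N))"
proof -
  \<comment> \<open>This choice balances the two terms of the first factor:
    \<open>N + \<sigma> * H = 2 * N\<close>.\<close>
  define \<sigma> where "\<sigma> = N / H"
  have \<sigma>: "\<sigma> > 0" using N H by (simp add: \<sigma>_def)
  define s where "s z = supn (z - x)" for z
  have s [measurable]: "s \<in> BM"
    unfolding s_def supn_def by (intro borel_measurable_continuous_onI continuous_intros)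
  have s0: "0 \<le> s z" for z by (simp add: s_def)
  define w where "w z = 1 + \<sigma> / sqrt (s z)" for z
  have w: "w z > 0" for z using \<sigma> s0[of z] by (auto simp: w_def intro!: add_pos_nonneg)
  have [measurable]: "w \<in> BM" unfolding w_def by measurable
  define g where "g z = ind {0..d} (s z) * (1 / (s z * sqrt (w z)))" for z
  have [measurable]: "g \<in> BM" unfolding g_def by measurable
  have fg: "ennreal (f z / s z) = ennreal (f z * sqrt (w z)) * ennreal (g z)" for z
  proof -
    have "f z / s z = (f z * sqrt (w z)) * g z"
      using supp[of z] w[of z] s0[of z] by (cases "f z = 0") (auto simp: g_def s_def)
    then show ?thesis using f[of z] w[of z] by (simp add: ennreal_mult' less_imp_le)
  qed
  have "(NN z. ennreal (f z / s z))\<^sup>2 \<le>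
      (NN z. (ennreal (f z * sqrt (w z)))\<^sup>2) * (NN z. (ennreal (g z))\<^sup>2)"
    unfolding fg by (rule Cauchy_Schwarz_nn_integral) auto
  also have "(NN z. (ennreal (f z * sqrt (w z)))\<^sup>2) \<le> ennreal (2 * N)"
  proof -
    have "(NN z. (ennreal (f z * sqrt (w z)))\<^sup>2) =
        (NN z. ennreal ((f z)\<^sup>2) + ennreal \<sigma> * ennreal ((f z)\<^sup>2 / sqrt (s z)))"
    proof (rule nn_integral_cong)
      fix z
      have "(ennreal (f z * sqrt (w z)))\<^sup>2 = ennreal ((f z)\<^sup>2 * w z)"
        using f[of z] w[of z] by (simp add: ennreal_power power_mult_distrib less_imp_le)
      also have "(f z)\<^sup>2 * w z = (f z)\<^sup>2 + \<sigma> * ((f z)\<^sup>2 / sqrt (s z))"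
        by (simp add: w_def algebra_simps)
      also have "ennreal ((f z)\<^sup>2 + \<sigma> * ((f z)\<^sup>2 / sqrt (s z))) = ennreal ((f z)\<^sup>2) + ennreal (\<sigma> * ((f z)\<^sup>2 / sqrt (s z)))"
        using \<sigma> s0[of z] by (intro ennreal_plus) auto
      also have "ennreal (\<sigma> * ((f z)\<^sup>2 / sqrt (s z))) = ennreal \<sigma> * ennreal ((f z)\<^sup>2 / sqrt (s z))"
        using \<sigma> by (intro ennreal_mult') auto
      finally show "(ennreal (f z * sqrt (w z)))\<^sup>2 = ennreal ((f z)\<^sup>2) + ennreal \<sigma> * ennreal ((f z)\<^sup>2 / sqrt (s z))" .
    qed
    also have "\<dots> = (NN z. ennreal ((f z)\<^sup>2)) + ennreal \<sigma> * (NN z. ennreal ((f z)\<^sup>2 / sqrt (s z)))"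
      by (simp add: nn_integral_add nn_integral_cmult)
    also have "\<dots> \<le> ennreal N + ennreal \<sigma> * ennreal H"
      using N(2) H(2) by (intro add_mono mult_left_mono) (auto simp: s_def)
    also have "\<dots> = ennreal (2 * N)"
      using N(1) H(1) by (simp add: \<sigma>_def flip: ennreal_mult' ennreal_plus)
    finally show ?thesis .
  qed
  \<comment> \<open>Here \<open>16 = 8 * 2\<close> comes from \<open>nn_integral_supn_le\<close> and
    \<open>nn_integral_log_kernel\<close>; together with the factor \<open>2 * N\<close> it makes
    \<open>32 * N\<close>.\<close>
  also have "(NN z. (ennreal (g z))\<^sup>2) \<le> ennreal (16 * ln (1 + sqrt d * H / N))"
  proof -
    define \<psi> where "\<psi> t = ennreal (ind {0..d} t * (1 / (t\<^sup>2 * (1 + \<sigma> / sqrt t))))" for t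
    have "(NN z. (ennreal (g z))\<^sup>2) = (NN z. \<psi> (supn (z - x)))"
    proof (rule nn_integral_cong)
      fix z
      show "(ennreal (g z))\<^sup>2 = \<psi> (supn (z - x))"
        using s0[of z] w[of z]
        by (auto simp: g_def \<psi>_def s_def[symmetric] w_def[symmetric] ennreal_power power_mult_distrib power_divide indicator_def less_imp_le)
    qed
    also have "\<dots> \<le> 8 * (NN t. ennreal t * \<psi> t * ind {0..} t)"
      by (rule nn_integral_supn_le) (simp add: \<psi>_def)
    also have "(NN t. ennreal t * \<psi> t * ind {0..} t) =
        (NN t. ennreal (1 / (t + \<sigma> * sqrt t)) * ind {0..d} t)"
    proof (rule nn_integral_cong)
      fix t :: real
      have "t * (1 / (t\<^sup>2 * (1 + \<sigma> / sqrt t))) = 1 / (t + \<sigma> * sqrt t)" if "t > 0"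
      proof -
        have "t * (1 + \<sigma> / sqrt t) = t + \<sigma> * sqrt t"
        proof -
          have "t * (1 + \<sigma> / sqrt t) = t + \<sigma> * (t / sqrt t)" by (simp add: algebra_simps)
          then show ?thesis using that real_div_sqrt[of t] by (simp only:)
        qed
        then show ?thesis using that by (simp add: power2_eq_square)
      qed
      then show "ennreal t * \<psi> t * ind {0..} t = ennreal (1 / (t + \<sigma> * sqrt t)) * ind {0..d} t"
        by (cases "t = 0"; cases "0 < t") (auto simp: \<psi>_def indicator_def simp flip: ennreal_mult')
    qed
    also have "\<dots> = ennreal (2 * ln (1 + sqrt d / \<sigma>))"
      by (rule nn_integral_log_kernel[OF d \<sigma>])
    also have "8 * ennreal (2 * ln (1 + sqrt d / \<sigma>)) = ennreal (16 * ln (1 + sqrt d * H / N))"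
      using ennreal_mult'[of 8 "2 * ln (1 + sqrt d / \<sigma>)"] by (simp add: \<sigma>_def)
    finally show ?thesis .
  qed
  finally have "(NN z. ennreal (f z / s z))\<^sup>2 \<le> ennreal (2 * N) * ennreal (16 * ln (1 + sqrt d * H / N))"
    by (simp add: mult_left_mono mult_right_mono)
  also have "\<dots> = ennreal (32 * N * ln (1 + sqrt d * H / N))"
    using N(1) by (simp add: mult.assoc flip: ennreal_mult')
  finally show ?thesis unfolding s_def .
qed

section \<open>Deviation from the mean as a potential of the gradient\<close>

lemma C1_segment_bound:
  fixes v :: "plane \<Rightarrow> complex"
  assumes R: "convex R" "x \<in> R" "y \<in> R"
    and der: "\<And>z. z \<in> R \<Longrightarrow> (v has_derivative (\<lambda>h. of_real (fst h) * d1 z + of_real (snd h) * d2 z)) (at z within R)"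
    and cont: "continuous_on R d1" "continuous_on R d2"
  shows "ennreal (cmod (v y - v x)) \<le>
    (NN t. ennreal (max \<bar>fst (y - x)\<bar> \<bar>snd (y - x)\<bar> * (cmod (d1 (x + t *\<^sub>R (y - x))) + cmod (d2 (x + t *\<^sub>R (y - x))))) * ind {0..1} t)"
proof -
  define p where "p t = x + t *\<^sub>R (y - x)" for t :: real
  have pR: "p t \<in> R" if "t \<in> {0..1}" for t
  proof -
    have "p t = (1 - t) *\<^sub>R x + t *\<^sub>R y" by (simp add: p_def algebra_simps)
    then show ?thesis using that R by (simp add: convexD_alt)
  qed
  define D where "D t = of_real (fst (y - x)) * d1 (p t) + of_real (snd (y - x)) * d2 (p t)" for t
  define f where "f t = max \<bar>fst (y - x)\<bar> \<bar>snd (y - x)\<bar> * (cmod (d1 (p t)) + cmod (d2 (p t)))" for t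
  have cp: "continuous_on {0..1} p" unfolding p_def by (intro continuous_intros)
  have cd: "continuous_on {0..1} (\<lambda>t. d1 (p t))" "continuous_on {0..1} (\<lambda>t. d2 (p t))"
    using pR by (auto intro!: continuous_on_compose2[OF cont(1) cp] continuous_on_compose2[OF cont(2) cp])
  have cf: "continuous_on {0..1} f" unfolding f_def by (intro continuous_intros cd)
  have vd: "((\<lambda>t. v (p t)) has_vector_derivative D t) (at t within {0..1})" if "t \<in> {0..1}" for t
  proof -
    have dp: "(p has_derivative (\<lambda>h. h *\<^sub>R (y - x))) (at t within {0..1})"
      unfolding p_def by (auto intro!: derivative_eq_intros)
    have "(v has_derivative (\<lambda>h. of_real (fst h) * d1 (p t) + of_real (snd h) * d2 (p t))) (at (p t) within p ` {0..1})"
      by (rule has_derivative_subset[OF der[OF pR[OF that]]]) (use pR in auto)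
    from has_derivative_in_compose[OF dp this]
    have "((\<lambda>t. v (p t)) has_derivative (\<lambda>h. of_real (fst (h *\<^sub>R (y - x))) * d1 (p t) + of_real (snd (h *\<^sub>R (y - x))) * d2 (p t))) (at t within {0..1})" .
    then show ?thesis unfolding has_vector_derivative_def D_def
      by (rule has_derivative_eq_rhs) (auto simp: fun_eq_iff scaleR_conv_of_real algebra_simps)
  qed
  have I: "(D has_integral (v (p 1) - v (p 0))) {0..1}"
    by (rule fundamental_theorem_of_calculus) (use vd in auto)
  have fi: "f integrable_on {0..1}" by (rule integrable_continuous_interval[OF cf])
  have le: "cmod (D t) \<le> f t" for t
  proof -
    have "cmod (D t) \<le> \<bar>fst (y - x)\<bar> * cmod (d1 (p t)) + \<bar>snd (y - x)\<bar> * cmod (d2 (p t))"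
      unfolding D_def by (rule norm_triangle_le) (simp add: norm_mult del: fst_diff snd_diff)
    also have "\<dots> \<le> max \<bar>fst (y - x)\<bar> \<bar>snd (y - x)\<bar> * cmod (d1 (p t)) + max \<bar>fst (y - x)\<bar> \<bar>snd (y - x)\<bar> * cmod (d2 (p t))"
      by (intro add_mono mult_right_mono) auto
    finally show ?thesis by (simp add: f_def distrib_left)
  qed
  have "norm (integral {0..1} D) \<le> integral {0..1} f"
    using I fi le by (intro integral_norm_bound_integral) auto
  then have 1: "cmod (v y - v x) \<le> integral {0..1} f"
    using I by (simp add: integral_unique p_def)
  have f0: "0 \<le> f t" for t unfolding f_def by (intro mult_nonneg_nonneg) auto
  have "set_integrable lborel {0..1} f"
    unfolding set_integrable_def by (rule borel_integrable_compact[OF _ cf]) simp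
  then have "integrable lborel (\<lambda>t. ind {0..1} t *\<^sub>R f t)" by (simp add: set_integrable_def)
  moreover have "integral {0..1} f = (sint {0..1} f)"
    using set_borel_integral_eq_integral(2)[OF \<open>set_integrable lborel {0..1} f\<close>] by (simp add: set_lebesgue_integral_def)
  ultimately have "ennreal (integral {0..1} f) = (NN t. ennreal (ind {0..1} t *\<^sub>R f t))"
    using f0 by (subst nn_integral_eq_integral) (auto simp: indicator_def)
  also have "\<dots> = (NN t. ennreal (f t) * ind {0..1} t)"
    by (intro nn_integral_cong) (auto simp: indicator_def)
  finally have e: "ennreal (integral {0..1} f) = (NN t. ennreal (f t) * ind {0..1} t)" .
  show ?thesis using ennreal_leI[OF 1] unfolding e unfolding f_def p_def .
qed

lemma nn_integral_lborel2_scale: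
  fixes g :: "plane \<Rightarrow> ennreal" and x :: "plane"
  assumes g: "g \<in> BM" and t: "0 < t"
  shows "(NN z. g z) = ennreal (t\<^sup>2) * (NN y. g (x + t *\<^sub>R (y - x)))"
proof -
  obtain u w where x: "x = (u, w)" by force
  have g' [measurable]: "(\<lambda>z. g z) \<in> borel_measurable (borel \<Otimes>\<^sub>M borel)" using g by (simp add: borel_prod)
  have m: "(\<lambda>y. g (x + t *\<^sub>R (y - x))) \<in> BM"
    by (intro measurable_compose[OF _ g] borel_measurable_continuous_onI continuous_intros)
  have "(NN z. g z) = (NN a. NN b. g (a, b))"
    by (rule nn_integral_lborel2(1)[OF g])
  also have "\<dots> = t * (NN a. NN b. g ((u - t * u) + t * a, b))"
    using t by (subst nn_integral_real_affine[of _ t "u - t * u"]) auto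
  also have "\<dots> = t * (NN a. t * (NN b. g ((u - t * u) + t * a, (w - t * w) + t * b)))"
  proof (intro arg_cong2[where f = "(*)"] refl nn_integral_cong)
    fix a
    show "(NN b. g ((u - t * u) + t * a, b)) = t * (NN b. g ((u - t * u) + t * a, (w - t * w) + t * b))"
      using t by (subst nn_integral_real_affine[of _ t "w - t * w"]) auto
  qed
  also have "\<dots> = t * (t * (NN a. (NN b. g ((u - t * u) + t * a, (w - t * w) + t * b))))"
    by (subst nn_integral_cmult) auto
  also have "(NN a. (NN b. g ((u - t * u) + t * a, (w - t * w) + t * b))) =
      (NN y. g (x + t *\<^sub>R (y - x)))"
    by (simp only: nn_integral_lborel2(1)[OF m]) (simp add: x algebra_simps)
  finally show ?thesis using t by (simp add: power2_eq_square ennreal_mult' mult.assoc)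
qed

lemma nn_integral_inverse_cube_le:
  assumes "0 < r"
  shows "(NN t. ennreal (1 / t ^ 3) * ind {r..1} t) \<le> ennreal (1 / (2 * r\<^sup>2))"
proof (cases "r \<le> 1")
  case True
  have "(NN t. ennreal (1 / t ^ 3) * ind {r..1} t) = ennreal (- (1 / (2 * 1\<^sup>2)) - - (1 / (2 * r\<^sup>2)))"
  proof (rule nn_integral_FTC_interior[OF _ True])
    show "continuous_on {r..1} (\<lambda>t. - (1 / (2 * t\<^sup>2)))"
      using assms by (intro continuous_intros) auto
    show "((\<lambda>t. - (1 / (2 * t\<^sup>2))) has_real_derivative 1 / t ^ 3) (at t)" if "t \<in> {r<..<1}" for t
      using that assms by (auto intro!: derivative_eq_intros simp: power2_eq_square power3_eq_cube field_simps)
  qed (use assms in auto)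
  then show ?thesis by (simp add: ennreal_leI)
qed (simp add: indicator_def)

text \<open>The deviation from the mean is an average over all segments from \<open>x\<close> to
  \<open>y\<close>. For fixed \<open>t\<close> the substitution
  \<open>z = x + t *\<^sub>R (y - x)\<close> contributes \<open>1 / t^2\<close>, and
  \<open>supn (y - x) = supn (z - x) / t\<close> another \<open>1 / t\<close>. Since
  \<open>supn (y - x) \<le> d\<close>, only \<open>t \<ge> supn (z - x) / d\<close> occurs, and
  integrating \<open>1 / t^3\<close> leaves \<open>d^2 / 2\<close> times the kernel
  \<open>1 / supn (z - x)\<close>.\<close>

lemma kernel_representation:
  fixes v :: "plane \<Rightarrow> complex" and p1 q1 p2 q2 d :: real
  defines "R \<equiv> {p1..q1} \<times> {p2..q2}"
  assumes pq: "p1 < q1" "p2 < q2" and d: "q1 - p1 \<le> d" "q2 - p2 \<le> d"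
    and der: "\<And>z. z \<in> R \<Longrightarrow> (v has_derivative (\<lambda>h. of_real (fst h) * d1 z + of_real (snd h) * d2 z)) (at z within R)"
    and cont: "continuous_on R d1" "continuous_on R d2"
    and x: "x \<in> R"
  shows "ennreal (cmod (v x - (1 / ((q1 - p1) * (q2 - p2))) *\<^sub>R (sint R v))) \<le>
    ennreal (d\<^sup>2 / (2 * ((q1 - p1) * (q2 - p2)))) *
      (NN z. ennreal (ind R z * (cmod (d1 z) + cmod (d2 z)) / supn (z - x)))"
proof -
  define m where "m = (q1 - p1) * (q2 - p2)"
  have m: "m > 0" using pq by (simp add: m_def)
  have R_cbox: "R = cbox (p1, p2) (q1, q2)" by (simp add: R_def cbox_Pair_eq)
  have Rb [measurable]: "R \<in> sets borel" unfolding R_cbox by simp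
  have compR: "compact R" unfolding R_cbox by simp
  have convR: "convex R" unfolding R_cbox by (rule convex_box)
  have mR: "emeasure lborel R = ennreal m"
  proof -
    have "measure lborel (cbox (p1, p2) (q1, q2)) = m" unfolding content_Pair using pq by (simp add: m_def)
    moreover have "emeasure lborel (cbox (p1, p2) (q1, q2)) = ennreal (measure lborel (cbox (p1, p2) (q1, q2)))"
      by (rule emeasure_eq_ennreal_measure) (simp add: emeasure_lborel_cbox_eq)
    ultimately show ?thesis by (simp add: R_cbox)
  qed
  define F where "F z = ind R z * (cmod (d1 z) + cmod (d2 z))" for z
  have F0: "0 \<le> F z" for z by (simp add: F_def)
  have contv: "continuous_on R v"
    using der by (intro has_derivative_continuous_on) auto
  have mF: "F \<in> BM"
  proof -
    have "(\<lambda>z. ind R z *\<^sub>R (cmod (d1 z) + cmod (d2 z))) \<in> BM"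
      by (intro borel_measurable_continuous_on_indicator continuous_intros cont Rb)
    then show ?thesis by (simp add: F_def[abs_def])
  qed
  have iv: "integrable lborel (\<lambda>y. ind R y *\<^sub>R v y)"
    by (rule borel_integrable_compact[OF compR contv])
  have ic: "integrable lborel (\<lambda>y. ind R y *\<^sub>R v x)"
    using mR by (intro integrable_scaleR_left) (simp add: integrable_real_indicator)
  have ic': "(sint R (\<lambda>y. v x)) = m *\<^sub>R v x"
    using mR m by (subst integral_scaleR_left) (auto simp: measure_def)
  have "v x - (1 / m) *\<^sub>R (sint R v) =
      (1 / m) *\<^sub>R ((sint R (\<lambda>y. v x)) - (sint R v))"
    unfolding ic' using m by (simp add: scaleR_diff_right)
  also have "\<dots> = (1 / m) *\<^sub>R (LINT y|lborel. ind R y *\<^sub>R v x - ind R y *\<^sub>R v y)"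
    using ic iv by simp
  finally have "ennreal (cmod (v x - (1 / m) *\<^sub>R (sint R v))) =
      ennreal (1 / m) * ennreal (norm (LINT y|lborel. ind R y *\<^sub>R v x - ind R y *\<^sub>R v y))"
    using m by (simp add: ennreal_mult' flip: times_divide_eq_left)
  also have "\<dots> \<le> ennreal (1 / m) * (NN y. ennreal (norm (ind R y *\<^sub>R v x - ind R y *\<^sub>R v y)))"
    using ic iv by (intro mult_left_mono integral_norm_bound_ennreal) auto
  also have "(NN y. ennreal (norm (ind R y *\<^sub>R v x - ind R y *\<^sub>R v y))) \<le>
      (NN y. NN t. ennreal (supn (y - x) * F (x + t *\<^sub>R (y - x)) * ind R y * ind {0..1} t))"
  proof (rule nn_integral_mono)
    fix y
    show "ennreal (norm (ind R y *\<^sub>R v x - ind R y *\<^sub>R v y)) \<le>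
      (NN t. ennreal (supn (y - x) * F (x + t *\<^sub>R (y - x)) * ind R y * ind {0..1} t))"
    proof (cases "y \<in> R")
      case True
      have pR: "x + t *\<^sub>R (y - x) \<in> R" if "t \<in> {0..1}" for t
      proof -
        have "x + t *\<^sub>R (y - x) = (1 - t) *\<^sub>R x + t *\<^sub>R y" by (simp add: algebra_simps)
        then show ?thesis using that x True convR by (simp add: convexD_alt)
      qed
      have "ennreal (norm (v x - v y)) \<le> (NN t. ennreal (max \<bar>fst (y - x)\<bar> \<bar>snd (y - x)\<bar> * (cmod (d1 (x + t *\<^sub>R (y - x))) + cmod (d2 (x + t *\<^sub>R (y - x))))) * ind {0..1} t)"
        using C1_segment_bound[OF convR x True der cont] by (simp add: norm_minus_commute)
      also have "\<dots> = (NN t. ennreal (supn (y - x) * F (x + t *\<^sub>R (y - x)) * ind R y * ind {0..1} t))"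
        using pR True by (intro nn_integral_cong) (auto simp: F_def supn_def indicator_def)
      finally show ?thesis using True by simp
    qed simp
  qed
  also have "\<dots> = (NN t. NN y. ennreal (supn (y - x) * F (x + t *\<^sub>R (y - x)) * ind R y * ind {0..1} t))"
  proof (rule lborel_pair.Fubini'[symmetric])
    have c1: "(\<lambda>z::(plane) \<times> real. x + snd z *\<^sub>R (fst z - x)) \<in> BM"
      "(\<lambda>z::(plane) \<times> real. fst z - x) \<in> BM"
      "(\<lambda>z::(plane) \<times> real. snd z) \<in> BM"
      "(\<lambda>z::(plane) \<times> real. fst z) \<in> BM"
      by (intro borel_measurable_continuous_onI continuous_intros)+
    have "(\<lambda>z::(plane) \<times> real. ennreal (supn (fst z - x) * F (x + snd z *\<^sub>R (fst z - x)) * ind R (fst z) * ind {0..1} (snd z)))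
        \<in> BM"
      by (intro measurable_compose[OF _ measurable_ennreal] borel_measurable_times
          measurable_compose[OF c1(1) mF] measurable_compose[OF c1(2) supn_measurable]
          measurable_compose[OF c1(4) borel_measurable_indicator] measurable_compose[OF c1(3) borel_measurable_indicator] Rb) simp
    then show "(\<lambda>(y, t). ennreal (supn (y - x) * F (x + t *\<^sub>R (y - x)) * ind R y * ind {0..1} t))
        \<in> borel_measurable (lborel \<Otimes>\<^sub>M lborel)"
      by (simp only: lborel_prod split_beta' measurable_lborel2)
  qed
  also have "\<dots> \<le> (NN t. NN z. ennreal (1 / t ^ 3) * ennreal (supn (z - x) * F z) * ind {supn (z - x) / d..1} t * ind {0<..} t)"
  proof (rule nn_integral_mono_AE)
    have "AE t::real in lborel. t \<noteq> 0" by (rule AE_lborel_singleton)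
    then show "AE t in lborel. (NN y. ennreal (supn (y - x) * F (x + t *\<^sub>R (y - x)) * ind R y * ind {0..1} t)) \<le>
      (NN z. ennreal (1 / t ^ 3) * ennreal (supn (z - x) * F z) * ind {supn (z - x) / d..1} t * ind {0<..} t)"
    proof eventually_elim
      case (elim t)
      show ?case
      proof (cases "t \<in> {0..1}")
        case True
        with elim have t: "0 < t" "t \<le> 1" by auto
        \<comment> \<open>Chosen so that \<open>t^2 * g (x + t *\<^sub>R (y - x))\<close> equals the
          integrand for \<open>y\<close> in \<open>R\<close>; the indicator records
          \<open>supn (y - x) \<le> d\<close>.\<close>
        define g where "g z = ennreal (1 / t ^ 3) * ennreal (supn (z - x) * F z) * ind {supn (z - x) / d..1} t" for z
        have mg: "g \<in> BM"
        proof -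
          have c: "(\<lambda>z. z - x) \<in> BM"
            by (intro borel_measurable_continuous_onI continuous_intros)
          have sx: "(\<lambda>z. supn (z - x)) \<in> BM"
            by (rule measurable_compose[OF c supn_measurable])
          have "{z. supn (z - x) \<le> d * t} \<in> sets borel"
            using measurable_sets[OF sx, of "{..d * t}"] by (simp add: vimage_def)
          moreover have "ind {supn (z - x) / d..1} t = (ind {z. supn (z - x) \<le> d * t} z :: ennreal)" for z
            using t d pq by (auto simp: indicator_def field_simps)
          ultimately show ?thesis unfolding g_def
            by (intro borel_measurable_times_ennreal measurable_compose[OF _ measurable_ennreal] borel_measurable_times sx mF)
              (auto intro: borel_measurable_indicator)
        qed
        have le: "ennreal (supn (y - x) * F (x + t *\<^sub>R (y - x)) * ind R y) \<le> ennreal (t\<^sup>2) * g (x + t *\<^sub>R (y - x))" for y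
        proof (cases "y \<in> R")
          case True
          have "supn (y - x) \<le> d"
            using True x d by (auto simp: supn_def R_def mem_Times_iff abs_le_iff)
          moreover have s: "supn (t *\<^sub>R (y - x)) = t * supn (y - x)"
            using t by (simp add: supn_def abs_mult max_mult_distrib_left)
          moreover have "d > 0" using d pq by linarith
          ultimately have "t \<in> {supn (x + t *\<^sub>R (y - x) - x) / d..1}"
            using t by (auto simp: field_simps)
          then have "ennreal (t\<^sup>2) * g (x + t *\<^sub>R (y - x)) = ennreal (t\<^sup>2 * (1 / t ^ 3 * (t * supn (y - x) * F (x + t *\<^sub>R (y - x)))))"
            using t s F0 by (simp add: g_def flip: ennreal_mult')
          also have "t\<^sup>2 * (1 / t ^ 3 * (t * supn (y - x) * F (x + t *\<^sub>R (y - x)))) = supn (y - x) * F (x + t *\<^sub>R (y - x))"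
            using t by (simp add: power2_eq_square power3_eq_cube)
          finally show ?thesis using True by simp
        qed simp
        have "(NN y. ennreal (supn (y - x) * F (x + t *\<^sub>R (y - x)) * ind R y * ind {0..1} t)) \<le>
            (NN y. ennreal (t\<^sup>2) * g (x + t *\<^sub>R (y - x)))"
          using le True by (intro nn_integral_mono) simp
        also have "\<dots> = ennreal (t\<^sup>2) * (NN y. g (x + t *\<^sub>R (y - x)))"
          by (rule nn_integral_cmult) (simp, intro measurable_compose[OF _ mg] borel_measurable_continuous_onI continuous_intros)
        also have "\<dots> = (NN z. g z)"
          by (rule nn_integral_lborel2_scale[OF mg t(1), symmetric])
        also have "\<dots> = (NN z. ennreal (1 / t ^ 3) * ennreal (supn (z - x) * F z) * ind {supn (z - x) / d..1} t * ind {0<..} t)"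
          using t by (simp add: g_def)
        finally show ?thesis .
      qed simp
    qed
  qed
  also have "\<dots> = (NN z. NN t. ennreal (1 / t ^ 3) * ennreal (supn (z - x) * F z) * ind {supn (z - x) / d..1} t * ind {0<..} t)"
  proof (rule lborel_pair.Fubini')
    have c: "(\<lambda>z::(plane) \<times> real. fst z - x) \<in> BM"
      "(\<lambda>z::(plane) \<times> real. fst z) \<in> BM"
      "(\<lambda>z::(plane) \<times> real. snd z) \<in> BM"
      by (intro borel_measurable_continuous_onI continuous_intros)+
    have sx: "(\<lambda>z::(plane) \<times> real. supn (fst z - x)) \<in> BM"
      by (rule measurable_compose[OF c(1) supn_measurable])
    have cl: "closed {z::(plane) \<times> real. supn (fst z - x) / d \<le> snd z \<and> snd z \<le> 1}"
      unfolding supn_def using d pq by (intro closed_Collect_conj closed_Collect_le continuous_intros) auto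
    have "(\<lambda>z::(plane) \<times> real. ennreal (1 / (snd z) ^ 3) * ennreal (supn (fst z - x) * F (fst z)) *
        ind {z. supn (fst z - x) / d \<le> snd z \<and> snd z \<le> 1} z * ind {0<..} (snd z)) \<in> BM"
      by (intro borel_measurable_times_ennreal measurable_compose[OF _ measurable_ennreal] borel_measurable_times sx
        measurable_compose[OF c(2) mF] borel_measurable_divide borel_measurable_power c(3) borel_measurable_const
        borel_measurable_indicator[OF borel_closed[OF cl]] measurable_compose[OF c(3) borel_measurable_indicator]) simp
    moreover have "(\<lambda>z::(plane) \<times> real. ennreal (1 / (snd z) ^ 3) * ennreal (supn (fst z - x) * F (fst z)) *
        ind {z. supn (fst z - x) / d \<le> snd z \<and> snd z \<le> 1} z * ind {0<..} (snd z)) =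
        (\<lambda>(z, t). ennreal (1 / t ^ 3) * ennreal (supn (z - x) * F z) * ind {supn (z - x) / d..1} t * ind {0<..} t)"
      by (simp only: indicator_def mem_Collect_eq atLeastAtMost_iff split_beta')
    ultimately show "(\<lambda>(z, t). ennreal (1 / t ^ 3) * ennreal (supn (z - x) * F z) * ind {supn (z - x) / d..1} t * ind {0<..} t)
        \<in> borel_measurable (lborel \<Otimes>\<^sub>M lborel)"
      by (simp only: lborel_prod measurable_lborel2)
  qed
  also have "\<dots> \<le> (NN z. ennreal (d\<^sup>2 / 2) * ennreal (F z / supn (z - x)))"
  proof (rule nn_integral_mono)
    fix z
    have dpos: "d > 0" using d pq by linarith
    show "(NN t. ennreal (1 / t ^ 3) * ennreal (supn (z - x) * F z) * ind {supn (z - x) / d..1} t * ind {0<..} t)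
      \<le> ennreal (d\<^sup>2 / 2) * ennreal (F z / supn (z - x))"
    \<comment> \<open>At \<open>z = x\<close> the right side is 0 by the convention for division;
      the left integrand carries the factor \<open>supn (z - x)\<close> and vanishes as
      well.\<close>
    proof (cases "supn (z - x) = 0")
      case False
      then have s: "supn (z - x) > 0" using supn_nonneg[of "z - x"] by linarith
      have "(NN t. ennreal (1 / t ^ 3) * ennreal (supn (z - x) * F z) * ind {supn (z - x) / d..1} t * ind {0<..} t)
        \<le> (NN t. ennreal (supn (z - x) * F z) * (ennreal (1 / t ^ 3) * ind {supn (z - x) / d..1} t))"
        by (intro nn_integral_mono) (auto simp: indicator_def mult.commute)
      also have "\<dots> = ennreal (supn (z - x) * F z) * (NN t. (ennreal (1 / t ^ 3) * ind {supn (z - x) / d..1} t))"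
        by (rule nn_integral_cmult) simp
      also have "\<dots> \<le> ennreal (supn (z - x) * F z) * ennreal (1 / (2 * (supn (z - x) / d)\<^sup>2))"
        using s dpos by (intro mult_left_mono nn_integral_inverse_cube_le) auto
      also have "\<dots> = ennreal (d\<^sup>2 / 2 * (F z / supn (z - x)))"
        using s F0[of z] by (simp flip: ennreal_mult') (simp add: power2_eq_square field_simps)
      also have "\<dots> = ennreal (d\<^sup>2 / 2) * ennreal (F z / supn (z - x))"
        by (rule ennreal_mult') simp
      finally show ?thesis .
    qed simp
  qed
  also have "\<dots> = ennreal (d\<^sup>2 / 2) * (NN z. ennreal (F z / supn (z - x)))"
  proof (rule nn_integral_cmult)
    have c: "(\<lambda>z. z - x) \<in> BM"
      by (intro borel_measurable_continuous_onI continuous_intros)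
    show "(\<lambda>z. ennreal (F z / supn (z - x))) \<in> borel_measurable lborel"
      unfolding measurable_lborel2
      by (intro measurable_compose[OF _ measurable_ennreal] borel_measurable_divide mF measurable_compose[OF c supn_measurable])
  qed
  finally have "ennreal (cmod (v x - (1 / m) *\<^sub>R (sint R v))) \<le>
      ennreal (1 / m) * (ennreal (d\<^sup>2 / 2) * (NN z. ennreal (F z / supn (z - x))))"
    by (simp add: mult_left_mono)
  also have "\<dots> = ennreal (d\<^sup>2 / (2 * m)) * (NN z. ennreal (F z / supn (z - x)))"
  proof -
    have "ennreal (1 / m) * ennreal (d\<^sup>2 / 2) = ennreal (1 / m * (d\<^sup>2 / 2))"
      using m by (intro ennreal_mult'[symmetric]) simp
    also have "1 / m * (d\<^sup>2 / 2) = d\<^sup>2 / (2 * m)" by simp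
    finally show ?thesis by (simp only: mult.assoc[symmetric])
  qed
  finally show ?thesis unfolding F_def m_def .
qed

text \<open>Edges of rectangles are null sets, so open, closed and half-open rectangles may be
  exchanged under the integral.\<close>

lemma AE_lborel_fst_neq: "AE z in lborel. fst (z :: plane) \<noteq> y"
  and AE_lborel_snd_neq: "AE z in lborel. snd (z :: plane) \<noteq> y"
proof -
  have cl: "closed {z::plane. fst z = y}" "closed {z::plane. snd z = y}"
    by (intro closed_Collect_eq continuous_intros)+
  have e1: "ind {z. fst z = y} (a, b) = (ind {y} a :: ennreal)" for a b
    by (simp add: indicator_def)
  have e2: "ind {z. snd z = y} (a, b) = (ind {y} b :: ennreal)" for a b
    by (simp add: indicator_def)
  have m: "(\<lambda>z. ind {z::plane. fst z = y} z :: ennreal) \<in> BM"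
    "(\<lambda>z. ind {z::plane. snd z = y} z :: ennreal) \<in> BM"
    using cl by (auto intro!: borel_measurable_indicator)
  have "emeasure lborel {z::plane. fst z = y} = (NN z. ind {z::plane. fst z = y} z)"
    by (rule nn_integral_indicator[symmetric], simp only: sets_lborel, rule borel_closed, rule cl)
  also have "\<dots> = (\<integral>\<^sup>+b. \<integral>\<^sup>+a. ind {y} a \<partial>lborel \<partial>(lborel :: real measure))"
    by (simp only: nn_integral_lborel2(2)[OF m(1)] e1)
  also have "\<dots> = 0" by simp
  finally have "{z::plane. fst z = y} \<in> null_sets lborel"
    using cl by (intro null_setsI) auto
  from AE_not_in[OF this] show "AE z in lborel. fst (z :: plane) \<noteq> y" by simp
  have "emeasure lborel {z::plane. snd z = y} = (NN z. ind {z::plane. snd z = y} z)"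
    by (rule nn_integral_indicator[symmetric], simp only: sets_lborel, rule borel_closed, rule cl)
  also have "\<dots> = (\<integral>\<^sup>+a. \<integral>\<^sup>+b. ind {y} b \<partial>lborel \<partial>(lborel :: real measure))"
    by (simp only: nn_integral_lborel2(1)[OF m(2)] e2)
  also have "\<dots> = 0" by simp
  finally have "{z::plane. snd z = y} \<in> null_sets lborel"
    using cl by (intro null_setsI) auto
  from AE_not_in[OF this] show "AE z in lborel. snd (z :: plane) \<noteq> y" by simp
qed

section \<open>Young's inequality and exponential integrability\<close>

lemma young_exp:
  fixes V \<phi> s :: real
  assumes "0 \<le> V" "0 < \<phi>"
  shows "V * s \<le> V * max 0 (ln (V / \<phi>)) + \<phi> * exp s"
proof (cases "s \<le> max 0 (ln (V / \<phi>))")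
  case True
  then have "V * s \<le> V * max 0 (ln (V / \<phi>))" using assms by (intro mult_left_mono)
  moreover have "0 \<le> \<phi> * exp s" using assms by simp
  ultimately show ?thesis by linarith
next
  case False
  \<comment> \<open>\<open>\<phi> * exp L\<close> is at least \<open>V\<close>, so beyond
    \<open>L\<close> the linear growth of \<open>V * s\<close> is dominated by the
    exponential.\<close>
  define L where "L = max 0 (ln (V / \<phi>))"
  have V: "V \<le> \<phi> * exp L"
  proof (cases "V = 0")
    case False
    then have "V / \<phi> > 0" using assms by simp
    then have "V / \<phi> = exp (ln (V / \<phi>))" by simp
    also have "\<dots> \<le> exp L" by (simp add: L_def)
    finally show ?thesis using assms by (simp add: field_simps)
  qed (use assms in auto)
  have "V * (s - L) \<le> \<phi> * exp L * (s - L)" using V False by (intro mult_right_mono) (auto simp: L_def)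
  also have "\<dots> \<le> \<phi> * exp L * exp (s - L)"
    using assms exp_ge_add_one_self[of "s - L"] by (intro mult_left_mono) (auto simp del: exp_ge_add_one_self)
  also have "\<dots> = \<phi> * exp s" by (simp add: exp_diff)
  finally show ?thesis by (simp add: L_def algebra_simps)
qed

text \<open>\<open>H\<close> may be 0 or infinite, whereas the kernel estimate wants a finite
  positive bound; an arbitrarily small surplus over \<open>H\<close> bridges the gap.\<close>

lemma exp_le_from_log_bounds:
  fixes H :: ennreal and y c :: real
  assumes c: "0 < c" and le: "\<And>h. 0 < h \<Longrightarrow> H \<le> ennreal h \<Longrightarrow> y \<le> ln (1 + c * h)"
  shows "ennreal (exp y) \<le> 1 + ennreal c * H"
proof (cases H)
  case (real h)
  have "exp y \<le> 1 + c * (h + e)" if "e > 0" for e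
  proof -
    have "y \<le> ln (1 + c * (h + e))" using le[of "h + e"] real that by (simp add: ennreal_leI)
    moreover have "1 + c * (h + e) > 0" using c real that by (simp add: add_pos_nonneg)
    ultimately show ?thesis by (metis exp_le_cancel_iff exp_ln)
  qed
  then have "exp y \<le> 1 + c * h + e" if "e > 0" for e
    using that c spec[of _ "e / c"] by (metis (no_types, opaque_lifting) divide_pos_pos add.assoc distrib_left nonzero_mult_div_cancel_left order_less_irrefl times_divide_eq_right)
  then have "exp y \<le> 1 + c * h" by (rule field_le_epsilon)
  then have "ennreal (exp y) \<le> ennreal (1 + c * h)" by (rule ennreal_leI)
  then show ?thesis using real c by (simp add: ennreal_mult' ennreal_plus)
next
  case top
  then show ?thesis using c by (simp add: ennreal_mult_top)
qed

text \<open>The kernel bounds give \<open>exp w \<le> 1 + (sqrt d / N) * H\<close> pointwise for the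
  normalised square \<open>w\<close> of the deviation from the mean. Integrated over a vertical
  segment, the right side is at most a fixed multiple of the length, uniformly in the first
  coordinate; since \<open>\<phi>\<close> depends on that coordinate alone, it factors out. Young's
  inequality for \<open>V * w\<close> then finishes the proof.\<close>

lemma smooth_log_inequality:
  fixes v :: "plane \<Rightarrow> complex" and p1 q1 p2 q2 d :: real and V :: "plane \<Rightarrow> real" and \<phi> :: "real \<Rightarrow> real"
  defines "R \<equiv> {p1..q1} \<times> {p2..q2}"
  defines "K \<equiv> d\<^sup>2 / (2 * ((q1 - p1) * (q2 - p2)))"
  assumes pq: "p1 < q1" "p2 < q2" and d: "q1 - p1 \<le> d" "q2 - p2 \<le> d"
    and der: "\<And>z. z \<in> R \<Longrightarrow> (v has_derivative (\<lambda>h. of_real (fst h) * d1 z + of_real (snd h) * d2 z)) (at z within R)"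
    and cont: "continuous_on R d1" "continuous_on R d2"
    and N: "0 < N" "(NN z. ennreal (ind R z * (cmod (d1 z) + cmod (d2 z))\<^sup>2)) \<le> ennreal N"
    and V: "V \<in> BM" "\<And>z. 0 \<le> V z"
    and \<phi>: "\<phi> \<in> BM" "\<And>x. 0 < \<phi> x"
  shows "(NN z. ennreal (ind R z * (V z * nsq (v z - (1 / ((q1 - p1) * (q2 - p2))) *\<^sub>R (sint R v)))))
    \<le> ennreal (32 * K\<^sup>2 * N) * (NN z. ennreal (ind R z * (V z * max 0 (ln (V z / \<phi> (fst z))) + (1 + 4 * d / (q2 - p2)) * \<phi> (fst z))))"
proof -
  define c where "c = (1 / ((q1 - p1) * (q2 - p2))) *\<^sub>R (sint R v)"
  have dpos: "d > 0" using d pq by linarith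
  have K: "K > 0" unfolding K_def using pq dpos by simp
  have R_cbox: "R = cbox (p1, p2) (q1, q2)" by (simp add: R_def cbox_Pair_eq)
  have Rb [measurable]: "R \<in> sets borel" unfolding R_cbox by simp
  define F where "F z = ind R z * (cmod (d1 z) + cmod (d2 z))" for z
  have F0: "0 \<le> F z" for z by (simp add: F_def)
  have mF [measurable]: "F \<in> BM"
  proof -
    have "(\<lambda>z. ind R z *\<^sub>R (cmod (d1 z) + cmod (d2 z))) \<in> BM"
      by (intro borel_measurable_continuous_on_indicator continuous_intros cont Rb)
    then show ?thesis by (simp add: F_def[abs_def])
  qed
  have F2: "(NN z. ennreal ((F z)\<^sup>2)) \<le> ennreal N"
  proof -
    have "(F z)\<^sup>2 = ind R z * (cmod (d1 z) + cmod (d2 z))\<^sup>2" for z by (simp add: F_def indicator_def)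
    then show ?thesis using N(2) by simp
  qed
  \<comment> \<open>Normalised by the constant \<open>K^2 * (32 * N)\<close> of the kernel estimate,
    so that the logarithmic bound reads \<open>w x \<le> ln (1 + sqrt d / N * h)\<close>.\<close>
  define w where "w z = nsq (v z - c) / (32 * K\<^sup>2 * N)" for z
  have w0: "0 \<le> w z" for z using N by (simp add: w_def)
  have contv: "continuous_on R v"
    using der by (intro has_derivative_continuous_on) auto
  have mw: "(\<lambda>z. ind R z * w z) \<in> BM"
  proof -
    have "(\<lambda>z. ind R z *\<^sub>R w z) \<in> BM"
      unfolding w_def using K N
      by (intro borel_measurable_continuous_on_indicator continuous_intros contv Rb) auto
    then show ?thesis by simp
  qed
  define H where "H x = (NN z. ennreal ((F z)\<^sup>2 / sqrt (supn (z - x))))" for x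
  have expw: "ennreal (exp (w x)) \<le> 1 + ennreal (sqrt d / N) * H x" if x: "x \<in> R" for x
  proof (rule exp_le_from_log_bounds)
    show "0 < sqrt d / N" using dpos N by simp
    fix h :: real assume h: "0 < h" "H x \<le> ennreal h"
    have supp: "supn (z - x) \<le> d" if "F z \<noteq> 0" for z
    proof -
      have "z \<in> R" using that by (auto simp: F_def indicator_def split: if_splits)
      then show ?thesis using x d by (auto simp: supn_def R_def mem_Times_iff abs_le_iff)
    qed
    have "(ennreal (cmod (v x - c)))\<^sup>2 \<le> (ennreal K * (NN z. ennreal (F z / supn (z - x))))\<^sup>2"
      using kernel_representation[OF pq d der[unfolded R_def] cont[unfolded R_def] x[unfolded R_def]]
      unfolding c_def F_def R_def K_def by (intro power_mono) auto
    also have "\<dots> = (ennreal K)\<^sup>2 * (NN z. ennreal (F z / supn (z - x)))\<^sup>2"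
      by (rule power_mult_distrib)
    also have "\<dots> \<le> (ennreal K)\<^sup>2 * ennreal (32 * N * ln (1 + sqrt d * h / N))"
      using log_kernel_bound[OF mF F0 supp _ N(1) F2 h(1) h(2)[unfolded H_def]] dpos
      by (intro mult_left_mono) auto
    also have "\<dots> = ennreal (K\<^sup>2 * (32 * N * ln (1 + sqrt d * h / N)))"
      using K by (simp add: ennreal_power ennreal_mult')
    finally have "esq (v x - c) \<le> ennreal (K\<^sup>2 * (32 * N * ln (1 + sqrt d * h / N)))"
      by (simp add: ennreal_power)
    then have "nsq (v x - c) \<le> K\<^sup>2 * (32 * N * ln (1 + sqrt d * h / N))"
      using N(1) h dpos by (subst (asm) ennreal_le_iff) auto
    then show "w x \<le> ln (1 + sqrt d / N * h)"
      unfolding w_def using K N(1) by (subst pos_divide_le_eq) (auto simp: mult_ac)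
  qed
  have mH: "H \<in> BM"
  proof -
    have c: "(\<lambda>z::(plane) \<times> (plane). snd z - fst z) \<in> BM"
      "(\<lambda>z::(plane) \<times> (plane). snd z) \<in> BM"
      by (intro borel_measurable_continuous_onI continuous_intros)+
    have "(\<lambda>z::(plane) \<times> (plane). ennreal ((F (snd z))\<^sup>2 / sqrt (supn (snd z - fst z)))) \<in> BM"
      by (intro measurable_compose[OF _ measurable_ennreal] borel_measurable_divide borel_measurable_power
        measurable_compose[OF c(2) mF] measurable_compose[OF measurable_compose[OF c(1) supn_measurable] borel_measurable_sqrt])
    then have "(\<lambda>(x, z). ennreal ((F z)\<^sup>2 / sqrt (supn (z - x)))) \<in> borel_measurable (borel \<Otimes>\<^sub>M lborel)"
      unfolding split_beta' by (simp add: borel_prod cong: measurable_cong_sets)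
    from lborel.borel_measurable_nn_integral[OF this] show ?thesis by (simp add: H_def[abs_def])
  qed
  \<comment> \<open>By \<open>supn (z - (x, y)) \<ge> \<bar>y - snd z\<bar>\<close> the kernel is
    majorised by a function of the vertical distance, whose integral \<open>4 * sqrt d\<close> does
    not depend on \<open>x\<close>.\<close>
  have intH: "(NN y. H (x, y) * ind {p2..q2} y) \<le> ennreal (4 * sqrt d * N)" for x
  proof -
    have m1: "(\<lambda>z. ennreal ((F z)\<^sup>2)) \<in> BM" by measurable
    have "(NN y. H (x, y) * ind {p2..q2} y) \<le>
      (NN y. NN z. ennreal ((F z)\<^sup>2) * (ennreal (1 / sqrt \<bar>y - snd z\<bar>) * ind {snd z - d..snd z + d} y))"
    proof (rule nn_integral_mono_AE)
      have "AE y in lborel. (y::real) \<in> UNIV" by simp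
      show "AE y in lborel. H (x, y) * ind {p2..q2} y \<le>
        (NN z. ennreal ((F z)\<^sup>2) * (ennreal (1 / sqrt \<bar>y - snd z\<bar>) * ind {snd z - d..snd z + d} y))"
      proof (rule AE_I2)
        fix y :: real
        have null: "AE z in lborel. snd (z :: plane) \<noteq> y" by (rule AE_lborel_snd_neq)
        show "H (x, y) * ind {p2..q2} y \<le>
          (NN z. ennreal ((F z)\<^sup>2) * (ennreal (1 / sqrt \<bar>y - snd z\<bar>) * ind {snd z - d..snd z + d} y))"
        proof (cases "y \<in> {p2..q2}")
          case True
          have "H (x, y) \<le> (NN z. ennreal ((F z)\<^sup>2) * (ennreal (1 / sqrt \<bar>y - snd z\<bar>) * ind {snd z - d..snd z + d} y))"
            unfolding H_def
          proof (rule nn_integral_mono_AE)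
            show "AE z in lborel. ennreal ((F z)\<^sup>2 / sqrt (supn (z - (x, y)))) \<le>
              ennreal ((F z)\<^sup>2) * (ennreal (1 / sqrt \<bar>y - snd z\<bar>) * ind {snd z - d..snd z + d} y)"
              using null
            proof eventually_elim
              case (elim z)
              show ?case
              proof (cases "z \<in> R")
                case z: True
                have "y \<in> {snd z - d..snd z + d}" using z True d by (auto simp: R_def)
                moreover have "\<bar>y - snd z\<bar> \<le> supn (z - (x, y))" by (simp add: supn_def abs_minus_commute)
                moreover have "0 < \<bar>y - snd z\<bar>" using elim by simp
                ultimately have "(F z)\<^sup>2 / sqrt (supn (z - (x, y))) \<le> (F z)\<^sup>2 * (1 / sqrt \<bar>y - snd z\<bar>)"
                  by (simp add: frac_le)
                then have "ennreal ((F z)\<^sup>2 / sqrt (supn (z - (x, y)))) \<le> ennreal ((F z)\<^sup>2) * ennreal (1 / sqrt \<bar>y - snd z\<bar>)"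
                  by (simp add: ennreal_leI flip: ennreal_mult')
                then show ?thesis using \<open>y \<in> {snd z - d..snd z + d}\<close> by simp
              qed (simp add: F_def)
            qed
          qed
          then show ?thesis using True by simp
        qed simp
      qed
    qed
    also have "\<dots> = (NN z. NN y. ennreal ((F z)\<^sup>2) * (ennreal (1 / sqrt \<bar>y - snd z\<bar>) * ind {snd z - d..snd z + d} y))"
    proof (rule lborel_pair.Fubini')
      have c: "(\<lambda>z::(plane) \<times> real. snd z - snd (fst z)) \<in> BM"
        "(\<lambda>z::(plane) \<times> real. fst z) \<in> BM"
        by (intro borel_measurable_continuous_onI continuous_intros)+
      have k: "(\<lambda>t. ennreal (1 / sqrt \<bar>t\<bar>) * ind {-d..d} t) \<in> BM" by measurable
      have "(\<lambda>z::(plane) \<times> real. ennreal ((F (fst z))\<^sup>2) * (ennreal (1 / sqrt \<bar>snd z - snd (fst z)\<bar>) * ind {-d..d} (snd z - snd (fst z)))) \<in> BM"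
        by (intro borel_measurable_times_ennreal measurable_compose[OF c(1) k] measurable_compose[OF c(2) m1])
      moreover have "ind {-d..d} (y - b) = (ind {b - d..b + d} y :: ennreal)" for y b
        by (auto simp: indicator_def)
      ultimately show "(\<lambda>(z, y). ennreal ((F z)\<^sup>2) * (ennreal (1 / sqrt \<bar>y - snd z\<bar>) * ind {snd z - d..snd z + d} y)) \<in> borel_measurable (lborel \<Otimes>\<^sub>M lborel)"
        by (simp only: lborel_prod measurable_lborel2 split_beta')
    qed
    also have "\<dots> = (NN z. ennreal ((F z)\<^sup>2) * ennreal (4 * sqrt d))"
      using dpos by (intro nn_integral_cong, subst nn_integral_cmult) (auto simp: nn_integral_inverse_sqrt)
    also have "\<dots> = (NN z. ennreal ((F z)\<^sup>2)) * ennreal (4 * sqrt d)"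
      by (rule nn_integral_multc) (simp add: m1)
    also have "\<dots> \<le> ennreal N * ennreal (4 * sqrt d)" using F2 by (intro mult_right_mono) auto
    also have "\<dots> = ennreal (4 * sqrt d * N)" using N dpos by (simp add: mult.commute flip: ennreal_mult')
    finally show ?thesis .
  qed
  define L where "L z = ind R z * (V z * max 0 (ln (V z / \<phi> (fst z))))" for z
  have mphi: "(\<lambda>z::plane. \<phi> (fst z)) \<in> BM"
    by (rule measurable_compose[OF fst_borel_measurable \<phi>(1)])
  have mL: "L \<in> BM"
    unfolding L_def
    by (intro borel_measurable_times borel_measurable_max V(1) borel_measurable_ln borel_measurable_divide mphi
        borel_measurable_const borel_measurable_indicator Rb)
  have L0: "0 \<le> L z" for z using V by (simp add: L_def)
  define E where "E z = ennreal (ind R z * (\<phi> (fst z) * exp (w z)))" for z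
  have mE: "E \<in> BM"
  proof -
    have "E = (\<lambda>z. ennreal (ind R z * (\<phi> (fst z) * exp (ind R z * w z))))"
      by (auto simp: E_def indicator_def)
    then show ?thesis
      using measurable_compose[OF mw borel_measurable_exp] mphi Rb
      by (simp only:) (intro measurable_compose[OF _ measurable_ennreal] borel_measurable_times
          borel_measurable_indicator measurable_compose[OF mw borel_measurable_exp] mphi Rb)
  qed
  \<comment> \<open>The segment contributes its length \<open>q2 - p2\<close>, the potential
    \<open>(sqrt d / N) * (4 * sqrt d * N) = 4 * d\<close>.\<close>
  define c2 where "c2 = 1 + 4 * d / (q2 - p2)"
  have c2: "0 \<le> c2" using dpos pq by (simp add: c2_def)
  have intE: "(NN z. E z) \<le> (NN z. ennreal (ind R z * (c2 * \<phi> (fst z))))"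
  proof -
    have mr: "(\<lambda>z. ennreal (ind R z * (c2 * \<phi> (fst z)))) \<in> BM"
      by (intro measurable_compose[OF _ measurable_ennreal] borel_measurable_times borel_measurable_const
          borel_measurable_indicator mphi Rb)
    have mHx: "(\<lambda>y. H (x, y)) \<in> BM" for x
      by (intro measurable_compose[OF _ mH] borel_measurable_continuous_onI continuous_intros)
    show ?thesis
      unfolding nn_integral_lborel2(1)[OF mE] nn_integral_lborel2(1)[OF mr]
    proof (rule nn_integral_mono)
      fix x :: real
      show "(NN y. E (x, y)) \<le> (NN y. ennreal (ind R (x, y) * (c2 * \<phi> (fst (x, y)))))"
      proof (cases "x \<in> {p1..q1}")
        case True
        have "(NN y. E (x, y)) \<le>
          (NN y. ennreal (\<phi> x) * (ind {p2..q2} y + ennreal (sqrt d / N) * (H (x, y) * ind {p2..q2} y)))"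
        proof (rule nn_integral_mono)
          fix y
          show "E (x, y) \<le> ennreal (\<phi> x) * (ind {p2..q2} y + ennreal (sqrt d / N) * (H (x, y) * ind {p2..q2} y))"
          proof (cases "y \<in> {p2..q2}")
            case y: True
            then have xy: "(x, y) \<in> R" using True by (simp add: R_def)
            have "E (x, y) = ennreal (\<phi> x) * ennreal (exp (w (x, y)))"
              using xy \<phi>(2)[of x] by (simp add: E_def ennreal_mult' less_imp_le)
            also have "\<dots> \<le> ennreal (\<phi> x) * (1 + ennreal (sqrt d / N) * H (x, y))"
              by (intro mult_left_mono expw xy) simp
            finally show ?thesis using y by simp
          qed (simp add: E_def R_def)
        qed
        also have "\<dots> = ennreal (\<phi> x) * (ennreal (q2 - p2) + ennreal (sqrt d / N) * (NN y. H (x, y) * ind {p2..q2} y))"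
          using mHx pq by (simp add: nn_integral_cmult nn_integral_add)
        also have "\<dots> \<le> ennreal (\<phi> x) * (ennreal (q2 - p2) + ennreal (sqrt d / N) * ennreal (4 * sqrt d * N))"
          by (intro mult_left_mono add_left_mono intH) auto
        also have "\<dots> = ennreal (\<phi> x) * ennreal (c2 * (q2 - p2))"
        proof -
          have "ennreal (sqrt d / N) * ennreal (4 * sqrt d * N) = ennreal (sqrt d / N * (4 * sqrt d * N))"
            using N dpos by (intro ennreal_mult'[symmetric]) auto
          also have "sqrt d / N * (4 * sqrt d * N) = 4 * d" using N dpos by (simp add: field_simps)
          finally have "ennreal (q2 - p2) + ennreal (sqrt d / N) * ennreal (4 * sqrt d * N) = ennreal (q2 - p2 + 4 * d)"
            using pq dpos by (simp add: ennreal_plus)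
          also have "q2 - p2 + 4 * d = c2 * (q2 - p2)" using pq by (simp add: c2_def field_simps)
          finally show ?thesis by simp
        qed
        also have "\<dots> = (NN y. ennreal (c2 * \<phi> x) * ind {p2..q2} y)"
          using pq c2 \<phi>(2)[of x] by (simp add: nn_integral_cmult mult_ac flip: ennreal_mult')
        also have "\<dots> = (NN y. ennreal (ind R (x, y) * (c2 * \<phi> (fst (x, y)))))"
          using True by (intro nn_integral_cong) (auto simp: R_def indicator_def)
        finally show ?thesis .
      qed (simp add: E_def R_def indicator_times)
    qed
  qed
  have KN: "32 * K\<^sup>2 * N > 0" using K N by simp
  have "(NN z. ennreal (ind R z * (V z * nsq (v z - c)))) \<le>
      (NN z. ennreal (32 * K\<^sup>2 * N) * (ennreal (L z) + E z))"
  proof (rule nn_integral_mono)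
    fix z
    show "ennreal (ind R z * (V z * nsq (v z - c))) \<le> ennreal (32 * K\<^sup>2 * N) * (ennreal (L z) + E z)"
    proof (cases "z \<in> R")
      case True
      have "V z * nsq (v z - c) = 32 * K\<^sup>2 * N * (V z * w z)"
        using K N by (simp add: w_def)
      also have "\<dots> \<le> 32 * K\<^sup>2 * N * (L z + \<phi> (fst z) * exp (w z))"
        using young_exp[OF V(2) \<phi>(2), of z "w z" "fst z"] KN True by (intro mult_left_mono) (auto simp: L_def)
      finally have "ennreal (V z * nsq (v z - c)) \<le> ennreal (32 * K\<^sup>2 * N * (L z + \<phi> (fst z) * exp (w z)))"
        by (rule ennreal_leI)
      also have "\<dots> = ennreal (32 * K\<^sup>2 * N) * (ennreal (L z) + E z)"
        using KN L0[of z] \<phi>(2)[of "fst z"] True by (simp add: E_def ennreal_mult' ennreal_plus less_imp_le)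
      finally show ?thesis using True by simp
    qed simp
  qed
  also have "\<dots> = ennreal (32 * K\<^sup>2 * N) * ((NN z. ennreal (L z)) + (NN z. E z))"
    using mL mE by (simp add: nn_integral_cmult nn_integral_add)
  also have "\<dots> \<le> ennreal (32 * K\<^sup>2 * N) * ((NN z. ennreal (L z)) + (NN z. ennreal (ind R z * (c2 * \<phi> (fst z)))))"
    by (intro mult_left_mono add_left_mono intE) simp
  also have "(NN z. ennreal (L z)) + (NN z. ennreal (ind R z * (c2 * \<phi> (fst z)))) =
      (NN z. ennreal (L z) + ennreal (ind R z * (c2 * \<phi> (fst z))))"
  proof (rule nn_integral_add[symmetric])
    show "(\<lambda>z. ennreal (ind R z * (c2 * \<phi> (fst z)))) \<in> borel_measurable lborel"
      unfolding measurable_lborel2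
      by (intro measurable_compose[OF _ measurable_ennreal] borel_measurable_times borel_measurable_const
          borel_measurable_indicator mphi Rb)
  qed (use mL in simp)
  also have "\<dots> = (NN z. ennreal (ind R z * (V z * max 0 (ln (V z / \<phi> (fst z))) + c2 * \<phi> (fst z))))"
  proof (rule nn_integral_cong)
    fix z
    have "ennreal (L z) + ennreal (ind R z * (c2 * \<phi> (fst z))) = ennreal (L z + ind R z * (c2 * \<phi> (fst z)))"
      using L0[of z] c2 \<phi>(2)[of "fst z"] by (intro ennreal_plus[symmetric]) (auto simp: less_imp_le)
    also have "L z + ind R z * (c2 * \<phi> (fst z)) = ind R z * (V z * max 0 (ln (V z / \<phi> (fst z))) + c2 * \<phi> (fst z))"
      by (simp add: L_def distrib_left)
    finally show "ennreal (L z) + ennreal (ind R z * (c2 * \<phi> (fst z))) = \<dots>" .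
  qed
  finally show ?thesis unfolding c_def c2_def .
qed

subsection \<open>Steklov averages\<close>

lemma integrable_indicator_L2:
  fixes g :: "'a::euclidean_space \<Rightarrow> complex"
  assumes "g \<in> BM" "sq_int g"
    and "B \<in> sets borel" "emeasure lborel B < \<infinity>"
  shows "integrable lborel (\<lambda>z. ind B z *\<^sub>R g z)"
proof (rule Bochner_Integration.integrable_bound)
  show "integrable lborel (\<lambda>z. ind B z + nsq (g z))"
    using assms by (intro Bochner_Integration.integrable_add integrable_real_indicator) auto
  show "(\<lambda>z. ind B z *\<^sub>R g z) \<in> borel_measurable lborel" using assms by simp
  have "t \<le> 1 + t\<^sup>2" for t :: real using sum_squares_ge_zero[of "t - 1/2" 0] by (simp add: power2_eq_square algebra_simps)
  then show "AE z in lborel. norm (ind B z *\<^sub>R g z) \<le> norm (ind B z + nsq (g z))"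
    by (intro AE_I2) (simp add: indicator_def)
qed

lemma emeasure_rect_finite: "emeasure lborel ({p<..<q} \<times> {c<..<d}) < \<infinity>" for p q c d :: real
proof -
  have "emeasure lborel ({p<..<q} \<times> {c<..<d}) \<le> emeasure lborel (cbox (p, c) (q, d))"
  proof (rule emeasure_mono)
    show "{p<..<q} \<times> {c<..<d} \<subseteq> cbox (p, c) (q, d)" by (auto simp: cbox_Pair_eq)
  qed simp
  also have "\<dots> < \<infinity>" by (rule emeasure_lborel_cbox_finite)
  finally show ?thesis .
qed

lemma emeasure_lborel_Times:
  assumes "A \<in> sets borel" "B \<in> sets borel"
  shows "emeasure (lborel :: plane measure) (A \<times> B) = emeasure lborel A * emeasure lborel B"
  using lborel.emeasure_pair_measure_Times[of A lborel B] assms by (simp add: lborel_prod)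

lemma rect_borel [measurable]: "{p<..<q} \<times> {c<..<d} \<in> sets (borel :: plane measure)"
  by (intro borel_open open_Times) auto

lemma integrable_rect_L2:
  fixes g :: "plane \<Rightarrow> complex"
  assumes "g \<in> BM" "sq_int g"
  shows "integrable lborel (\<lambda>z. ind ({p<..<q} \<times> {c<..<d}) z *\<^sub>R g z)"
  by (rule integrable_indicator_L2[OF assms rect_borel emeasure_rect_finite])

text \<open>The indicators of the moved rectangles converge off four lines, so dominated convergence
  applies.\<close>

lemma continuous_rint:
  fixes g :: "plane \<Rightarrow> complex"
  assumes g: "g \<in> BM" "sq_int g"
  shows "continuous_on UNIV (\<lambda>z. rint g (fst z) (fst z + h) (snd z) (snd z + k))"
proof -
  have "continuous (at z) (\<lambda>z. rint g (fst z) (fst z + h) (snd z) (snd z + k))" for z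
    unfolding continuous_at_sequentially
  proof (intro allI impI)
    fix X :: "nat \<Rightarrow> plane" assume X: "X \<longlonglongrightarrow> z"
    have X1: "(\<lambda>n. fst (X n)) \<longlonglongrightarrow> fst z" and X2: "(\<lambda>n. snd (X n)) \<longlonglongrightarrow> snd z"
      using X by (auto intro: tendsto_fst tendsto_snd)
    obtain M where M: "\<And>n. norm (X n) \<le> M"
      using Bseq_eq_bounded X convergentI convergent_imp_Bseq[of X] by (metis BseqE)
    define B where "B = {-M - 1 - \<bar>h\<bar><..<M + 1 + \<bar>h\<bar>} \<times> {-M - 1 - \<bar>k\<bar><..<M + 1 + \<bar>k\<bar>}"
    have "(\<lambda>n. LINT w|lborel. ind ({fst (X n)<..<fst (X n) + h} \<times> {snd (X n)<..<snd (X n) + k}) w *\<^sub>R g w) \<longlonglongrightarrow>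
        (sint ({fst z<..<fst z + h} \<times> {snd z<..<snd z + k}) g)"
    proof (rule integral_dominated_convergence[where w = "\<lambda>w. norm (ind B w *\<^sub>R g w)"])
      show "integrable lborel (\<lambda>w. norm (ind B w *\<^sub>R g w))"
        unfolding B_def by (intro integrable_norm integrable_rect_L2 g)
      show "AE w in lborel. norm (ind ({fst (X n)<..<fst (X n) + h} \<times> {snd (X n)<..<snd (X n) + k}) w *\<^sub>R g w) \<le> norm (ind B w *\<^sub>R g w)" for n
      proof (rule AE_I2)
        fix w
        have "\<bar>fst (X n)\<bar> \<le> M" "\<bar>snd (X n)\<bar> \<le> M"
          using M[of n] norm_fst_le[of "fst (X n)" "snd (X n)"] norm_snd_le[of "snd (X n)" "fst (X n)"] by (simp_all add: norm_Pair)
        then have "{fst (X n)<..<fst (X n) + h} \<times> {snd (X n)<..<snd (X n) + k} \<subseteq> B"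
          unfolding B_def by (intro Sigma_mono) (auto simp: abs_le_iff)
        then show "norm (ind ({fst (X n)<..<fst (X n) + h} \<times> {snd (X n)<..<snd (X n) + k}) w *\<^sub>R g w) \<le> norm (ind B w *\<^sub>R g w)"
          by (cases "w \<in> {fst (X n)<..<fst (X n) + h} \<times> {snd (X n)<..<snd (X n) + k}") (drule (1) subsetD, simp_all)
      qed
      have lim1: "(\<lambda>n. ind {p n<..<p n + e} t :: real) \<longlonglongrightarrow> ind {p0<..<p0 + e} t"
        if p: "p \<longlonglongrightarrow> p0" and t: "t \<noteq> p0" "t \<noteq> p0 + e" for p :: "nat \<Rightarrow> real" and p0 e t
      proof (rule tendsto_eventually)
        have pe: "(\<lambda>n. p n + e) \<longlonglongrightarrow> p0 + e" using p by (intro tendsto_intros)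
        have "\<forall>\<^sub>F n in sequentially. (p n < t) = (p0 < t)"
          using t(1) order_tendstoD[OF p, of t] by (cases "p0 < t") (force elim: eventually_mono)+
        moreover have "\<forall>\<^sub>F n in sequentially. (t < p n + e) = (t < p0 + e)"
          using t(2) order_tendstoD[OF pe, of t] by (cases "t < p0 + e") (force elim: eventually_mono)+
        ultimately show "\<forall>\<^sub>F n in sequentially. ind {p n<..<p n + e} t = (ind {p0<..<p0 + e} t :: real)"
          by eventually_elim (simp add: indicator_def)
      qed
      show "AE w in lborel. (\<lambda>n. ind ({fst (X n)<..<fst (X n) + h} \<times> {snd (X n)<..<snd (X n) + k}) w *\<^sub>R g w)
        \<longlonglongrightarrow> ind ({fst z<..<fst z + h} \<times> {snd z<..<snd z + k}) w *\<^sub>R g w"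
        using AE_lborel_fst_neq[of "fst z"] AE_lborel_fst_neq[of "fst z + h"] AE_lborel_snd_neq[of "snd z"] AE_lborel_snd_neq[of "snd z + k"]
      proof eventually_elim
        case (elim w)
        then show ?case unfolding indicator_times
          by (intro tendsto_scaleR tendsto_mult lim1 X1 X2 tendsto_const) simp_all
      qed
    qed (use g in \<open>simp_all\<close>)
    then show "((\<lambda>z. rint g (fst z) (fst z + h) (snd z) (snd z + k)) \<circ> X) \<longlonglongrightarrow> rint g (fst z) (fst z + h) (snd z) (snd z + k)"
      by (simp add: rint_def o_def)
  qed
  then show ?thesis by (simp add: continuous_on_eq_continuous_at)
qed

text \<open>The weak gradient in integrated form. Rectangles may touch the boundary of the strip,
  and all functions live on the whole plane, so integrals are taken with respect to
  \<open>lborel\<close> throughout.\<close>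

definition rect_weak_grad :: "real \<Rightarrow> (plane \<Rightarrow> complex) \<Rightarrow> (plane \<Rightarrow> complex) \<Rightarrow> (plane \<Rightarrow> complex) \<Rightarrow> bool" where
  "rect_weak_grad a u g1 g2 \<longleftrightarrow>
    u \<in> BM \<and> g1 \<in> BM \<and> g2 \<in> BM \<and>
    sq_int u \<and> sq_int g1 \<and> sq_int g2 \<and>
    (\<forall>s t h c d. s \<le> t \<longrightarrow> 0 < h \<longrightarrow> 0 \<le> c \<longrightarrow> d \<le> a \<longrightarrow>
      rint u t (t + h) c d - rint u s (s + h) c d = (sint {s<..<t} (\<lambda>r. rint g1 r (r + h) c d))) \<and>
    (\<forall>s t h p q. s \<le> t \<longrightarrow> 0 < h \<longrightarrow> 0 \<le> s \<longrightarrow> t + h \<le> a \<longrightarrow>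
      rint u p q t (t + h) - rint u p q s (s + h) = (sint {s<..<t} (\<lambda>r. rint g2 p q r (r + h))))"

text \<open>As \<open>G\<close> is continuous, this is the fundamental theorem; the open intervals
  of the identity differ from closed ones by null sets.\<close>

lemma integral_form_imp_derivative:
  fixes U G :: "real \<Rightarrow> complex"
  assumes G: "continuous_on UNIV G" and ab: "x \<in> {\<alpha>..\<beta>}"
    and U: "\<And>t. \<alpha> \<le> t \<Longrightarrow> t \<le> \<beta> \<Longrightarrow> U t - U \<alpha> = (sint {\<alpha><..<t} G)"
  shows "(U has_vector_derivative G x) (at x within {\<alpha>..\<beta>})"
proof -
  have cG: "continuous_on S G" for S using G continuous_on_subset by blast
  have eq: "U t = U \<alpha> + integral {\<alpha>..t} G" if "t \<in> {\<alpha>..\<beta>}" for t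
  proof -
    have si: "set_integrable lborel {\<alpha>..t} G"
      unfolding set_integrable_def by (rule borel_integrable_compact[OF _ cG]) simp
    have "(sint {\<alpha><..<t} G) = (sint {\<alpha>..t} G)"
    proof (rule integral_cong_AE)
      show "AE r in lborel. ind {\<alpha><..<t} r *\<^sub>R G r = ind {\<alpha>..t} r *\<^sub>R G r"
        using AE_lborel_singleton[of \<alpha>] AE_lborel_singleton[of t] by eventually_elim (auto simp: indicator_def)
    qed (use borel_measurable_continuous_onI[OF G] in simp_all)
    also have "\<dots> = integral {\<alpha>..t} G"
      using set_borel_integral_eq_integral(2)[OF si] by (simp add: set_lebesgue_integral_def)
    finally show ?thesis using U[of t] that by (simp add: algebra_simps)
  qed
  have "((\<lambda>t. U \<alpha> + integral {\<alpha>..t} G) has_vector_derivative 0 + G x) (at x within {\<alpha>..\<beta>})"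
    by (intro has_vector_derivative_add has_vector_derivative_const integral_has_vector_derivative cG ab)
  then have "((\<lambda>t. U \<alpha> + integral {\<alpha>..t} G) has_vector_derivative G x) (at x within {\<alpha>..\<beta>})" by simp
  then show ?thesis by (rule has_vector_derivative_transform[OF ab, rotated]) (rule eq)
qed

text \<open>The Steklov average over the square with lower left corner \<open>z\<close>. As the
  square extends to the right and upwards, averages on a rectangle shortened by \<open>h\<close> at
  these two sides use values inside the rectangle.\<close>

definition stek :: "real \<Rightarrow> (plane \<Rightarrow> complex) \<Rightarrow> plane \<Rightarrow> complex" where
  "stek h u z = (1 / h\<^sup>2) *\<^sub>R rint u (fst z) (fst z + h) (snd z) (snd z + h)"

lemma continuous_stek:
  assumes "g \<in> BM" "sq_int g"
  shows "continuous_on S (stek h g)"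
proof -
  have "continuous_on UNIV (stek h g)"
    unfolding stek_def by (intro continuous_on_scaleR continuous_on_const continuous_rint assms)
  then show ?thesis using continuous_on_subset by blast
qed

text \<open>Both partial derivatives are averages of \<open>g1\<close> and \<open>g2\<close>, hence
  continuous, so the total derivative exists. It is taken within the closed rectangle, whose lower
  edge may lie on the boundary of the strip.\<close>

lemma stek_has_derivative:
  assumes w: "rect_weak_grad a u g1 g2" and h: "0 < h" and c: "0 \<le> p2" "q2 + h \<le> a"
    and z: "z \<in> {p1..q1} \<times> {p2..q2}"
  shows "(stek h u has_derivative (\<lambda>k. of_real (fst k) * stek h g1 z + of_real (snd k) * stek h g2 z))
    (at z within {p1..q1} \<times> {p2..q2})"
proof -
  obtain x y where xy: "z = (x, y)" by force
  define U where "U x y = stek h u (x, y)" for x y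
  have g: "g1 \<in> BM" "sq_int g1"
    "g2 \<in> BM" "sq_int g2"
    using w by (auto simp: rect_weak_grad_def)
  have c1: "continuous_on UNIV (\<lambda>r. rint g1 r (r + h) y (y + h))" for y
    using continuous_on_compose2[OF continuous_rint[OF g(1,2)], of UNIV "\<lambda>r. (r, y)" h h]
    by (simp add: continuous_on_Pair)
  have c2: "continuous_on UNIV (\<lambda>r. rint g2 x (x + h) r (r + h))" for x
    using continuous_on_compose2[OF continuous_rint[OF g(3,4)], of UNIV "\<lambda>r. (x, r)" h h]
    by (simp add: continuous_on_Pair)
  have d1: "((\<lambda>x. U x y) has_vector_derivative stek h g1 (x, y)) (at x within {p1..q1})"
    if "x \<in> {p1..q1}" "y \<in> {p2..q2}" for x y
  proof -
    have "((\<lambda>r. rint u r (r + h) y (y + h)) has_vector_derivative rint g1 x (x + h) y (y + h)) (at x within {p1..q1})"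
      by (rule integral_form_imp_derivative[OF c1 that(1)]) (use w h c that in \<open>auto simp: rect_weak_grad_def\<close>)
    then have "((\<lambda>r. (1 / h\<^sup>2) *\<^sub>R rint u r (r + h) y (y + h)) has_vector_derivative (1 / h\<^sup>2) *\<^sub>R rint g1 x (x + h) y (y + h)) (at x within {p1..q1})"
      by (rule bounded_linear.has_vector_derivative[OF bounded_linear_scaleR_right])
    then show ?thesis by (simp add: U_def stek_def)
  qed
  have d2: "((\<lambda>y. U x y) has_vector_derivative stek h g2 (x, y)) (at y within {p2..q2})"
    if "x \<in> {p1..q1}" "y \<in> {p2..q2}" for x y
  proof -
    have "((\<lambda>r. rint u x (x + h) r (r + h)) has_vector_derivative rint g2 x (x + h) y (y + h)) (at y within {p2..q2})"
      by (rule integral_form_imp_derivative[OF c2 that(2)]) (use w h c that in \<open>auto simp: rect_weak_grad_def\<close>)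
    then have "((\<lambda>r. (1 / h\<^sup>2) *\<^sub>R rint u x (x + h) r (r + h)) has_vector_derivative (1 / h\<^sup>2) *\<^sub>R rint g2 x (x + h) y (y + h)) (at y within {p2..q2})"
      by (rule bounded_linear.has_vector_derivative[OF bounded_linear_scaleR_right])
    then show ?thesis by (simp add: U_def stek_def)
  qed
  have "((\<lambda>(x, y). U x y) has_derivative (\<lambda>(tx, ty). tx *\<^sub>R stek h g1 (x, y) + blinfun_apply (blinfun_scaleR_left (stek h g2 (x, y))) ty))
      (at (x, y) within {p1..q1} \<times> {p2..q2})"
  proof (rule has_derivative_partialsI)
    show "((\<lambda>x. U x y) has_derivative (\<lambda>tx. tx *\<^sub>R stek h g1 (x, y))) (at x within {p1..q1})"
      using d1[of x y] z xy by (simp add: has_vector_derivative_def)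
    show "((\<lambda>y. U x y) has_derivative blinfun_apply (blinfun_scaleR_left (stek h g2 (x, y)))) (at y within {p2..q2})"
      if "x \<in> {p1..q1}" "y \<in> {p2..q2}" for x y
      using d2[OF that] by (simp add: has_vector_derivative_def)
    have "continuous_on ({p1..q1} \<times> {p2..q2}) (\<lambda>z. blinfun_scaleR_left (stek h g2 z))"
      by (rule bounded_linear.continuous_on[OF bounded_linear_blinfun_scaleR_left continuous_stek[OF g(3,4)]])
    then show "continuous (at (x, y) within {p1..q1} \<times> {p2..q2}) (\<lambda>(x, y). blinfun_scaleR_left (stek h g2 (x, y)))"
      using z xy by (simp add: continuous_on_eq_continuous_within split_beta')
  qed (use z xy in auto)
  then show ?thesis unfolding xy U_def
    by (simp add: split_beta' scaleR_conv_of_real)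
qed

text \<open>Cauchy-Schwarz on a square of area \<open>h^2\<close>, which cancels one of the two
  normalising factors.\<close>

lemma norm_rint_square_le:
  assumes g: "g \<in> BM" "sq_int g" and h: "0 < h"
  shows "esq (stek h g z) \<le> ennreal (1 / h\<^sup>2) *
    (NN w. ind ({fst z<..<fst z + h} \<times> {snd z<..<snd z + h}) w * esq (g w))"
proof -
  let ?B = "{fst z<..<fst z + h} \<times> {snd z<..<snd z + h}"
  have mB: "emeasure lborel ?B = ennreal (h\<^sup>2)"
    using h by (subst emeasure_lborel_Times) (auto simp: power2_eq_square simp flip: ennreal_mult')
  have "ennreal (cmod (rint g (fst z) (fst z + h) (snd z) (snd z + h))) \<le> (NN w. ennreal (norm (ind ?B w *\<^sub>R g w)))"
    unfolding rint_def by (rule integral_norm_bound_ennreal[OF integrable_rect_L2[OF g]])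
  also have "\<dots> = (NN w. (ind ?B w * ennreal (cmod (g w))) * ind ?B w)"
    by (intro nn_integral_cong) (simp add: indicator_def)
  finally have "(ennreal (cmod (rint g (fst z) (fst z + h) (snd z) (snd z + h))))\<^sup>2 \<le>
      (NN w. (ind ?B w * ennreal (cmod (g w))) * ind ?B w)\<^sup>2"
    by (intro power_mono) auto
  also have "\<dots> \<le> (NN w. (ind ?B w * ennreal (cmod (g w)))\<^sup>2) * (NN w. (ind ?B w)\<^sup>2)"
    by (rule Cauchy_Schwarz_nn_integral) (use g in simp_all)
  also have "(NN w. (ind ?B w * ennreal (cmod (g w)))\<^sup>2) = (NN w. ind ?B w * esq (g w))"
    by (intro nn_integral_cong) (simp add: indicator_def ennreal_power)
  also have "(NN w. (ind ?B w)\<^sup>2) = (NN w. ind ?B w)"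
    by (intro nn_integral_cong) (simp add: indicator_def)
  also have "\<dots> = ennreal (h\<^sup>2)" using mB by simp
  finally have le: "(ennreal (cmod (rint g (fst z) (fst z + h) (snd z) (snd z + h))))\<^sup>2 \<le>
      (NN w. ind ?B w * esq (g w)) * ennreal (h\<^sup>2)" .
  have "esq (stek h g z) = ennreal ((1 / h\<^sup>2)\<^sup>2) * (ennreal (cmod (rint g (fst z) (fst z + h) (snd z) (snd z + h))))\<^sup>2"
    using h by (simp add: stek_def power_mult_distrib ennreal_power power_divide flip: ennreal_mult')
  also have "\<dots> \<le> ennreal ((1 / h\<^sup>2)\<^sup>2) * ((NN w. ind ?B w * esq (g w)) * ennreal (h\<^sup>2))"
    by (intro mult_left_mono le) simp
  also have "\<dots> = (ennreal ((1 / h\<^sup>2)\<^sup>2) * ennreal (h\<^sup>2)) * (NN w. ind ?B w * esq (g w))"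
    by (simp only: mult_ac)
  also have "ennreal ((1 / h\<^sup>2)\<^sup>2) * ennreal (h\<^sup>2) = ennreal ((1 / h\<^sup>2)\<^sup>2 * h\<^sup>2)"
    by (rule ennreal_mult'[symmetric]) simp
  also have "(1 / h\<^sup>2)\<^sup>2 * h\<^sup>2 = 1 / h\<^sup>2" using h by (simp add: power2_eq_square)
  finally show ?thesis .
qed

text \<open>After Cauchy-Schwarz and Fubini every \<open>w\<close> is counted by those
  \<open>z\<close> whose square contains it. They fill an area of at most \<open>h^2\<close>, which
  cancels \<open>1 / h^2\<close>, and all these squares stay in the larger rectangle.\<close>

lemma stek_L2_bound:
  assumes g: "g \<in> BM" "sq_int g" and h: "0 < h"
  shows "(NN z. ind ({p1..q1-h} \<times> {p2..q2-h}) z * esq (stek h g z)) \<le>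
    (NN w. ind ({p1..q1} \<times> {p2..q2}) w * esq (g w))"
proof -
  let ?R' = "{p1..q1-h} \<times> {p2..q2-h}" and ?R = "{p1..q1} \<times> {p2..q2}"
  let ?B = "\<lambda>z. {fst z<..<fst z + h} \<times> {snd z<..<snd z + h}"
  have R'b: "?R' \<in> sets borel" "?R \<in> sets borel" by (intro borel_closed closed_Times closed_real_atLeastAtMost)+
  have "(NN z. ind ?R' z * esq (stek h g z)) \<le>
    (NN z. NN w. ennreal (1 / h\<^sup>2) * (ind ?R' z * ind (?B z) w * esq (g w)))"
  proof (rule nn_integral_mono)
    fix z
    show "ind ?R' z * esq (stek h g z) \<le>
      (NN w. ennreal (1 / h\<^sup>2) * (ind ?R' z * ind (?B z) w * esq (g w)))"
      using norm_rint_square_le[OF g h, of z] g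
      by (cases "z \<in> ?R'") (simp_all add: nn_integral_cmult)
  qed
  also have "\<dots> = (NN w. NN z. ennreal (1 / h\<^sup>2) * (ind ?R' z * ind (?B z) w * esq (g w)))"
  proof (rule lborel_pair.Fubini'[symmetric])
    have op: "open {v::(plane) \<times> (plane). fst (fst v) < fst (snd v) \<and> fst (snd v) < fst (fst v) + h \<and>
        snd (fst v) < snd (snd v) \<and> snd (snd v) < snd (fst v) + h}" (is "open ?O")
      by (intro open_Collect_conj open_Collect_less continuous_intros)
    have c: "(\<lambda>v::(plane) \<times> (plane). snd v) \<in> BM" "(\<lambda>v::(plane) \<times> (plane). fst v) \<in> BM"
      by (intro borel_measurable_continuous_onI continuous_intros)+
    have mg: "(\<lambda>w. esq (g w)) \<in> BM" using g by simp
    have "(\<lambda>v. ennreal (1 / h\<^sup>2) * (ind ?R' (fst v) * ind ?O v * esq (g (snd v)))) \<in> BM"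
      by (intro borel_measurable_times_ennreal borel_measurable_const measurable_compose[OF c(2) borel_measurable_indicator] R'b
        borel_measurable_indicator borel_open op measurable_compose[OF c(1) mg])
    moreover have "ind ?O v = (ind (?B (fst v)) (snd v) :: ennreal)" for v
      by (simp add: indicator_def mem_Times_iff conj_ac)
    ultimately show "(\<lambda>(z, w). ennreal (1 / h\<^sup>2) * (ind ?R' z * ind (?B z) w * esq (g w)))
        \<in> borel_measurable (lborel \<Otimes>\<^sub>M lborel)"
      by (simp only: lborel_prod measurable_lborel2 split_beta')
  qed
  also have "\<dots> \<le> (NN w. ind ?R w * esq (g w))"
  proof (rule nn_integral_mono)
    fix w
    let ?Bw = "{fst w - h<..<fst w} \<times> {snd w - h<..<snd w}"
    have mB: "emeasure lborel ?Bw = ennreal (h\<^sup>2)"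
      using h by (subst emeasure_lborel_Times) (auto simp: power2_eq_square simp flip: ennreal_mult')
    have "(NN z. ennreal (1 / h\<^sup>2) * (ind ?R' z * ind (?B z) w * esq (g w))) \<le>
        (NN z. (ennreal (1 / h\<^sup>2) * (ind ?R w * esq (g w))) * ind ?Bw z)"
    proof (rule nn_integral_mono)
      fix z
      have "z \<in> ?R' \<Longrightarrow> w \<in> ?B z \<Longrightarrow> w \<in> ?R \<and> z \<in> ?Bw"
        by (auto simp: mem_Times_iff)
      then show "ennreal (1 / h\<^sup>2) * (ind ?R' z * ind (?B z) w * esq (g w)) \<le>
        (ennreal (1 / h\<^sup>2) * (ind ?R w * esq (g w))) * ind ?Bw z"
        by (cases "z \<in> ?R' \<and> w \<in> ?B z") auto
    qed
    also have "\<dots> = (ennreal (1 / h\<^sup>2) * (ind ?R w * esq (g w))) * ennreal (h\<^sup>2)"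
      using mB by (simp add: nn_integral_cmult)
    also have "\<dots> = (ennreal (1 / h\<^sup>2) * ennreal (h\<^sup>2)) * (ind ?R w * esq (g w))"
      by (simp only: mult_ac)
    also have "ennreal (1 / h\<^sup>2) * ennreal (h\<^sup>2) = 1"
      using h by (simp flip: ennreal_mult')
    finally show "(NN z. ennreal (1 / h\<^sup>2) * (ind ?R' z * ind (?B z) w * esq (g w))) \<le>
        ind ?R w * esq (g w)" by simp
  qed
  finally show ?thesis .
qed

text \<open>Lebesgue differentiation along squares that have the point as a corner.\<close>

lemma stek_tendsto_AE:
  assumes g: "g \<in> BM" "sq_int g"
    and H: "\<And>n. 0 < H n" "H \<longlonglongrightarrow> 0"
  shows "AE z in lborel. (\<lambda>n. stek (H n) g z) \<longlonglongrightarrow> g z"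
proof -
  have si: "set_integrable lborel (cbox a b) g" for a b
    unfolding set_integrable_def by (rule integrable_indicator_L2[OF g _ emeasure_lborel_cbox_finite]) simp
  have ii: "g integrable_on cbox a b" for a b
    by (rule set_borel_integral_eq_integral(1)[OF si])
  obtain N where N: "negligible N" "\<And>x e. \<lbrakk>x \<notin> N; 0 < e\<rbrakk> \<Longrightarrow>
      \<exists>d>0. \<forall>h. 0 < h \<and> h < d \<longrightarrow> norm (integral (cbox x (x + h *\<^sub>R One)) g /\<^sub>R h ^ DIM(plane) - g x) < e"
    by (rule integrable_ccontinuous_explicit[OF ii]) (rule that)
  have st: "stek h g x = integral (cbox x (x + h *\<^sub>R One)) g /\<^sub>R h ^ DIM(plane)" for h x
  proof -
    have One: "(One :: plane) = (1, 1)"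
      by (simp add: Basis_prod_def sum.union_disjoint)
    have cb: "cbox x (x + h *\<^sub>R One) = {fst x..fst x + h} \<times> {snd x..snd x + h}"
      unfolding One by (cases x) (simp add: cbox_Pair_eq)
    have "rint g (fst x) (fst x + h) (snd x) (snd x + h) = (sint (cbox x (x + h *\<^sub>R One)) g)"
      unfolding rint_def
    proof (rule integral_cong_AE)
      show "AE w in lborel. ind ({fst x<..<fst x + h} \<times> {snd x<..<snd x + h}) w *\<^sub>R g w = ind (cbox x (x + h *\<^sub>R One)) w *\<^sub>R g w"
        using AE_lborel_fst_neq[of "fst x"] AE_lborel_fst_neq[of "fst x + h"] AE_lborel_snd_neq[of "snd x"] AE_lborel_snd_neq[of "snd x + h"]
      proof eventually_elim
        case (elim w)
        then have "(w \<in> {fst x<..<fst x + h} \<times> {snd x<..<snd x + h}) = (w \<in> cbox x (x + h *\<^sub>R One))"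
          unfolding cb mem_Times_iff by auto
        then show ?case by (simp add: indicator_def)
      qed
    qed (use g in simp_all)
    also have "\<dots> = integral (cbox x (x + h *\<^sub>R One)) g"
      using set_borel_integral_eq_integral(2)[OF si] by (simp add: set_lebesgue_integral_def)
    finally show ?thesis by (simp add: stek_def divide_inverse power2_eq_square)
  qed
  have "(\<lambda>n. stek (H n) g z) \<longlonglongrightarrow> g z" if "z \<notin> N" for z
  proof (rule LIMSEQ_I)
    fix e :: real assume "0 < e"
    from N(2)[OF that this] obtain d where d: "d > 0" "\<And>h. 0 < h \<Longrightarrow> h < d \<Longrightarrow> norm (stek h g z - g z) < e"
      unfolding st by blast
    from order_tendstoD(2)[OF H(2) d(1)] obtain n0 where "\<And>n. n \<ge> n0 \<Longrightarrow> H n < d"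
      unfolding eventually_sequentially by blast
    then show "\<exists>no. \<forall>n\<ge>no. norm (stek (H n) g z - g z) < e" using d(2) H(1) by blast
  qed
  moreover have "AE z in lebesgue. z \<notin> N" using N(1) by (intro AE_not_in) (simp add: negligible_iff_null_sets)
  ultimately have "AE z in lebesgue. (\<lambda>n. stek (H n) g z) \<longlonglongrightarrow> g z"
    by (auto elim: eventually_mono)
  then show ?thesis by (rule AE_completion_iff[THEN iffD1, rotated]) 
qed

subsection \<open>The logarithmic inequality on a rectangle\<close>

text \<open>The mean-zero condition concerns \<open>u\<close>, but the smooth estimate subtracts the
  mean of the average over the shortened rectangle. By Fubini that mean is an integral of
  \<open>g\<close> with a weight tending to the indicator of the rectangle.\<close>

lemma stek_mean_tendsto:
  assumes g: "g \<in> BM" "sq_int g"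
    and H: "\<And>n. 0 < H n" "H \<longlonglongrightarrow> 0"
  shows "(\<lambda>n. LINT z|lborel. ind ({p1..q1 - H n} \<times> {p2..q2 - H n}) z *\<^sub>R stek (H n) g z) \<longlonglongrightarrow>
    (sint ({p1..q1} \<times> {p2..q2}) g)"
proof -
  let ?R = "{p1..q1} \<times> {p2..q2}"
  let ?R' = "\<lambda>h. {p1..q1 - h} \<times> {p2..q2 - h}"
  let ?B = "\<lambda>h z. {fst z<..<fst z + h} \<times> {snd z<..<snd z + h}"
  let ?Bw = "\<lambda>h w. {fst w - h<..<fst w} \<times> {snd w - h<..<snd w}"
  have Rb: "{p..q} \<times> {c..d} \<in> sets (borel :: plane measure)" for p q c d :: real
    by (intro borel_closed closed_Times closed_real_atLeastAtMost)
  have Rfin: "emeasure lborel ({p..q} \<times> {c..d}) < \<infinity>" for p q c d :: real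
    using emeasure_lborel_cbox_finite[of "(p, c)" "(q, d)"] by (simp add: cbox_Pair_eq)
  have Bm: "emeasure lborel (?Bw h w) = ennreal (h\<^sup>2)" if "h > 0" for h w
    using that by (subst emeasure_lborel_Times) (auto simp: power2_eq_square simp flip: ennreal_mult')
  \<comment> \<open>The share of the squares through \<open>w\<close> whose corner lies in the
    shortened rectangle: at most 1, zero outside \<open>?R\<close>, and equal to 1 once
    \<open>w\<close> is further than \<open>h\<close> from the boundary.\<close>
  define \<omega> where "\<omega> h w = (1 / h\<^sup>2) * measure lborel (?R' h \<inter> ?Bw h w)" for h w
  have \<omega>_bound: "0 \<le> \<omega> h w \<and> \<omega> h w \<le> ind ?R w" if h: "h > 0" for h w
  proof (cases "w \<in> ?R")
    case True
    have "measure lborel (?R' h \<inter> ?Bw h w) \<le> measure lborel (?Bw h w)"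
      using Bm[OF h, of w] Rb by (intro measure_mono_fmeasurable) (auto simp: fmeasurable_def intro!: sets.Int)
    also have "\<dots> = h\<^sup>2" using Bm[OF h, of w] by (simp add: measure_def)
    finally show ?thesis using True h by (simp add: \<omega>_def)
  next
    case False
    have "?R' h \<inter> ?Bw h w = {}" using False by (auto simp: mem_Times_iff)
    then show ?thesis using False by (simp add: \<omega>_def)
  qed
  have fub: "(sint (?R' h) (stek h g)) = (LINT w|lborel. \<omega> h w *\<^sub>R g w)
      \<and> (\<lambda>w. \<omega> h w *\<^sub>R g w) \<in> BM" if h: "h > 0" for h
  proof -
    define F where "F z w = (ind (?R' h) z * ind (?B h z) w / h\<^sup>2) *\<^sub>R g w" for z w
    have op: "open {v::(plane) \<times> (plane). fst (fst v) < fst (snd v) \<and> fst (snd v) < fst (fst v) + h \<and>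
        snd (fst v) < snd (snd v) \<and> snd (snd v) < snd (fst v) + h}" (is "open ?O")
      by (intro open_Collect_conj open_Collect_less continuous_intros)
    have c: "(\<lambda>v::(plane) \<times> (plane). snd v) \<in> BM" "(\<lambda>v::(plane) \<times> (plane). fst v) \<in> BM"
      by (intro borel_measurable_continuous_onI continuous_intros)+
    have Oeq: "ind ?O v = (ind (?B h (fst v)) (snd v) :: real)" for v
      by (simp add: indicator_def mem_Times_iff conj_ac)
    have "(\<lambda>v. (ind (?R' h) (fst v) * ind ?O v / h\<^sup>2) *\<^sub>R g (snd v)) \<in> BM"
      by (intro borel_measurable_scaleR borel_measurable_divide borel_measurable_times borel_measurable_const
        measurable_compose[OF c(2) borel_measurable_indicator] Rb borel_measurable_indicator borel_open op measurable_compose[OF c(1) g(1)])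
    then have mF: "(\<lambda>(z, w). F z w) \<in> borel_measurable (lborel \<Otimes>\<^sub>M lborel)"
      unfolding F_def by (simp only: lborel_prod measurable_lborel2 split_beta' Oeq)
    have intF: "integrable (lborel \<Otimes>\<^sub>M lborel) (\<lambda>(z, w). F z w)"
    proof (rule integrableI_bounded[OF mF])
      have iR: "integrable lborel (\<lambda>w. ind ?R w *\<^sub>R g w)"
        by (rule integrable_indicator_L2[OF g Rb Rfin])
      have "(\<integral>\<^sup>+v. ennreal (norm (case v of (z, w) \<Rightarrow> F z w)) \<partial>(lborel \<Otimes>\<^sub>M lborel)) = (NN z. NN w. ennreal (norm (F z w)))"
        using mF by (subst lborel.nn_integral_fst[symmetric]) auto
      also have "\<dots> \<le> (NN z. NN w. ind (?R' h) z * (ennreal (1 / h\<^sup>2) * ennreal (norm (ind ?R w *\<^sub>R g w))))"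
      proof (intro nn_integral_mono)
        fix z w
        have "z \<in> ?R' h \<Longrightarrow> w \<in> ?B h z \<Longrightarrow> w \<in> ?R" by (auto simp: mem_Times_iff)
        then show "ennreal (norm (F z w)) \<le> ind (?R' h) z * (ennreal (1 / h\<^sup>2) * ennreal (norm (ind ?R w *\<^sub>R g w)))"
          by (cases "z \<in> ?R' h \<and> w \<in> ?B h z") (auto simp: F_def simp flip: ennreal_mult')
      qed
      also have "\<dots> = (NN z. ind (?R' h) z * (ennreal (1 / h\<^sup>2) * (NN w. ennreal (norm (ind ?R w *\<^sub>R g w)))))"
      proof (rule nn_integral_cong)
        fix z
        have m: "(\<lambda>w. ennreal (norm (ind ?R w *\<^sub>R g w))) \<in> borel_measurable lborel" using g(1) Rb[of p1 q1 p2 q2] by simp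
        show "(NN w. ind (?R' h) z * (ennreal (1 / h\<^sup>2) * ennreal (norm (ind ?R w *\<^sub>R g w)))) =
          ind (?R' h) z * (ennreal (1 / h\<^sup>2) * (NN w. ennreal (norm (ind ?R w *\<^sub>R g w))))"
          using m by (simp add: nn_integral_cmult)
      qed
      also have "\<dots> = emeasure lborel (?R' h) * (ennreal (1 / h\<^sup>2) * (NN w. ennreal (norm (ind ?R w *\<^sub>R g w))))"
        using Rb by (simp add: nn_integral_multc)
      also have "\<dots> < \<infinity>"
        using Rfin[of p1 "q1 - h" p2 "q2 - h"] iR by (auto simp: integrable_iff_bounded ennreal_mult_less_top)
      finally show "(\<integral>\<^sup>+v. ennreal (norm (case v of (z, w) \<Rightarrow> F z w)) \<partial>(lborel \<Otimes>\<^sub>M lborel)) < \<infinity>" .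
    qed
    have e1: "(sint (?R' h) (stek h g)) = (LINT z|lborel. LINT w|lborel. F z w)"
    proof (rule Bochner_Integration.integral_cong[OF refl])
      fix z
      have "(LINT w|lborel. F z w) = (LINT w|lborel. (ind (?R' h) z / h\<^sup>2) *\<^sub>R (ind (?B h z) w *\<^sub>R g w))"
        by (simp add: F_def)
      also have "\<dots> = (ind (?R' h) z / h\<^sup>2) *\<^sub>R (sint (?B h z) g)"
        by (rule integral_scaleR_right)
      finally show "ind (?R' h) z *\<^sub>R stek h g z = (LINT w|lborel. F z w)"
        by (simp add: stek_def rint_def)
    qed
    have Fw: "(LINT z|lborel. F z w) = \<omega> h w *\<^sub>R g w" for w
    proof -
      have "F z w = ind (?R' h \<inter> ?Bw h w) z *\<^sub>R ((1 / h\<^sup>2) *\<^sub>R g w)" for z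
      proof -
        have "w \<in> ?B h z \<longleftrightarrow> z \<in> ?Bw h w" by (auto simp: mem_Times_iff)
        then show ?thesis by (auto simp: F_def indicator_def)
      qed
      then have "(LINT z|lborel. F z w) = (sint (?R' h \<inter> ?Bw h w) (\<lambda>z. ((1 / h\<^sup>2) *\<^sub>R g w)))" by simp
      also have "\<dots> = measure lborel (?R' h \<inter> ?Bw h w) *\<^sub>R ((1 / h\<^sup>2) *\<^sub>R g w)"
      proof -
        have s: "?R' h \<inter> ?Bw h w \<in> sets lborel" using Rb rect_borel by (simp add: sets.Int)
        have "emeasure lborel (?R' h \<inter> ?Bw h w) \<le> emeasure lborel (?R' h)"
          by (rule emeasure_mono) (use Rb in auto)
        then have "emeasure lborel (?R' h \<inter> ?Bw h w) < \<infinity>" using Rfin by (rule le_less_trans)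
        then show ?thesis using s by (subst integral_scaleR_left) (auto simp: integrable_real_indicator)
      qed
      finally show ?thesis by (simp add: \<omega>_def)
    qed
    have "(LINT z|lborel. LINT w|lborel. F z w) = (LINT w|lborel. \<omega> h w *\<^sub>R g w)"
      using lborel_pair.Fubini_integral[OF intF] by (simp add: Fw)
    moreover have "(\<lambda>w. \<omega> h w *\<^sub>R g w) \<in> BM"
    proof -
      have "(\<lambda>(w, z). F z w) \<in> borel_measurable (lborel \<Otimes>\<^sub>M lborel)"
        using measurable_pair_swap[OF mF] by (simp add: split_beta')
      from lborel.borel_measurable_lebesgue_integral[OF this] show ?thesis by (simp add: Fw)
    qed
    ultimately show ?thesis using e1 by simp
  qed
  have "(\<lambda>n. LINT w|lborel. \<omega> (H n) w *\<^sub>R g w) \<longlonglongrightarrow> (sint ?R g)"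
  proof (rule integral_dominated_convergence[where w = "\<lambda>w. norm (ind ?R w *\<^sub>R g w)"])
    show "integrable lborel (\<lambda>w. norm (ind ?R w *\<^sub>R g w))"
      by (intro integrable_norm integrable_indicator_L2[OF g Rb Rfin])
    show "AE w in lborel. norm (\<omega> (H n) w *\<^sub>R g w) \<le> norm (ind ?R w *\<^sub>R g w)" for n
    proof (rule AE_I2)
      fix w
      show "norm (\<omega> (H n) w *\<^sub>R g w) \<le> norm (ind ?R w *\<^sub>R g w)"
        using \<omega>_bound[OF H(1)[of n], of w] by (auto intro!: mult_right_mono)
    qed
    show "AE w in lborel. (\<lambda>n. \<omega> (H n) w *\<^sub>R g w) \<longlonglongrightarrow> ind ?R w *\<^sub>R g w"
      using AE_lborel_fst_neq[of p1] AE_lborel_fst_neq[of q1] AE_lborel_snd_neq[of p2] AE_lborel_snd_neq[of q2]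
    proof eventually_elim
      case (elim w)
      show ?case
      proof (cases "w \<in> ?R")
        case True
        define e where "e = min (min (fst w - p1) (q1 - fst w)) (min (snd w - p2) (q2 - snd w))"
        have "e > 0" using True elim by (auto simp: e_def mem_Times_iff)
        from order_tendstoD(2)[OF H(2) this]
        have "\<forall>\<^sub>F n in sequentially. \<omega> (H n) w *\<^sub>R g w = ind ?R w *\<^sub>R g w"
        proof eventually_elim
          case (elim n)
          have "?R' (H n) \<inter> ?Bw (H n) w = ?Bw (H n) w"
            using elim by (auto simp: e_def mem_Times_iff)
          then have "\<omega> (H n) w = 1" using Bm[OF H(1)[of n], of w] H(1)[of n] by (simp add: \<omega>_def measure_def)
          then show ?case using True by simp
        qed
        then show ?thesis by (rule tendsto_eventually)
      next
        case False
        then have "\<omega> (H n) w = 0" for n using \<omega>_bound[OF H(1)[of n], of w] by simp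
        then show ?thesis using False by simp
      qed
    qed
  qed (use fub H g Rb in auto)
  then show ?thesis using fub H(1) by simp
qed

text \<open>The density of the measure \<open>\<mu>\<close> in the overview.\<close>

definition lpot :: "(plane \<Rightarrow> real) \<Rightarrow> (real \<Rightarrow> real) \<Rightarrow> plane \<Rightarrow> real" where
  "lpot V \<phi> z = V z * max 0 (ln (V z / \<phi> (fst z))) + \<phi> (fst z)"

text \<open>The smooth estimate is applied to Steklov averages on rectangles shortened by
  \<open>H n\<close>, and Fatou's lemma removes the smoothing. As the sides keep at least half their
  length, \<open>K \<le> 2 * A^2\<close> and \<open>1 + 4 * d / (q2 - H n - p2) \<le> 9 * A\<close>;
  this gives \<open>32 * 4 * 9 = 1152\<close>, doubled by the bound for the square of a sum of two
  partial derivatives.\<close>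

lemma rect_log_inequality:
  fixes p1 q1 p2 q2 A M :: real
  defines "R \<equiv> {p1..q1} \<times> {p2..q2}"
  assumes w: "rect_weak_grad a u g1 g2"
    and pq: "p1 < q1" "p2 < q2" "0 \<le> p2" "q2 \<le> a"
    and A: "1 \<le> A" "q1 - p1 \<le> A * (q2 - p2)" "q2 - p2 \<le> A * (q1 - p1)"
    and V: "V \<in> BM" "\<And>z. 0 \<le> V z"
    and \<phi>: "\<phi> \<in> BM" "\<And>x. 0 < \<phi> x"
    and M: "0 \<le> M" "(NN z. ind R z * ennreal (lpot V \<phi> z)) \<le> ennreal M"
    and mean: "(sint R u) = 0"
  shows "(NN z. ind R z * ennreal (V z * nsq (u z))) \<le>
    ennreal (2304 * A ^ 5 * M) * (NN z. ind R z * ennreal (nsq (g1 z) + nsq (g2 z)))"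
proof -
  have um: "u \<in> BM" "sq_int u"
    and gm: "g1 \<in> BM" "sq_int g1"
      "g2 \<in> BM" "sq_int g2"
    using w by (auto simp: rect_weak_grad_def)
  define l where "l = min (q1 - p1) (q2 - p2)"
  define d where "d = max (q1 - p1) (q2 - p2)"
  have l: "l > 0" using pq by (simp add: l_def)
  have dl: "d \<le> A * (q1 - p1)" "d \<le> A * (q2 - p2)" "0 < d"
    using A pq mult_right_mono[of 1 A "q1 - p1"] mult_right_mono[of 1 A "q2 - p2"] by (auto simp: d_def)
  \<comment> \<open>At most half of each side, so no shortened rectangle degenerates.\<close>
  define H where "H n = (l / 2) * inverse (real (Suc n))" for n
  have H: "0 < H n" for n unfolding H_def using l by (intro mult_pos_pos) auto
  have Hle: "H n \<le> (q1 - p1) / 2" "H n \<le> (q2 - p2) / 2" for n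
  proof -
    have "inverse (real (Suc n)) \<le> 1" by (simp add: inverse_le_1_iff)
    then have "H n \<le> l / 2" unfolding H_def using l by (intro mult_left_le) auto
    then show "H n \<le> (q1 - p1) / 2" "H n \<le> (q2 - p2) / 2" by (auto simp: l_def)
  qed
  have H0: "H \<longlonglongrightarrow> 0"
  proof -
    have "(\<lambda>n. (l / 2) * inverse (real (Suc n))) \<longlonglongrightarrow> (l / 2) * 0"
      by (intro tendsto_mult tendsto_const LIMSEQ_inverse_real_of_nat)
    then show ?thesis unfolding H_def by simp
  qed
  define R' where "R' n = {p1..q1 - H n} \<times> {p2..q2 - H n}" for n
  have Rb: "{p..q} \<times> {c..d} \<in> sets (borel :: plane measure)" for p q c d :: real
    by (intro borel_closed closed_Times closed_real_atLeastAtMost)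
  have R'R: "R' n \<subseteq> R" for n using H[of n] by (auto simp: R'_def R_def)
  define c where "c n = (1 / ((q1 - H n - p1) * (q2 - H n - p2))) *\<^sub>R (sint (R' n) (\<lambda>y. stek (H n) u y))" for n
  have c0: "c \<longlonglongrightarrow> 0"
  proof -
    have "c \<longlonglongrightarrow> (1 / ((q1 - 0 - p1) * (q2 - 0 - p2))) *\<^sub>R (sint R u)"
      unfolding c_def R'_def R_def
      by (intro tendsto_scaleR tendsto_divide tendsto_mult tendsto_diff tendsto_const H0 stek_mean_tendsto um H)
        (use pq in auto)
    then show ?thesis by (simp add: mean)
  qed
  define I where "I = (NN z. ind R z * ennreal (nsq (g1 z) + nsq (g2 z)))"
  have mg: "(\<lambda>z. esq (g1 z)) \<in> BM" "(\<lambda>z. esq (g2 z)) \<in> BM"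
    using gm by auto
  have Isum: "I = (NN z. ind R z * esq (g1 z)) + (NN z. ind R z * esq (g2 z))"
    unfolding I_def R_def by (subst nn_integral_add[symmetric])
      (use mg Rb[of p1 q1 p2 q2] in \<open>auto simp: distrib_left ennreal_plus\<close>)
  have "I < \<infinity>"
  proof -
    have "(NN z. ind R z * esq (g z)) < \<infinity>" if "sq_int g" for g
    proof -
      have "(NN z. ind R z * esq (g z)) \<le> (NN z. ennreal (norm (nsq (g z))))"
        by (intro nn_integral_mono) (simp add: indicator_def)
      also have "\<dots> < \<infinity>" using that by (simp add: integrable_iff_bounded)
      finally show ?thesis .
    qed
    from this[OF gm(2)] this[OF gm(4)] show ?thesis unfolding Isum by simp
  qed
  then obtain I0 where I0: "I = ennreal I0" "0 \<le> I0" by (cases I) auto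
  \<comment> \<open>Strictly above \<open>2 * I0\<close>, because the smooth estimate wants a
    positive \<open>N\<close> and the gradient may vanish; \<open>N\<close> is lowered to
    \<open>2 * I0\<close> at the end.\<close>
  have step: "(NN z. ind (R' n) z * ennreal (V z * nsq (stek (H n) u z - c n))) \<le> ennreal (1152 * A ^ 5 * M * N)"
    if N: "N > 2 * I0" for N n
  proof -
    let ?h = "H n"
    have N0: "N > 0" using N I0 by linarith
    have pq': "p1 < q1 - ?h" "p2 < q2 - ?h" using Hle[of n] pq by auto
    have d': "q1 - ?h - p1 \<le> d" "q2 - ?h - p2 \<le> d" using H[of n] by (auto simp: d_def)
    define K where "K = d\<^sup>2 / (2 * ((q1 - ?h - p1) * (q2 - ?h - p2)))"
    have K: "0 \<le> K" "K \<le> 2 * A\<^sup>2"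
    proof -
      show "0 \<le> K" using pq' by (simp add: K_def)
      have "d \<le> 2 * A * (q1 - ?h - p1)" "d \<le> 2 * A * (q2 - ?h - p2)"
        using dl Hle[of n] A by (auto intro: order_trans[OF _ mult_left_mono[of "(q1 - p1) / 2" "q1 - ?h - p1" "2 * A"]]
            order_trans[OF _ mult_left_mono[of "(q2 - p2) / 2" "q2 - ?h - p2" "2 * A"]])
      then have "d * d \<le> (2 * A * (q1 - ?h - p1)) * (2 * A * (q2 - ?h - p2))"
        using dl pq' A by (intro mult_mono) auto
      moreover have "(2 * A * X) * (2 * A * Y) = 2 * A\<^sup>2 * (2 * (X * Y))" for X Y
        by (simp add: power2_eq_square)
      ultimately have "d\<^sup>2 \<le> 2 * A\<^sup>2 * (2 * ((q1 - ?h - p1) * (q2 - ?h - p2)))"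
        unfolding power2_eq_square[of d] by metis
      then show "K \<le> 2 * A\<^sup>2" unfolding K_def using pq' by (subst pos_divide_le_eq) auto
    qed
    have c2: "1 + 4 * d / (q2 - ?h - p2) \<le> 9 * A"
    proof -
      have "d \<le> 2 * A * (q2 - ?h - p2)"
        using dl Hle[of n] A by (auto intro: order_trans[OF _ mult_left_mono[of "(q2 - p2) / 2" "q2 - ?h - p2" "2 * A"]])
      then have "4 * d / (q2 - ?h - p2) \<le> 8 * A" using pq' by (subst divide_le_eq) auto
      then show ?thesis using A by linarith
    qed
    have c20: "0 \<le> 1 + 4 * d / (q2 - ?h - p2)" using pq' dl by (auto intro!: add_nonneg_nonneg divide_nonneg_nonneg)
    have der: "(stek ?h u has_derivative (\<lambda>k. of_real (fst k) * stek ?h g1 z + of_real (snd k) * stek ?h g2 z)) (at z within {p1..q1 - ?h} \<times> {p2..q2 - ?h})"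
      if "z \<in> {p1..q1 - ?h} \<times> {p2..q2 - ?h}" for z
      by (rule stek_has_derivative[OF w H pq(3) _ that]) (use pq in simp)
    have NP: "(NN z. ennreal (ind (R' n) z * (cmod (stek ?h g1 z) + cmod (stek ?h g2 z))\<^sup>2)) \<le> ennreal N"
    proof -
      have ms: "(\<lambda>z. ind (R' n) z * esq (stek ?h g z)) \<in> BM"
        if "g \<in> BM" "sq_int g" for g
        using borel_measurable_continuous_onI[OF continuous_stek[where S = UNIV and h = "H n", OF that]] Rb by (simp add: R'_def)
      have "(NN z. ennreal (ind (R' n) z * (cmod (stek ?h g1 z) + cmod (stek ?h g2 z))\<^sup>2)) \<le>
        (NN z. 2 * (ind (R' n) z * esq (stek ?h g1 z) + ind (R' n) z * esq (stek ?h g2 z)))"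
      proof (rule nn_integral_mono)
        fix z
        have "(s + t)\<^sup>2 \<le> 2 * (s\<^sup>2 + t\<^sup>2)" for s t :: real
          using zero_le_power2[of "s - t"] by (simp add: power2_eq_square algebra_simps)
        then have "ennreal ((cmod (stek ?h g1 z) + cmod (stek ?h g2 z))\<^sup>2) \<le> ennreal (2 * (nsq (stek ?h g1 z) + nsq (stek ?h g2 z)))"
          by (rule ennreal_leI)
        also have "\<dots> = 2 * (esq (stek ?h g1 z) + esq (stek ?h g2 z))"
          by (simp add: ennreal_mult' ennreal_plus)
        finally show "ennreal (ind (R' n) z * (cmod (stek ?h g1 z) + cmod (stek ?h g2 z))\<^sup>2) \<le>
          2 * (ind (R' n) z * esq (stek ?h g1 z) + ind (R' n) z * esq (stek ?h g2 z))"
          by (cases "z \<in> R' n") simp_all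
      qed
      also have "\<dots> = 2 * ((NN z. ind (R' n) z * esq (stek ?h g1 z)) +
          (NN z. ind (R' n) z * esq (stek ?h g2 z)))"
        using ms[OF gm(1,2)] ms[OF gm(3,4)] by (simp add: nn_integral_cmult nn_integral_add)
      also have "\<dots> \<le> 2 * I"
        unfolding Isum R'_def R_def by (intro mult_left_mono add_mono stek_L2_bound gm H) auto
      also have "\<dots> = ennreal (2 * I0)" using I0 by (simp add: ennreal_mult')
      also have "\<dots> \<le> ennreal N" using N by (intro ennreal_leI) simp
      finally show ?thesis .
    qed
    have "(NN z. ind (R' n) z * ennreal (V z * nsq (stek ?h u z - c n))) =
      (NN z. ennreal (ind (R' n) z * (V z * nsq (stek ?h u z - c n))))"
      by (intro nn_integral_cong) (simp add: indicator_def)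
    also have "\<dots> \<le> ennreal (32 * K\<^sup>2 * N) * (NN z. ennreal (ind (R' n) z * (V z * max 0 (ln (V z / \<phi> (fst z))) + (1 + 4 * d / (q2 - ?h - p2)) * \<phi> (fst z))))"
      unfolding c_def K_def R'_def
      by (rule smooth_log_inequality[OF pq' d' der continuous_stek[OF gm(1,2)] continuous_stek[OF gm(3,4)] N0 NP[unfolded R'_def] V \<phi>])
    also have "\<dots> \<le> ennreal (128 * A ^ 4 * N) * (ennreal (9 * A) * ennreal M)"
    proof (rule mult_mono)
      have "K\<^sup>2 \<le> (2 * A\<^sup>2)\<^sup>2" using K by (intro power_mono) auto
      also have "\<dots> = 4 * A ^ 4" by (simp add: power_mult_distrib flip: power_mult)
      finally show "ennreal (32 * K\<^sup>2 * N) \<le> ennreal (128 * A ^ 4 * N)" using N0 by (intro ennreal_leI) simp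
      have "(NN z. ennreal (ind (R' n) z * (V z * max 0 (ln (V z / \<phi> (fst z))) + (1 + 4 * d / (q2 - ?h - p2)) * \<phi> (fst z)))) \<le>
        (NN z. ennreal (9 * A) * (ind R z * ennreal (lpot V \<phi> z)))"
      proof (rule nn_integral_mono)
        fix z
        show "ennreal (ind (R' n) z * (V z * max 0 (ln (V z / \<phi> (fst z))) + (1 + 4 * d / (q2 - ?h - p2)) * \<phi> (fst z))) \<le>
          ennreal (9 * A) * (ind R z * ennreal (lpot V \<phi> z))"
        proof (cases "z \<in> R' n")
          case True
          have L: "0 \<le> V z * max 0 (ln (V z / \<phi> (fst z)))" using V(2)[of z] by simp
          have "V z * max 0 (ln (V z / \<phi> (fst z))) + (1 + 4 * d / (q2 - ?h - p2)) * \<phi> (fst z) \<le>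
             9 * A * (V z * max 0 (ln (V z / \<phi> (fst z)))) + 9 * A * \<phi> (fst z)"
          proof (rule add_mono)
            show "V z * max 0 (ln (V z / \<phi> (fst z))) \<le> 9 * A * (V z * max 0 (ln (V z / \<phi> (fst z))))"
              using L A mult_right_mono[of 1 "9 * A" "V z * max 0 (ln (V z / \<phi> (fst z)))"] by simp
            show "(1 + 4 * d / (q2 - ?h - p2)) * \<phi> (fst z) \<le> 9 * A * \<phi> (fst z)"
              using c2 \<phi>(2)[of "fst z"] by (intro mult_right_mono) auto
          qed
          also have "\<dots> = 9 * A * lpot V \<phi> z" by (simp add: lpot_def distrib_left)
          finally have "ennreal (V z * max 0 (ln (V z / \<phi> (fst z))) + (1 + 4 * d / (q2 - ?h - p2)) * \<phi> (fst z)) \<le> ennreal (9 * A * lpot V \<phi> z)"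
            by (rule ennreal_leI)
          also have "\<dots> = ennreal (9 * A) * ennreal (lpot V \<phi> z)" using A by (intro ennreal_mult') simp
          finally show ?thesis using True subsetD[OF R'R True] by simp
        qed simp
      qed
      also have "\<dots> = ennreal (9 * A) * (NN z. ind R z * ennreal (lpot V \<phi> z))"
      proof (rule nn_integral_cmult)
        have mphi: "(\<lambda>z::plane. \<phi> (fst z)) \<in> BM"
          by (rule measurable_compose[OF fst_borel_measurable \<phi>(1)])
        have "lpot V \<phi> \<in> BM"
          unfolding lpot_def[abs_def]
          by (intro borel_measurable_add borel_measurable_times borel_measurable_max V(1) borel_measurable_ln borel_measurable_divide mphi
            borel_measurable_const)
        then show "(\<lambda>z. ind R z * ennreal (lpot V \<phi> z)) \<in> borel_measurable lborel"
          using Rb by (simp add: R_def)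
      qed
      also have "\<dots> \<le> ennreal (9 * A) * ennreal M" using M by (intro mult_left_mono) auto
      finally show "(NN z. ennreal (ind (R' n) z * (V z * max 0 (ln (V z / \<phi> (fst z))) + (1 + 4 * d / (q2 - ?h - p2)) * \<phi> (fst z)))) \<le> ennreal (9 * A) * ennreal M" .
    qed auto
    also have "\<dots> = ennreal (128 * A ^ 4 * N * (9 * A * M))"
    proof -
      have "ennreal (9 * A) * ennreal M = ennreal (9 * A * M)" using A by (intro ennreal_mult'[symmetric]) simp
      moreover have "ennreal (128 * A ^ 4 * N) * ennreal (9 * A * M) = ennreal (128 * A ^ 4 * N * (9 * A * M))"
        using A N0 by (intro ennreal_mult'[symmetric]) simp
      ultimately show ?thesis by simp
    qed
    also have "128 * A ^ 4 * N * (9 * A * M) = 1152 * A ^ 5 * M * N"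
      by (simp add: power_numeral_reduce mult_ac)
    finally show ?thesis .
  qed
  have key: "(NN z. ind R z * ennreal (V z * nsq (u z))) \<le> ennreal (1152 * A ^ 5 * M * N)" if N: "N > 2 * I0" for N
  proof -
    have "(NN z. ind R z * ennreal (V z * nsq (u z))) \<le>
      (NN z. liminf (\<lambda>n. ind (R' n) z * ennreal (V z * nsq (stek (H n) u z - c n))))"
    proof (rule nn_integral_mono_AE)
      \<comment> \<open>The right and the upper edge are left out: no shortened rectangle reaches
        them, while every other point of \<open>R\<close> lies in \<open>R' n\<close>
        eventually.\<close>
      show "AE z in lborel. ind R z * ennreal (V z * nsq (u z)) \<le>
        liminf (\<lambda>n. ind (R' n) z * ennreal (V z * nsq (stek (H n) u z - c n)))"
        using stek_tendsto_AE[OF um H H0] AE_lborel_fst_neq[of q1] AE_lborel_snd_neq[of q2]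
      proof eventually_elim
        case (elim z)
        show ?case
        proof (cases "z \<in> R")
          case True
          have "(\<lambda>n. ennreal (V z * nsq (stek (H n) u z - c n))) \<longlonglongrightarrow> ennreal (V z * nsq (u z - 0))"
            by (intro tendsto_ennrealI tendsto_mult tendsto_power tendsto_norm tendsto_diff elim c0 tendsto_const)
          moreover have "\<forall>\<^sub>F n in sequentially. ennreal (V z * nsq (stek (H n) u z - c n)) =
              ind (R' n) z * ennreal (V z * nsq (stek (H n) u z - c n))"
          proof -
            have "min (q1 - fst z) (q2 - snd z) > 0" using True elim by (auto simp: R_def mem_Times_iff)
            from order_tendstoD(2)[OF H0 this] show ?thesis
            proof eventually_elim
              case (elim n)
              then have "z \<in> R' n" using True by (auto simp: R_def R'_def mem_Times_iff)
              then show ?case by simp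
            qed
          qed
          ultimately have "(\<lambda>n. ind (R' n) z * ennreal (V z * nsq (stek (H n) u z - c n))) \<longlonglongrightarrow> ennreal (V z * nsq (u z - 0))"
            by (rule Lim_transform_eventually)
          then have "liminf (\<lambda>n. ind (R' n) z * ennreal (V z * nsq (stek (H n) u z - c n))) = ennreal (V z * nsq (u z - 0))"
            by (intro lim_imp_Liminf) auto
          then show ?thesis using True by simp
        qed simp
      qed
    qed
    also have "\<dots> \<le> liminf (\<lambda>n. NN z. ind (R' n) z * ennreal (V z * nsq (stek (H n) u z - c n)))"
    proof (rule nn_integral_liminf)
      show "(\<lambda>z. ind (R' n) z * ennreal (V z * nsq (stek (H n) u z - c n))) \<in> borel_measurable lborel" for n
        using borel_measurable_continuous_onI[OF continuous_stek[where S = UNIV and h = "H n", OF um]] Rb V(1) by (simp add: R'_def)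
    qed
    also have "\<dots> \<le> liminf (\<lambda>n::nat. ennreal (1152 * A ^ 5 * M * N))"
      by (intro Liminf_mono always_eventually allI step N)
    also have "\<dots> = ennreal (1152 * A ^ 5 * M * N)" by (simp add: Liminf_const)
    finally show ?thesis .
  qed
  have "(NN z. ind R z * ennreal (V z * nsq (u z))) \<le> ennreal (1152 * A ^ 5 * M * (2 * I0))"
  proof (rule LIMSEQ_le_const)
    have "(\<lambda>n. 1152 * A ^ 5 * M * (2 * I0 + inverse (real (Suc n)))) \<longlonglongrightarrow> 1152 * A ^ 5 * M * (2 * I0 + 0)"
      by (intro tendsto_intros LIMSEQ_inverse_real_of_nat)
    then show "(\<lambda>n. ennreal (1152 * A ^ 5 * M * (2 * I0 + inverse (real (Suc n))))) \<longlonglongrightarrow> ennreal (1152 * A ^ 5 * M * (2 * I0))"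
      by (intro tendsto_ennrealI) simp
    show "\<exists>N. \<forall>n\<ge>N. (NN z. ind R z * ennreal (V z * nsq (u z))) \<le> ennreal (1152 * A ^ 5 * M * (2 * I0 + inverse (real (Suc n))))"
      by (intro exI allI impI key) simp
  qed
  also have "1152 * A ^ 5 * M * (2 * I0) = 2304 * A ^ 5 * M * I0" by simp
  also have "ennreal (2304 * A ^ 5 * M * I0) = ennreal (2304 * A ^ 5 * M) * I"
    unfolding I0(1) using A M by (intro ennreal_mult') auto
  finally show ?thesis unfolding I_def .
qed

subsection \<open>Selecting squares of bounded overlap\<close>

definition sep :: "real \<Rightarrow> (plane) set \<Rightarrow> bool" where
  "sep s E \<longleftrightarrow> (\<forall>x\<in>E. \<forall>y\<in>E. x \<noteq> y \<longrightarrow> s < supn (x - y))"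

lemma supn_minus_commute: "supn (x - y) = supn (y - x)"
  by (simp add: supn_def abs_minus_commute)

text \<open>Two points in the same cell of a grid of mesh \<open>s\<close> are closer than
  \<open>s\<close> in the maximum norm. The signs and the corner \<open>p\<close> let one argument
  count the points in any quadrant at \<open>p\<close>.\<close>

lemma sep_floor_inj:
  assumes "sep s E" "0 < s" "\<bar>\<sigma>1\<bar> = 1" "\<bar>\<sigma>2\<bar> = (1::real)"
  shows "inj_on (\<lambda>x. (\<lfloor>\<sigma>1 * (fst x - fst p) / s\<rfloor>, \<lfloor>\<sigma>2 * (snd x - snd p) / s\<rfloor>)) E"
proof (rule inj_onI, rule ccontr)
  fix x y assume xy: "x \<in> E" "y \<in> E" "x \<noteq> y"
    and eq: "(\<lfloor>\<sigma>1 * (fst x - fst p) / s\<rfloor>, \<lfloor>\<sigma>2 * (snd x - snd p) / s\<rfloor>) = (\<lfloor>\<sigma>1 * (fst y - fst p) / s\<rfloor>, \<lfloor>\<sigma>2 * (snd y - snd p) / s\<rfloor>)"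
  have close: "\<bar>b - c\<bar> < s" if "\<lfloor>\<sigma> * (b - e) / s\<rfloor> = \<lfloor>\<sigma> * (c - e) / s\<rfloor>" "\<bar>\<sigma>\<bar> = 1" for \<sigma> b c e :: real
  proof -
    have "\<bar>\<sigma> * (b - e) / s - \<sigma> * (c - e) / s\<bar> < 1" using that(1) by linarith
    also have "\<sigma> * (b - e) / s - \<sigma> * (c - e) / s = \<sigma> * (b - c) / s" by (simp add: diff_divide_distrib right_diff_distrib)
    finally have "\<bar>b - c\<bar> / s < 1" using that(2) assms(2) by (simp add: abs_mult)
    then show ?thesis using assms(2) by simp
  qed
  have "supn (x - y) < s"
    using eq close[of \<sigma>1 "fst x" "fst p" "fst y"] close[of \<sigma>2 "snd x" "snd p" "snd y"] assms(3,4)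
    by (simp add: supn_def)
  moreover have "s < supn (x - y)" using assms(1) xy unfolding sep_def by blast
  ultimately show False by simp
qed

text \<open>A grid count; it bounds all cardinalities, so that a separated set of largest size
  exists.\<close>

lemma sep_finite_card:
  assumes "sep s E" "0 < s" "\<And>x. x \<in> E \<Longrightarrow> supn x \<le> B"
  shows "finite E \<and> card E \<le> card ({- \<lceil>B / s\<rceil> - 1..\<lceil>B / s\<rceil>} \<times> {- \<lceil>B / s\<rceil> - 1..\<lceil>B / s\<rceil>})"
proof -
  let ?f = "\<lambda>x::plane. (\<lfloor>1 * (fst x - fst (0::real, 0::real)) / s\<rfloor>, \<lfloor>1 * (snd x - snd (0::real, 0::real)) / s\<rfloor>)"
  let ?S = "{- \<lceil>B / s\<rceil> - 1..\<lceil>B / s\<rceil>} \<times> {- \<lceil>B / s\<rceil> - 1..\<lceil>B / s\<rceil>}"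
  have inj: "inj_on ?f E" by (rule sep_floor_inj[OF assms(1,2)]) auto
  have fl: "\<lfloor>t / s\<rfloor> \<in> {- \<lceil>B / s\<rceil> - 1..\<lceil>B / s\<rceil>}" if "\<bar>t\<bar> \<le> B" for t
  proof -
    have "t / s \<le> B / s" "- (B / s) \<le> t / s"
      using that assms(2) by (simp_all add: field_simps abs_le_iff)
    then show ?thesis unfolding atLeastAtMost_iff by linarith
  qed
  have "?f ` E \<subseteq> ?S"
    using assms(3) fl by (auto simp: supn_def)
  then show ?thesis
    using card_inj_on_le[OF inj, of ?S] inj_on_finite[OF inj, of ?S] by blast
qed

text \<open>A separated set of largest cardinality covers, since an uncovered point could be added
  to it.\<close>

lemma maximal_sep:
  assumes "0 < s" "\<And>x. x \<in> U \<Longrightarrow> supn x \<le> B"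
  obtains E where "finite E" "E \<subseteq> U" "sep s E" "\<And>x. x \<in> U \<Longrightarrow> \<exists>y\<in>E. supn (x - y) \<le> s"
proof -
  let ?P = "\<lambda>E. finite E \<and> E \<subseteq> U \<and> sep s E"
  define b where "b = Suc (card ({- \<lceil>B / s\<rceil> - 1..\<lceil>B / s\<rceil>} \<times> {- \<lceil>B / s\<rceil> - 1..\<lceil>B / s\<rceil>}))"
  have bound: "card E < b" if "?P E" for E
    using sep_finite_card[of s E B] that assms unfolding b_def by (auto simp: subset_iff less_Suc_eq_le)
  have "?P {}" by (simp add: sep_def)
  from ex_has_greatest_nat[of ?P, OF this] bound
  obtain E where E: "?P E" "\<And>E'. ?P E' \<Longrightarrow> card E' \<le> card E" by (metis less_imp_le)
  have "\<exists>y\<in>E. supn (x - y) \<le> s" if x: "x \<in> U" for x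
  proof (rule ccontr)
    assume "\<not> ?thesis"
    then have far: "\<And>y. y \<in> E \<Longrightarrow> s < supn (x - y)" by (auto simp: not_le)
    have "x \<notin> E" using far[of x] assms(1) by (auto simp: supn_def)
    moreover have "sep s (insert x E)"
      using E(1) far supn_minus_commute by (auto simp: sep_def)
    ultimately have "?P (insert x E)" using E(1) x by simp
    from E(2)[OF this] show False using E(1) \<open>x \<notin> E\<close> by simp
  qed
  with E(1) that show ?thesis by blast
qed

text \<open>The squares are selected by dyadic size classes, larger classes first; inside a class the
  centres form a maximal separated subset of the points not yet covered. Two selected squares of
  different classes whose centres lie in the same quadrant with respect to a common point would
  contradict the selection rule, so the overlap is at most 4 times 9.\<close>

lemma besicovitch_squares:
  fixes r :: "plane \<Rightarrow> real"
  assumes r: "\<And>x. x \<in> X \<Longrightarrow> rmin < r x \<and> r x \<le> r0" and rmin: "0 < rmin"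
    and X: "\<And>x. x \<in> X \<Longrightarrow> supn x \<le> B"
  obtains F where "finite F" "F \<subseteq> X" "\<And>x. x \<in> X \<Longrightarrow> \<exists>y\<in>F. supn (x - y) \<le> r y"
    "\<And>p. card {y\<in>F. supn (p - y) \<le> r y} \<le> 36"
proof (cases "X = {}")
  case True
  then show ?thesis by (intro that[of "{}"]) auto
next
  case False
  then have r0: "r0 > 0" using r rmin by fastforce
  \<comment> \<open>Class \<open>k\<close> will consist of points with \<open>s k < r x\<close> and
    \<open>r x \<le> 2 * s k\<close>; the lower bound \<open>rmin\<close> leaves finitely many
    classes.\<close>
  define s where "s k = r0 / 2 ^ Suc k" for k
  have s: "s k > 0" for k using r0 by (simp add: s_def)
  have s_Suc: "2 * s (Suc k) = s k" for k by (simp add: s_def)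
  have s_mono: "s l \<le> s k" if "k \<le> l" for k l
    unfolding s_def using that r0 by (intro divide_left_mono power_increasing) auto
  obtain K where K: "r0 / rmin < 2 ^ K" using real_arch_pow[of 2 "r0 / rmin"] by auto
  then have sK: "s k < rmin" if "k \<ge> K" for k
  proof -
    have "s K < rmin"
    proof -
      have "r0 < rmin * 2 ^ K" using K rmin by (simp add: field_simps)
      then have "r0 / 2 ^ K < rmin" by (simp add: field_simps)
      moreover have "s K \<le> r0 / 2 ^ K" unfolding s_def using r0 by (simp add: field_simps)
      ultimately show ?thesis by simp
    qed
    then show ?thesis using s_mono[OF that] by simp
  qed
  define cls where "cls x = (LEAST k. s k < r x)" for x
  have cls: "s (cls x) < r x" "r x \<le> 2 * s (cls x)" "cls x \<le> K" if "x \<in> X" for x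
  proof -
    have ex: "s K < r x" using sK[of K] r[OF that] by simp
    show "s (cls x) < r x" unfolding cls_def by (rule LeastI[of "\<lambda>k. s k < r x", OF ex])
    show "cls x \<le> K" unfolding cls_def by (rule Least_le[of "\<lambda>k. s k < r x", OF ex])
    show "r x \<le> 2 * s (cls x)"
    proof (cases "cls x")
      case 0
      then show ?thesis using r[OF that] by (simp add: s_def)
    next
      case (Suc k)
      then have "\<not> s k < r x" using not_less_Least[of k "\<lambda>k. s k < r x"] by (simp add: cls_def)
      then show ?thesis using Suc s_Suc[of k] by simp
    qed
  qed
  \<comment> \<open>Asymmetric: a centre of a later class lies outside the squares of all earlier
    ones, while centres of one class are merely separated by the lower bound of the class.\<close>
  define good where "good F \<longleftrightarrow> (\<forall>x\<in>F. \<forall>y\<in>F. x \<noteq> y \<longrightarrow>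
      (cls x < cls y \<longrightarrow> r x < supn (y - x)) \<and> (cls x = cls y \<longrightarrow> s (cls x) < supn (y - x)))" for F
  have ex: "\<exists>F. finite F \<and> F \<subseteq> {x\<in>X. cls x < k} \<and> (\<forall>x\<in>X. cls x < k \<longrightarrow> (\<exists>y\<in>F. supn (x - y) \<le> r y)) \<and> good F" for k
  proof (induction k)
    case 0
    show ?case by (intro exI[of _ "{}"]) (auto simp: good_def)
  next
    case (Suc k)
    then obtain F where F: "finite F" "F \<subseteq> {x\<in>X. cls x < k}" "\<And>x. x \<in> X \<Longrightarrow> cls x < k \<Longrightarrow> \<exists>y\<in>F. supn (x - y) \<le> r y" "good F"
      by blast
    define U where "U = {x\<in>X. cls x = k \<and> (\<forall>y\<in>F. r y < supn (x - y))}"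
    obtain E where E: "finite E" "E \<subseteq> U" "sep (s k) E" "\<And>x. x \<in> U \<Longrightarrow> \<exists>y\<in>E. supn (x - y) \<le> s k"
      by (rule maximal_sep[OF s[of k], of U B]) (use X in \<open>auto simp: U_def\<close>)
    have cE: "cls x = k" "x \<in> X" if "x \<in> E" for x using that E(2) by (auto simp: U_def)
    have cF: "cls x < k" "x \<in> X" if "x \<in> F" for x using that F(2) by auto
    have "good (F \<union> E)"
      unfolding good_def
    proof (intro ballI impI)
      fix x y assume xy: "x \<in> F \<union> E" "y \<in> F \<union> E" "x \<noteq> y"
      consider "x \<in> F" "y \<in> F" | "x \<in> F" "y \<in> E" | "x \<in> E" "y \<in> F" | "x \<in> E" "y \<in> E" using xy by blast
      then show "(cls x < cls y \<longrightarrow> r x < supn (y - x)) \<and> (cls x = cls y \<longrightarrow> s (cls x) < supn (y - x))"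
      proof cases
        case 1 then show ?thesis using F(4) xy(3) by (auto simp: good_def)
      next
        case 2
        then have "r x < supn (y - x)" using E(2) by (auto simp: U_def)
        then show ?thesis using cE(1)[OF 2(2)] cF(1)[OF 2(1)] by simp
      next
        case 3
        then show ?thesis using cE(1)[OF 3(1)] cF(1)[OF 3(2)] by simp
      next
        case 4
        then have "s k < supn (y - x)" using E(3) xy(3) by (auto simp: sep_def)
        then show ?thesis using cE(1)[OF 4(1)] cE(1)[OF 4(2)] by simp
      qed
    qed
    moreover have "\<exists>y\<in>F \<union> E. supn (x - y) \<le> r y" if x: "x \<in> X" "cls x < Suc k" for x
    proof (cases "cls x < k")
      case True then show ?thesis using F(3) x by blast
    next
      case False
      then have ck: "cls x = k" using x by simp
      show ?thesis
      proof (cases "x \<in> U")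
        case True
        then obtain y where y: "y \<in> E" "supn (x - y) \<le> s k" using E(4) by blast
        then have "supn (x - y) \<le> r y" using cls(1)[OF cE(2)[OF y(1)]] cE(1)[OF y(1)] by simp
        then show ?thesis using y by blast
      next
        case False
        then show ?thesis using x ck by (auto simp: U_def not_less)
      qed
    qed
    moreover have "F \<union> E \<subseteq> {x\<in>X. cls x < Suc k}" using cE cF by (auto simp: less_Suc_eq)
    ultimately show ?case using F(1) E(1) by (intro exI[of _ "F \<union> E"]) auto
  qed
  from ex[of "Suc K"] obtain F where F': "finite F" "F \<subseteq> {x\<in>X. cls x < Suc K}"
      "\<forall>x\<in>X. cls x < Suc K \<longrightarrow> (\<exists>y\<in>F. supn (x - y) \<le> r y)" "good F"
    by (elim exE conjE)
  have F: "finite F" "F \<subseteq> X" "\<And>x. x \<in> X \<Longrightarrow> \<exists>y\<in>F. supn (x - y) \<le> r y" "good F"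
    using F' cls(3) by (auto simp: less_Suc_eq_le)
  have "card {y\<in>F. supn (p - y) \<le> r y} \<le> 36" for p
  proof -
    define Q where "Q \<sigma>1 \<sigma>2 = {y\<in>F. supn (p - y) \<le> r y \<and> 0 \<le> \<sigma>1 * (fst y - fst p) \<and> 0 \<le> \<sigma>2 * (snd y - snd p)}" for \<sigma>1 \<sigma>2 :: real
    have Q9: "card (Q \<sigma>1 \<sigma>2) \<le> 9" if \<sigma>: "\<bar>\<sigma>1\<bar> = 1" "\<bar>\<sigma>2\<bar> = 1" for \<sigma>1 \<sigma>2
    proof (cases "Q \<sigma>1 \<sigma>2 = {}")
      case False
      then obtain x0 where x0: "x0 \<in> Q \<sigma>1 \<sigma>2" by blast
      have comp: "\<bar>b - e\<bar> = \<sigma> * (b - e)" if "\<bar>\<sigma>\<bar> = 1" "0 \<le> \<sigma> * (b - e)" for b e \<sigma> :: real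
        using that by (metis abs_mult abs_of_nonneg mult_1)
      have off: "0 \<le> \<sigma>1 * (fst y - fst p)" "\<sigma>1 * (fst y - fst p) \<le> r y" "0 \<le> \<sigma>2 * (snd y - snd p)" "\<sigma>2 * (snd y - snd p) \<le> r y" "y \<in> F" "y \<in> X"
        if "y \<in> Q \<sigma>1 \<sigma>2" for y
        using that comp[OF \<sigma>(1), of "fst y" "fst p"] comp[OF \<sigma>(2), of "snd y" "snd p"] F(2)
        by (auto simp: Q_def supn_def abs_minus_commute)
      \<comment> \<open>In one quadrant both offsets from \<open>p\<close> have the same sign, so
        their difference is at most the larger of them; this is why quadrants are treated
        separately.\<close>
      have dist: "supn (y - x) \<le> max (r x) (r y)" if "x \<in> Q \<sigma>1 \<sigma>2" "y \<in> Q \<sigma>1 \<sigma>2" for x y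
      proof -
        have "\<bar>b - c\<bar> \<le> max u v" if "\<bar>\<sigma>\<bar> = 1" "0 \<le> \<sigma> * (b - e)" "\<sigma> * (b - e) \<le> u" "0 \<le> \<sigma> * (c - e)" "\<sigma> * (c - e) \<le> v" for b c e u v \<sigma> :: real
        proof -
          have "\<bar>b - c\<bar> = \<bar>\<sigma> * (b - e) - \<sigma> * (c - e)\<bar>"
            using that(1) by (metis abs_mult diff_diff_eq2 diff_add_cancel mult_1 right_diff_distrib')
          then show ?thesis using that by linarith
        qed
        from this[OF \<sigma>(1) off(1,2)[OF that(2)] off(1,2)[OF that(1)]] this[OF \<sigma>(2) off(3,4)[OF that(2)] off(3,4)[OF that(1)]]
        show ?thesis by (simp add: supn_def max.commute)
      qed
      \<comment> \<open>Radii of a later class are smaller than \<open>r x\<close>, so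
        \<open>y\<close> would lie in the square of \<open>x\<close>, which the selection forbids.
        Hence all centres in the quadrant share one class.\<close>
      have same: "\<not> cls x < cls y" if xy: "x \<in> Q \<sigma>1 \<sigma>2" "y \<in> Q \<sigma>1 \<sigma>2" for x y
      proof
        assume lt: "cls x < cls y"
        have "r y \<le> 2 * s (cls y)" by (rule cls(2)[OF off(6)[OF xy(2)]])
        also have "\<dots> \<le> 2 * s (Suc (cls x))" using s_mono[of "Suc (cls x)" "cls y"] lt by simp
        also have "\<dots> = s (cls x)" by (rule s_Suc)
        also have "\<dots> < r x" by (rule cls(1)[OF off(6)[OF xy(1)]])
        finally have "supn (y - x) \<le> r x" using dist[OF xy] by simp
        moreover have "r x < supn (y - x)" using F(4) off(5)[OF xy(1)] off(5)[OF xy(2)] lt by (auto simp: good_def)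
        ultimately show False by simp
      qed
      define k where "k = cls x0"
      have ck: "cls x = k" if "x \<in> Q \<sigma>1 \<sigma>2" for x using same[OF that x0] same[OF x0 that] by (simp add: k_def)
      have "sep (s k) (Q \<sigma>1 \<sigma>2)"
        unfolding sep_def
      proof (intro ballI impI)
        fix x y assume "x \<in> Q \<sigma>1 \<sigma>2" "y \<in> Q \<sigma>1 \<sigma>2" "x \<noteq> y"
        then show "s k < supn (x - y)" using F(4) off(5)[of x] off(5)[of y] ck[of x] ck[of y] by (auto simp: good_def)
      qed
      from sep_floor_inj[OF this s \<sigma>, of p]
      have inj: "inj_on (\<lambda>x. (\<lfloor>\<sigma>1 * (fst x - fst p) / s k\<rfloor>, \<lfloor>\<sigma>2 * (snd x - snd p) / s k\<rfloor>)) (Q \<sigma>1 \<sigma>2)" .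
      \<comment> \<open>Offsets are at most \<open>r x \<le> 2 * s k\<close>, so each coordinate
        meets three grid cells, which gives 9 centres per quadrant.\<close>
      have fl: "\<lfloor>t / s k\<rfloor> \<in> {0, 1, 2}" if "0 \<le> t" "t \<le> 2 * s k" for t
      proof -
        have "0 \<le> t / s k" "t / s k \<le> 2" using that s[of k] by (auto simp: divide_le_eq)
        then have "0 \<le> \<lfloor>t / s k\<rfloor>" "\<lfloor>t / s k\<rfloor> \<le> 2" by linarith+
        then have "\<lfloor>t / s k\<rfloor> = 0 \<or> \<lfloor>t / s k\<rfloor> = 1 \<or> \<lfloor>t / s k\<rfloor> = 2" by arith
        then show ?thesis by blast
      qed
      have "(\<lambda>x. (\<lfloor>\<sigma>1 * (fst x - fst p) / s k\<rfloor>, \<lfloor>\<sigma>2 * (snd x - snd p) / s k\<rfloor>)) ` Q \<sigma>1 \<sigma>2 \<subseteq> {0, 1, 2} \<times> {0, 1, 2}"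
      proof (rule image_subsetI)
        fix x assume x: "x \<in> Q \<sigma>1 \<sigma>2"
        have "r x \<le> 2 * s k" using cls(2)[OF off(6)[OF x]] ck[OF x] by simp
        then show "(\<lfloor>\<sigma>1 * (fst x - fst p) / s k\<rfloor>, \<lfloor>\<sigma>2 * (snd x - snd p) / s k\<rfloor>) \<in> {0, 1, 2} \<times> {0, 1, 2}"
          using off(1-4)[OF x] by (intro SigmaI fl) linarith+
      qed
      from card_inj_on_le[OF inj this] show ?thesis by (simp add: card_cartesian_product)
    qed simp
    have fin: "finite (Q \<sigma>1 \<sigma>2)" for \<sigma>1 \<sigma>2 using F(1) by (simp add: Q_def)
    have "{y\<in>F. supn (p - y) \<le> r y} \<subseteq> (Q 1 1 \<union> Q 1 (-1)) \<union> (Q (-1) 1 \<union> Q (-1) (-1))"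
      by (auto simp: Q_def)
    then have "card {y\<in>F. supn (p - y) \<le> r y} \<le> card ((Q 1 1 \<union> Q 1 (-1)) \<union> (Q (-1) 1 \<union> Q (-1) (-1)))"
      using fin by (intro card_mono) auto
    also have "\<dots> \<le> (card (Q 1 1) + card (Q 1 (-1))) + (card (Q (-1) 1) + card (Q (-1) (-1)))"
      by (intro order_trans[OF card_Un_le] add_mono card_Un_le)
    also have "\<dots> \<le> (9 + 9) + (9 + 9)" by (intro add_mono Q9) auto
    finally show ?thesis by simp
  qed
  with F(1-3) show ?thesis by (intro that)
qed

subsection \<open>Entropy of the potential and the Orlicz norm\<close>

lemma nn_integral_lebesgue_on:
  assumes "f \<in> BM" "S \<in> sets borel"
  shows "(\<integral>\<^sup>+x. f x \<partial>lebesgue_on S) = (NN x. ind S x * f x)"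
proof -
  have "(\<integral>\<^sup>+x. f x \<partial>lebesgue_on S) = (\<integral>\<^sup>+x. f x * ind S x \<partial>lebesgue)"
    using assms(2) by (intro nn_integral_restrict_space) simp
  also have "\<dots> = (NN x. f x * ind S x)"
    by (rule nn_integral_completion)
  finally show ?thesis by (simp add: mult.commute)
qed

text \<open>Since \<open>N_fun_A s \<le> exp s - 1\<close> for \<open>s \<ge> 0\<close>,
  \<open>g\<close> is admissible in the supremum. Boundedness of \<open>g\<close> makes
  \<open>f * g\<close> integrable, so the Bochner integral inside \<open>norm_B\<close> is not the
  default value 0.\<close>

lemma norm_B_ge:
  fixes f g :: "real \<Rightarrow> real"
  assumes f: "f \<in> BM" "\<And>x. 0 \<le> f x" "(NN x. ind I x * ennreal (f x)) < \<infinity>"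
    and g: "g \<in> BM" "\<And>x. 0 \<le> g x" "\<And>x. g x \<le> b"
    and I: "I \<in> sets borel"
    and A: "(NN x. ind I x * ennreal (exp (g x) - 1)) \<le> 1"
  shows "(NN x. ind I x * ennreal (f x * g x)) \<le> norm_B I f"
proof -
  have gm: "g \<in> borel_measurable (lebesgue_on I)" "f \<in> borel_measurable (lebesgue_on I)"
    using f g by (auto intro!: measurable_restrict_space1 measurable_completion)
  have b: "0 \<le> b" using g(2,3) order_trans by blast
  have "(\<integral>\<^sup>+x. ennreal (N_fun_A \<bar>g x\<bar>) \<partial>lebesgue_on I) = (NN x. ind I x * ennreal (N_fun_A \<bar>g x\<bar>))"
    by (rule nn_integral_lebesgue_on[OF _ I]) (use g in \<open>simp add: N_fun_A_def[abs_def]\<close>)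
  also have "\<dots> \<le> (NN x. ind I x * ennreal (exp (g x) - 1))"
    using g(2) by (intro nn_integral_mono mult_left_mono ennreal_leI) (auto simp: N_fun_A_def)
  also note A
  finally have mem: "g \<in> {g \<in> borel_measurable (lebesgue_on I). (\<integral>\<^sup>+x. ennreal (N_fun_A \<bar>g x\<bar>) \<partial>lebesgue_on I) \<le> 1}"
    using gm by simp
  have nn: "(\<integral>\<^sup>+x. ennreal (f x * g x) \<partial>lebesgue_on I) = (NN x. ind I x * ennreal (f x * g x))"
    by (rule nn_integral_lebesgue_on[OF _ I]) (use f g in simp)
  have "integrable (lebesgue_on I) (\<lambda>x. f x * g x)"
  proof (rule integrableI_bounded)
    have "(\<integral>\<^sup>+x. ennreal (norm (f x * g x)) \<partial>lebesgue_on I) = (NN x. ind I x * ennreal (f x * g x))"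
      using f g nn by simp
    also have "\<dots> \<le> (NN x. ennreal b * (ind I x * ennreal (f x)))"
    proof (rule nn_integral_mono)
      fix x
      have "ennreal (f x * g x) \<le> ennreal (b * f x)"
        using mult_left_mono[OF g(3) f(2), of x x] by (intro ennreal_leI) (simp add: mult.commute)
      also have "\<dots> = ennreal b * ennreal (f x)" using b by (rule ennreal_mult')
      finally show "ind I x * ennreal (f x * g x) \<le> ennreal b * (ind I x * ennreal (f x))"
        by (cases "x \<in> I") simp_all
    qed
    also have "\<dots> = ennreal b * (NN x. ind I x * ennreal (f x))"
      by (rule nn_integral_cmult) (use f I in simp)
    also have "\<dots> < \<infinity>" using f(3) by (simp add: ennreal_mult_less_top)
    finally show "(\<integral>\<^sup>+x. ennreal (norm (f x * g x)) \<partial>lebesgue_on I) < \<infinity>" .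
  qed (use gm in simp)
  then have "(\<integral>\<^sup>+x. ennreal (f x * g x) \<partial>lebesgue_on I) = ennreal (\<integral>x. f x * g x \<partial>lebesgue_on I)"
    by (rule nn_integral_eq_integral) (use f g in simp)
  also have "\<dots> \<le> ennreal \<bar>\<integral>x. f x * g x \<partial>lebesgue_on I\<bar>" by (intro ennreal_leI) simp
  also have "\<dots> \<le> norm_B I f" unfolding norm_B_def by (rule SUP_upper[OF mem])
  finally show ?thesis unfolding nn .
qed

text \<open>Convexity between 0 and \<open>L\<close>; it takes the factor \<open>\<theta>\<close>
  out of the exponent.\<close>

lemma exp_scaled_le:
  fixes \<theta> L :: real
  assumes "0 \<le> \<theta>" "\<theta> \<le> 1"
  shows "exp (\<theta> * L) \<le> 1 + \<theta> * (exp L - 1)"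
  using convex_onD[OF exp_convex, of \<theta> 0 L] assms by (simp add: algebra_simps)

text \<open>Two trial functions are inserted: \<open>\<theta>\<close> times a truncation of
  \<open>max 0 (ln (f x / \<phi>))\<close>, admissible because
  \<open>exp (g k x) - 1 \<le> \<theta> / \<phi> * f x\<close> and the mass of \<open>f\<close> is
  bounded, and the constant \<open>\<theta> / 2\<close>. The factor \<open>\<theta>\<close> serves
  convexity (\<open>\<theta> \<le> 1\<close>) and normalisation
  (\<open>\<theta> * a \<le> 1\<close>).\<close>

lemma norm_B_bounds:
  fixes f :: "real \<Rightarrow> real" and a \<phi> :: real
  assumes a: "0 < a"
    and f: "f \<in> BM" "\<And>x. 0 \<le> f x" "(NN x. ind {0<..<a} x * ennreal (f x)) \<le> ennreal (a * \<phi>)"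
    and \<phi>: "0 < \<phi>"
  defines "\<theta> \<equiv> min 1 (1 / a)"
  shows "ennreal \<theta> * (NN x. ind {0<..<a} x * ennreal (f x * max 0 (ln (f x / \<phi>)))) \<le> norm_B {0<..<a} f"
    and "ennreal (\<theta> / 2) * (NN x. ind {0<..<a} x * ennreal (f x)) \<le> norm_B {0<..<a} f"
proof -
  let ?I = "{0<..<a}"
  have \<theta>: "0 < \<theta>" "\<theta> \<le> 1" "\<theta> * a \<le> 1" using a by (auto simp: \<theta>_def min_def field_simps)
  have fin: "(NN x. ind ?I x * ennreal (f x)) < \<infinity>" using f(3) by (simp add: order.strict_trans1)
  \<comment> \<open>Truncated at \<open>k\<close> to be bounded, as \<open>norm_B_ge\<close>
    demands; monotone convergence removes the truncation.\<close>
  define g where "g k x = \<theta> * min (real k) (max 0 (ln (f x / \<phi>)))" for k x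
  have gm: "g k \<in> BM" for k unfolding g_def using f(1) by measurable
  have g0: "0 \<le> g k x" for k x using \<theta> by (simp add: g_def)
  have gb: "g k x \<le> real k" for k x
    using \<theta> mult_mono[of \<theta> 1 "min (real k) (max 0 (ln (f x / \<phi>)))" "real k"] by (simp add: g_def)
  have ge: "exp (g k x) - 1 \<le> \<theta> / \<phi> * f x" for k x
  proof -
    define L where "L = max 0 (ln (f x / \<phi>))"
    have "exp (g k x) \<le> exp (\<theta> * L)" using \<theta> by (simp add: g_def L_def mult_left_mono)
    also have "\<dots> \<le> 1 + \<theta> * (exp L - 1)" using \<theta> by (intro exp_scaled_le) auto
    also have "exp L - 1 \<le> f x / \<phi>"
    proof (cases "f x / \<phi> > 1")
      case True
      then have "L = ln (f x / \<phi>)" by (simp add: L_def)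
      then show ?thesis using True by simp
    next
      case False
      have "ln (f x / \<phi>) \<le> 0"
      proof (cases "f x = 0")
        case False
        then have "0 < f x / \<phi>" using f(2)[of x] \<phi> by simp
        then show ?thesis using \<open>\<not> f x / \<phi> > 1\<close> by (subst ln_le_zero_iff) auto
      qed simp
      then show ?thesis using f(2)[of x] \<phi> by (simp add: L_def)
    qed
    finally show ?thesis using \<theta> by (simp add: mult_left_mono)
  qed
  have A: "(NN x. ind ?I x * ennreal (exp (g k x) - 1)) \<le> 1" for k
  proof -
    have "(NN x. ind ?I x * ennreal (exp (g k x) - 1)) \<le> (NN x. ennreal (\<theta> / \<phi>) * (ind ?I x * ennreal (f x)))"
    proof (rule nn_integral_mono)
      fix x
      have "ennreal (exp (g k x) - 1) \<le> ennreal (\<theta> / \<phi> * f x)" by (intro ennreal_leI ge)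
      also have "\<dots> = ennreal (\<theta> / \<phi>) * ennreal (f x)" using \<theta> \<phi> by (intro ennreal_mult') simp
      finally show "ind ?I x * ennreal (exp (g k x) - 1) \<le> ennreal (\<theta> / \<phi>) * (ind ?I x * ennreal (f x))"
        by (cases "x \<in> ?I") simp_all
    qed
    also have "\<dots> = ennreal (\<theta> / \<phi>) * (NN x. ind ?I x * ennreal (f x))"
      by (rule nn_integral_cmult) (use f in simp)
    also have "\<dots> \<le> ennreal (\<theta> / \<phi>) * ennreal (a * \<phi>)" by (intro mult_left_mono f(3)) simp
    also have "\<dots> = ennreal (\<theta> * a)" using \<theta> \<phi> a by (simp flip: ennreal_mult')
    also have "\<dots> \<le> 1" using \<theta> by (simp add: ennreal_le_1)
    finally show ?thesis .
  qed
  have le: "(NN x. ind ?I x * ennreal (f x * g k x)) \<le> norm_B ?I f" for k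
    by (rule norm_B_ge[OF f(1,2) fin gm g0 gb _ A]) simp
  have "ennreal \<theta> * (NN x. ind ?I x * ennreal (f x * max 0 (ln (f x / \<phi>)))) =
      (NN x. ennreal \<theta> * (ind ?I x * ennreal (f x * max 0 (ln (f x / \<phi>)))))"
    by (rule nn_integral_cmult[symmetric]) (use f in simp)
  also have "\<dots> = (NN x. (SUP k. ind ?I x * ennreal (f x * g k x)))"
  proof (rule nn_integral_cong)
    fix x
    obtain m :: nat where m: "max 0 (ln (f x / \<phi>)) \<le> real m" using real_arch_simple by blast
    have up: "f x * g k x \<le> \<theta> * (f x * max 0 (ln (f x / \<phi>)))" for k
    proof -
      have "f x * g k x \<le> f x * (\<theta> * max 0 (ln (f x / \<phi>)))"
        unfolding g_def using f(2)[of x] \<theta> by (intro mult_left_mono) auto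
      then show ?thesis by (simp only: mult_ac)
    qed
    have "(SUP k. ennreal (f x * g k x)) = ennreal (\<theta> * (f x * max 0 (ln (f x / \<phi>))))"
    proof (rule antisym)
      show "(SUP k. ennreal (f x * g k x)) \<le> ennreal (\<theta> * (f x * max 0 (ln (f x / \<phi>))))"
        by (intro SUP_least ennreal_leI up)
      have "f x * g m x = \<theta> * (f x * max 0 (ln (f x / \<phi>)))" unfolding g_def min_absorb2[OF m] by (simp only: mult_ac)
      then show "ennreal (\<theta> * (f x * max 0 (ln (f x / \<phi>)))) \<le> (SUP k. ennreal (f x * g k x))"
        by (metis SUP_upper UNIV_I)
    qed
    also have "\<dots> = ennreal \<theta> * ennreal (f x * max 0 (ln (f x / \<phi>)))" using \<theta> by (intro ennreal_mult') simp
    finally show "ennreal \<theta> * (ind ?I x * ennreal (f x * max 0 (ln (f x / \<phi>)))) = (SUP k. ind ?I x * ennreal (f x * g k x))"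
      by (cases "x \<in> ?I") simp_all
  qed
  also have "\<dots> = (SUP k. NN x. ind ?I x * ennreal (f x * g k x))"
  proof (rule nn_integral_monotone_convergence_SUP)
    show "incseq (\<lambda>k x. ind ?I x * ennreal (f x * g k x))"
    proof (intro incseq_SucI le_funI mult_left_mono ennreal_leI)
      fix k x
      show "g k x \<le> g (Suc k) x"
        unfolding g_def using \<theta> by (intro mult_left_mono) auto
    qed (use f in auto)
  qed (use f gm in simp)
  also have "\<dots> \<le> norm_B ?I f" by (intro SUP_least le)
  finally show "ennreal \<theta> * (NN x. ind ?I x * ennreal (f x * max 0 (ln (f x / \<phi>)))) \<le> norm_B ?I f" .
  have "ennreal (\<theta> / 2) * (NN x. ind ?I x * ennreal (f x)) = (NN x. ennreal (\<theta> / 2) * (ind ?I x * ennreal (f x)))"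
    by (rule nn_integral_cmult[symmetric]) (use f in simp)
  also have "\<dots> = (NN x. ind ?I x * ennreal (f x * (\<theta> / 2)))"
  proof (rule nn_integral_cong)
    fix x
    have "ennreal (f x * (\<theta> / 2)) = ennreal (f x) * ennreal (\<theta> / 2)" using \<theta> f(2) by (intro ennreal_mult) auto
    then show "ennreal (\<theta> / 2) * (ind ?I x * ennreal (f x)) = ind ?I x * ennreal (f x * (\<theta> / 2))"
      by (simp only: mult_ac)
  qed
  also have "\<dots> \<le> norm_B ?I f"
  proof (rule norm_B_ge[where g = "\<lambda>_. \<theta> / 2" and b = \<theta>, OF f(1,2) fin])
    have "exp (\<theta> / 2) - 1 \<le> \<theta>"
    proof -
      have "exp (\<theta> / 2) \<le> 1 + \<theta> / 2 + (\<theta> / 2)\<^sup>2" by (rule exp_bound) (use \<theta> in auto)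
      moreover have "(\<theta> / 2)\<^sup>2 \<le> \<theta> / 2" using \<theta> mult_left_le[of "\<theta> / 2" "\<theta> / 2"] by (simp add: power2_eq_square)
      ultimately show ?thesis by linarith
    qed
    then have e: "ennreal (exp (\<theta> / 2) - 1) \<le> ennreal \<theta>" by (rule ennreal_leI)
    have "(NN x. ind ?I x * ennreal (exp (\<theta> / 2) - 1)) = ennreal a * ennreal (exp (\<theta> / 2) - 1)"
      using a by (simp add: nn_integral_multc)
    also have "\<dots> \<le> ennreal a * ennreal \<theta>" by (intro mult_left_mono e) simp
    also have "\<dots> = ennreal (\<theta> * a)" using a \<theta> by (simp add: mult.commute flip: ennreal_mult')
    also have "\<dots> \<le> 1" using \<theta> by (simp add: ennreal_le_1)
    finally show "(NN x. ind ?I x * ennreal (exp (\<theta> / 2) - 1)) \<le> 1" .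
  qed (use \<theta> in auto)
  finally show "ennreal (\<theta> / 2) * (NN x. ind ?I x * ennreal (f x)) \<le> norm_B ?I f" .
qed

text \<open>With \<open>\<phi>\<close> the column mean plus \<open>\<eta>\<close>, the integral of
  \<open>\<phi>\<close> over a column is the mass of the column plus \<open>a * \<eta>\<close>, and
  mass and logarithmic part are both bounded by the Orlicz norm of the column. The positive
  \<open>\<eta>\<close> keeps \<open>\<phi>\<close> away from 0 on empty columns.\<close>

lemma lpot_le_D:
  fixes V W :: "plane \<Rightarrow> real" and \<eta> a :: real and n :: int
  defines "\<theta> \<equiv> min 1 (1 / a)"
  defines "\<phi> \<equiv> (\<lambda>x. enn2real (NN y. ind {0<..<a} y * ennreal (W (x, y))) / a + \<eta>)"
  assumes a: "0 < a" and \<eta>: "0 < \<eta>"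
    and W: "W \<in> BM" "\<And>z. 0 \<le> W z"
    and fin: "AE x in lborel. x \<in> {real_of_int n<..<real_of_int n + 1} \<longrightarrow> (NN y. ind {0<..<a} y * ennreal (W (x, y))) < \<infinity>"
    and VW: "AE x in lborel. norm_B {0<..<a} (\<lambda>y. W (x, y)) = norm_B {0<..<a} (\<lambda>y. V (x, y))"
  shows "(NN z. ind (cell a n) z * ennreal (lpot W \<phi> z)) \<le>
    ennreal (3 / \<theta>) * D a V n + ennreal (a * \<eta>)"
    and "\<phi> \<in> BM" "\<And>x. 0 < \<phi> x"
proof -
  let ?I = "{0<..<a}" and ?J = "{real_of_int n<..<real_of_int n + 1}"
  have \<theta>: "0 < \<theta>" using a by (simp add: \<theta>_def)
  have W2: "(\<lambda>z. ennreal (W z)) \<in> borel_measurable (borel \<Otimes>\<^sub>M borel)" using W(1) by (simp add: borel_prod)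
  define F where "F x = (NN y. ind ?I y * ennreal (W (x, y)))" for x
  have F: "F \<in> BM"
  proof -
    have "(\<lambda>(x, y). ind ?I y * ennreal (W (x, y))) \<in> borel_measurable (borel \<Otimes>\<^sub>M lborel)"
      using W2 by (simp add: split_beta' cong: measurable_cong_sets)
    from lborel.borel_measurable_nn_integral[OF this] show ?thesis by (simp add: F_def[abs_def])
  qed
  have \<phi>_eq: "\<phi> x = enn2real (F x) / a + \<eta>" for x by (simp add: \<phi>_def F_def)
  show \<phi>m: "\<phi> \<in> BM" unfolding \<phi>_eq[abs_def] using F by measurable
  show \<phi>0: "0 < \<phi> x" for x unfolding \<phi>_eq using a \<eta> by (intro add_nonneg_pos) auto
  have \<phi>2: "(\<lambda>z::plane. \<phi> (fst z)) \<in> BM"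
    by (rule measurable_compose[OF fst_borel_measurable \<phi>m])
  have lm: "lpot W \<phi> \<in> BM"
    unfolding lpot_def[abs_def]
    by (intro borel_measurable_add borel_measurable_times borel_measurable_max W(1) borel_measurable_ln borel_measurable_divide \<phi>2
      borel_measurable_const)
  define L where "L x = (NN y. ind ?I y * ennreal (W (x, y) * max 0 (ln (W (x, y) / \<phi> x))))" for x
  have Lm: "L \<in> BM"
  proof -
    have "(\<lambda>z. ennreal (W z * max 0 (ln (W z / \<phi> (fst z))))) \<in> BM"
      by (intro measurable_compose[OF _ measurable_ennreal] borel_measurable_times borel_measurable_max W(1) borel_measurable_ln borel_measurable_divide \<phi>2
        borel_measurable_const)
    then have "(\<lambda>z. ennreal (W z * max 0 (ln (W z / \<phi> (fst z))))) \<in> borel_measurable (borel \<Otimes>\<^sub>M borel)" by (simp add: borel_prod)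
    then have "(\<lambda>(x, y). ind ?I y * ennreal (W (x, y) * max 0 (ln (W (x, y) / \<phi> x)))) \<in> borel_measurable (borel \<Otimes>\<^sub>M lborel)"
      by (simp add: split_beta' cong: measurable_cong_sets)
    from lborel.borel_measurable_nn_integral[OF this] show ?thesis by (simp add: L_def[abs_def])
  qed
  have Rb: "cell a n \<in> sets borel"
    by (intro borel_closed closed_Times closed_real_atLeastAtMost)
  have "(NN z. ind (cell a n) z * ennreal (lpot W \<phi> z)) =
      (NN x. NN y. ind (cell a n) (x, y) * ennreal (lpot W \<phi> (x, y)))"
    by (rule nn_integral_lborel2(1)) (use lm Rb in simp)
  also have "\<dots> = (NN x. ind ?J x * (L x + ennreal (a * \<phi> x)))"
  proof (rule nn_integral_cong_AE)
    show "AE x in lborel. (NN y. ind (cell a n) (x, y) * ennreal (lpot W \<phi> (x, y))) =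
      ind ?J x * (L x + ennreal (a * \<phi> x))"
      using AE_lborel_singleton[of "real_of_int n"] AE_lborel_singleton[of "real_of_int n + 1"]
    proof eventually_elim
      case (elim x)
      have Wx: "(\<lambda>y. W (x, y)) \<in> BM"
        by (rule measurable_compose[OF _ W(1)]) (intro borel_measurable_continuous_onI continuous_intros)
      have "(NN y. ind (cell a n) (x, y) * ennreal (lpot W \<phi> (x, y))) =
        (NN y. ind ?J x * (ind ?I y * ennreal (W (x, y) * max 0 (ln (W (x, y) / \<phi> x))) + ind ?I y * ennreal (\<phi> x)))"
      proof (rule nn_integral_cong_AE)
        show "AE y in lborel. ind (cell a n) (x, y) * ennreal (lpot W \<phi> (x, y)) =
          ind ?J x * (ind ?I y * ennreal (W (x, y) * max 0 (ln (W (x, y) / \<phi> x))) + ind ?I y * ennreal (\<phi> x))"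
          using AE_lborel_singleton[of 0] AE_lborel_singleton[of a]
        proof eventually_elim
          case (elim y)
          have "((x, y) \<in> cell a n) = (x \<in> ?J \<and> y \<in> ?I)"
            using elim \<open>x \<noteq> real_of_int n\<close> \<open>x \<noteq> real_of_int n + 1\<close> by auto
          moreover have "ennreal (lpot W \<phi> (x, y)) = ennreal (W (x, y) * max 0 (ln (W (x, y) / \<phi> x))) + ennreal (\<phi> x)"
            unfolding lpot_def fst_conv using W(2)[of "(x, y)"] \<phi>0[of x] by (intro ennreal_plus) auto
          ultimately show ?case by (cases "x \<in> ?J"; cases "y \<in> ?I") (simp_all add: indicator_def)
        qed
      qed
      also have "\<dots> = ind ?J x * (L x + ennreal (a * \<phi> x))"
        using Wx a \<phi>0[of x] by (simp add: nn_integral_cmult nn_integral_add nn_integral_multc L_def ennreal_mult' less_imp_le)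
      finally show ?case .
    qed
  qed
  also have "\<dots> \<le> (NN x. ind ?J x * (L x + F x) + ind ?J x * ennreal (a * \<eta>))"
  proof (rule nn_integral_mono)
    fix x
    have "ennreal (a * \<phi> x) = ennreal (enn2real (F x)) + ennreal (a * \<eta>)"
      unfolding \<phi>_eq using a \<eta> by (subst ennreal_plus[symmetric]) (auto simp: distrib_left)
    also have "\<dots> \<le> F x + ennreal (a * \<eta>)"
      by (intro add_right_mono) (metis ennreal_enn2real_if order_refl zero_le)
    finally show "ind ?J x * (L x + ennreal (a * \<phi> x)) \<le> ind ?J x * (L x + F x) + ind ?J x * ennreal (a * \<eta>)"
      by (cases "x \<in> ?J") (simp_all add: add.assoc add_left_mono)
  qed
  also have "\<dots> = (NN x. ind ?J x * (L x + F x)) + ennreal (a * \<eta>)"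
    using Lm F by (subst nn_integral_add) (simp_all add: nn_integral_multc)
  also have "(NN x. ind ?J x * (L x + F x)) \<le> ennreal (3 / \<theta>) * D a V n"
  proof -
    \<comment> \<open>The convex combination
      \<open>1/3 * (\<theta> * L x) + 2/3 * (\<theta> / 2 * F x)\<close> uses both Orlicz bounds
      with the common factor \<open>\<theta> / 3\<close>. Only monotonicity of the integral is
      invoked, so measurability of the Orlicz norm in \<open>x\<close> does not come up.\<close>
    have "(\<integral>\<^sup>+x. ennreal (\<theta> / 3) * (L x + F x) \<partial>lebesgue_on ?J) \<le> D a V n"
      unfolding D_def norm_L1_B_def
    proof (rule nn_integral_mono_AE)
      have "AE x in lborel. x \<in> ?J \<longrightarrow> ennreal (\<theta> / 3) * (L x + F x) \<le> norm_B ?I (\<lambda>y. V (x, y))"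
        using fin VW
      proof eventually_elim
        case (elim x)
        show ?case
        proof
          assume x: "x \<in> ?J"
          then have Ff: "F x < \<infinity>" using elim by (simp add: F_def)
          then have Fx: "F x = ennreal (enn2real (F x))" by simp
          have Wx: "(\<lambda>y. W (x, y)) \<in> BM"
            by (rule measurable_compose[OF _ W(1)]) (intro borel_measurable_continuous_onI continuous_intros)
          have le: "(NN y. ind ?I y * ennreal (W (x, y))) \<le> ennreal (a * \<phi> x)"
            unfolding F_def[symmetric] by (subst Fx) (use a \<eta> in \<open>auto simp: \<phi>_eq distrib_left intro!: ennreal_leI\<close>)
          note bds = norm_B_bounds[OF a Wx W(2) le \<phi>0]
          have b1: "ennreal \<theta> * L x \<le> norm_B ?I (\<lambda>y. V (x, y))"
            using bds(1) elim by (simp add: L_def \<theta>_def)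
          have b2: "ennreal (\<theta> / 2) * F x \<le> norm_B ?I (\<lambda>y. V (x, y))"
            using bds(2) elim by (simp add: F_def \<theta>_def)
          have "ennreal (\<theta> / 3) * (L x + F x) = ennreal (1 / 3) * (ennreal \<theta> * L x) + ennreal (2 / 3) * (ennreal (\<theta> / 2) * F x)"
            using \<theta> by (simp add: distrib_left flip: mult.assoc ennreal_mult')
          also have "\<dots> \<le> ennreal (1 / 3) * norm_B ?I (\<lambda>y. V (x, y)) + ennreal (2 / 3) * norm_B ?I (\<lambda>y. V (x, y))"
            by (intro add_mono mult_left_mono b1 b2) auto
          also have "\<dots> = (ennreal (1 / 3) + ennreal (2 / 3)) * norm_B ?I (\<lambda>y. V (x, y))" by (rule distrib_right[symmetric])
          also have "ennreal (1 / 3) + ennreal (2 / 3) = 1" by (subst ennreal_plus[symmetric]) auto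
          finally show "ennreal (\<theta> / 3) * (L x + F x) \<le> norm_B ?I (\<lambda>y. V (x, y))" by simp
        qed
      qed
      then have "AE x in lebesgue. x \<in> ?J \<longrightarrow> ennreal (\<theta> / 3) * (L x + F x) \<le> norm_B ?I (\<lambda>y. V (x, y))"
        by (rule AE_completion)
      then show "AE x in lebesgue_on ?J. ennreal (\<theta> / 3) * (L x + F x) \<le> norm_B ?I (\<lambda>y. V (x, y))"
        by (subst AE_restrict_space_iff) auto
    qed
    moreover have "(\<integral>\<^sup>+x. ennreal (\<theta> / 3) * (L x + F x) \<partial>lebesgue_on ?J) = ennreal (\<theta> / 3) * (NN x. ind ?J x * (L x + F x))"
    proof -
      have "(\<integral>\<^sup>+x. ennreal (\<theta> / 3) * (L x + F x) \<partial>lebesgue_on ?J) = (NN x. ind ?J x * (ennreal (\<theta> / 3) * (L x + F x)))"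
        by (rule nn_integral_lebesgue_on) (use Lm F in simp_all)
      also have "\<dots> = (NN x. ennreal (\<theta> / 3) * (ind ?J x * (L x + F x)))"
        by (intro nn_integral_cong) (simp add: mult_ac)
      also have "\<dots> = ennreal (\<theta> / 3) * (NN x. ind ?J x * (L x + F x))"
        by (rule nn_integral_cmult) (use Lm F in simp)
      finally show ?thesis .
    qed
    ultimately have "ennreal (3 / \<theta>) * (ennreal (\<theta> / 3) * (NN x. ind ?J x * (L x + F x))) \<le> ennreal (3 / \<theta>) * D a V n"
      by (intro mult_left_mono) auto
    moreover have "ennreal (3 / \<theta>) * ennreal (\<theta> / 3) = 1" using \<theta> by (simp flip: ennreal_mult')
    ultimately show ?thesis by (simp flip: mult.assoc)
  qed
  finally show "(NN z. ind (cell a n) z * ennreal (lpot W \<phi> z)) \<le>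
    ennreal (3 / \<theta>) * D a V n + ennreal (a * \<eta>)" by (simp add: add_right_mono)
qed

subsection \<open>Functionals for one cell of the strip\<close>

text \<open>Absolute continuity of the integral: truncate at a level \<open>k\<close> with small
  remainder; a small set then carries at most \<open>k\<close> times its measure of the truncated
  part.\<close>

lemma integrable_small_sets:
  fixes h :: "'a::euclidean_space \<Rightarrow> real"
  assumes h: "integrable lborel h" "\<And>z. 0 \<le> h z" and e: "0 < e"
  obtains \<rho> where "0 < \<rho>" "\<And>A. A \<in> sets borel \<Longrightarrow> emeasure lborel A < ennreal \<rho> \<Longrightarrow> (sint A h) < e"
proof -
  have hm: "h \<in> BM" using h(1) by auto
  have "(\<lambda>k. LINT z|lborel. h z - min (h z) (real k)) \<longlonglongrightarrow> (LINT z|lborel. (0::real) * (h z))"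
  proof (rule integral_dominated_convergence[where w = h])
    show "AE z in lborel. (\<lambda>k. h z - min (h z) (real k)) \<longlonglongrightarrow> 0 * h z"
    proof (rule AE_I2)
      fix z
      obtain k0 :: nat where k0: "h z \<le> real k0" using real_arch_simple by blast
      have "\<forall>\<^sub>F k in sequentially. h z - min (h z) (real k) = 0 * h z"
        using eventually_ge_at_top[of k0]
      proof eventually_elim
        case (elim k)
        then have "h z \<le> real k" using k0 by (meson of_nat_mono order_trans)
        then show ?case by simp
      qed
      then show "(\<lambda>k. h z - min (h z) (real k)) \<longlonglongrightarrow> 0 * h z" by (rule tendsto_eventually)
    qed
    show "AE z in lborel. norm (h z - min (h z) (real k)) \<le> h z" for k
      using h(2) by (intro AE_I2) (auto simp: min_def)
  qed (use h hm in simp_all)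
  then have "(\<lambda>k. LINT z|lborel. h z - min (h z) (real k)) \<longlonglongrightarrow> 0" by simp
  from order_tendstoD(2)[OF this, of "e / 2"] e
  obtain k where k: "(LINT z|lborel. h z - min (h z) (real k)) < e / 2"
    by (auto simp: eventually_sequentially)
  define \<rho> where "\<rho> = e / (2 * (real k + 1))"
  have \<rho>: "0 < \<rho>" using e by (simp add: \<rho>_def)
  have ih: "integrable lborel (\<lambda>z. h z - min (h z) (real k))"
    by (rule Bochner_Integration.integrable_bound[OF h(1)]) (use h(2) hm in \<open>auto simp: min_def\<close>)
  show ?thesis
  proof (rule that[OF \<rho>])
    fix A :: "'a set" assume A: "A \<in> sets borel" "emeasure lborel A < ennreal \<rho>"
    have fin: "emeasure lborel A < \<infinity>" using A(2) by (rule order.strict_trans) simp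
    have mA: "measure lborel A < \<rho>"
    proof -
      have "emeasure lborel A = ennreal (measure lborel A)" using fin by (intro emeasure_eq_ennreal_measure) simp
      then show ?thesis using A(2) by (simp add: ennreal_less_iff)
    qed
    have iA: "integrable lborel (\<lambda>z. ind A z * real k)"
      using A fin by (intro integrable_mult_left integrable_real_indicator) auto
    have "(sint A h) \<le> (LINT z|lborel. (h z - min (h z) (real k)) + ind A z * real k)"
    proof (rule integral_mono)
      show "integrable lborel (\<lambda>z. ind A z *\<^sub>R h z)"
        by (rule Bochner_Integration.integrable_bound[OF h(1)]) (use hm A in \<open>auto simp: indicator_def\<close>)
      show "integrable lborel (\<lambda>z. (h z - min (h z) (real k)) + ind A z * real k)"
        by (intro Bochner_Integration.integrable_add ih iA)
      show "ind A z *\<^sub>R h z \<le> (h z - min (h z) (real k)) + ind A z * real k" for z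
        using h(2)[of z] by (auto simp: indicator_def min_def)
    qed
    also have "\<dots> = (LINT z|lborel. h z - min (h z) (real k)) + measure lborel A * real k"
      using A fin by (subst Bochner_Integration.integral_add[OF ih iA]) simp
    also have "\<dots> < e / 2 + \<rho> * (real k + 1)"
      using k mA mult_mono[of "measure lborel A" \<rho> "real k" "real k + 1"] \<rho> by simp
    also have "\<dots> = e" by (simp add: \<rho>_def field_simps)
    finally show "(sint A h) < e" .
  qed
qed

text \<open>The sides of a square are null sets. The continuity feeds the intermediate value theorem
  that determines the radii.\<close>

lemma continuous_square_integral:
  fixes h :: "plane \<Rightarrow> real"
  assumes h: "integrable lborel h"
  shows "continuous_on UNIV (\<lambda>r. LINT z|lborel. ind ({x1 - r..x1 + r} \<times> {x2 - r..x2 + r}) z *\<^sub>R h z)"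
proof -
  have Rb: "{p..q} \<times> {c..d} \<in> sets (borel :: plane measure)" for p q c d :: real
    by (intro borel_closed closed_Times closed_real_atLeastAtMost)
  have lim1: "(\<lambda>n. ind {x - X n..x + X n} t :: real) \<longlonglongrightarrow> ind {x - r..x + r} t"
    if X: "X \<longlonglongrightarrow> r" and t: "t \<noteq> x - r" "t \<noteq> x + r" for X :: "nat \<Rightarrow> real" and x r t
  proof (rule tendsto_eventually)
    have a: "\<bar>t - x\<bar> \<noteq> r" using t by (auto simp: abs_if)
    have "\<forall>\<^sub>F n in sequentially. (\<bar>t - x\<bar> \<le> X n) = (\<bar>t - x\<bar> \<le> r)"
    proof (cases "\<bar>t - x\<bar> < r")
      case True
      from order_tendstoD(1)[OF X this] show ?thesis
      proof eventually_elim
        case (elim n)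
        then show ?case using True by auto
      qed
    next
      case False
      then have "r < \<bar>t - x\<bar>" using a by simp
      from order_tendstoD(2)[OF X this] show ?thesis
      proof eventually_elim
        case (elim n)
        then show ?case using False a by auto
      qed
    qed
    then show "\<forall>\<^sub>F n in sequentially. ind {x - X n..x + X n} t = (ind {x - r..x + r} t :: real)"
    proof eventually_elim
      case (elim n)
      have "t \<in> {x - s..x + s} \<longleftrightarrow> \<bar>t - x\<bar> \<le> s" for s by auto
      then show ?case using elim by (simp add: indicator_def)
    qed
  qed
  have "continuous (at r) (\<lambda>r. LINT z|lborel. ind ({x1 - r..x1 + r} \<times> {x2 - r..x2 + r}) z *\<^sub>R h z)" for r
    unfolding continuous_at_sequentially o_def
  proof (intro allI impI)
    fix X :: "nat \<Rightarrow> real" assume X: "X \<longlonglongrightarrow> r"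
    show "(\<lambda>n. LINT z|lborel. ind ({x1 - X n..x1 + X n} \<times> {x2 - X n..x2 + X n}) z *\<^sub>R h z)
      \<longlonglongrightarrow> (sint ({x1 - r..x1 + r} \<times> {x2 - r..x2 + r}) h)"
    proof (rule integral_dominated_convergence[where w = "\<lambda>z. norm (h z)"])
      show "AE z in lborel. (\<lambda>n. ind ({x1 - X n..x1 + X n} \<times> {x2 - X n..x2 + X n}) z *\<^sub>R h z)
        \<longlonglongrightarrow> ind ({x1 - r..x1 + r} \<times> {x2 - r..x2 + r}) z *\<^sub>R h z"
        using AE_lborel_fst_neq[of "x1 - r"] AE_lborel_fst_neq[of "x1 + r"] AE_lborel_snd_neq[of "x2 - r"] AE_lborel_snd_neq[of "x2 + r"]
      proof eventually_elim
        case (elim z)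
        then show ?case unfolding indicator_times
          by (intro tendsto_scaleR tendsto_mult lim1 X tendsto_const) simp_all
      qed
      show "AE z in lborel. norm (ind ({x1 - X n..x1 + X n} \<times> {x2 - X n..x2 + X n}) z *\<^sub>R h z) \<le> norm (h z)" for n
        by (intro AE_I2) (simp add: indicator_def)
    qed (use h Rb in \<open>auto intro!: borel_measurable_times borel_measurable_indicator\<close>)
  qed
  then show ?thesis by (simp add: continuous_on_eq_continuous_at)
qed

text \<open>Around each point of the cell the square is grown until the mass of \<open>lpot\<close>
  in it, restricted to the cell, is exactly \<open>\<delta>\<close>. Bounded overlap limits the
  number of squares, and mean zero on each clipped square controls its part of the potential. The
  condition on \<open>\<delta>\<close> ensures that this mass is reached before the radius exceeds
  half of the shorter side of the cell.\<close>

lemma local_functionals: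
  fixes W :: "plane \<Rightarrow> real" and \<phi> :: "real \<Rightarrow> real" and a m \<delta> :: real and n :: int
  defines "Q \<equiv> cell a n"
  assumes a: "0 < a"
    and W: "W \<in> BM" "\<And>z. 0 \<le> W z"
    and \<phi>: "\<phi> \<in> BM" "\<And>x. \<eta> \<le> \<phi> x" "0 < \<eta>"
    and m: "0 \<le> m" "(NN z. ind Q z * ennreal (lpot W \<phi> z)) \<le> ennreal m"
    and \<delta>: "0 < \<delta>" "\<delta> \<le> \<eta> * (min 1 a / 2)\<^sup>2"
  obtains S :: "(plane) set set" where "finite S" "real (card S) \<le> 36 * m / \<delta>"
    "\<And>E. E \<in> S \<Longrightarrow> \<exists>p1 q1 p2 q2. E = {p1..q1} \<times> {p2..q2} \<and> 0 \<le> p2 \<and> q2 \<le> a"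
    "\<And>u g1 g2. rect_weak_grad a u g1 g2 \<Longrightarrow> (\<And>E. E \<in> S \<Longrightarrow> (sint E u) = 0) \<Longrightarrow>
      (NN z. ind Q z * ennreal (W z * nsq (u z))) \<le>
      ennreal (2654208 * \<delta>) * (NN z. ind Q z * ennreal (nsq (g1 z) + nsq (g2 z)))"
proof -
  define r0 where "r0 = min 1 a / 2"
  have r0: "0 < r0" "r0 \<le> 1 / 2" "r0 \<le> a / 2" using a by (auto simp: r0_def)
  have Rb: "{p..q} \<times> {c..d} \<in> sets (borel :: plane measure)" for p q c d :: real
    by (intro borel_closed closed_Times closed_real_atLeastAtMost)
  have Qb: "Q \<in> sets borel" unfolding Q_def by (rule Rb)
  have \<phi>0: "0 < \<phi> x" for x using \<phi>(2)[of x] \<phi>(3) by linarith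
  have mphi: "(\<lambda>z::plane. \<phi> (fst z)) \<in> BM"
    by (rule measurable_compose[OF fst_borel_measurable \<phi>(1)])
  have lm: "lpot W \<phi> \<in> BM"
    unfolding lpot_def[abs_def]
    by (intro borel_measurable_add borel_measurable_times borel_measurable_max W(1) borel_measurable_ln borel_measurable_divide mphi
      borel_measurable_const)
  have l\<eta>: "\<eta> \<le> lpot W \<phi> z" for z
    unfolding lpot_def using W(2)[of z] \<phi>(2)[of "fst z"] by (intro order_trans[OF \<phi>(2)[of "fst z"]]) simp
  define h where "h z = ind Q z * lpot W \<phi> z" for z
  have h0: "0 \<le> h z" for z using l\<eta>[of z] \<phi>(3) by (simp add: h_def)
  have hm: "h \<in> BM" unfolding h_def by (intro borel_measurable_times borel_measurable_indicator Qb lm)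
  have hnn: "(NN z. ennreal (h z)) \<le> ennreal m"
  proof -
    have "ennreal (h z) = ind Q z * ennreal (lpot W \<phi> z)" for z by (simp add: h_def indicator_def)
    then show ?thesis using m(2) by simp
  qed
  have hi: "integrable lborel h"
    by (rule integrableI_bounded) (use hm h0 hnn in \<open>auto intro: order.strict_trans1\<close>)
  have him: "(LINT z|lborel. h z) \<le> m"
  proof -
    have "ennreal (LINT z|lborel. h z) \<le> ennreal m"
      using hnn by (subst nn_integral_eq_integral[symmetric, OF hi]) (use h0 in auto)
    then show ?thesis using m(1) by simp
  qed
  have si: "integrable lborel (\<lambda>z. ind A z *\<^sub>R h z)" if "A \<in> sets borel" for A
    by (rule Bochner_Integration.integrable_bound[OF hi]) (use hm that in \<open>auto simp: indicator_def\<close>)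
  define B where "B x r = {fst x - r..fst x + r} \<times> {snd x - r..snd x + r}" for x :: "plane" and r
  have Bb: "B x r \<in> sets borel" for x r unfolding B_def by (rule Rb)
  define T where "T x r = {max (real_of_int n) (fst x - r)..min (real_of_int n + 1) (fst x + r)} \<times> {max 0 (snd x - r)..min a (snd x + r)}" for x :: "plane" and r
  have TQ: "T x r = Q \<inter> B x r" for x r by (auto simp: T_def Q_def B_def)
  have Tb: "T x r \<in> sets borel" for x r unfolding T_def by (rule Rb)
  define \<Phi> where "\<Phi> x r = (sint (B x r) h)" for x r
  \<comment> \<open>Clipping to an interval of length at least \<open>2 * r\<close> leaves a length
    between \<open>r\<close> and \<open>2 * r\<close>, so clipped squares have eccentricity at most
    2.\<close>
  have side: "r \<le> min (N + L) (y + r) - max N (y - r)" "min (N + L) (y + r) - max N (y - r) \<le> 2 * r"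
    if "N \<le> y" "y \<le> N + L" "0 \<le> r" "r \<le> L / 2" for N L y r :: real
    using that by (auto simp: min_def max_def)
  have "\<exists>r. 0 \<le> r \<and> r \<le> r0 \<and> \<Phi> x r = \<delta>" if x: "x \<in> Q" for x
  proof (rule IVT'[of "\<Phi> x" 0])
    show "continuous_on {0..r0} (\<Phi> x)"
      unfolding \<Phi>_def B_def by (rule continuous_on_subset[OF continuous_square_integral[OF hi]]) simp
    have "AE z in lborel. ind (B x 0) z *\<^sub>R h z = 0"
      using AE_lborel_fst_neq[of "fst x"] by eventually_elim (auto simp: B_def indicator_def)
    then have "\<Phi> x 0 = 0" unfolding \<Phi>_def by (rule integral_eq_zero_AE)
    then show "\<Phi> x 0 \<le> \<delta>" using \<delta>(1) by simp
    \<comment> \<open>\<open>lpot\<close> is at least \<open>\<eta>\<close>, and the clipped square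
      has area at least \<open>r0 * r0\<close>.\<close>
    show "\<delta> \<le> \<Phi> x r0"
    proof -
      have x': "real_of_int n \<le> fst x" "fst x \<le> real_of_int n + 1" "0 \<le> snd x" "snd x \<le> a"
        using x by (auto simp: Q_def mem_Times_iff)
      have s1: "r0 \<le> min (real_of_int n + 1) (fst x + r0) - max (real_of_int n) (fst x - r0)"
        by (rule side(1)) (use x' r0 in auto)
      have s2: "r0 \<le> min a (snd x + r0) - max 0 (snd x - r0)"
        using side(1)[of 0 "snd x" a r0] x' r0 by simp
      have "ennreal \<delta> \<le> ennreal (\<eta> * (r0 * r0))" using \<delta>(2) by (intro ennreal_leI) (simp add: r0_def power2_eq_square)
      also have "\<dots> = ennreal \<eta> * (ennreal r0 * ennreal r0)" using r0 \<phi>(3) by (simp add: ennreal_mult')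
      also have "\<dots> \<le> ennreal \<eta> * emeasure lborel (T x r0)"
      proof (intro mult_left_mono)
        have "emeasure lborel (T x r0) = ennreal (min (real_of_int n + 1) (fst x + r0) - max (real_of_int n) (fst x - r0)) * ennreal (min a (snd x + r0) - max 0 (snd x - r0))"
        proof -
          have "max (real_of_int n) (fst x - r0) \<le> min (real_of_int n + 1) (fst x + r0)" "max 0 (snd x - r0) \<le> min a (snd x + r0)"
            using s1 s2 r0 by linarith+
          then show ?thesis unfolding T_def
            by (simp only: emeasure_lborel_Times[OF borel_closed[OF closed_real_atLeastAtMost] borel_closed[OF closed_real_atLeastAtMost]]
              emeasure_lborel_Icc)
        qed
        then show "ennreal r0 * ennreal r0 \<le> emeasure lborel (T x r0)"
          using mult_mono[OF ennreal_leI[OF s1] ennreal_leI[OF s2]] by simp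
      qed simp
      also have "\<dots> = (NN z. ennreal \<eta> * ind (T x r0) z)" using Tb by (simp add: nn_integral_cmult)
      also have "\<dots> \<le> (NN z. ennreal (ind (B x r0) z *\<^sub>R h z))"
        using l\<eta> by (intro nn_integral_mono) (auto simp: TQ h_def indicator_def ennreal_leI)
      also have "\<dots> = ennreal (\<Phi> x r0)"
        unfolding \<Phi>_def by (rule nn_integral_eq_integral[OF si[OF Bb]]) (use h0 in auto)
      finally show ?thesis using h0 by (subst (asm) ennreal_le_iff) (auto simp: \<Phi>_def intro!: Bochner_Integration.integral_nonneg)
    qed
  qed (use r0 in auto)
  then obtain r where r: "\<And>x. x \<in> Q \<Longrightarrow> 0 \<le> r x \<and> r x \<le> r0 \<and> \<Phi> x (r x) = \<delta>" by metis
  obtain \<rho> where \<rho>: "0 < \<rho>" "\<And>A. A \<in> sets borel \<Longrightarrow> emeasure lborel A < ennreal \<rho> \<Longrightarrow> (sint A h) < \<delta>"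
    by (rule integrable_small_sets[OF hi h0 \<delta>(1)]) (rule that)
  \<comment> \<open>A square of radius at most \<open>rmin\<close> has area
    \<open>4 * r^2 \<le> \<rho> / 2\<close>, too small to carry the mass
    \<open>\<delta>\<close>.\<close>
  define rmin where "rmin = min 1 (\<rho> / 8)"
  have rmin: "0 < rmin" using \<rho> by (simp add: rmin_def)
  have rlow: "rmin < r x" if x: "x \<in> Q" for x
  proof (rule ccontr)
    assume "\<not> rmin < r x"
    then have le: "r x \<le> 1" "r x \<le> \<rho> / 8" "0 \<le> r x" using r[OF x] by (auto simp: rmin_def)
    have "emeasure lborel (B x (r x)) = ennreal (2 * r x) * ennreal (2 * r x)"
      unfolding B_def using le by (subst emeasure_lborel_Times) simp_all
    also have "\<dots> = ennreal (2 * r x * (2 * r x))" using le by (intro ennreal_mult'[symmetric]) simp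
    also have "2 * r x * (2 * r x) < \<rho>"
      using le \<rho>(1) mult_mono[of "r x" 1 "r x" "\<rho> / 8"] by simp
    then have "ennreal (2 * r x * (2 * r x)) < ennreal \<rho>" using le by (intro ennreal_lessI) (auto intro: \<rho>(1))
    finally have "\<Phi> x (r x) < \<delta>" unfolding \<Phi>_def using \<rho>(2)[OF Bb] by simp
    then show False using r[OF x] by simp
  qed
  obtain F where F: "finite F" "F \<subseteq> Q" "\<And>x. x \<in> Q \<Longrightarrow> \<exists>y\<in>F. supn (x - y) \<le> r y"
    "\<And>p. card {y\<in>F. supn (p - y) \<le> r y} \<le> 36"
  proof (rule besicovitch_squares[of Q rmin r r0 "\<bar>real_of_int n\<bar> + 1 + a"])
    show "rmin < r x \<and> r x \<le> r0" if "x \<in> Q" for x using rlow r that by blast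
    show "supn x \<le> \<bar>real_of_int n\<bar> + 1 + a" if "x \<in> Q" for x
      using that a by (auto simp: Q_def mem_Times_iff supn_def)
  qed (use rmin that in auto)
  have inB: "supn (z - y) \<le> s \<longleftrightarrow> z \<in> B y s" for z y s
    by (auto simp: supn_def B_def mem_Times_iff abs_le_iff)
  have sumB: "(\<Sum>y\<in>F. ind (B y (r y)) z) = real (card {y\<in>F. supn (z - y) \<le> r y})" for z
    using F(1) by (simp add: inB indicator_def sum.If_cases Int_def Collect_conj_eq[symmetric])
  \<comment> \<open>Every selected square carries exactly the mass \<open>\<delta>\<close>, and the
    overlap bound limits the total to \<open>36 * m\<close>.\<close>
  have count: "real (card F) * \<delta> \<le> 36 * m"
  proof -
    have "real (card F) * \<delta> = (\<Sum>y\<in>F. \<Phi> y (r y))" using r F(2) by (subst sum.cong[OF refl, of F _ "\<lambda>_. \<delta>"]) auto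
    also have "\<dots> = (LINT z|lborel. (\<Sum>y\<in>F. ind (B y (r y)) z *\<^sub>R h z))"
      unfolding \<Phi>_def by (rule Bochner_Integration.integral_sum[symmetric]) (rule si[OF Bb])
    also have "\<dots> \<le> (LINT z|lborel. 36 * h z)"
    proof (rule integral_mono)
      fix z
      have "(\<Sum>y\<in>F. ind (B y (r y)) z *\<^sub>R h z) = (\<Sum>y\<in>F. ind (B y (r y)) z) * h z"
        by (simp add: sum_distrib_right)
      also have "\<dots> \<le> 36 * h z" unfolding sumB using F(4)[of z] h0 by (intro mult_right_mono) auto
      finally show "(\<Sum>y\<in>F. ind (B y (r y)) z *\<^sub>R h z) \<le> 36 * h z" .
    qed (use hi si[OF Bb] in auto)
    also have "\<dots> \<le> 36 * m" using him by simp
    finally show ?thesis .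
  qed
  define S where "S = (\<lambda>y. T y (r y)) ` F"
  show ?thesis
  proof (rule that[of S])
    show "finite S" using F(1) by (simp add: S_def)
    have "real (card S) \<le> real (card F)" unfolding S_def using card_image_le[OF F(1)] by simp
    also have "\<dots> \<le> 36 * m / \<delta>" using count \<delta>(1) by (simp add: pos_le_divide_eq)
    finally show "real (card S) \<le> 36 * m / \<delta>" .
    show "\<exists>p1 q1 p2 q2. E = {p1..q1} \<times> {p2..q2} \<and> 0 \<le> p2 \<and> q2 \<le> a" if "E \<in> S" for E
    proof -
      from that obtain y where "E = T y (r y)" by (auto simp: S_def)
      then have E: "E = {max (real_of_int n) (fst y - r y)..min (real_of_int n + 1) (fst y + r y)} \<times> {max 0 (snd y - r y)..min a (snd y + r y)}"
        by (simp only: T_def)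
      have b: "0 \<le> max 0 (snd y - r y)" "min a (snd y + r y) \<le> a" by simp_all
      show ?thesis by (intro exI conjI, rule E, rule b, rule b)
    qed
    fix u g1 g2 assume w: "rect_weak_grad a u g1 g2" and mean: "\<And>E. E \<in> S \<Longrightarrow> (sint E u) = 0"
    have um: "u \<in> BM" "g1 \<in> BM" "g2 \<in> BM"
      using w by (auto simp: rect_weak_grad_def)
    define gg where "gg z = ennreal (nsq (g1 z) + nsq (g2 z))" for z
    define uu where "uu z = ennreal (W z * nsq (u z))" for z
    have ggm: "gg \<in> BM" unfolding gg_def using um by simp
    have uum: "uu \<in> BM" unfolding uu_def using um W(1) by simp
    have each: "(NN z. ind (T y (r y)) z * uu z) \<le> ennreal (73728 * \<delta>) * (NN z. ind (T y (r y)) z * gg z)" if y: "y \<in> F" for y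
    proof -
      have yQ: "y \<in> Q" using y F(2) by blast
      then have y': "real_of_int n \<le> fst y" "fst y \<le> real_of_int n + 1" "0 \<le> snd y" "snd y \<le> a"
        by (auto simp: Q_def mem_Times_iff)
      have ry: "0 < r y" "r y \<le> 1 / 2" "r y \<le> a / 2" using rlow[OF yQ] rmin r[OF yQ] r0 by auto
      have s1: "r y \<le> min (real_of_int n + 1) (fst y + r y) - max (real_of_int n) (fst y - r y)"
        "min (real_of_int n + 1) (fst y + r y) - max (real_of_int n) (fst y - r y) \<le> 2 * r y"
        by (rule side; use y' ry in simp)+
      have s2: "r y \<le> min a (snd y + r y) - max 0 (snd y - r y)" "min a (snd y + r y) - max 0 (snd y - r y) \<le> 2 * r y"
        using side[of 0 "snd y" a "r y"] y' ry by simp_all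
      have aux: "b \<le> 2 * b'" if "b \<le> 2 * s" "s \<le> b'" for b b' s :: real using that by linarith
      have aux2: "b < b'" if "s \<le> b' - b" "0 < s" for b b' s :: real using that by linarith
      \<comment> \<open>With \<open>A = 2\<close> and \<open>M = \<delta>\<close> the factor is
        \<open>2304 * 2^5 = 73728\<close>; the overlap 36 turns it into 2654208 in the end.\<close>
      have "(NN z. ind (T y (r y)) z * ennreal (W z * nsq (u z))) \<le>
        ennreal (2304 * 2 ^ 5 * \<delta>) * (NN z. ind (T y (r y)) z * ennreal (nsq (g1 z) + nsq (g2 z)))"
        unfolding T_def
      proof (rule rect_log_inequality[OF w _ _ _ _ _ _ _ W \<phi>(1) \<phi>0])
        have "(NN z. ind (T y (r y)) z * ennreal (lpot W \<phi> z)) = (NN z. ennreal (ind (B y (r y)) z *\<^sub>R h z))"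
          by (intro nn_integral_cong) (auto simp: TQ h_def indicator_def)
        also have "\<dots> = ennreal (\<Phi> y (r y))"
          unfolding \<Phi>_def by (rule nn_integral_eq_integral[OF si[OF Bb]]) (use h0 in auto)
        also have "\<dots> = ennreal \<delta>" using r[OF yQ] by simp
        finally show "(NN z. ind ({max (real_of_int n) (fst y - r y)..min (real_of_int n + 1) (fst y + r y)} \<times> {max 0 (snd y - r y)..min a (snd y + r y)}) z * ennreal (lpot W \<phi> z)) \<le> ennreal \<delta>"
          by (simp add: T_def)
        show "(sint ({max (real_of_int n) (fst y - r y)..min (real_of_int n + 1) (fst y + r y)} \<times> {max 0 (snd y - r y)..min a (snd y + r y)}) u) = 0"
          using mean[of "T y (r y)"] y by (auto simp: S_def T_def)
        show "min (real_of_int n + 1) (fst y + r y) - max (real_of_int n) (fst y - r y) \<le> 2 * (min a (snd y + r y) - max 0 (snd y - r y))"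
          by (rule aux[OF s1(2) s2(1)])
        show "min a (snd y + r y) - max 0 (snd y - r y) \<le> 2 * (min (real_of_int n + 1) (fst y + r y) - max (real_of_int n) (fst y - r y))"
          by (rule aux[OF s2(2) s1(1)])
        show "max (real_of_int n) (fst y - r y) < min (real_of_int n + 1) (fst y + r y)" by (rule aux2[OF s1(1) ry(1)])
        show "max 0 (snd y - r y) < min a (snd y + r y)" by (rule aux2[OF s2(1) ry(1)])
      qed (use \<delta> in auto)
      then show ?thesis by (simp add: uu_def gg_def)
    qed
    have cover: "ind Q z * uu z \<le> (\<Sum>y\<in>F. ind (T y (r y)) z * uu z)" for z
    proof (cases "z \<in> Q")
      case True
      then obtain y where y: "y \<in> F" "z \<in> B y (r y)" using F(3) inB by blast
      then have "ind Q z * uu z = ind (T y (r y)) z * uu z" using True by (simp add: TQ)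
      also have "\<dots> \<le> (\<Sum>y\<in>F. ind (T y (r y)) z * uu z)" by (rule member_le_sum) (use y F(1) in auto)
      finally show ?thesis .
    qed simp
    have overlap: "(\<Sum>y\<in>F. ind (T y (r y)) z * gg z) \<le> 36 * (ind Q z * gg z)" for z
    proof (cases "z \<in> Q")
      case True
      have "(\<Sum>y\<in>F. ind (T y (r y)) z * gg z) = (\<Sum>y\<in>F. ind (B y (r y)) z) * gg z"
        using True by (simp add: sum_distrib_right TQ indicator_inter_arith)
      also have "(\<Sum>y\<in>F. ind (B y (r y)) z :: ennreal) = ennreal (\<Sum>y\<in>F. ind (B y (r y)) z)"
        by (simp add: ennreal_indicator flip: sum_ennreal)
      also have "\<dots> \<le> ennreal 36" unfolding sumB using F(4)[of z] by (intro ennreal_leI) simp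
      finally show ?thesis using True by (simp add: mult_right_mono)
    next
      case False
      then have "z \<notin> T y (r y)" for y by (simp add: TQ)
      then show ?thesis by simp
    qed
    have "(NN z. ind Q z * uu z) \<le> (NN z. (\<Sum>y\<in>F. ind (T y (r y)) z * uu z))"
      by (intro nn_integral_mono cover)
    also have "\<dots> = (\<Sum>y\<in>F. NN z. ind (T y (r y)) z * uu z)"
      by (rule nn_integral_sum) (use Tb uum in simp)
    also have "\<dots> \<le> (\<Sum>y\<in>F. ennreal (73728 * \<delta>) * (NN z. ind (T y (r y)) z * gg z))"
      by (intro sum_mono each)
    also have "\<dots> = ennreal (73728 * \<delta>) * (NN z. (\<Sum>y\<in>F. ind (T y (r y)) z * gg z))"
      using Tb ggm by (subst nn_integral_sum) (auto simp: sum_distrib_left)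
    also have "\<dots> \<le> ennreal (73728 * \<delta>) * (NN z. 36 * (ind Q z * gg z))"
      by (intro mult_left_mono nn_integral_mono overlap) simp
    also have "\<dots> = ennreal (73728 * \<delta>) * (36 * (NN z. ind Q z * gg z))"
      using Qb ggm by (subst nn_integral_cmult) auto
    also have "\<dots> = ennreal (2654208 * \<delta>) * (NN z. ind Q z * gg z)"
    proof -
      have "ennreal (73728 * \<delta>) * ennreal 36 = ennreal (73728 * \<delta> * 36)" using \<delta> by (intro ennreal_mult'[symmetric]) simp
      then have "ennreal (73728 * \<delta>) * 36 = ennreal (2654208 * \<delta>)" by (simp add: mult.commute)
      then show ?thesis by (simp only: mult.assoc[symmetric])
    qed
    finally show "(NN z. ind Q z * ennreal (W z * nsq (u z))) \<le>
      ennreal (2654208 * \<delta>) * (NN z. ind Q z * ennreal (nsq (g1 z) + nsq (g2 z)))"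
      by (simp add: uu_def gg_def)
  qed
qed

subsection \<open>Functions of one variable with square integrable derivative\<close>

text \<open>The fundamental theorem up to a null set of exceptional points: column means obey it
  only almost everywhere, and no continuous representative is chosen.\<close>

definition ae_primitive :: "(real \<Rightarrow> complex) \<Rightarrow> (real \<Rightarrow> complex) \<Rightarrow> bool" where
  "ae_primitive U gr \<longleftrightarrow> U \<in> BM \<and> gr \<in> BM \<and>
    (\<forall>p q. integrable lborel (\<lambda>x. ind {p..q} x *\<^sub>R U x)) \<and>
    sq_int gr \<and>
    (\<exists>N\<in>null_sets lborel. \<forall>s t. s \<notin> N \<longrightarrow> t \<notin> N \<longrightarrow> s \<le> t \<longrightarrow> U t - U s = (sint {s<..<t} gr))"

text \<open>As the mean over \<open>[p, q]\<close> vanishes, \<open>U x\<close> is the average of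
  \<open>U x - U y\<close> over \<open>y\<close> there, and each difference is an integral of
  \<open>gr\<close> between \<open>x\<close> and \<open>y\<close>. Bounds \<open>m\<close>,
  \<open>n\<close> that depend on \<open>x\<close> cover both a fixed interval and the growing
  intervals of the Hardy inequality.\<close>

lemma ae_primitive_bound:
  assumes U: "ae_primitive U gr" and pq: "p < q"
    and mean: "(sint {p..q} U) = 0"
    and m: "\<And>x. x \<in> X \<Longrightarrow> m x \<le> p \<and> m x \<le> x \<and> q \<le> n x \<and> x \<le> n x"
  shows "AE x in lborel. x \<in> X \<longrightarrow> ennreal (cmod (U x)) \<le> (NN t. ind {m x..n x} t * ennreal (cmod (gr t)))"
proof -
  from U obtain N where N: "N \<in> null_sets lborel"
    "\<And>s t. s \<notin> N \<Longrightarrow> t \<notin> N \<Longrightarrow> s \<le> t \<Longrightarrow> U t - U s = (sint {s<..<t} gr)"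
    and [measurable]: "U \<in> BM" "gr \<in> BM"
    and Ui: "integrable lborel (\<lambda>x. ind {p..q} x *\<^sub>R U x)"
    and Gi: "sq_int gr" unfolding ae_primitive_def by blast
  have diff: "ennreal (cmod (U t - U s)) \<le> (NN x. ind {\<alpha>..\<beta>} x * ennreal (cmod (gr x)))"
    if "s \<notin> N" "t \<notin> N" "s \<le> t" "\<alpha> \<le> s" "t \<le> \<beta>" for s t \<alpha> \<beta>
  proof -
    have "integrable lborel (\<lambda>x. ind {s<..<t} x *\<^sub>R gr x)"
      by (rule integrable_indicator_L2[OF _ Gi]) (use that in auto)
    then have "ennreal (cmod (U t - U s)) \<le> (NN x. ennreal (norm (ind {s<..<t} x *\<^sub>R gr x)))"
      unfolding N(2)[OF that(1-3)] by (rule integral_norm_bound_ennreal)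
    also have "\<dots> \<le> (NN x. ind {\<alpha>..\<beta>} x * ennreal (cmod (gr x)))"
      using that by (intro nn_integral_mono) (auto simp: indicator_def)
    finally show ?thesis .
  qed
  have "AE x in lborel. x \<notin> N" using N(1) by (rule AE_not_in)
  then show ?thesis
  proof eventually_elim
    case (elim x)
    show ?case
    proof
      assume x: "x \<in> X"
      define C where "C = (NN t. ind {m x..n x} t * ennreal (cmod (gr t)))"
      have ic: "integrable lborel (\<lambda>y. ind {p..q} y *\<^sub>R U x)" using pq by (intro integrable_scaleR_left integrable_real_indicator) simp_all
      have "(q - p) *\<^sub>R U x = (sint {p..q} (\<lambda>y. U x)) - (sint {p..q} U)"
        unfolding mean using pq by (subst integral_scaleR_left) auto
      also have "\<dots> = (LINT y|lborel. ind {p..q} y *\<^sub>R U x - ind {p..q} y *\<^sub>R U y)"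
        using ic Ui by simp
      finally have e: "(q - p) *\<^sub>R U x = \<dots>" .
      have "ennreal (q - p) * ennreal (cmod (U x)) = ennreal (norm ((q - p) *\<^sub>R U x))"
        using pq by (simp add: ennreal_mult')
      also have "\<dots> \<le> (NN y. ennreal (norm (ind {p..q} y *\<^sub>R U x - ind {p..q} y *\<^sub>R U y)))"
        unfolding e using ic Ui by (intro integral_norm_bound_ennreal) simp
      also have "\<dots> \<le> (NN y. C * ind {p..q} y)"
      proof (rule nn_integral_mono_AE)
        have "AE y in lborel. y \<notin> N" using N(1) by (rule AE_not_in)
        then show "AE y in lborel. ennreal (norm (ind {p..q} y *\<^sub>R U x - ind {p..q} y *\<^sub>R U y)) \<le> C * ind {p..q} y"
        proof eventually_elim
          case yN: (elim y)
          show ?case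
          proof (cases "y \<in> {p..q}")
            case True
            have "ennreal (cmod (U x - U y)) \<le> C"
            proof (cases "x \<le> y")
              case le: True
              have "ennreal (cmod (U y - U x)) \<le> C"
                unfolding C_def by (rule diff) (use elim yN le m[OF x] True in auto)
              then show ?thesis by (simp add: norm_minus_commute)
            next
              case False
              show ?thesis
                unfolding C_def by (rule diff) (use elim yN False m[OF x] True in auto)
            qed
            then show ?thesis using True by simp
          qed simp
        qed
      qed
      also have "\<dots> = ennreal (q - p) * C" using pq by (simp add: nn_integral_cmult mult.commute)
      finally have "ennreal (q - p) * ennreal (cmod (U x)) \<le> ennreal (q - p) * C" .
      then show "ennreal (cmod (U x)) \<le> (NN t. ind {m x..n x} t * ennreal (cmod (gr t)))"
        unfolding C_def[symmetric] using pq by (subst (asm) ennreal_mult_le_mult_iff) auto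
    qed
  qed
qed

text \<open>The uniform bound on \<open>U\<close>, squared by Cauchy-Schwarz, splits into mass of
  the weight times length times energy.\<close>

lemma mean_zero_interval:
  assumes U: "ae_primitive U gr" and pq: "p < q"
    and mean: "(sint {p..q} U) = 0"
    and w: "w \<in> BM"
  shows "(NN x. ind {p<..q} x * (w x * esq (U x))) \<le>
    (NN x. ind {p<..q} x * w x) * (ennreal (q - p) * (NN x. ind {p<..q} x * esq (gr x)))"
proof -
  have Gm: "gr \<in> BM" using U by (auto simp: ae_primitive_def)
  let ?E = "(NN x. ind {p<..q} x * esq (gr x))"
  have CS: "(NN t. ind {p..q} t * ennreal (cmod (gr t)))\<^sup>2 \<le> ennreal (q - p) * ?E"
  proof -
    have "(NN t. ind {p..q} t * ennreal (cmod (gr t)))\<^sup>2 =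
        (NN t. ind {p<..q} t * (ind {p<..q} t * ennreal (cmod (gr t))))\<^sup>2"
    proof (intro arg_cong[where f = "\<lambda>x. x\<^sup>2"] nn_integral_cong_AE)
      show "AE t in lborel. ind {p..q} t * ennreal (cmod (gr t)) = ind {p<..q} t * (ind {p<..q} t * ennreal (cmod (gr t)))"
        using AE_lborel_singleton[of p] by eventually_elim (auto simp: indicator_def)
    qed
    also have "\<dots> \<le> (NN t. (ind {p<..q} t)\<^sup>2) * (NN t. (ind {p<..q} t * ennreal (cmod (gr t)))\<^sup>2)"
      by (rule Cauchy_Schwarz_nn_integral) (use Gm in simp_all)
    also have "(NN t. (ind {p<..q} t)\<^sup>2) = (NN t. ind {p<..q} t)"
      by (intro nn_integral_cong) (simp add: indicator_def)
    also have "\<dots> = ennreal (q - p)" using pq by simp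
    also have "(NN t. (ind {p<..q} t * ennreal (cmod (gr t)))\<^sup>2) = ?E"
      by (intro nn_integral_cong) (simp add: indicator_def ennreal_power)
    finally show ?thesis .
  qed
  have "AE x in lborel. x \<in> {p..q} \<longrightarrow> ennreal (cmod (U x)) \<le> (NN t. ind {p..q} t * ennreal (cmod (gr t)))"
    by (rule ae_primitive_bound[OF U pq mean]) auto
  then have "AE x in lborel. ind {p<..q} x * (w x * esq (U x)) \<le> (ind {p<..q} x * w x) * (ennreal (q - p) * ?E)"
  proof eventually_elim
    case (elim x)
    show ?case
    proof (cases "x \<in> {p<..q}")
      case True
      then have "(ennreal (cmod (U x)))\<^sup>2 \<le> (NN t. ind {p..q} t * ennreal (cmod (gr t)))\<^sup>2"
        using elim by (intro power_mono) auto
      then have "esq (U x) \<le> ennreal (q - p) * ?E"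
        using CS by (simp add: ennreal_power)
      then show ?thesis using True by (simp add: mult_left_mono)
    qed simp
  qed
  then have "(NN x. ind {p<..q} x * (w x * esq (U x))) \<le> (NN x. (ind {p<..q} x * w x) * (ennreal (q - p) * ?E))"
    by (rule nn_integral_mono_AE)
  also have "\<dots> = (NN x. ind {p<..q} x * w x) * (ennreal (q - p) * ?E)"
    by (rule nn_integral_multc) (use w in simp)
  finally show ?thesis .
qed

text \<open>The sum of normalised mass and normalised length is continuous, strictly increasing and
  at most 2 in total. Cutting it into \<open>M\<close> equal increments bounds both quantities at
  once.\<close>

lemma interval_equipartition:
  fixes w :: "real \<Rightarrow> real"
  assumes pq: "p < q" and w: "w \<in> BM" "\<And>x. 0 \<le> w x"
    and \<omega>: "0 < \<omega>" "(NN x. ind {p<..q} x * ennreal (w x)) \<le> ennreal \<omega>"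
    and M: "0 < (M::nat)"
  obtains x :: "nat \<Rightarrow> real" where "x 0 = p" "x M = q" "\<And>j. j < M \<Longrightarrow> x j < x (Suc j)" 
    "\<And>j. j < M \<Longrightarrow> x (Suc j) - x j \<le> 2 * (q - p) / M"
    "\<And>j. j < M \<Longrightarrow> (NN t. ind {x j<..x (Suc j)} t * ennreal (w t)) \<le> ennreal (2 * \<omega> / M)"
proof -
  define f where "f t = ind {p<..q} t * w t" for t
  have fm: "f \<in> BM" unfolding f_def using w by simp
  have f0: "0 \<le> f t" for t using w by (simp add: f_def)
  have fnn: "(NN t. ennreal (f t)) \<le> ennreal \<omega>"
  proof -
    have "ennreal (f t) = ind {p<..q} t * ennreal (w t)" for t by (simp add: f_def indicator_def)
    then show ?thesis using \<omega>(2) by simp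
  qed
  have fi: "integrable lborel f"
    by (rule integrableI_bounded) (use fm f0 fnn in \<open>auto intro: order.strict_trans1\<close>)
  define c where "c x = (sint {p<..x} f) / \<omega> + (x - p) / (q - p)" for x
  have si: "integrable lborel (\<lambda>t. ind A t *\<^sub>R f t)" if "A \<in> sets borel" for A
    by (rule Bochner_Integration.integrable_bound[OF fi]) (use fm that in \<open>auto simp: indicator_def\<close>)
  have inc: "c y - c x = (sint {x<..y} f) / \<omega> + (y - x) / (q - p)" if "p \<le> x" "x \<le> y" for x y
  proof -
    have "(sint {p<..y} f) = (LINT t|lborel. ind {p<..x} t *\<^sub>R f t + ind {x<..y} t *\<^sub>R f t)"
      by (intro Bochner_Integration.integral_cong) (use that in \<open>auto simp: indicator_def\<close>)
    also have "\<dots> = (sint {p<..x} f) + (sint {x<..y} f)"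
      by (intro Bochner_Integration.integral_add si) auto
    finally show ?thesis unfolding c_def by (simp add: add_divide_distrib diff_divide_distrib)
  qed
  have nn: "0 \<le> (sint A f)" for A
    by (rule Bochner_Integration.integral_nonneg) (use f0 in simp)
  have strict: "c x < c y" if "p \<le> x" "x < y" for x y
  proof -
    have "0 < (y - x) / (q - p)" using that pq by simp
    moreover have "0 \<le> (sint {x<..y} f) / \<omega>" using nn \<omega>(1) by simp
    ultimately show ?thesis using inc[of x y] that by simp
  qed
  have cp: "c p = 0" by (simp add: c_def)
  have cq: "c q \<le> 2"
  proof -
    have "(sint {p<..q} f) \<le> (LINT t|lborel. f t)"
      by (intro integral_mono si fi) (use f0 in \<open>auto simp: indicator_def\<close>)
    also have "ennreal (LINT t|lborel. f t) \<le> ennreal \<omega>"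
      using fnn by (subst nn_integral_eq_integral[symmetric, OF fi]) (use f0 in auto)
    then have "(LINT t|lborel. f t) \<le> \<omega>" using \<omega>(1) by simp
    finally show ?thesis using \<omega>(1) pq by (simp add: c_def field_simps)
  qed
  have contc: "continuous_on {p..q} c"
  proof -
    have ii: "f integrable_on {p..q}"
      using integrable_on_lborel[OF fi] integrable_on_subinterval[of f UNIV p q] by auto
    have "(sint {p<..x} f) = integral {p..x} f" if "x \<in> {p..q}" for x
    proof -
      have s: "set_integrable lborel {p..x} f" unfolding set_integrable_def by (rule si) simp
      have "(sint {p<..x} f) = (sint {p..x} f)"
      proof (rule integral_cong_AE)
        show "AE t in lborel. ind {p<..x} t *\<^sub>R f t = ind {p..x} t *\<^sub>R f t"
          using AE_lborel_singleton[of p] by eventually_elim (auto simp: indicator_def)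
      qed (use fm in simp_all)
      also have "\<dots> = integral {p..x} f" using set_borel_integral_eq_integral(2)[OF s] by (simp add: set_lebesgue_integral_def)
      finally show ?thesis .
    qed
    then have "\<And>x. x \<in> {p..q} \<Longrightarrow> integral {p..x} f / \<omega> + (x - p) / (q - p) = c x" by (simp add: c_def)
    moreover have "continuous_on {p..q} (\<lambda>x. integral {p..x} f / \<omega> + (x - p) / (q - p))"
      using pq \<omega>(1) by (intro continuous_intros indefinite_integral_continuous_1 ii) auto
    ultimately show ?thesis by (blast intro: continuous_on_eq)
  qed
  have "\<exists>x. p \<le> x \<and> x \<le> q \<and> c x = c q * j / M" if "j \<le> M" for j :: nat
  proof (rule IVT'[of c p])
    have cq0: "0 \<le> c q" using strict[of p q] pq cp by simp
    show "c p \<le> c q * real j / real M" unfolding cp using cq0 by simp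
    show "c q * real j / real M \<le> c q" using that M cq0 by (simp add: divide_le_eq mult_left_mono)
  qed (use pq contc in auto)
  then obtain x where x: "\<And>j. j \<le> M \<Longrightarrow> p \<le> x j \<and> x j \<le> q \<and> c (x j) = c q * j / M" by metis
  have inj: "x1 = x2" if "c x1 = c x2" "p \<le> x1" "p \<le> x2" for x1 x2
    using strict[of x1 x2] strict[of x2 x1] that by (cases x1 x2 rule: linorder_cases) auto
  have cq0: "0 < c q" using strict[of p q] pq cp by simp
  have step: "c (x (Suc j)) - c (x j) \<le> 2 / M" "x j < x (Suc j)" if "j < M" for j
  proof -
    have "c (x (Suc j)) - c (x j) = c q / M" using x[of j] x[of "Suc j"] that by (simp add: field_simps)
    then show "c (x (Suc j)) - c (x j) \<le> 2 / M" using cq by (simp add: divide_right_mono)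
    have "0 < c q / M" using cq0 M by simp
    then have "c (x j) < c (x (Suc j))" using \<open>c (x (Suc j)) - c (x j) = c q / M\<close> by linarith
    then show "x j < x (Suc j)" using strict[of "x (Suc j)" "x j"] x[of j] x[of "Suc j"] that
      by (cases "x j" "x (Suc j)" rule: linorder_cases) auto
  qed
  show ?thesis
  proof (rule that[of x])
    show "x 0 = p" by (rule inj) (use x[of 0] cp in auto)
    show "x M = q" by (rule inj) (use x[of M] M pq in auto)
    fix j assume j: "j < M"
    show "x j < x (Suc j)" by (rule step(2)[OF j])
    have d: "(sint {x j<..x (Suc j)} f) / \<omega> + (x (Suc j) - x j) / (q - p) \<le> 2 / M"
      using step[OF j] inc[of "x j" "x (Suc j)"] x[of j] j by simp
    have n0: "0 \<le> (sint {x j<..x (Suc j)} f) / \<omega>" using nn \<omega>(1) by simp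
    have n1: "0 \<le> (x (Suc j) - x j) / (q - p)" using step(2)[OF j] pq by simp
    have "(x (Suc j) - x j) / (q - p) \<le> 2 / M" using d n0 by linarith
    then show "x (Suc j) - x j \<le> 2 * (q - p) / M" using pq by (simp add: pos_divide_le_eq)
    have "(sint {x j<..x (Suc j)} f) / \<omega> \<le> 2 / M" using d n1 by linarith
    then have le: "(sint {x j<..x (Suc j)} f) \<le> 2 * \<omega> / M" using \<omega>(1) by (simp add: pos_divide_le_eq)
    have "(NN t. ind {x j<..x (Suc j)} t * ennreal (w t)) = (NN t. ennreal (ind {x j<..x (Suc j)} t *\<^sub>R f t))"
      using x[of j] x[of "Suc j"] j by (intro nn_integral_cong) (auto simp: f_def indicator_def)
    also have "\<dots> = ennreal (sint {x j<..x (Suc j)} f)"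
      by (rule nn_integral_eq_integral[OF si]) (use f0 in auto)
    also have "\<dots> \<le> ennreal (2 * \<omega> / M)" by (rule ennreal_leI[OF le])
    finally show "(NN t. ind {x j<..x (Suc j)} t * ennreal (w t)) \<le> ennreal (2 * \<omega> / M)" .
  qed
qed

text \<open>Each piece contributes mass \<open>2 * \<omega> / M\<close> times length
  \<open>2 * (q - p) / M\<close>. The quadratic gain in \<open>M\<close> is the origin of the square
  root of \<open>G\<close> in the count.\<close>

lemma interval_functionals:
  fixes w :: "real \<Rightarrow> real"
  assumes pq: "p < q" and w: "w \<in> BM" "\<And>x. 0 \<le> w x"
    and \<omega>: "0 < \<omega>" "(NN x. ind {p<..q} x * ennreal (w x)) \<le> ennreal \<omega>"
    and M: "0 < (M::nat)"
  obtains S :: "(plane) set" where "finite S" "card S \<le> M"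
    "\<And>U gr. ae_primitive U gr \<Longrightarrow> (\<And>c d. (c, d) \<in> S \<Longrightarrow> (sint {c..d} U) = 0) \<Longrightarrow>
      (NN x. ind {p<..q} x * (ennreal (w x) * esq (U x))) \<le>
      ennreal (4 * (q - p) * \<omega> / M\<^sup>2) * (NN x. ind {p<..q} x * esq (gr x))"
proof -
  obtain x :: "nat \<Rightarrow> real" where x: "x 0 = p" "x M = q" "\<And>j. j < M \<Longrightarrow> x j < x (Suc j)" 
    "\<And>j. j < M \<Longrightarrow> x (Suc j) - x j \<le> 2 * (q - p) / M"
    "\<And>j. j < M \<Longrightarrow> (NN t. ind {x j<..x (Suc j)} t * ennreal (w t)) \<le> ennreal (2 * \<omega> / M)"
    by (rule interval_equipartition[OF pq w \<omega> M]) (rule that)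
  define S where "S = (\<lambda>j. (x j, x (Suc j))) ` {..<M}"
  show ?thesis
  proof (rule that[of S])
    show "finite S" by (simp add: S_def)
    show "card S \<le> M" unfolding S_def by (rule order_trans[OF card_image_le]) auto
    fix U gr assume U: "ae_primitive U gr"
      and mean: "\<And>c d. (c, d) \<in> S \<Longrightarrow> (sint {c..d} U) = 0"
    have Um: "U \<in> BM" "gr \<in> BM" using U by (auto simp: ae_primitive_def)
    define K where "K = 4 * (q - p) * \<omega> / M\<^sup>2"
    have xp: "p \<le> x j" if "j \<le> M" for j
      using that
    proof (induction j)
      case (Suc j) then show ?case using x(3)[of j] by simp
    qed (simp add: x(1))
    have "(NN t. ind {p<..x j} t * (ennreal (w t) * esq (U t))) \<le>
        ennreal K * (NN t. ind {p<..x j} t * esq (gr t))" if "j \<le> M" for j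
      using that
    proof (induction j)
      case 0 then show ?case by (simp add: x(1))
    next
      case (Suc j)
      then have j: "j < M" by simp
      have split: "(NN t. ind {p<..x (Suc j)} t * f t) =
          (NN t. ind {p<..x j} t * f t) + (NN t. ind {x j<..x (Suc j)} t * f t)"
        if "f \<in> BM" for f :: "real \<Rightarrow> ennreal"
      proof -
        have "(NN t. ind {p<..x (Suc j)} t * f t) = (NN t. ind {p<..x j} t * f t + ind {x j<..x (Suc j)} t * f t)"
          using x(3)[OF j] xp[of j] j by (intro nn_integral_cong) (auto simp: indicator_def)
        then show ?thesis using that by (simp add: nn_integral_add)
      qed
      have "(NN t. ind {x j<..x (Suc j)} t * (ennreal (w t) * esq (U t))) \<le>
          (NN t. ind {x j<..x (Suc j)} t * ennreal (w t)) * (ennreal (x (Suc j) - x j) * (NN t. ind {x j<..x (Suc j)} t * esq (gr t)))"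
        by (rule mean_zero_interval[OF U x(3)[OF j] mean]) (use j w in \<open>auto simp: S_def\<close>)
      also have "\<dots> \<le> ennreal (2 * \<omega> / M) * (ennreal (2 * (q - p) / M) * (NN t. ind {x j<..x (Suc j)} t * esq (gr t)))"
        by (intro mult_mono mult_right_mono x(5)[OF j] ennreal_leI x(4)[OF j]) auto
      also have "\<dots> = ennreal K * (NN t. ind {x j<..x (Suc j)} t * esq (gr t))"
      proof -
        have "ennreal (2 * \<omega> / M) * ennreal (2 * (q - p) / M) = ennreal ((2 * \<omega> / M) * (2 * (q - p) / M))"
          using \<omega>(1) by (intro ennreal_mult'[symmetric]) simp
        also have "(2 * \<omega> / M) * (2 * (q - p) / M) = K" by (simp add: K_def power2_eq_square)
        finally show ?thesis by (simp only: mult.assoc[symmetric])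
      qed
      finally have st: "(NN t. ind {x j<..x (Suc j)} t * (ennreal (w t) * esq (U t))) \<le> \<dots>" .
      show ?case
        using add_mono[OF Suc.IH[OF less_imp_le[OF j]] st] Um w(1) by (subst (1 2) split) (auto simp: distrib_left)
    qed
    from this[of M] show "(NN x. ind {p<..q} x * (ennreal (w x) * esq (U x))) \<le>
      ennreal (4 * (q - p) * \<omega> / M\<^sup>2) * (NN x. ind {p<..q} x * esq (gr x))"
      by (simp add: x(2) K_def)
  qed
qed

section \<open>A weighted Hardy inequality across the dyadic intervals of small mass\<close>

lemma dyadic_sqrt_sum_le:
  fixes t :: real
  shows "(\<Sum>k. ennreal (if \<bar>t\<bar> \<le> 2 ^ Suc k then sqrt (min 1 (\<bar>t\<bar> / 2 ^ k)) else 0)) \<le> ennreal 8"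
proof -
  let ?b = "\<lambda>k. if \<bar>t\<bar> \<le> 2 ^ Suc k then sqrt (min 1 (\<bar>t\<bar> / 2 ^ k)) else 0"
  obtain K where K: "\<bar>t\<bar> < 2 ^ K" using real_arch_pow[of 2 "\<bar>t\<bar>"] by auto
  then have K': "\<bar>t\<bar> \<le> 2 ^ Suc K" by simp
  define k0 where "k0 = (LEAST k. \<bar>t\<bar> \<le> (2::real) ^ Suc k)"
  have k0: "\<bar>t\<bar> \<le> 2 ^ Suc k0" unfolding k0_def by (rule LeastI[of "\<lambda>k. \<bar>t\<bar> \<le> (2::real) ^ Suc k", OF K'])
  \<comment> \<open>From \<open>k0\<close> on the terms decay like powers of
    \<open>sqrt (1/2)\<close>; the rational base 3/4, whose square exceeds 1/2, majorises them and
    gives the sum 8.\<close>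
  define f where "f k = (if k < k0 then 0 else 2 * (3 / 4) ^ (k - k0) :: real)" for k
  have b0: "0 \<le> ?b k" for k by simp
  have le: "?b k \<le> f k" for k
  proof (cases "k < k0")
    case True
    then have "\<not> \<bar>t\<bar> \<le> 2 ^ Suc k" unfolding k0_def using not_less_Least by blast
    then show ?thesis using True by (simp add: f_def)
  next
    case False
    define j where "j = k - k0"
    have k: "k = k0 + j" using False by (simp add: j_def)
    have "\<bar>t\<bar> / 2 ^ k \<le> 2 ^ Suc k0 / 2 ^ k" using k0 by (intro divide_right_mono) auto
    also have "\<dots> = 2 * (1 / 2) ^ j" by (simp add: k power_add power_divide)
    also have "\<dots> \<le> 4 * (9 / 16) ^ j"
      by (intro mult_mono power_mono) auto
    also have "\<dots> = (2 * (3 / 4) ^ j)\<^sup>2"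
    proof -
      have "(9 / 16 :: real) ^ j = (3 / 4) ^ j * (3 / 4) ^ j" by (simp flip: power_mult_distrib)
      then show ?thesis by (simp add: power2_eq_square)
    qed
    finally have "min 1 (\<bar>t\<bar> / 2 ^ k) \<le> (2 * (3 / 4) ^ j)\<^sup>2" by simp
    then have "sqrt (min 1 (\<bar>t\<bar> / 2 ^ k)) \<le> 2 * (3 / 4) ^ j" by (intro real_le_lsqrt) auto
    then show ?thesis using False by (simp add: f_def j_def)
  qed
  have fs: "f sums 8"
  proof -
    have "(\<lambda>j. 2 * (3 / 4 :: real) ^ j) sums (2 * (1 / (1 - 3 / 4)))"
      by (intro sums_mult geometric_sums) simp
    then have "(\<lambda>i. f (i + k0)) sums 8" by (simp add: f_def)
    then show ?thesis by (subst (asm) sums_zero_iff_shift) (auto simp: f_def)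
  qed
  have "(\<Sum>k. ennreal (?b k)) \<le> (\<Sum>k. ennreal (f k))"
    by (intro suminf_le ennreal_leI le) auto
  also have "\<dots> = ennreal (suminf f)"
  proof (rule suminf_ennreal2)
    show "0 \<le> f k" for k by (simp add: f_def)
  qed (rule sums_summable[OF fs])
  also have "suminf f = 8" using fs by (simp add: sums_iff)
  finally show ?thesis .
qed

text \<open>In the Hardy inequality this becomes the factor of the energy density at
  \<open>t\<close>. On the annulus with index \<open>k\<close> the kernel
  \<open>sqrt \<bar>t\<bar> * sqrt \<bar>x\<bar>\<close> is at most
  \<open>sqrt (min 1 (\<bar>t\<bar> / 2^k)) * \<bar>x\<bar>\<close>, so the contributions sum up
  geometrically to \<open>c + 8 * (2 * c) = 17 * c\<close>.\<close>

lemma good_part_kernel: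
  fixes w :: "real \<Rightarrow> ennreal" and c t :: real
  assumes w [measurable]: "w \<in> BM" and c: "0 \<le> c"
    and w0: "(NN x. ind {-1..1} x * w x) \<le> ennreal c"
    and wk: "\<And>k::nat. (NN x. ind {x. 2 ^ k < \<bar>x\<bar> \<and> \<bar>x\<bar> \<le> 2 ^ Suc k} x * (w x * ennreal \<bar>x\<bar>)) \<le> ennreal (2 * c)"
  shows "ennreal (sqrt \<bar>t\<bar>) * (NN x. ind {x. \<bar>t\<bar> \<le> max 1 \<bar>x\<bar>} x * (w x * ennreal (sqrt (max 1 \<bar>x\<bar>)))) \<le> ennreal (17 * c)"
proof -
  let ?A = "\<lambda>k::nat. {x::real. 2 ^ k < \<bar>x\<bar> \<and> \<bar>x\<bar> \<le> 2 ^ Suc k}"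
  let ?b = "\<lambda>k. if \<bar>t\<bar> \<le> 2 ^ Suc k then sqrt (min 1 (\<bar>t\<bar> / 2 ^ k)) else 0"
  have Ab: "?A k \<in> sets borel" for k by measurable
  have tb: "{x::real. \<bar>t\<bar> \<le> max 1 \<bar>x\<bar>} \<in> sets borel" by measurable
  have "ennreal (sqrt \<bar>t\<bar>) * (NN x. ind {x. \<bar>t\<bar> \<le> max 1 \<bar>x\<bar>} x * (w x * ennreal (sqrt (max 1 \<bar>x\<bar>)))) =
      (NN x. ennreal (sqrt \<bar>t\<bar>) * (ind {x. \<bar>t\<bar> \<le> max 1 \<bar>x\<bar>} x * (w x * ennreal (sqrt (max 1 \<bar>x\<bar>)))))"
    by (rule nn_integral_cmult[symmetric]) (use tb in simp)
  also have "\<dots> \<le> (NN x. ind {-1..1} x * w x + (\<Sum>k. ennreal (?b k) * (ind (?A k) x * (w x * ennreal \<bar>x\<bar>))))"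
  proof (rule nn_integral_mono)
    fix x
    show "ennreal (sqrt \<bar>t\<bar>) * (ind {x. \<bar>t\<bar> \<le> max 1 \<bar>x\<bar>} x * (w x * ennreal (sqrt (max 1 \<bar>x\<bar>)))) \<le>
      ind {-1..1} x * w x + (\<Sum>k. ennreal (?b k) * (ind (?A k) x * (w x * ennreal \<bar>x\<bar>)))"
    proof (cases "\<bar>t\<bar> \<le> max 1 \<bar>x\<bar>")
      case t: True
      show ?thesis
      proof (cases "\<bar>x\<bar> \<le> 1")
        case True
        then have "\<bar>t\<bar> \<le> 1" using t by simp
        then have "ennreal (sqrt \<bar>t\<bar>) \<le> 1" by (simp add: ennreal_le_1)
        then have "ennreal (sqrt \<bar>t\<bar>) * w x \<le> 1 * w x" by (rule mult_right_mono) simp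
        moreover have "x \<in> {-1..1}" using True by auto
        ultimately show ?thesis using True t by (simp add: max_def add_increasing2)
      next
        case False
        define k where "k = (LEAST k. \<bar>x\<bar> \<le> (2::real) ^ Suc k)"
        obtain K where "\<bar>x\<bar> < 2 ^ K" using real_arch_pow[of 2 "\<bar>x\<bar>"] by auto
        then have "\<bar>x\<bar> \<le> 2 ^ Suc K" by simp
        then have k1: "\<bar>x\<bar> \<le> 2 ^ Suc k" unfolding k_def by (rule LeastI)
        have k2: "2 ^ k < \<bar>x\<bar>"
        proof (cases k)
          case 0 then show ?thesis using False by simp
        next
          case (Suc l)
          then have "\<not> \<bar>x\<bar> \<le> 2 ^ Suc l" using not_less_Least[of l "\<lambda>k. \<bar>x\<bar> \<le> (2::real) ^ Suc k"] by (simp add: k_def)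
          then show ?thesis using Suc by simp
        qed
        have xA: "x \<in> ?A k" using k1 k2 by simp
        have tx: "\<bar>t\<bar> \<le> \<bar>x\<bar>" using t False by (simp add: max_def split: if_splits)
        have mx: "max 1 \<bar>x\<bar> = \<bar>x\<bar>" using False by simp
        have bk: "sqrt \<bar>t\<bar> * sqrt \<bar>x\<bar> \<le> ?b k * \<bar>x\<bar>"
        proof -
          have "\<bar>t\<bar> * \<bar>x\<bar> \<le> min 1 (\<bar>t\<bar> / 2 ^ k) * \<bar>x\<bar> * \<bar>x\<bar>"
          proof (cases "1 \<le> \<bar>t\<bar> / 2 ^ k")
            case True
            then show ?thesis using mult_right_mono[OF tx, of "\<bar>x\<bar>"] by (simp add: min_def)
          next
            case False
            have "2 ^ k * (\<bar>t\<bar> * \<bar>x\<bar>) \<le> \<bar>x\<bar> * (\<bar>t\<bar> * \<bar>x\<bar>)" using k2 by (intro mult_right_mono) auto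
            then have "\<bar>t\<bar> * \<bar>x\<bar> \<le> \<bar>t\<bar> / 2 ^ k * \<bar>x\<bar> * \<bar>x\<bar>" by (simp add: field_simps)
            then show ?thesis using False by (simp add: min_def)
          qed
          then have "sqrt (\<bar>t\<bar> * \<bar>x\<bar>) \<le> sqrt (min 1 (\<bar>t\<bar> / 2 ^ k) * (\<bar>x\<bar> * \<bar>x\<bar>))" by (simp add: mult.assoc)
          also have "\<dots> = sqrt (min 1 (\<bar>t\<bar> / 2 ^ k)) * \<bar>x\<bar>" by (simp add: real_sqrt_mult)
          finally show ?thesis using tx k1 by (simp add: real_sqrt_mult)
        qed
        have "ennreal (sqrt \<bar>t\<bar>) * (ind {x. \<bar>t\<bar> \<le> max 1 \<bar>x\<bar>} x * (w x * ennreal (sqrt (max 1 \<bar>x\<bar>)))) = w x * ennreal (sqrt \<bar>t\<bar> * sqrt \<bar>x\<bar>)"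
          using t mx by (simp add: ennreal_mult' mult_ac)
        also have "\<dots> \<le> w x * ennreal (?b k * \<bar>x\<bar>)" by (intro mult_left_mono ennreal_leI bk) simp
        also have "\<dots> = ennreal (?b k) * (ind (?A k) x * (w x * ennreal \<bar>x\<bar>))"
        proof -
          have "ennreal (?b k * \<bar>x\<bar>) = ennreal (?b k) * ennreal \<bar>x\<bar>" by (intro ennreal_mult) auto
          moreover have "ind (?A k) x = (1 :: ennreal)" using xA by (simp only: indicator_simps)
          ultimately show ?thesis by (simp only: mult_ac mult_1_left mult_1_right)
        qed
        also have "\<dots> \<le> (\<Sum>k. ennreal (?b k) * (ind (?A k) x * (w x * ennreal \<bar>x\<bar>)))"
          using sum_le_suminf[of "\<lambda>k. ennreal (?b k) * (ind (?A k) x * (w x * ennreal \<bar>x\<bar>))" "{k}"] by simp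
        finally show ?thesis by (rule add_increasing[rotated]) simp
      qed
    qed simp
  qed
  also have "\<dots> = (NN x. ind {-1..1} x * w x) + (\<Sum>k. NN x. ennreal (?b k) * (ind (?A k) x * (w x * ennreal \<bar>x\<bar>)))"
    using Ab by (subst nn_integral_add) (auto simp: nn_integral_suminf)
  also have "\<dots> \<le> ennreal c + (\<Sum>k. ennreal (?b k) * ennreal (2 * c))"
  proof (intro add_mono w0 suminf_le)
    fix k
    have "(NN x. ennreal (?b k) * (ind (?A k) x * (w x * ennreal \<bar>x\<bar>))) = ennreal (?b k) * (NN x. ind (?A k) x * (w x * ennreal \<bar>x\<bar>))"
      by (rule nn_integral_cmult) (use Ab in simp)
    also have "\<dots> \<le> ennreal (?b k) * ennreal (2 * c)" by (intro mult_left_mono wk) simp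
    finally show "(NN x. ennreal (?b k) * (ind (?A k) x * (w x * ennreal \<bar>x\<bar>))) \<le> ennreal (?b k) * ennreal (2 * c)" .
  qed auto
  also have "(\<Sum>k. ennreal (?b k) * ennreal (2 * c)) = (\<Sum>k. ennreal (?b k)) * ennreal (2 * c)"
    by (rule ennreal_suminf_multc)
  also have "ennreal c + (\<Sum>k. ennreal (?b k)) * ennreal (2 * c) \<le> ennreal c + ennreal 8 * ennreal (2 * c)"
    by (intro add_left_mono mult_right_mono dyadic_sqrt_sum_le) simp
  also have "ennreal 8 * ennreal (2 * c) = ennreal (16 * c)"
    by (subst ennreal_mult'[symmetric]) auto
  also have "ennreal c + ennreal (16 * c) = ennreal (17 * c)" using c by (subst ennreal_plus[symmetric]) auto
  finally show ?thesis .
qed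

text \<open>A Schur-type proof of Hardy's inequality: Cauchy-Schwarz with the weight
  \<open>sqrt \<bar>t\<bar>\<close> costs the factor \<open>4 * sqrt (\<rho> x)\<close>, and
  exchanging the integrals reduces the rest to \<open>good_part_kernel\<close>; hence
  \<open>68 = 4 * 17\<close>.\<close>

lemma good_part:
  fixes w :: "real \<Rightarrow> ennreal" and c :: real
  assumes U: "ae_primitive U gr" and mean: "(sint {-1..1} U) = 0"
    and w [measurable]: "w \<in> BM" and c: "0 \<le> c"
    and w0: "(NN x. ind {-1..1} x * w x) \<le> ennreal c"
    and wk: "\<And>k::nat. (NN x. ind {x. 2 ^ k < \<bar>x\<bar> \<and> \<bar>x\<bar> \<le> 2 ^ Suc k} x * (w x * ennreal \<bar>x\<bar>)) \<le> ennreal (2 * c)"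
  shows "(NN x. w x * esq (U x)) \<le> ennreal (68 * c) * (NN x. esq (gr x))"
proof -
  have gm [measurable]: "gr \<in> BM" using U by (auto simp: ae_primitive_def)
  \<comment> \<open>The interval from \<open>- \<rho> x\<close> to \<open>\<rho> x\<close> contains
    both \<open>x\<close> and \<open>[-1, 1]\<close>, where the mean vanishes.\<close>
  define \<rho> where "\<rho> x = max 1 \<bar>x\<bar>" for x :: real
  have \<rho>: "1 \<le> \<rho> x" for x by (simp add: \<rho>_def)
  define S where "S = {v::plane. \<bar>snd v\<bar> \<le> max 1 \<bar>fst v\<bar>}"
  have Sc: "closed S" unfolding S_def by (intro closed_Collect_le continuous_intros)
  define H where "H x = (NN t. ind {-\<rho> x..\<rho> x} t * ennreal (nsq (gr t) * sqrt \<bar>t\<bar>))" for x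
  have CS: "(NN t. ind {-\<rho> x..\<rho> x} t * ennreal (cmod (gr t)))\<^sup>2 \<le> H x * ennreal (4 * sqrt (\<rho> x))" for x
  proof -
    let ?i = "ind {-\<rho> x..\<rho> x} :: real \<Rightarrow> ennreal"
    have "(NN t. ?i t * ennreal (cmod (gr t))) =
      (NN t. (?i t * ennreal (cmod (gr t) * sqrt (sqrt \<bar>t\<bar>))) * (?i t * ennreal (1 / sqrt (sqrt \<bar>t\<bar>))))"
    proof (rule nn_integral_cong_AE)
      show "AE t in lborel. ?i t * ennreal (cmod (gr t)) = (?i t * ennreal (cmod (gr t) * sqrt (sqrt \<bar>t\<bar>))) * (?i t * ennreal (1 / sqrt (sqrt \<bar>t\<bar>)))"
        using AE_lborel_singleton[of 0]
      proof eventually_elim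
        case (elim t)
        have "ennreal (cmod (gr t) * sqrt (sqrt \<bar>t\<bar>)) * ennreal (1 / sqrt (sqrt \<bar>t\<bar>)) = ennreal (cmod (gr t) * sqrt (sqrt \<bar>t\<bar>) * (1 / sqrt (sqrt \<bar>t\<bar>)))"
          by (intro ennreal_mult'[symmetric]) simp
        also have "cmod (gr t) * sqrt (sqrt \<bar>t\<bar>) * (1 / sqrt (sqrt \<bar>t\<bar>)) = cmod (gr t)" using elim by simp
        finally show ?case by (cases "t \<in> {-\<rho> x..\<rho> x}") simp_all
      qed
    qed
    then have "(NN t. ?i t * ennreal (cmod (gr t)))\<^sup>2 \<le>
      (NN t. (?i t * ennreal (cmod (gr t) * sqrt (sqrt \<bar>t\<bar>)))\<^sup>2) * (NN t. (?i t * ennreal (1 / sqrt (sqrt \<bar>t\<bar>)))\<^sup>2)"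
      by (simp only:) (rule Cauchy_Schwarz_nn_integral; measurable)
    also have "(NN t. (?i t * ennreal (cmod (gr t) * sqrt (sqrt \<bar>t\<bar>)))\<^sup>2) = H x"
      unfolding H_def by (intro nn_integral_cong) (simp add: indicator_def ennreal_power power_mult_distrib)
    also have "(NN t. (?i t * ennreal (1 / sqrt (sqrt \<bar>t\<bar>)))\<^sup>2) = (NN t. ennreal (1 / sqrt \<bar>t - 0\<bar>) * ind {0 - \<rho> x..0 + \<rho> x} t)"
      by (intro nn_integral_cong) (simp add: indicator_def ennreal_power power_divide)
    also have "\<dots> = ennreal (4 * sqrt (\<rho> x))" by (rule nn_integral_inverse_sqrt) (use \<rho>[of x] in simp)
    finally show ?thesis .
  qed
  have "AE x in lborel. x \<in> UNIV \<longrightarrow> ennreal (cmod (U x)) \<le> (NN t. ind {- \<rho> x..\<rho> x} t * ennreal (cmod (gr t)))"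
    by (rule ae_primitive_bound[OF U _ mean]) (auto simp: \<rho>_def)
  then have "AE x in lborel. w x * esq (U x) \<le> w x * (H x * ennreal (4 * sqrt (\<rho> x)))"
  proof eventually_elim
    case (elim x)
    then have "(ennreal (cmod (U x)))\<^sup>2 \<le> (NN t. ind {- \<rho> x..\<rho> x} t * ennreal (cmod (gr t)))\<^sup>2"
      by (intro power_mono) auto
    also note CS
    finally show ?case by (intro mult_left_mono) (simp_all add: ennreal_power)
  qed
  then have "(NN x. w x * esq (U x)) \<le> (NN x. w x * (H x * ennreal (4 * sqrt (\<rho> x))))"
    by (rule nn_integral_mono_AE)
  also have "\<dots> = (NN x. NN t. ind S (x, t) * ((w x * ennreal (4 * sqrt (\<rho> x))) * ennreal (nsq (gr t) * sqrt \<bar>t\<bar>)))"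
  proof (rule nn_integral_cong)
    fix x
    have "t \<in> {-\<rho> x..\<rho> x} \<longleftrightarrow> (x, t) \<in> S" for t by (auto simp: S_def \<rho>_def)
    then have ie: "ind S (x, t) = (ind {-\<rho> x..\<rho> x} t :: ennreal)" for t by (simp add: indicator_def)
    have "(NN t. ind S (x, t) * ((w x * ennreal (4 * sqrt (\<rho> x))) * ennreal (nsq (gr t) * sqrt \<bar>t\<bar>))) =
      (NN t. (w x * ennreal (4 * sqrt (\<rho> x))) * (ind {-\<rho> x..\<rho> x} t * ennreal (nsq (gr t) * sqrt \<bar>t\<bar>)))"
      unfolding ie by (intro nn_integral_cong) (simp only: mult_ac)
    also have "\<dots> = (w x * ennreal (4 * sqrt (\<rho> x))) * H x"
      unfolding H_def by (rule nn_integral_cmult) measurable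
    finally show "w x * (H x * ennreal (4 * sqrt (\<rho> x))) =
      (NN t. ind S (x, t) * ((w x * ennreal (4 * sqrt (\<rho> x))) * ennreal (nsq (gr t) * sqrt \<bar>t\<bar>)))"
      by (simp only: mult_ac)
  qed
  also have "\<dots> = (NN t. NN x. ind S (x, t) * ((w x * ennreal (4 * sqrt (\<rho> x))) * ennreal (nsq (gr t) * sqrt \<bar>t\<bar>)))"
  proof (rule lborel_pair.Fubini'[symmetric])
    have r: "(\<lambda>x. w x * ennreal (4 * sqrt (\<rho> x))) \<in> BM" unfolding \<rho>_def by measurable
    have g: "(\<lambda>t. ennreal (nsq (gr t) * sqrt \<bar>t\<bar>)) \<in> BM" by measurable
    have "(\<lambda>v. ind S v * ((w (fst v) * ennreal (4 * sqrt (\<rho> (fst v)))) * ennreal (nsq (gr (snd v)) * sqrt \<bar>snd v\<bar>))) \<in> BM"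
      by (intro borel_measurable_times_ennreal borel_measurable_indicator borel_closed Sc measurable_compose[OF fst_borel_measurable r]
        measurable_compose[OF snd_borel_measurable g])
    then show "(\<lambda>(x, t). ind S (x, t) * ((w x * ennreal (4 * sqrt (\<rho> x))) * ennreal (nsq (gr t) * sqrt \<bar>t\<bar>))) \<in> borel_measurable (lborel \<Otimes>\<^sub>M lborel)"
      by (simp only: lborel_prod measurable_lborel2 split_beta' prod.collapse)
  qed
  also have "\<dots> \<le> (NN t. ennreal (68 * c) * esq (gr t))"
  proof (rule nn_integral_mono)
    fix t
    have tb: "{x::real. \<bar>t\<bar> \<le> max 1 \<bar>x\<bar>} \<in> sets borel" by measurable
    have e: "ind S (x, t) = (ind {x. \<bar>t\<bar> \<le> max 1 \<bar>x\<bar>} x :: ennreal)" for x by (simp add: S_def indicator_def)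
    have "(NN x. ind S (x, t) * ((w x * ennreal (4 * sqrt (\<rho> x))) * ennreal (nsq (gr t) * sqrt \<bar>t\<bar>))) =
      (NN x. (4 * esq (gr t) * ennreal (sqrt \<bar>t\<bar>)) * (ind {x. \<bar>t\<bar> \<le> max 1 \<bar>x\<bar>} x * (w x * ennreal (sqrt (max 1 \<bar>x\<bar>)))))"
    proof (rule nn_integral_cong)
      fix x
      have "ennreal (4 * sqrt (\<rho> x)) = 4 * ennreal (sqrt (max 1 \<bar>x\<bar>))" by (subst ennreal_mult') (auto simp: \<rho>_def)
      moreover have "ennreal (nsq (gr t) * sqrt \<bar>t\<bar>) = esq (gr t) * ennreal (sqrt \<bar>t\<bar>)" by (intro ennreal_mult) auto
      ultimately show "ind S (x, t) * ((w x * ennreal (4 * sqrt (\<rho> x))) * ennreal (nsq (gr t) * sqrt \<bar>t\<bar>)) =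
        (4 * esq (gr t) * ennreal (sqrt \<bar>t\<bar>)) * (ind {x. \<bar>t\<bar> \<le> max 1 \<bar>x\<bar>} x * (w x * ennreal (sqrt (max 1 \<bar>x\<bar>))))"
        unfolding e by (simp only: mult_ac)
    qed
    also have "\<dots> = (4 * esq (gr t) * ennreal (sqrt \<bar>t\<bar>)) * (NN x. ind {x. \<bar>t\<bar> \<le> max 1 \<bar>x\<bar>} x * (w x * ennreal (sqrt (max 1 \<bar>x\<bar>))))"
      by (rule nn_integral_cmult) (use tb in simp)
    also have "\<dots> = 4 * esq (gr t) * (ennreal (sqrt \<bar>t\<bar>) * (NN x. ind {x. \<bar>t\<bar> \<le> max 1 \<bar>x\<bar>} x * (w x * ennreal (sqrt (max 1 \<bar>x\<bar>)))))"
      by (simp only: mult.assoc)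
    also have "\<dots> \<le> 4 * esq (gr t) * ennreal (17 * c)"
      by (intro mult_left_mono good_part_kernel w c w0 wk) simp
    also have "\<dots> = ennreal (68 * c) * esq (gr t)"
    proof -
      have "ennreal (68 * c) = ennreal (4 * (17 * c))" by simp
      also have "\<dots> = 4 * ennreal (17 * c)" by (subst ennreal_mult') auto
      finally show ?thesis by (simp only: mult_ac)
    qed
    finally show "(NN x. ind S (x, t) * ((w x * ennreal (4 * sqrt (\<rho> x))) * ennreal (nsq (gr t) * sqrt \<bar>t\<bar>))) \<le>
      ennreal (68 * c) * esq (gr t)" .
  qed
  also have "\<dots> = ennreal (68 * c) * (NN t. esq (gr t))"
    by (rule nn_integral_cmult) measurable
  finally show ?thesis .
qed

subsection \<open>Means over the cross section\<close>

definition ysum :: "real \<Rightarrow> (plane \<Rightarrow> complex) \<Rightarrow> real \<Rightarrow> complex" where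
  "ysum a u x = (sint {0<..<a} (\<lambda>y. u (x, y)))"

lemma borel_section:
  assumes "u \<in> BM"
  shows "(\<lambda>y. u (x :: real, y :: real)) \<in> BM"
  by (rule measurable_compose[OF _ assms]) (intro borel_measurable_continuous_onI continuous_intros)

lemma ysum_measurable:
  assumes "u \<in> BM"
  shows "ysum a u \<in> BM"
proof -
  have c: "(\<lambda>z::plane. ind {0<..<a} (snd z) *\<^sub>R u z) \<in> BM"
    by (intro borel_measurable_scaleR measurable_compose[OF snd_borel_measurable borel_measurable_indicator] assms) simp
  then have "(\<lambda>(x, y). ind {0<..<a} y *\<^sub>R u (x, y)) \<in> borel_measurable (lborel \<Otimes>\<^sub>M lborel)"
    by (simp only: lborel_prod measurable_lborel2 split_beta' prod.collapse)
  then have "(\<lambda>(x, y). ind {0<..<a} y *\<^sub>R u (x, y)) \<in> borel_measurable (borel \<Otimes>\<^sub>M lborel)"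
    by (simp cong: measurable_cong_sets)
  from lborel.borel_measurable_lebesgue_integral[OF this] show ?thesis
    by (simp add: ysum_def[abs_def])
qed

lemma ysum_square_le:
  assumes u: "u \<in> BM" and a: "0 < a"
  shows "esq (ysum a u x) \<le> ennreal a * (NN y. ind {0<..<a} y * esq (u (x, y)))"
proof -
  note m = borel_section[OF u, of x]
  have CS: "(NN y. ind {0<..<a} y * (ind {0<..<a} y * ennreal (cmod (u (x, y)))))\<^sup>2 \<le>
      (NN y. (ind {0<..<a} y)\<^sup>2) * (NN y. (ind {0<..<a} y * ennreal (cmod (u (x, y))))\<^sup>2)"
    by (rule Cauchy_Schwarz_nn_integral) (use m in simp_all)
  have "ennreal (cmod (ysum a u x)) \<le> (NN y. ind {0<..<a} y * (ind {0<..<a} y * ennreal (cmod (u (x, y)))))"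
  \<comment> \<open>A column that is not integrable has Bochner integral 0, for which the bound is
    trivial.\<close>
  proof (cases "integrable lborel (\<lambda>y. ind {0<..<a} y *\<^sub>R u (x, y))")
    case True
    then have "ennreal (cmod (ysum a u x)) \<le> (NN y. ennreal (norm (ind {0<..<a} y *\<^sub>R u (x, y))))"
      unfolding ysum_def by (rule integral_norm_bound_ennreal)
    also have "\<dots> = (NN y. ind {0<..<a} y * (ind {0<..<a} y * ennreal (cmod (u (x, y)))))"
      by (intro nn_integral_cong) (simp add: indicator_def)
    finally show ?thesis .
  next
    case False
    then show ?thesis by (simp add: ysum_def not_integrable_integral_eq)
  qed
  then have "(ennreal (cmod (ysum a u x)))\<^sup>2 \<le> (NN y. ind {0<..<a} y * (ind {0<..<a} y * ennreal (cmod (u (x, y)))))\<^sup>2"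
    by (intro power_mono) auto
  also note CS
  also have "(NN y. (ind {0<..<a} y)\<^sup>2) = (NN y. ind {0<..<a} y)"
    by (intro nn_integral_cong) (simp add: indicator_def)
  also have "\<dots> = ennreal a" using a by simp
  also have "(NN y. (ind {0<..<a} y * ennreal (cmod (u (x, y))))\<^sup>2) = (NN y. ind {0<..<a} y * esq (u (x, y)))"
    by (intro nn_integral_cong) (simp add: indicator_def ennreal_power)
  finally show ?thesis by (simp add: ennreal_power)
qed

lemma ysum_L2:
  assumes u: "u \<in> BM" "sq_int u" and a: "0 < a"
  shows "integrable lborel (\<lambda>x. nsq (ysum a u x))"
proof (rule integrableI_bounded)
  have um: "(\<lambda>z. esq (u z)) \<in> BM" using u(1) by simp
  have m: "(\<lambda>x. NN y. esq (u (x, y))) \<in> BM"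
  proof -
    have "u \<in> borel_measurable (borel \<Otimes>\<^sub>M borel)" using u(1) by (simp add: borel_prod)
    then have "(\<lambda>(x, y). esq (u (x, y))) \<in> borel_measurable (borel \<Otimes>\<^sub>M lborel)"
      by (simp add: split_beta' cong: measurable_cong_sets)
    from lborel.borel_measurable_nn_integral[OF this] show ?thesis .
  qed
  have "(NN x. ennreal (norm (nsq (ysum a u x)))) \<le> (NN x. ennreal a * (NN y. esq (u (x, y))))"
  proof (rule nn_integral_mono)
    fix x
    have "ennreal (norm (nsq (ysum a u x))) \<le> ennreal a * (NN y. ind {0<..<a} y * esq (u (x, y)))"
      using ysum_square_le[OF u(1) a, of x] by simp
    also have "\<dots> \<le> ennreal a * (NN y. esq (u (x, y)))"
      by (intro mult_left_mono nn_integral_mono) (auto simp: indicator_def)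
    finally show "ennreal (norm (nsq (ysum a u x))) \<le> ennreal a * (NN y. esq (u (x, y)))" .
  qed
  also have "\<dots> = ennreal a * (NN x. NN y. esq (u (x, y)))"
    by (rule nn_integral_cmult) (use m in simp)
  also have "(NN x. NN y. esq (u (x, y))) = (NN z. esq (u z))"
    by (rule nn_integral_lborel2(1)[OF um, symmetric])
  also have "ennreal a * \<dots> < \<infinity>"
    using u(2) by (auto simp: integrable_iff_bounded ennreal_mult_less_top)
  finally show "(NN x. ennreal (norm (nsq (ysum a u x)))) < \<infinity>" .
qed (use ysum_measurable[OF u(1)] in simp)

lemma integral_rect_ysum:
  assumes u: "u \<in> BM" "sq_int u"
    and A: "A \<in> sets borel" "emeasure lborel A < \<infinity>" and a: "0 < a"
  shows "(sint (A \<times> {0<..<a}) u) = (sint A (ysum a u))"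
proof -
  have b: "A \<times> {0<..<a} \<in> sets borel" using A by (intro borel_Times) auto
  have "emeasure lborel (A \<times> {0<..<a}) < \<infinity>"
    using A a by (subst emeasure_lborel_Times) (auto simp: ennreal_mult_less_top)
  from integrable_indicator_L2[OF u b this]
  have i: "integrable (lborel \<Otimes>\<^sub>M lborel) (\<lambda>z. ind (A \<times> {0<..<a}) z *\<^sub>R u z)" by (simp add: lborel_prod)
  have "(sint (A \<times> {0<..<a}) u) = (LINT x|lborel. LINT y|lborel. ind (A \<times> {0<..<a}) (x, y) *\<^sub>R u (x, y))"
    using lborel_pair.integral_fst'[OF i] by (simp add: lborel_prod)
  also have "\<dots> = (sint A (ysum a u))"
  proof (rule Bochner_Integration.integral_cong[OF refl])
    fix x
    have "(LINT y|lborel. ind (A \<times> {0<..<a}) (x, y) *\<^sub>R u (x, y)) = (LINT y|lborel. ind A x *\<^sub>R (ind {0<..<a} y *\<^sub>R u (x, y)))"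
      by (intro Bochner_Integration.integral_cong) (auto simp: indicator_times)
    also have "\<dots> = ind A x *\<^sub>R ysum a u x" unfolding ysum_def by (rule integral_scaleR_right)
    finally show "(LINT y|lborel. ind (A \<times> {0<..<a}) (x, y) *\<^sub>R u (x, y)) = ind A x *\<^sub>R ysum a u x" .
  qed
  finally show ?thesis .
qed

text \<open>One-dimensional Lebesgue differentiation; the exceptional set is enlarged to a null set
  of \<open>lborel\<close>, as \<open>ae_primitive\<close> asks for.\<close>

lemma lebesgue_points:
  fixes f :: "real \<Rightarrow> complex"
  assumes fm [measurable]: "f \<in> BM"
    and f: "\<And>p q. integrable lborel (\<lambda>x. ind {p..q} x *\<^sub>R f x)"
    and H: "\<And>n. 0 < H n" "H \<longlonglongrightarrow> 0"
  obtains N where "N \<in> null_sets lborel" "\<And>t. t \<notin> N \<Longrightarrow> (\<lambda>n. (1 / H n) *\<^sub>R (sint {t<..<t + H n} f)) \<longlonglongrightarrow> f t"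
proof -
  have si: "set_integrable lborel {p..q} f" for p q unfolding set_integrable_def by (rule f)
  have ii: "f integrable_on cbox p q" for p q
    using set_borel_integral_eq_integral(1)[OF si[of p q]] by simp
  obtain M where M: "negligible M" "\<And>x e. \<lbrakk>x \<notin> M; 0 < e\<rbrakk> \<Longrightarrow>
      \<exists>d>0. \<forall>h. 0 < h \<and> h < d \<longrightarrow> norm (integral (cbox x (x + h *\<^sub>R One)) f /\<^sub>R h ^ DIM(real) - f x) < e"
    by (rule integrable_ccontinuous_explicit[OF ii]) (rule that)
  have st: "(1 / h) *\<^sub>R (sint {x<..<x + h} f) = integral (cbox x (x + h *\<^sub>R One)) f /\<^sub>R h ^ DIM(real)" for h x
  proof -
    have "(sint {x<..<x + h} f) = (sint {x..x + h} f)"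
    proof (rule integral_cong_AE)
      show "(\<lambda>y. ind {x..x + h} y *\<^sub>R f y) \<in> borel_measurable lborel" by (rule borel_measurable_integrable[OF f])
      show "(\<lambda>y. ind {x<..<x + h} y *\<^sub>R f y) \<in> borel_measurable lborel" by simp
      show "AE y in lborel. ind {x<..<x + h} y *\<^sub>R f y = ind {x..x + h} y *\<^sub>R f y"
        using AE_lborel_singleton[of x] AE_lborel_singleton[of "x + h"] by eventually_elim (auto simp: indicator_def)
    qed
    also have "\<dots> = integral {x..x + h} f"
      using set_borel_integral_eq_integral(2)[OF si] by (simp add: set_lebesgue_integral_def)
    finally show ?thesis by (simp add: divide_inverse)
  qed
  have lim: "(\<lambda>n. (1 / H n) *\<^sub>R (sint {t<..<t + H n} f)) \<longlonglongrightarrow> f t" if "t \<notin> M" for t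
  proof (rule LIMSEQ_I)
    fix e :: real assume "0 < e"
    from M(2)[OF that this] obtain d where d: "d > 0" "\<And>h. 0 < h \<Longrightarrow> h < d \<Longrightarrow> norm ((1 / h) *\<^sub>R (sint {t<..<t + h} f) - f t) < e"
      unfolding st by blast
    from order_tendstoD(2)[OF H(2) d(1)] obtain n0 where "\<And>n. n \<ge> n0 \<Longrightarrow> H n < d"
      unfolding eventually_sequentially by blast
    then show "\<exists>no. \<forall>n\<ge>no. norm ((1 / H n) *\<^sub>R (sint {t<..<t + H n} f) - f t) < e" using d(2) H(1) by blast
  qed
  from M(1) have "M \<in> null_sets lebesgue" by (simp add: negligible_iff_null_sets)
  then obtain N where "N \<in> null_sets lborel" "M \<subseteq> N"
    by (auto simp: null_sets_completion_iff2)
  then show ?thesis using lim by (intro that) auto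
qed

text \<open>The rectangle identity over the full height is divided by the width \<open>h\<close>.
  The left side is a difference of one-sided averages, which converge at Lebesgue points; the right
  side is an integral of \<open>g1\<close> with the overlap weight \<open>l h / h\<close>, which
  tends to the indicator of \<open>(s, t)\<close>.\<close>

lemma ysum_ae_primitive:
  assumes w: "rect_weak_grad a u g1 g2" and a: "0 < a"
  shows "ae_primitive (ysum a u) (ysum a g1)"
proof -
  have um: "u \<in> BM" "sq_int u"
    and gm: "g1 \<in> BM" "sq_int g1"
    and id: "\<And>s t h. s \<le> t \<Longrightarrow> 0 < h \<Longrightarrow> rint u t (t + h) 0 a - rint u s (s + h) 0 a = (sint {s<..<t} (\<lambda>r. rint g1 r (r + h) 0 a))"
    using w by (auto simp: rect_weak_grad_def)
  note Um = ysum_measurable[OF um(1), of a] note Ui = ysum_L2[OF um a]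
  note Gm = ysum_measurable[OF gm(1), of a] note Gi = ysum_L2[OF gm a]
  have iU: "integrable lborel (\<lambda>x. ind {p..q} x *\<^sub>R ysum a u x)" for p q
    by (rule integrable_indicator_L2[OF Um Ui]) (auto simp: emeasure_lborel_Icc_eq)
  define H where "H n = inverse (real (Suc n))" for n
  have H: "0 < H n" for n by (simp add: H_def)
  have H0: "H \<longlonglongrightarrow> 0" unfolding H_def by (rule LIMSEQ_inverse_real_of_nat)
  obtain N where N: "N \<in> null_sets lborel" "\<And>t. t \<notin> N \<Longrightarrow> (\<lambda>n. (1 / H n) *\<^sub>R (sint {t<..<t + H n} (ysum a u))) \<longlonglongrightarrow> ysum a u t"
    by (rule lebesgue_points[OF Um iU H H0]) (rule that)
  have fin: "emeasure lborel {p<..<q} < \<infinity>" for p q :: real by (cases "p \<le> q") auto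
  have rU: "rint u p q 0 a = (sint {p<..<q} (ysum a u))" for p q
    unfolding rint_def by (rule integral_rect_ysum[OF um _ fin a]) simp
  have main: "ysum a u t - ysum a u s = (sint {s<..<t} (ysum a g1))" if st: "s \<notin> N" "t \<notin> N" "s \<le> t" for s t
  proof -
    define l where "l h x1 = (sint {s<..<t} (\<lambda>r. (ind {r<..<r + h} x1 :: real)))" for h x1
    have l_eq: "l h x = measure lborel ({s<..<t} \<inter> {x - h<..<x})" for h x
    proof -
      have "l h x = (LINT r|lborel. ind ({s<..<t} \<inter> {x - h<..<x}) r)"
        unfolding l_def by (intro Bochner_Integration.integral_cong) (auto simp: indicator_def)
      then show ?thesis by simp
    qed
    have l_bound: "0 \<le> l h x \<and> l h x \<le> h * ind {s<..<t + h} x" if h: "0 < h" for h x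
    proof (cases "x \<in> {s<..<t + h}")
      case True
      have "measure lborel ({s<..<t} \<inter> {x - h<..<x}) \<le> measure lborel {x - h<..<x}"
        using h by (intro measure_mono_fmeasurable) (auto simp: fmeasurable_def)
      also have "\<dots> = h" using h by simp
      finally show ?thesis using True by (simp add: l_eq)
    next
      case False
      then have "{s<..<t} \<inter> {x - h<..<x} = {}" by auto
      then show ?thesis using False by (simp add: l_eq)
    qed
    have lm: "l h \<in> BM" for h
    proof -
      have "(\<lambda>v::plane. ind {s<..<t} (snd v) *\<^sub>R (ind {v. snd v < fst v \<and> fst v < snd v + h} v :: real)) \<in> BM"
        by (intro borel_measurable_scaleR measurable_compose[OF snd_borel_measurable borel_measurable_indicator]
          borel_measurable_indicator borel_open open_Collect_conj open_Collect_less continuous_intros)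
      moreover have "(\<lambda>v::plane. ind {s<..<t} (snd v) *\<^sub>R (ind {v. snd v < fst v \<and> fst v < snd v + h} v :: real)) =
          (\<lambda>(x1, r). ind {s<..<t} r *\<^sub>R (ind {r<..<r + h} x1 :: real))"
        by (auto simp: fun_eq_iff indicator_def)
      ultimately have "(\<lambda>(x1, r). ind {s<..<t} r *\<^sub>R (ind {r<..<r + h} x1 :: real)) \<in> BM"
        by (rule back_subst[of "\<lambda>f. f \<in> BM"])
      then have "(\<lambda>(x1, r). ind {s<..<t} r *\<^sub>R (ind {r<..<r + h} x1 :: real)) \<in> borel_measurable (lborel \<Otimes>\<^sub>M lborel)"
        by (simp only: lborel_prod measurable_lborel2)
      then have "(\<lambda>(x1, r). ind {s<..<t} r *\<^sub>R (ind {r<..<r + h} x1 :: real)) \<in> borel_measurable (borel \<Otimes>\<^sub>M lborel)"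
        by (subst measurable_cong_sets[OF sets_pair_measure_cong[OF sets_lborel[symmetric] refl] refl])
      from lborel.borel_measurable_lebesgue_integral[OF this] show ?thesis by (simp only: l_def[abs_def])
    qed
    define W where "W n z = (1 / H n) *\<^sub>R (g1 z * of_real (l (H n) (fst z) * ind {0<..<a} (snd z)))" for n z
    have Wm: "W n \<in> BM" for n
      unfolding W_def
      by (intro borel_measurable_scaleR borel_measurable_times measurable_compose[OF _ borel_measurable_of_real] gm(1) borel_measurable_const
        measurable_compose[OF fst_borel_measurable lm] measurable_compose[OF snd_borel_measurable borel_measurable_indicator] borel_open open_greaterThanLessThan)
    have e: "(1 / H n) *\<^sub>R (rint u t (t + H n) 0 a - rint u s (s + H n) 0 a) = (LINT z|lborel. W n z)" for n
    proof -
      have "rint u t (t + H n) 0 a - rint u s (s + H n) 0 a = (LINT z|lborel. g1 z * of_real (l (H n) (fst z) * ind {0<..<a} (snd z)))"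
        unfolding id[OF st(3) H] l_def
        by (rule Fubini_rint[OF gm(1) integrable_rect_L2[OF gm] st(3) H, symmetric])
      then show ?thesis unfolding W_def by (simp only: integral_scaleR_right)
    qed
    \<comment> \<open>The weight \<open>l (H n) / H n\<close> is at most 1 and supported in
      \<open>(s, t + H n)\<close>; off the vertical lines over \<open>s\<close> and \<open>t\<close>
      it eventually equals the indicator.\<close>
    have "(\<lambda>n. LINT z|lborel. W n z) \<longlonglongrightarrow> (sint ({s<..<t} \<times> {0<..<a}) g1)"
    proof (rule integral_dominated_convergence[where w = "\<lambda>z. norm (ind ({s<..<t + 1} \<times> {0<..<a}) z *\<^sub>R g1 z)"])
      show "integrable lborel (\<lambda>z. norm (ind ({s<..<t + 1} \<times> {0<..<a}) z *\<^sub>R g1 z))"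
        by (intro integrable_norm integrable_rect_L2 gm)
      show "AE z in lborel. norm (W n z) \<le> norm (ind ({s<..<t + 1} \<times> {0<..<a}) z *\<^sub>R g1 z)" for n
      proof (rule AE_I2)
        fix z :: "plane"
        have H1: "H n \<le> 1" by (simp add: H_def inverse_le_1_iff)
        have "\<bar>l (H n) (fst z) / H n\<bar> \<le> ind {s<..<t + H n} (fst z)"
          using l_bound[OF H[of n], of "fst z"] H[of n] by (simp add: pos_divide_le_eq mult.commute)
        also have "\<dots> \<le> ind {s<..<t + 1} (fst z)" using H1 by (auto simp: indicator_def)
        finally have le: "\<bar>l (H n) (fst z) / H n\<bar> \<le> ind {s<..<t + 1} (fst z)" .
        have "norm (W n z) = cmod (g1 z) * ind {0<..<a} (snd z) * \<bar>l (H n) (fst z) / H n\<bar>"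
          using H[of n] by (simp add: W_def norm_mult abs_mult)
        also have "\<dots> \<le> cmod (g1 z) * ind {0<..<a} (snd z) * ind {s<..<t + 1} (fst z)"
          by (intro mult_left_mono le) simp
        also have "\<dots> = norm (ind ({s<..<t + 1} \<times> {0<..<a}) z *\<^sub>R g1 z)"
          by (simp add: indicator_times)
        finally show "norm (W n z) \<le> norm (ind ({s<..<t + 1} \<times> {0<..<a}) z *\<^sub>R g1 z)" .
      qed
      show "AE z in lborel. (\<lambda>n. W n z) \<longlonglongrightarrow> ind ({s<..<t} \<times> {0<..<a}) z *\<^sub>R g1 z"
        using AE_lborel_fst_neq[of s] AE_lborel_fst_neq[of t]
      proof eventually_elim
        case (elim z)
        have "\<forall>\<^sub>F n in sequentially. W n z = ind ({s<..<t} \<times> {0<..<a}) z *\<^sub>R g1 z"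
        proof (cases "fst z \<in> {s<..<t}")
          case True
          then have "0 < fst z - s" by simp
          from order_tendstoD(2)[OF H0 this] show ?thesis
          proof eventually_elim
            case (elim n)
            then have "{s<..<t} \<inter> {fst z - H n<..<fst z} = {fst z - H n<..<fst z}" using True by auto
            then have "l (H n) (fst z) = H n" using H[of n] by (simp add: l_eq)
            then show ?case using True H[of n] by (simp add: W_def indicator_times scaleR_conv_of_real mult.commute)
          qed
        next
          case False
          show ?thesis
          proof (cases "fst z < s")
            case True
            then have "{s<..<t} \<inter> {fst z - H n<..<fst z} = {}" for n by auto
            then show ?thesis using False by (simp add: W_def l_eq indicator_times)
          next
            case nless: False
            then have "0 < fst z - t" using False elim by auto
            from order_tendstoD(2)[OF H0 this] show ?thesis
            proof eventually_elim
              case (elim n)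
              then have "{s<..<t} \<inter> {fst z - H n<..<fst z} = {}" by auto
              then show ?case using False by (simp add: W_def l_eq indicator_times)
            qed
          qed
        qed
        then show ?case by (rule tendsto_eventually)
      qed
    qed (use Wm gm(1) in \<open>simp_all\<close>)
    then have "(\<lambda>n. (1 / H n) *\<^sub>R (rint u t (t + H n) 0 a - rint u s (s + H n) 0 a)) \<longlonglongrightarrow> (sint ({s<..<t} \<times> {0<..<a}) g1)"
      by (simp only: e)
    moreover have "(\<lambda>n. (1 / H n) *\<^sub>R (rint u t (t + H n) 0 a - rint u s (s + H n) 0 a)) \<longlonglongrightarrow> ysum a u t - ysum a u s"
      unfolding rU scaleR_diff_right by (intro tendsto_diff N(2) st)
    ultimately have "ysum a u t - ysum a u s = (sint ({s<..<t} \<times> {0<..<a}) g1)"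
      by (rule LIMSEQ_unique[rotated])
    also have "\<dots> = (sint {s<..<t} (ysum a g1))"
      by (rule integral_rect_ysum[OF gm _ fin a]) simp
    finally show ?thesis .
  qed
  show ?thesis unfolding ae_primitive_def using Um Gm iU Gi N(1) main by blast
qed

section \<open>The column mean on the plane and its orthogonality to the remainder\<close>

definition column_mean :: "real \<Rightarrow> (plane \<Rightarrow> complex) \<Rightarrow> plane \<Rightarrow> complex" where
  "column_mean a u z = (1 / a) *\<^sub>R (ind {0<..<a} (snd z) *\<^sub>R ysum a u (fst z))"

lemma column_mean_measurable:
  assumes "u \<in> BM"
  shows "column_mean a u \<in> BM"
  unfolding column_mean_def[abs_def]
  by (intro borel_measurable_scaleR borel_measurable_const measurable_compose[OF snd_borel_measurable borel_measurable_indicator]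
      measurable_compose[OF fst_borel_measurable ysum_measurable[OF assms]] borel_open open_greaterThanLessThan)

lemma nn_integral_column_mean:
  fixes W :: "plane \<Rightarrow> ennreal"
  assumes u: "u \<in> BM" and W: "W \<in> BM" and a: "0 < a"
  shows "(NN z. W z * esq (column_mean a u z)) =
    ennreal (1 / a\<^sup>2) * (NN x. (NN y. ind {0<..<a} y * W (x, y)) * esq (ysum a u x))"
proof -
  have m: "(\<lambda>z. W z * esq (column_mean a u z)) \<in> BM"
    using column_mean_measurable[OF u] W by simp
  have Wy: "(\<lambda>y. W (x, y)) \<in> BM" for x
    by (rule measurable_compose[OF _ W]) (intro borel_measurable_continuous_onI continuous_intros)
  have Wc: "(\<lambda>z::plane. ind {0<..<a} (snd z) * W z) \<in> BM"
    by (intro borel_measurable_times_ennreal measurable_compose[OF snd_borel_measurable borel_measurable_indicator] W) simp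
  have w: "(\<lambda>x. NN y. ind {0<..<a} y * W (x, y)) \<in> BM"
  proof -
    from Wc have "(\<lambda>(x, y). ind {0<..<a} y * W (x, y)) \<in> borel_measurable (lborel \<Otimes>\<^sub>M lborel)"
      by (simp only: lborel_prod measurable_lborel2 split_beta' prod.collapse)
    then have "(\<lambda>(x, y). ind {0<..<a} y * W (x, y)) \<in> borel_measurable (borel \<Otimes>\<^sub>M lborel)"
      by (simp cong: measurable_cong_sets)
    from lborel.borel_measurable_nn_integral[OF this] show ?thesis .
  qed
  have "(NN z. W z * esq (column_mean a u z)) =
      (NN x. NN y. W (x, y) * esq (column_mean a u (x, y)))"
    by (rule nn_integral_lborel2(1)[OF m])
  also have "\<dots> = (NN x. ennreal (1 / a\<^sup>2) * ((NN y. ind {0<..<a} y * W (x, y)) * esq (ysum a u x)))"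
  proof (rule nn_integral_cong)
    fix x
    have "(NN y. W (x, y) * esq (column_mean a u (x, y))) =
        (NN y. (ind {0<..<a} y * W (x, y)) * ennreal (1 / a\<^sup>2 * nsq (ysum a u x)))"
      by (intro nn_integral_cong) (simp add: column_mean_def indicator_def power_divide power_mult_distrib)
    also have "\<dots> = (NN y. ind {0<..<a} y * W (x, y)) * ennreal (1 / a\<^sup>2 * nsq (ysum a u x))"
      by (rule nn_integral_multc) (use Wy in simp)
    also have "ennreal (1 / a\<^sup>2 * nsq (ysum a u x)) = ennreal (1 / a\<^sup>2) * esq (ysum a u x)"
      by (rule ennreal_mult) auto
    finally show "(NN y. W (x, y) * esq (column_mean a u (x, y))) =
        ennreal (1 / a\<^sup>2) * ((NN y. ind {0<..<a} y * W (x, y)) * esq (ysum a u x))"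
      by (simp add: mult_ac)
  qed
  also have "\<dots> = ennreal (1 / a\<^sup>2) * (NN x. (NN y. ind {0<..<a} y * W (x, y)) * esq (ysum a u x))"
    by (rule nn_integral_cmult) (use w ysum_measurable[OF u] in simp)
  finally show ?thesis .
qed

lemma nn_integral_column_mean_square:
  assumes u: "u \<in> BM" and a: "0 < a"
  shows "(NN z. esq (column_mean a u z)) = ennreal (1 / a) * (NN x. esq (ysum a u x))"
proof -
  have "(NN z. esq (column_mean a u z)) =
      ennreal (1 / a\<^sup>2) * (NN x. (NN y. ind {0<..<a} y) * esq (ysum a u x))"
    using nn_integral_column_mean[OF u borel_measurable_const[of 1] a] by simp
  also have "\<dots> = ennreal (1 / a\<^sup>2) * (NN x. ennreal a * esq (ysum a u x))"
    using a by simp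
  also have "\<dots> = ennreal (1 / a\<^sup>2) * (ennreal a * (NN x. esq (ysum a u x)))"
    by (subst nn_integral_cmult) (use ysum_measurable[OF u] in simp_all)
  also have "\<dots> = ennreal (1 / a\<^sup>2 * a) * (NN x. esq (ysum a u x))"
    using a by (subst ennreal_mult) (auto simp: mult.assoc)
  also have "1 / a\<^sup>2 * a = 1 / a" using a by (simp add: power2_eq_square)
  finally show ?thesis .
qed

lemma column_mean_L2:
  assumes u: "u \<in> BM" "sq_int u" and a: "0 < a"
  shows "integrable lborel (\<lambda>z. nsq (column_mean a u z))"
proof (rule integrableI_bounded)
  have "(NN x. esq (ysum a u x)) < \<infinity>"
    using ysum_L2[OF u a] by (simp add: integrable_iff_bounded)
  then show "(NN z. ennreal (norm (nsq (column_mean a u z)))) < \<infinity>"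
    by (simp add: nn_integral_column_mean_square[OF u(1) a] ennreal_mult_less_top)
qed (use column_mean_measurable[OF u(1)] in simp)

lemma integral_column_mean:
  assumes u: "u \<in> BM" "sq_int u"
    and A: "A \<in> sets borel" "emeasure lborel A < \<infinity>" and B: "B \<in> sets borel" "emeasure lborel B < \<infinity>" and a: "0 < a"
  shows "(sint (A \<times> B) (column_mean a u)) =
    (measure lborel (B \<inter> {0<..<a}) / a) *\<^sub>R (sint A (ysum a u))"
proof -
  have b: "A \<times> B \<in> sets borel" using A B by (intro borel_Times)
  have "emeasure lborel (A \<times> B) < \<infinity>"
    using A B by (subst emeasure_lborel_Times) (auto simp: ennreal_mult_less_top)
  from integrable_indicator_L2[OF column_mean_measurable[OF u(1)] column_mean_L2[OF u a] b this]
  have i: "integrable (lborel \<Otimes>\<^sub>M lborel) (\<lambda>z. ind (A \<times> B) z *\<^sub>R column_mean a u z)" by (simp add: lborel_prod)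
  have "(sint (A \<times> B) (column_mean a u)) = (LINT x|lborel. LINT y|lborel. ind (A \<times> B) (x, y) *\<^sub>R column_mean a u (x, y))"
    using lborel_pair.integral_fst'[OF i] by (simp add: lborel_prod)
  also have "\<dots> = (LINT x|lborel. (measure lborel (B \<inter> {0<..<a}) / a) *\<^sub>R (ind A x *\<^sub>R ysum a u x))"
  proof (rule Bochner_Integration.integral_cong[OF refl])
    fix x
    have fin: "emeasure lborel (B \<inter> {0<..<a}) < \<infinity>"
      by (rule le_less_trans[OF emeasure_mono B(2)]) (use B in auto)
    have "(LINT y|lborel. ind (A \<times> B) (x, y) *\<^sub>R column_mean a u (x, y)) =
        (sint (B \<inter> {0<..<a}) (\<lambda>y. ((1 / a) *\<^sub>R (ind A x *\<^sub>R ysum a u x))))"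
      by (intro Bochner_Integration.integral_cong) (auto simp: column_mean_def indicator_def)
    also have "\<dots> = measure lborel (B \<inter> {0<..<a}) *\<^sub>R ((1 / a) *\<^sub>R (ind A x *\<^sub>R ysum a u x))"
      using B fin by (subst integral_scaleR_left) auto
    finally show "(LINT y|lborel. ind (A \<times> B) (x, y) *\<^sub>R column_mean a u (x, y)) =
        (measure lborel (B \<inter> {0<..<a}) / a) *\<^sub>R (ind A x *\<^sub>R ysum a u x)" by simp
  qed
  also have "\<dots> = (measure lborel (B \<inter> {0<..<a}) / a) *\<^sub>R (sint A (ysum a u))"
    by (rule integral_scaleR_right)
  finally show ?thesis .
qed

lemma rint_column_mean:
  assumes u: "u \<in> BM" "sq_int u"
    and a: "0 < a" "0 \<le> c" "d \<le> a"
  shows "rint (column_mean a u) p q c d = (measure lborel {c<..<d} / a) *\<^sub>R rint u p q 0 a"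
proof -
  have fin: "emeasure lborel {p<..<q} < \<infinity>" for p q :: real by (cases "p \<le> q") auto
  have "{c<..<d} \<inter> {0<..<a} = {c<..<d}" using a by auto
  then show ?thesis
    unfolding rint_def integral_rect_ysum[OF u borel_open[OF open_greaterThanLessThan] fin a(1)]
    using integral_column_mean[OF u borel_open[OF open_greaterThanLessThan] fin borel_open[OF open_greaterThanLessThan] fin a(1), of p q c d] by simp
qed

text \<open>Inside the strip the height of a rectangle enters the integral of a column mean only
  through the factor \<open>measure lborel {c<..<d} / a\<close>. The horizontal identity is thus a
  multiple of the one for full height, and vertical shifts change nothing.\<close>

lemma rect_weak_grad_column_mean:
  assumes w: "rect_weak_grad a u g1 g2" and a: "0 < a"
  shows "rect_weak_grad a (column_mean a u) (column_mean a g1) (\<lambda>_. 0)"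
proof -
  have u: "u \<in> BM" "sq_int u"
    and g: "g1 \<in> BM" "sq_int g1"
    and id: "\<And>s t h. s \<le> t \<Longrightarrow> 0 < h \<Longrightarrow> rint u t (t + h) 0 a - rint u s (s + h) 0 a = (sint {s<..<t} (\<lambda>r. rint g1 r (r + h) 0 a))"
    using w by (auto simp: rect_weak_grad_def)
  note m = column_mean_measurable[OF u(1), of a] column_mean_measurable[OF g(1), of a] column_mean_L2[OF u a] column_mean_L2[OF g a]
  show ?thesis
    unfolding rect_weak_grad_def
  proof (intro conjI allI impI m)
    fix s t h c d :: real assume st: "s \<le> t" "0 < h" "0 \<le> c" "d \<le> a"
    show "rint (column_mean a u) t (t + h) c d - rint (column_mean a u) s (s + h) c d = (sint {s<..<t} (\<lambda>r. rint (column_mean a g1) r (r + h) c d))"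
      unfolding rint_column_mean[OF u a st(3,4)] rint_column_mean[OF g a st(3,4)]
      unfolding scaleR_right_diff_distrib[symmetric] id[OF st(1,2)] integral_scaleR_right[symmetric]
      by (intro Bochner_Integration.integral_cong) auto
  next
    fix s t h p q :: real assume st: "s \<le> t" "0 < h" "0 \<le> s" "t + h \<le> a"
    then have "rint (column_mean a u) p q t (t + h) = rint (column_mean a u) p q s (s + h)"
      by (simp add: rint_column_mean[OF u a])
    then show "rint (column_mean a u) p q t (t + h) - rint (column_mean a u) p q s (s + h) = (sint {s<..<t} (\<lambda>r. rint (\<lambda>_. 0) p q r (r + h)))"
      by (simp add: rint_def)
  qed simp_all
qed

lemma integrable_rint:
  assumes g: "g \<in> BM" "sq_int g"
  shows "integrable lborel (\<lambda>r. ind {s<..<t} r *\<^sub>R rint g r (r + h) c d)"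
    and "integrable lborel (\<lambda>r. ind {s<..<t} r *\<^sub>R rint g p q r (r + h))"
proof -
  have sub: "integrable lborel (\<lambda>r. ind {s<..<t} r *\<^sub>R f r)" if f: "continuous_on UNIV f" for f :: "real \<Rightarrow> complex"
  proof -
    have "integrable lborel (\<lambda>r. ind {s..t} r *\<^sub>R f r)"
      by (rule borel_integrable_compact) (use f continuous_on_subset in auto)
    from set_integrable_subset[OF this[folded set_integrable_def], of "{s<..<t}"] show ?thesis
      unfolding set_integrable_def by (rule meta_mp) auto
  qed
  have "continuous_on UNIV (\<lambda>r. rint g r (r + h) c d)"
    using continuous_on_compose2[OF continuous_rint[OF g, of h "d - c"], of UNIV "\<lambda>r. (r, c)"]
    by (simp add: continuous_on_Pair continuous_on_id continuous_on_const)
  then show "integrable lborel (\<lambda>r. ind {s<..<t} r *\<^sub>R rint g r (r + h) c d)" by (rule sub)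
  have "continuous_on UNIV (\<lambda>r. rint g p q r (r + h))"
    using continuous_on_compose2[OF continuous_rint[OF g, of "q - p" h], of UNIV "\<lambda>r. (p, r)"]
    by (simp add: continuous_on_Pair continuous_on_id continuous_on_const)
  then show "integrable lborel (\<lambda>r. ind {s<..<t} r *\<^sub>R rint g p q r (r + h))" by (rule sub)
qed

lemma L2_diff:
  fixes u v :: "plane \<Rightarrow> complex"
  assumes u: "u \<in> BM" "sq_int u"
    and v: "v \<in> BM" "sq_int v"
  shows "integrable lborel (\<lambda>z. nsq (u z - v z))"
proof (rule Bochner_Integration.integrable_bound)
  show "integrable lborel (\<lambda>z. 2 * nsq (u z) + 2 * nsq (v z))" using u v by simp
  show "AE z in lborel. norm (nsq (u z - v z)) \<le> norm (2 * nsq (u z) + 2 * nsq (v z))"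
  proof (rule AE_I2)
    fix z
    have "nsq (u z - v z) \<le> (cmod (u z) + cmod (v z))\<^sup>2" by (intro power_mono norm_triangle_ineq4) simp
    also have "\<dots> \<le> 2 * nsq (u z) + 2 * nsq (v z)"
      using zero_le_power2[of "cmod (u z) - cmod (v z)"] by (simp add: power2_diff power2_sum)
    finally show "norm (nsq (u z - v z)) \<le> norm (2 * nsq (u z) + 2 * nsq (v z))" by simp
  qed
qed (use u v in simp)

text \<open>The integrated form is linear, so the remainder inherits it from \<open>u\<close> and
  its column mean.\<close>

lemma rect_weak_grad_diff:
  assumes u: "rect_weak_grad a u g1 g2" and v: "rect_weak_grad a v h1 h2"
  shows "rect_weak_grad a (\<lambda>z. u z - v z) (\<lambda>z. g1 z - h1 z) (\<lambda>z. g2 z - h2 z)"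
proof -
  have U: "u \<in> BM" "sq_int u"
      "g1 \<in> BM" "sq_int g1"
      "g2 \<in> BM" "sq_int g2"
    and U1: "\<And>s t h c d. s \<le> t \<Longrightarrow> 0 < h \<Longrightarrow> 0 \<le> c \<Longrightarrow> d \<le> a \<Longrightarrow> rint u t (t + h) c d - rint u s (s + h) c d = (sint {s<..<t} (\<lambda>r. rint g1 r (r + h) c d))"
    and U2: "\<And>s t h p q. s \<le> t \<Longrightarrow> 0 < h \<Longrightarrow> 0 \<le> s \<Longrightarrow> t + h \<le> a \<Longrightarrow> rint u p q t (t + h) - rint u p q s (s + h) = (sint {s<..<t} (\<lambda>r. rint g2 p q r (r + h)))"
    using u unfolding rect_weak_grad_def by blast+
  have V: "v \<in> BM" "sq_int v"
      "h1 \<in> BM" "sq_int h1"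
      "h2 \<in> BM" "sq_int h2"
    and V1: "\<And>s t h c d. s \<le> t \<Longrightarrow> 0 < h \<Longrightarrow> 0 \<le> c \<Longrightarrow> d \<le> a \<Longrightarrow> rint v t (t + h) c d - rint v s (s + h) c d = (sint {s<..<t} (\<lambda>r. rint h1 r (r + h) c d))"
    and V2: "\<And>s t h p q. s \<le> t \<Longrightarrow> 0 < h \<Longrightarrow> 0 \<le> s \<Longrightarrow> t + h \<le> a \<Longrightarrow> rint v p q t (t + h) - rint v p q s (s + h) = (sint {s<..<t} (\<lambda>r. rint h2 p q r (r + h)))"
    using v unfolding rect_weak_grad_def by blast+
  have rd: "rint (\<lambda>z. f z - k z) p q c d = rint f p q c d - rint k p q c d"
    if "f \<in> BM" "sq_int f" "k \<in> BM" "sq_int k"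
    for f k p q c d
    unfolding rint_def scaleR_right_diff_distrib
    by (rule Bochner_Integration.integral_diff[OF integrable_rect_L2[OF that(1,2)] integrable_rect_L2[OF that(3,4)]])
  show ?thesis
    unfolding rect_weak_grad_def
  proof (intro conjI allI impI borel_measurable_diff L2_diff U V)
    fix s t h c d :: real assume st: "s \<le> t" "0 < h" "0 \<le> c" "d \<le> a"
    have "rint (\<lambda>z. u z - v z) t (t + h) c d - rint (\<lambda>z. u z - v z) s (s + h) c d =
        (rint u t (t + h) c d - rint u s (s + h) c d) - (rint v t (t + h) c d - rint v s (s + h) c d)"
      unfolding rd[OF U(1,2) V(1,2)] by simp
    also have "\<dots> = (LINT r|lborel. ind {s<..<t} r *\<^sub>R rint g1 r (r + h) c d - ind {s<..<t} r *\<^sub>R rint h1 r (r + h) c d)"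
      unfolding U1[OF st] V1[OF st]
      by (rule Bochner_Integration.integral_diff[symmetric, OF integrable_rint(1)[OF U(3,4)] integrable_rint(1)[OF V(3,4)]])
    finally show "rint (\<lambda>z. u z - v z) t (t + h) c d - rint (\<lambda>z. u z - v z) s (s + h) c d = (sint {s<..<t} (\<lambda>r. rint (\<lambda>z. g1 z - h1 z) r (r + h) c d))"
      unfolding rd[OF U(3,4) V(3,4)] scaleR_right_diff_distrib .
  next
    fix s t h p q :: real assume st: "s \<le> t" "0 < h" "0 \<le> s" "t + h \<le> a"
    have "rint (\<lambda>z. u z - v z) p q t (t + h) - rint (\<lambda>z. u z - v z) p q s (s + h) =
        (rint u p q t (t + h) - rint u p q s (s + h)) - (rint v p q t (t + h) - rint v p q s (s + h))"
      unfolding rd[OF U(1,2) V(1,2)] by simp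
    also have "\<dots> = (LINT r|lborel. ind {s<..<t} r *\<^sub>R rint g2 p q r (r + h) - ind {s<..<t} r *\<^sub>R rint h2 p q r (r + h))"
      unfolding U2[OF st] V2[OF st]
      by (rule Bochner_Integration.integral_diff[symmetric, OF integrable_rint(2)[OF U(5,6)] integrable_rint(2)[OF V(5,6)]])
    finally show "rint (\<lambda>z. u z - v z) p q t (t + h) - rint (\<lambda>z. u z - v z) p q s (s + h) = (sint {s<..<t} (\<lambda>r. rint (\<lambda>z. g2 z - h2 z) p q r (r + h)))"
      unfolding rd[OF U(5,6) V(5,6)] scaleR_right_diff_distrib .
  qed
qed

lemma variance_identity:
  fixes f :: "real \<Rightarrow> complex"
  assumes f: "f \<in> BM" "integrable lborel (\<lambda>y. ind {0<..<a} y *\<^sub>R (cmod (f y))\<^sup>2)" and a: "0 < a"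
  defines "m \<equiv> (1 / a) *\<^sub>R (sint {0<..<a} f)"
  shows "(NN y. ind {0<..<a} y * esq (f y - m)) + ennreal (a * (cmod m)\<^sup>2) =
    (NN y. ind {0<..<a} y * esq (f y))"
proof -
  let ?I = "\<lambda>y::real. ind {0<..<a} y :: real"
  have i1: "integrable lborel ?I" using a by (intro integrable_real_indicator) auto
  have if': "integrable lborel (\<lambda>y. ?I y *\<^sub>R f y)"
  proof (rule Bochner_Integration.integrable_bound)
    show "integrable lborel (\<lambda>y. ?I y + ?I y *\<^sub>R (cmod (f y))\<^sup>2)" using i1 f(2) by simp
    show "AE y in lborel. norm (?I y *\<^sub>R f y) \<le> norm (?I y + ?I y *\<^sub>R (cmod (f y))\<^sup>2)"
    proof (rule AE_I2)
      fix y
      have "cmod (f y) \<le> 1 + nsq (f y)" using zero_le_power2[of "cmod (f y) - 1"] norm_ge_zero[of "f y"] unfolding power2_diff power_one mult_1_right by linarith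
      then show "norm (?I y *\<^sub>R f y) \<le> norm (?I y + ?I y *\<^sub>R (cmod (f y))\<^sup>2)" by (simp add: indicator_def)
    qed
  qed (use f(1) in simp)
  have ir: "integrable lborel (\<lambda>y. ?I y * Re (f y * cnj m))"
  proof -
    have "integrable lborel (\<lambda>y. Re (cnj m * (?I y *\<^sub>R f y)))" by (intro integrable_Re integrable_mult_right if')
    then show ?thesis by (simp add: mult_ac)
  qed
  have e: "?I y * nsq (f y - m) = ?I y *\<^sub>R (cmod (f y))\<^sup>2 - 2 * (?I y * Re (f y * cnj m)) + ?I y * (cmod m)\<^sup>2" for y
    unfolding cmod_power2 by (simp add: power2_eq_square algebra_simps)
  have im: "integrable lborel (\<lambda>y. ?I y * nsq (f y - m))"
    unfolding e by (intro Bochner_Integration.integrable_add Bochner_Integration.integrable_diff integrable_mult_right integrable_mult_left f(2) ir i1)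
  have "(LINT y|lborel. ?I y * Re (f y * cnj m)) = Re (cnj m * (LINT y|lborel. ?I y *\<^sub>R f y))"
  proof -
    have "(LINT y|lborel. ?I y * Re (f y * cnj m)) = (LINT y|lborel. Re (cnj m * (?I y *\<^sub>R f y)))"
      by (intro Bochner_Integration.integral_cong) (auto simp: mult_ac)
    also have "\<dots> = Re (LINT y|lborel. cnj m * (?I y *\<^sub>R f y))" by (intro integral_Re integrable_mult_right if')
    finally show ?thesis by (simp only: integral_mult_right_zero)
  qed
  also have "(LINT y|lborel. ?I y *\<^sub>R f y) = a *\<^sub>R m" using a by (simp add: m_def)
  also have "Re (cnj m * (a *\<^sub>R m)) = a * (cmod m)\<^sup>2"
  proof -
    have "Re (cnj m * (a *\<^sub>R m)) = a * ((Re m)\<^sup>2 + (Im m)\<^sup>2)" by (simp add: algebra_simps power2_eq_square)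
    then show ?thesis by (simp only: cmod_power2)
  qed
  finally have r: "(LINT y|lborel. ?I y * Re (f y * cnj m)) = a * (cmod m)\<^sup>2" .
  have "(LINT y|lborel. ?I y * nsq (f y - m)) = (LINT y|lborel. ?I y *\<^sub>R (cmod (f y))\<^sup>2) - 2 * (a * (cmod m)\<^sup>2) + a * (cmod m)\<^sup>2"
    unfolding e using f(2) ir i1 a r by simp
  then have E: "(LINT y|lborel. ?I y * nsq (f y - m)) + a * (cmod m)\<^sup>2 = (LINT y|lborel. ?I y *\<^sub>R (cmod (f y))\<^sup>2)" by simp
  have "(NN y. ind {0<..<a} y * esq (f y - m)) = (NN y. ennreal (?I y * nsq (f y - m)))"
    by (intro nn_integral_cong) (simp add: indicator_def)
  also have "\<dots> = ennreal (LINT y|lborel. ?I y * nsq (f y - m))"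
    by (rule nn_integral_eq_integral[OF im]) simp
  finally have 1: "(NN y. ind {0<..<a} y * esq (f y - m)) = ennreal (LINT y|lborel. ?I y * nsq (f y - m))" .
  have "(NN y. ind {0<..<a} y * esq (f y)) = (NN y. ennreal (?I y *\<^sub>R (cmod (f y))\<^sup>2))"
    by (intro nn_integral_cong) (simp add: indicator_def)
  also have "\<dots> = ennreal (LINT y|lborel. ?I y *\<^sub>R (cmod (f y))\<^sup>2)"
    by (rule nn_integral_eq_integral[OF f(2)]) simp
  finally have 2: "(NN y. ind {0<..<a} y * esq (f y)) = ennreal (LINT y|lborel. ?I y *\<^sub>R (cmod (f y))\<^sup>2)" .
  show ?thesis
    unfolding 1 2 E[symmetric] using a by (subst ennreal_plus) auto
qed

text \<open>The variance identity in almost every column, integrated over the first coordinate.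
  Being an equality, it lets the energies of mean and remainder add up to that of \<open>u\<close>
  without loss.\<close>

lemma column_mean_orthogonal:
  assumes g: "g \<in> BM" "sq_int g" "\<And>z. z \<notin> strip a \<Longrightarrow> g z = 0" and a: "0 < a"
  shows "(NN z. esq (column_mean a g z)) + (NN z. esq (g z - column_mean a g z)) =
    (NN z. esq (g z))"
proof -
  have m: "(\<lambda>z. esq (g z)) \<in> BM" using g(1) by simp
  have m1: "(\<lambda>z. esq (g z - column_mean a g z)) \<in> BM"
    and m2: "(\<lambda>z. esq (column_mean a g z)) \<in> BM"
    using g(1) column_mean_measurable[OF g(1)] by simp_all
  have m3: "(\<lambda>x. NN y. esq (g (x, y))) \<in> BM"
  proof -
    have "(\<lambda>(x, y). esq (g (x, y))) \<in> borel_measurable (lborel \<Otimes>\<^sub>M lborel)"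
      using m by (simp add: lborel_prod split_beta')
    then have "(\<lambda>(x, y). esq (g (x, y))) \<in> borel_measurable (borel \<Otimes>\<^sub>M lborel)" by (simp cong: measurable_cong_sets)
    from lborel.borel_measurable_nn_integral[OF this] show ?thesis .
  qed
  have sec: "(NN y. esq (g (x, y))) = (NN y. ind {0<..<a} y * esq (g (x, y)))" for x
    using g(3) by (intro nn_integral_cong) (auto simp: indicator_def strip_def)
  have "(NN x. NN y. esq (g (x, y))) \<noteq> \<infinity>"
    using g(2) unfolding nn_integral_lborel2(1)[OF m, symmetric] by (simp add: integrable_iff_bounded less_top)
  then have fin: "AE x in lborel. (NN y. esq (g (x, y))) \<noteq> \<infinity>"
    by (intro nn_integral_PInf_AE) (use m3 in simp_all)
  have "(NN z. esq (column_mean a g z)) + (NN z. esq (g z - column_mean a g z)) =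
      (NN z. esq (column_mean a g z) + esq (g z - column_mean a g z))"
    using m1 m2 by (intro nn_integral_add[symmetric]) simp_all
  also have "\<dots> = (NN x. NN y. esq (column_mean a g (x, y)) + esq (g (x, y) - column_mean a g (x, y)))"
    using m1 m2 by (intro nn_integral_lborel2(1)) simp
  also have "\<dots> = (NN x. NN y. esq (g (x, y)))"
  proof (rule nn_integral_cong_AE)
    show "AE x in lborel. (NN y. esq (column_mean a g (x, y)) + esq (g (x, y) - column_mean a g (x, y))) =
        (NN y. esq (g (x, y)))"
      using fin
    proof eventually_elim
      case (elim x)
      note gx = borel_section[OF g(1), of x]
      define m where "m = (1 / a) *\<^sub>R (sint {0<..<a} (\<lambda>y. g (x, y)))"
      have "integrable lborel (\<lambda>y. ind {0<..<a} y *\<^sub>R (cmod (g (x, y)))\<^sup>2)"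
      proof (rule integrableI_bounded)
        have "(NN y. ennreal (norm (ind {0<..<a} y *\<^sub>R (cmod (g (x, y)))\<^sup>2))) = (NN y. ind {0<..<a} y * esq (g (x, y)))"
          by (intro nn_integral_cong) (simp add: indicator_def)
        then show "(NN y. ennreal (norm (ind {0<..<a} y *\<^sub>R (cmod (g (x, y)))\<^sup>2))) < \<infinity>"
          using elim unfolding sec[symmetric] by (simp add: less_top)
      qed (use gx in simp)
      from variance_identity[OF gx this a, folded m_def]
      have v: "(NN y. ind {0<..<a} y * esq (g (x, y) - m)) + ennreal (a * (cmod m)\<^sup>2) = (NN y. esq (g (x, y)))"
        unfolding sec .
      have cm: "column_mean a g (x, y) = ind {0<..<a} y *\<^sub>R m" for y
        by (simp add: column_mean_def ysum_def m_def)
      have "(NN y. esq (column_mean a g (x, y)) + esq (g (x, y) - column_mean a g (x, y))) =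
          (NN y. ennreal ((cmod m)\<^sup>2) * ind {0<..<a} y + ind {0<..<a} y * esq (g (x, y) - m))"
        unfolding cm using g(3) by (intro nn_integral_cong) (auto simp: indicator_def strip_def)
      also have "\<dots> = (NN y. ennreal ((cmod m)\<^sup>2) * ind {0<..<a} y) + (NN y. ind {0<..<a} y * esq (g (x, y) - m))"
        by (rule nn_integral_add) (use gx in simp_all)
      also have "(NN y. ennreal ((cmod m)\<^sup>2) * ind {0<..<a} y) = ennreal (a * (cmod m)\<^sup>2)"
        using a by (subst nn_integral_cmult_indicator) (auto simp: ennreal_mult' mult.commute)
      finally show ?case using v by (simp add: add.commute)
    qed
  qed
  also have "\<dots> = (NN z. esq (g z))"
    by (rule nn_integral_lborel2(1)[OF m, symmetric])
  finally show ?thesis .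
qed

subsection \<open>Dyadic intervals\<close>

text \<open>The endpoints of \<open>I_int n\<close> as functions of \<open>n\<close>, from which
  half-open versions of the intervals are formed.\<close>

definition dyad_lo :: "int \<Rightarrow> real" where
  "dyad_lo n = (if n > 0 then 2 powi (n - 1) else if n = 0 then -1 else - (2 powi \<bar>n\<bar>))"

definition dyad_hi :: "int \<Rightarrow> real" where
  "dyad_hi n = (if n > 0 then 2 powi n else if n = 0 then 1 else - (2 powi (\<bar>n\<bar> - 1)))"

definition dyad_weight :: "int \<Rightarrow> real \<Rightarrow> real" where
  "dyad_weight n x = (if n = 0 then 1 else \<bar>x\<bar>)"

lemma powi_double: "(2::real) powi n = 2 * 2 powi (n - 1)"
  using power_int_add_1'[of "2::real" "n - 1"] by simp

lemma I_int_dyad: "I_int n = {dyad_lo n..dyad_hi n}"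
  by (simp add: I_int_def dyad_lo_def dyad_hi_def)

lemma dyad_lo_less_hi: "dyad_lo n < dyad_hi n"
proof -
  have "0 < (2::real) powi (\<bar>n\<bar> - 1)" by simp
  with powi_double[of "\<bar>n\<bar>"] have "(2::real) powi (\<bar>n\<bar> - 1) < 2 powi \<bar>n\<bar>" by linarith
  then show ?thesis by (auto simp: dyad_lo_def dyad_hi_def)
qed

text \<open>For \<open>n \<noteq> 0\<close> the length equals the least value of
  \<open>\<bar>x\<bar>\<close> on the interval; for \<open>n = 0\<close> length 2 and weight 1 force
  the factor 2.\<close>

lemma dyad_length_le_weight:
  assumes "x \<in> I_int n"
  shows "dyad_hi n - dyad_lo n \<le> 2 * dyad_weight n x"
  using assms powi_double[of n] powi_double[of "\<bar>n\<bar>"] unfolding I_int_dyad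
  by (auto simp: dyad_lo_def dyad_hi_def dyad_weight_def split: if_splits)

lemma dyad_hi_le_lo:
  assumes "m < n"
  shows "dyad_hi m \<le> dyad_lo n"
proof -
  have mono: "(2::real) powi j \<le> 2 powi k" if "j \<le> k" for j k :: int using that by (intro power_int_increasing) auto
  have ge1: "1 \<le> (2::real) powi k" if "0 \<le> k" for k :: int using mono[OF that] by simp
  have pos: "0 < (2::real) powi k" for k :: int by simp
  consider "0 < m" | "m = 0" | "m < 0" "0 < n" | "m < 0" "n = 0" | "m < 0" "n < 0" by linarith
  then show ?thesis
  proof cases
    case 1 then show ?thesis using assms mono[of m "n - 1"] by (simp add: dyad_lo_def dyad_hi_def)
  next
    case 2 then show ?thesis using assms ge1[of "n - 1"] by (simp add: dyad_lo_def dyad_hi_def)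
  next
    case 3 then show ?thesis using pos[of "n - 1"] pos[of "\<bar>m\<bar> - 1"] by (simp add: dyad_lo_def dyad_hi_def del: zero_less_power_int)
  next
    case 4 then show ?thesis using ge1[of "\<bar>m\<bar> - 1"] by (simp add: dyad_lo_def dyad_hi_def)
  next
    case 5 then show ?thesis using assms mono[of "\<bar>n\<bar>" "\<bar>m\<bar> - 1"] by (simp add: dyad_lo_def dyad_hi_def)
  qed
qed

text \<open>Half-open, because neighbouring intervals \<open>I_int\<close> share an endpoint;
  \<open>AE_dyad\<close> makes up for the difference.\<close>

lemma disjoint_dyad: "disjoint_family_on (\<lambda>n. {dyad_lo n<..dyad_hi n}) B"
  unfolding disjoint_family_on_def
proof (intro ballI impI)
  fix m n :: int assume "m \<noteq> n"
  then consider "m < n" | "n < m" by linarith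
  then show "{dyad_lo m<..dyad_hi m} \<inter> {dyad_lo n<..dyad_hi n} = {}"
    by cases (use dyad_hi_le_lo[of m n] dyad_hi_le_lo[of n m] in auto)
qed

lemma dyad_annulus:
  assumes "2 ^ k < \<bar>x\<bar>" "\<bar>x\<bar> \<le> 2 ^ Suc k"
  shows "x \<in> I_int (int (Suc k)) \<or> x \<in> I_int (- int (Suc k))"
proof -
  have p: "(2::real) powi (int (Suc k)) = 2 ^ Suc k" by (rule power_int_of_nat)
  have "int (Suc k) - 1 = int k" by simp
  then have p': "(2::real) powi (int (Suc k) - 1) = 2 ^ k" by (simp only: power_int_of_nat)
  have "I_int (int (Suc k)) = {2 ^ k..2 ^ Suc k}" unfolding I_int_def p p' by simp
  moreover have "I_int (- int (Suc k)) = {- (2 ^ Suc k)..- (2 ^ k)}"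
    unfolding I_int_def abs_minus_cancel abs_of_nat p p' by simp
  ultimately show ?thesis using assms by (cases "0 \<le> x") auto
qed

lemma AE_dyad: "AE x in lborel. ind (I_int n) x = (ind {dyad_lo n<..dyad_hi n} x :: ennreal)"
  using AE_lborel_singleton[of "dyad_lo n"] by eventually_elim (auto simp: I_int_dyad indicator_def)

text \<open>The weight is split into the intervals with \<open>c < \<gamma> n\<close>, handled by
  \<open>interval_functionals\<close>, and the rest, handled by \<open>good_part\<close>. Each part
  is allowed \<open>a / 4\<close>: the number \<open>M n\<close> of pieces satisfies
  \<open>8 * \<gamma> n / (M n)^2 \<le> a / 4\<close>, and \<open>68 * c \<le> a / 4\<close>
  explains the 272.\<close>

lemma column_functionals:
  fixes w :: "real \<Rightarrow> real" and \<gamma> :: "int \<Rightarrow> real"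
  assumes w: "w \<in> BM" "\<And>x. 0 \<le> w x"
    and \<gamma>: "\<And>n. (NN x. ind (I_int n) x * ennreal (dyad_weight n x * w x)) = ennreal (\<gamma> n)" "\<And>n. 0 \<le> \<gamma> n"
    and c: "0 < c" "c \<le> a / 272" and a: "0 < a" and fin: "finite {n. c < \<gamma> n}"
  obtains S :: "(plane) set" where "finite S"
    "real (card S) \<le> 1 + (sqrt (32 / a) + 1 / sqrt c) * (\<Sum>n | c < \<gamma> n. sqrt (\<gamma> n))"
    "\<And>U gr. ae_primitive U gr \<Longrightarrow> (\<And>c d. (c, d) \<in> S \<Longrightarrow> (sint {c..d} U) = 0) \<Longrightarrow>
      (NN x. ennreal (w x) * esq (U x)) \<le> ennreal (a / 2) * (NN x. esq (gr x))"
proof -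
  define B where "B = {n. c < \<gamma> n}"
  have finB: "finite B" using fin by (simp add: B_def)
  have wm: "(\<lambda>x. ennreal (w x)) \<in> BM" using w by simp
  define J where "J n = {dyad_lo n<..dyad_hi n}" for n
  define M where "M n = nat \<lceil>sqrt (32 * \<gamma> n / a)\<rceil>" for n
  define good where "good n T \<longleftrightarrow> (\<forall>U gr. ae_primitive U gr \<longrightarrow> (\<forall>c d. (c, d) \<in> T \<longrightarrow> (sint {c..d} U) = 0) \<longrightarrow>
      (NN x. ind (J n) x * (ennreal (w x) * esq (U x))) \<le> ennreal (a / 4) * (NN x. ind (J n) x * esq (gr x)))" for n T
  have local: "\<exists>T. finite T \<and> card T \<le> M n \<and> good n T"
    if n: "n \<in> B" for n
  proof -
    let ?L = "dyad_hi n - dyad_lo n"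
    have L: "0 < ?L" using dyad_lo_less_hi[of n] by simp
    have g: "0 < \<gamma> n" using n c by (simp add: B_def)
    \<comment> \<open>The length is at most twice the dyadic weight on the interval, so the
      unweighted mass is at most \<open>2 * \<gamma> n / ?L\<close>.\<close>
    define \<omega> where "\<omega> = 2 * \<gamma> n / ?L"
    have \<omega>: "0 < \<omega>" using g L by (simp add: \<omega>_def)
    have "(NN x. ind (J n) x * ennreal (w x)) \<le> (NN x. ennreal (2 / ?L) * (ind (I_int n) x * ennreal (dyad_weight n x * w x)))"
    proof (rule nn_integral_mono)
      fix x
      have "ennreal (w x) \<le> ennreal (2 / ?L) * ennreal (dyad_weight n x * w x)" if x: "x \<in> I_int n"
      proof -
        have "w x * ?L \<le> w x * (2 * dyad_weight n x)" by (intro mult_left_mono dyad_length_le_weight x w(2))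
        then have "w x \<le> 2 / ?L * (dyad_weight n x * w x)" using L by (simp add: field_simps)
        then have "ennreal (w x) \<le> ennreal (2 / ?L * (dyad_weight n x * w x))" by (rule ennreal_leI)
        also have "\<dots> = ennreal (2 / ?L) * ennreal (dyad_weight n x * w x)" using L by (intro ennreal_mult') simp
        finally show ?thesis .
      qed
      moreover have "J n \<subseteq> I_int n" by (auto simp: J_def I_int_dyad)
      ultimately show "ind (J n) x * ennreal (w x) \<le> ennreal (2 / ?L) * (ind (I_int n) x * ennreal (dyad_weight n x * w x))"
        by (auto simp: indicator_def)
    qed
    also have "\<dots> = ennreal (2 / ?L) * ennreal (\<gamma> n)"
      unfolding \<gamma>(1)[symmetric] by (rule nn_integral_cmult) (use w in \<open>simp add: dyad_weight_def I_int_dyad\<close>)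
    also have "\<dots> = ennreal \<omega>" using L by (simp add: \<omega>_def ennreal_mult'[symmetric])
    finally have w\<omega>: "(NN x. ind {dyad_lo n<..dyad_hi n} x * ennreal (w x)) \<le> ennreal \<omega>" by (simp only: J_def)
    have s: "0 < sqrt (32 * \<gamma> n / a)" using g a by simp
    have M0: "0 < M n" using s by (simp add: M_def)
    have "32 * \<gamma> n / a = (sqrt (32 * \<gamma> n / a))\<^sup>2" using g a by simp
    also have "\<dots> \<le> (real (M n))\<^sup>2" using s unfolding M_def by (intro power_mono) linarith+
    finally have M2: "32 * \<gamma> n / a \<le> (real (M n))\<^sup>2" .
    have "4 * l * (2 * g / l) / m = 8 * g / m" if "0 < l" for l g m :: real using that by simp
    from this[OF L] have "4 * ?L * \<omega> / (real (M n))\<^sup>2 = 8 * \<gamma> n / (real (M n))\<^sup>2" by (simp only: \<omega>_def)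
    also have "\<dots> \<le> a / 4" using M2 M0 a by (simp add: field_simps)
    finally have k: "4 * ?L * \<omega> / (real (M n))\<^sup>2 \<le> a / 4" .
    show ?thesis
    proof (rule interval_functionals[OF dyad_lo_less_hi w \<omega> w\<omega> M0])
      fix T :: "(plane) set" assume T: "finite T" "card T \<le> M n"
        "\<And>U gr. ae_primitive U gr \<Longrightarrow> (\<And>c d. (c, d) \<in> T \<Longrightarrow> (sint {c..d} U) = 0) \<Longrightarrow>
        (NN x. ind {dyad_lo n<..dyad_hi n} x * (ennreal (w x) * esq (U x))) \<le>
        ennreal (4 * ?L * \<omega> / (M n)\<^sup>2) * (NN x. ind {dyad_lo n<..dyad_hi n} x * esq (gr x))"
    show ?thesis
    proof (rule exI[of _ T], unfold good_def, intro conjI T(1,2) allI impI)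
      fix U gr assume U: "ae_primitive U gr" "\<forall>c d. (c, d) \<in> T \<longrightarrow> (sint {c..d} U) = 0"
      have "(NN x. ind (J n) x * (ennreal (w x) * esq (U x))) \<le> ennreal (4 * ?L * \<omega> / (M n)\<^sup>2) * (NN x. ind (J n) x * esq (gr x))"
        unfolding J_def by (rule T(3)[OF U(1)]) (use U(2) in blast)
      also have "ennreal (4 * ?L * \<omega> / (M n)\<^sup>2) * (NN x. ind (J n) x * esq (gr x)) \<le> ennreal (a / 4) * (NN x. ind (J n) x * esq (gr x))"
        using k by (intro mult_right_mono ennreal_leI) simp_all
      finally show "(NN x. ind (J n) x * (ennreal (w x) * esq (U x))) \<le> ennreal (a / 4) * (NN x. ind (J n) x * esq (gr x))" .
    qed
    qed
  qed
  have "\<exists>T. \<forall>n\<in>B. finite (T n) \<and> card (T n) \<le> M n \<and> good n (T n)" by (rule bchoice[OF ballI[OF local]])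
  then obtain T where T: "\<And>n. n \<in> B \<Longrightarrow> finite (T n)" "\<And>n. n \<in> B \<Longrightarrow> card (T n) \<le> M n" "\<And>n. n \<in> B \<Longrightarrow> good n (T n)"
    by metis
  have finT: "finite (\<Union>n\<in>B. T n)" using finB T(1) by blast
  \<comment> \<open>Rounding up adds at most 1, which is absorbed by
    \<open>1 \<le> 1 / sqrt c * sqrt (\<gamma> n)\<close> because
    \<open>c < \<gamma> n\<close>.\<close>
  have Mle: "real (M n) \<le> (sqrt (32 / a) + 1 / sqrt c) * sqrt (\<gamma> n)" if "n \<in> B" for n
  proof -
    have g: "c < \<gamma> n" using that by (simp add: B_def)
    have "0 \<le> sqrt (32 * \<gamma> n / a)" using \<gamma>(2) a by simp
    then have "real (M n) \<le> sqrt (32 * \<gamma> n / a) + 1" unfolding M_def by linarith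
    also have "sqrt (32 * \<gamma> n / a) = sqrt (32 / a) * sqrt (\<gamma> n)" by (simp add: real_sqrt_mult[symmetric])
    also have "1 \<le> 1 / sqrt c * sqrt (\<gamma> n)" using g c by simp
    finally show ?thesis by (simp add: algebra_simps)
  qed
  \<comment> \<open>The extra interval \<open>[-1, 1]\<close> anchors the Hardy inequality and is
    the source of the 1 in the final bound.\<close>
  have "card (insert (-1, 1) (\<Union>n\<in>B. T n)) \<le> Suc (card (\<Union>n\<in>B. T n))" by (rule card_insert_le_m1) auto
  also have "\<dots> \<le> Suc (\<Sum>n\<in>B. card (T n))" using card_UN_le[OF finB, of T] by simp
  finally have "real (card (insert (-1, 1) (\<Union>n\<in>B. T n))) \<le> 1 + (\<Sum>n\<in>B. real (card (T n)))"
    by (simp add: of_nat_sum[symmetric] del: of_nat_sum)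
  also have "(\<Sum>n\<in>B. real (card (T n))) \<le> (\<Sum>n\<in>B. (sqrt (32 / a) + 1 / sqrt c) * sqrt (\<gamma> n))"
  proof (rule sum_mono)
    fix n assume n: "n \<in> B"
    then have "real (card (T n)) \<le> real (M n)" using T(2) by simp
    also note Mle[OF n]
    finally show "real (card (T n)) \<le> (sqrt (32 / a) + 1 / sqrt c) * sqrt (\<gamma> n)" .
  qed
  finally have cardS: "real (card (insert (-1, 1) (\<Union>n\<in>B. T n))) \<le> 1 + (sqrt (32 / a) + 1 / sqrt c) * (\<Sum>n | c < \<gamma> n. sqrt (\<gamma> n))"
    by (simp add: sum_distrib_left B_def)
  \<comment> \<open>The weight off the large intervals: every dyadic interval then has weighted mass
    at most \<open>c\<close>, and an annulus, made of two of them, at most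
    \<open>2 * c\<close>.\<close>
  define wg where "wg x = ind (- (\<Union>n\<in>B. I_int n)) x * ennreal (w x)" for x
  have UB: "(\<Union>n\<in>B. I_int n) \<in> sets borel" using finB by (intro sets.finite_UN) (auto simp: I_int_dyad)
  have wgm: "wg \<in> BM"
    unfolding wg_def[abs_def] by (intro borel_measurable_times_ennreal borel_measurable_indicator borel_comp UB wm)
  have wgI: "(NN x. ind (I_int n) x * (wg x * ennreal (dyad_weight n x))) \<le> ennreal c" for n
  proof (cases "n \<in> B")
    case True
    then have z: "ind (I_int n) x * (wg x * ennreal (dyad_weight n x)) = 0" for x by (auto simp: wg_def indicator_def)
    show ?thesis unfolding z by simp
  next
    case False
    have "(NN x. ind (I_int n) x * (wg x * ennreal (dyad_weight n x))) \<le> (NN x. ind (I_int n) x * ennreal (dyad_weight n x * w x))"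
      by (intro nn_integral_mono) (auto simp: wg_def indicator_def dyad_weight_def ennreal_mult w(2) mult.commute)
    also have "\<dots> \<le> ennreal c" unfolding \<gamma>(1) using False by (intro ennreal_leI) (simp add: B_def)
    finally show ?thesis .
  qed
  have wg0: "(NN x. ind {-1..1} x * wg x) \<le> ennreal c"
    using wgI[of 0] by (simp add: dyad_weight_def I_int_def)
  have wgk: "(NN x. ind {x. 2 ^ k < \<bar>x\<bar> \<and> \<bar>x\<bar> \<le> 2 ^ Suc k} x * (wg x * ennreal \<bar>x\<bar>)) \<le> ennreal (2 * c)" for k :: nat
  proof -
    let ?n = "int (Suc k)"
    have "(NN x. ind {x. 2 ^ k < \<bar>x\<bar> \<and> \<bar>x\<bar> \<le> 2 ^ Suc k} x * (wg x * ennreal \<bar>x\<bar>)) \<le>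
        (NN x. ind (I_int ?n) x * (wg x * ennreal (dyad_weight ?n x)) + ind (I_int (- ?n)) x * (wg x * ennreal (dyad_weight (- ?n) x)))"
    proof (rule nn_integral_mono)
      fix x
      show "ind {x. 2 ^ k < \<bar>x\<bar> \<and> \<bar>x\<bar> \<le> 2 ^ Suc k} x * (wg x * ennreal \<bar>x\<bar>) \<le>
        ind (I_int ?n) x * (wg x * ennreal (dyad_weight ?n x)) + ind (I_int (- ?n)) x * (wg x * ennreal (dyad_weight (- ?n) x))"
      proof (cases "2 ^ k < \<bar>x\<bar> \<and> \<bar>x\<bar> \<le> 2 ^ Suc k")
        case True
        with dyad_annulus[of k x] consider "x \<in> I_int ?n" | "x \<in> I_int (- ?n)" by blast
        then show ?thesis by cases (auto simp: indicator_def dyad_weight_def)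
      qed simp
    qed
    also have "\<dots> = (NN x. ind (I_int ?n) x * (wg x * ennreal (dyad_weight ?n x))) + (NN x. ind (I_int (- ?n)) x * (wg x * ennreal (dyad_weight (- ?n) x)))"
      by (rule nn_integral_add) (use wgm in \<open>simp_all add: I_int_dyad dyad_weight_def\<close>)
    also have "\<dots> \<le> ennreal c + ennreal c" by (intro add_mono wgI)
    also have "\<dots> = ennreal (2 * c)" using c by (simp add: ennreal_plus[symmetric] del: ennreal_plus)
    finally show ?thesis .
  qed
  show ?thesis
  proof (rule that[of "insert (-1, 1) (\<Union>n\<in>B. T n)"])
    show "finite (insert (-1, 1) (\<Union>n\<in>B. T n))" using finT by simp
    show "real (card (insert (-1, 1) (\<Union>n\<in>B. T n))) \<le> 1 + (sqrt (32 / a) + 1 / sqrt c) * (\<Sum>n | c < \<gamma> n. sqrt (\<gamma> n))" by (rule cardS)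
    fix U gr assume U: "ae_primitive U gr" and z: "\<And>c d. (c, d) \<in> insert (-1, 1) (\<Union>n\<in>B. T n) \<Longrightarrow> (sint {c..d} U) = 0"
    let ?U = "\<lambda>x. esq (U x)" and ?g = "\<lambda>x. esq (gr x)"
    have Um: "U \<in> BM" and gm: "gr \<in> BM" using U by (auto simp: ae_primitive_def)
    have mU: "?U \<in> BM" and mg: "?g \<in> BM" using Um gm by simp_all
    have Jm: "J n \<in> sets borel" for n by (simp add: J_def)
    have "AE x in lborel. \<forall>n\<in>B. ind (I_int n) x = (ind (J n) x :: ennreal)"
      using finB AE_dyad unfolding J_def by (simp add: AE_finite_all)
    then have "AE x in lborel. ennreal (w x) * ?U x \<le> wg x * ?U x + (\<Sum>n\<in>B. ind (J n) x * (ennreal (w x) * ?U x))"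
    proof eventually_elim
      case (elim x)
      show ?case
      proof (cases "x \<in> (\<Union>n\<in>B. I_int n)")
        case True
        then obtain n where n: "n \<in> B" "x \<in> I_int n" by blast
        then have "ind (J n) x = (1 :: ennreal)" using elim by (metis indicator_simps(1))
        then have "ennreal (w x) * ?U x = ind (J n) x * (ennreal (w x) * ?U x)" by simp
        also have "\<dots> \<le> (\<Sum>n\<in>B. ind (J n) x * (ennreal (w x) * ?U x))"
          using n(1) finB by (intro member_le_sum) auto
        finally show ?thesis by (rule order_trans) simp
      next
        case False
        then show ?thesis by (simp add: wg_def)
      qed
    qed
    then have "(NN x. ennreal (w x) * ?U x) \<le> (NN x. wg x * ?U x + (\<Sum>n\<in>B. ind (J n) x * (ennreal (w x) * ?U x)))"
      by (rule nn_integral_mono_AE)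
    also have "\<dots> = (NN x. wg x * ?U x) + (NN x. (\<Sum>n\<in>B. ind (J n) x * (ennreal (w x) * ?U x)))"
      by (rule nn_integral_add) (use wgm wm mU Jm in simp_all)
    also have "(NN x. (\<Sum>n\<in>B. ind (J n) x * (ennreal (w x) * ?U x))) = (\<Sum>n\<in>B. NN x. ind (J n) x * (ennreal (w x) * ?U x))"
      by (rule nn_integral_sum) (use wm mU Jm in simp)
    also have "\<dots> \<le> (\<Sum>n\<in>B. ennreal (a / 4) * (NN x. ind (J n) x * ?g x))"
    proof (rule sum_mono)
      fix n assume n: "n \<in> B"
      have "\<forall>c d. (c, d) \<in> T n \<longrightarrow> (sint {c..d} U) = 0" using z n by blast
      from T(3)[OF n, unfolded good_def, rule_format, OF U this[rule_format]] show "(NN x. ind (J n) x * (ennreal (w x) * ?U x)) \<le> ennreal (a / 4) * (NN x. ind (J n) x * ?g x)" .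
    qed
    also have "\<dots> = ennreal (a / 4) * (NN x. (\<Sum>n\<in>B. ind (J n) x * ?g x))"
      unfolding sum_distrib_left[symmetric] by (subst nn_integral_sum) (use mg Jm in simp_all)
    also have "\<dots> \<le> ennreal (a / 4) * (NN x. ?g x)"
    proof (intro mult_left_mono nn_integral_mono)
      fix x
      have "(\<Sum>n\<in>B. ind (J n) x * ?g x) = ind (\<Union>n\<in>B. J n) x * ?g x"
        unfolding sum_distrib_right[symmetric] J_def by (simp only: indicator_UN_disjoint[OF finB disjoint_dyad])
      also have "\<dots> \<le> ?g x" by (simp add: indicator_def)
      finally show "(\<Sum>n\<in>B. ind (J n) x * ?g x) \<le> ?g x" .
    qed simp
    also have "(NN x. wg x * ?U x) \<le> ennreal (68 * c) * (NN x. ?g x)"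
      by (rule good_part[OF U _ wgm _ wg0 wgk]) (use c z[of "-1" 1] in auto)
    also have "\<dots> \<le> ennreal (a / 4) * (NN x. ?g x)"
      using c by (intro mult_right_mono ennreal_leI) auto
    finally have "(NN x. ennreal (w x) * ?U x) \<le> ennreal (a / 4) * (NN x. ?g x) + ennreal (a / 4) * (NN x. ?g x)"
      by (simp add: add_mono)
    also have "\<dots> = (ennreal (a / 4) + ennreal (a / 4)) * (NN x. ?g x)" by (simp add: distrib_right)
    also have "ennreal (a / 4) + ennreal (a / 4) = ennreal (a / 2)" using a by (simp add: ennreal_plus[symmetric] del: ennreal_plus)
    finally show "(NN x. ennreal (w x) * ?U x) \<le> ennreal (a / 2) * (NN x. ?g x)" .
  qed
qed

subsection \<open>Borel representatives\<close>

lemma open_strip: "open (strip a)"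
  unfolding strip_def by (intro open_Collect_conj open_Collect_less continuous_intros)

lemma AE_lebesgue_iff: "(AE x in lebesgue. P x) \<longleftrightarrow> (AE x in lborel. P x)"
  by (rule AE_completion_iff)

lemma complex_borel_representative:
  fixes f :: "'a::euclidean_space \<Rightarrow> complex"
  assumes f: "f \<in> borel_measurable (lebesgue_on S)" and S: "S \<in> sets borel"
  obtains f' where "f' \<in> BM" "\<And>x. x \<notin> S \<Longrightarrow> f' x = 0" "AE x in lborel. x \<in> S \<longrightarrow> f x = f' x"
proof -
  have "(\<lambda>x. ind S x *\<^sub>R f x) \<in> borel_measurable lebesgue"
    using f S by (subst (asm) borel_measurable_restrict_space_iff) auto
  then have "(\<lambda>x. Re (ind S x *\<^sub>R f x)) \<in> borel_measurable lebesgue" "(\<lambda>x. Im (ind S x *\<^sub>R f x)) \<in> borel_measurable lebesgue"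
    by - (rule measurable_compose[OF _ borel_measurable_Re] measurable_compose[OF _ borel_measurable_Im], assumption)+
  from completion_ex_borel_measurable_real[OF this(1)] completion_ex_borel_measurable_real[OF this(2)]
  obtain p q where pq: "p \<in> borel_measurable lborel" "AE x in lborel. Re (ind S x *\<^sub>R f x) = p x"
    "q \<in> borel_measurable lborel" "AE x in lborel. Im (ind S x *\<^sub>R f x) = q x" by blast
  define f' where "f' x = ind S x *\<^sub>R Complex (p x) (q x)" for x
  show ?thesis
  proof (rule that[of f'])
    have "(\<lambda>x. Complex (p x) (q x)) = (\<lambda>x. of_real (p x) + \<i> * of_real (q x))"
      by (auto simp: complex_eq_iff)
    then have "(\<lambda>x. Complex (p x) (q x)) \<in> BM" using pq(1,3) by simp
    then show "f' \<in> BM"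
      unfolding f'_def by (intro borel_measurable_scaleR borel_measurable_indicator S)
    show "f' x = 0" if "x \<notin> S" for x using that by (simp add: f'_def)
    show "AE x in lborel. x \<in> S \<longrightarrow> f x = f' x"
      using pq(2,4) by eventually_elim (auto simp: f'_def complex_eq_iff)
  qed
qed

lemma integral_lebesgue_on_AE:
  fixes f f' :: "'a::euclidean_space \<Rightarrow> 'b::{banach, second_countable_topology}"
  assumes f: "f \<in> borel_measurable (lebesgue_on S)" and S: "S \<in> sets borel"
    and f': "f' \<in> BM" and eq: "AE x in lborel. x \<in> S \<longrightarrow> f x = f' x"
  shows "(\<integral>x. f x \<partial>lebesgue_on S) = (sint S f')"
proof -
  have "(\<integral>x. f x \<partial>lebesgue_on S) = (\<integral>x. ind S x *\<^sub>R f x \<partial>lebesgue)"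
    using S by (intro integral_restrict_space) simp
  also have "\<dots> = (\<integral>x. ind S x *\<^sub>R f' x \<partial>lebesgue)"
  proof (rule integral_cong_AE)
    show "(\<lambda>x. ind S x *\<^sub>R f x) \<in> borel_measurable lebesgue"
      using f S by (subst (asm) borel_measurable_restrict_space_iff) auto
    show "(\<lambda>x. ind S x *\<^sub>R f' x) \<in> borel_measurable lebesgue"
      using f' S by (intro measurable_completion) simp
    show "AE x in lebesgue. ind S x *\<^sub>R f x = ind S x *\<^sub>R f' x"
      using eq unfolding AE_lebesgue_iff by eventually_elim (auto simp: indicator_def)
  qed
  also have "\<dots> = (sint S f')"
    using f' S by (intro integral_completion) simp
  finally show ?thesis .
qed

lemma nn_integral_lebesgue_on_AE:
  fixes f f' :: "'a::euclidean_space \<Rightarrow> ennreal"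
  assumes S: "S \<in> sets borel" and f': "f' \<in> BM" and eq: "AE x in lborel. x \<in> S \<longrightarrow> f x = f' x"
  shows "(\<integral>\<^sup>+x. f x \<partial>lebesgue_on S) = (NN x. ind S x * f' x)"
proof -
  have "(\<integral>\<^sup>+x. f x \<partial>lebesgue_on S) = (\<integral>\<^sup>+x. f x * ind S x \<partial>lebesgue)"
    using S by (intro nn_integral_restrict_space) simp
  also have "\<dots> = (\<integral>\<^sup>+x. f' x * ind S x \<partial>lebesgue)"
    by (rule nn_integral_cong_AE) (use eq in \<open>unfold AE_lebesgue_iff, eventually_elim, simp add: indicator_def\<close>)
  also have "\<dots> = (NN x. f' x * ind S x)"
    by (rule nn_integral_completion)
  finally show ?thesis by (simp add: mult.commute)
qed

text \<open>Extension by zero turns integrals over \<open>lebesgue_on S\<close> into integrals over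
  \<open>lborel\<close>, where the Fubini arguments take place.\<close>

lemma L2_representative:
  assumes u: "u \<in> L2 S" and S: "S \<in> sets borel"
  obtains u' where "u' \<in> BM" "\<And>x. x \<notin> S \<Longrightarrow> u' x = 0" "AE x in lborel. x \<in> S \<longrightarrow> u x = u' x"
    "sq_int u'"
proof -
  have um: "u \<in> borel_measurable (lebesgue_on S)" and ui: "integrable (lebesgue_on S) (\<lambda>x. nsq (u x))"
    using u by (auto simp: L2_def)
  obtain u' where u': "u' \<in> BM" "\<And>x. x \<notin> S \<Longrightarrow> u' x = 0" "AE x in lborel. x \<in> S \<longrightarrow> u x = u' x"
    by (rule complex_borel_representative[OF um S]) (rule that)
  have "sq_int u'"
  proof (rule integrableI_bounded)
    have "(NN x. ennreal (norm (nsq (u' x)))) = (NN x. ind S x * esq (u' x))"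
      using u'(2) by (intro nn_integral_cong) (auto simp: indicator_def)
    also have "\<dots> = (\<integral>\<^sup>+x. esq (u x) \<partial>lebesgue_on S)"
      by (rule nn_integral_lebesgue_on_AE[OF S, symmetric]) (use u'(1) in simp, use u'(3) in \<open>eventually_elim, simp\<close>)
    also have "\<dots> < \<infinity>" using ui by (simp add: integrable_iff_bounded)
    finally show "(NN x. ennreal (norm (nsq (u' x)))) < \<infinity>" .
  qed (use u'(1) in simp)
  with u' show ?thesis by (rule that)
qed

lemma product_test_function:
  assumes f: "\<And>n. smooth_k n f" "\<And>x. x \<notin> {p..q} \<Longrightarrow> f x = 0"
    and g: "\<And>n. smooth_k n g" "\<And>x. x \<notin> {c..d} \<Longrightarrow> g x = 0"
    and cd: "0 < c" "d < a"
  shows "(\<lambda>z. f (fst z) * g (snd z)) \<in> test_functions (strip a)"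
proof -
  have "compact ({p..q} \<times> {c..d})" by (intro compact_Times) auto
  moreover have "{p..q} \<times> {c..d} \<subseteq> strip a" using cd by (auto simp: strip_def)
  moreover have "f (fst z) * g (snd z) = 0" if "z \<notin> {p..q} \<times> {c..d}" for z
    using that f(2)[of "fst z"] g(2)[of "snd z"] by (auto simp: mem_Times_iff)
  ultimately show ?thesis
    unfolding test_functions_def mem_Collect_eq
    by (intro conjI allI C_k_product f(1) g(1) exI[of _ "{p..q} \<times> {c..d}"]) auto
qed

lemma frechet_derivative_product:
  fixes f g :: "real \<Rightarrow> real"
  assumes "(f has_real_derivative f') (at (fst x))" "(g has_real_derivative g') (at (snd x))"
  shows "frechet_derivative (\<lambda>z. f (fst z) * g (snd z)) (at x) = (\<lambda>h. fst h * (f' * g (snd x)) + snd h * (f (fst x) * g'))"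
proof -
  have "((\<lambda>x. f (fst x)) has_derivative (\<lambda>h. f' * fst h)) (at x)"
    by (rule has_derivative_compose[OF has_derivative_fst[OF has_derivative_ident] assms(1)[THEN has_field_derivative_imp_has_derivative]])
  moreover have "((\<lambda>x. g (snd x)) has_derivative (\<lambda>h. g' * snd h)) (at x)"
    by (rule has_derivative_compose[OF has_derivative_snd[OF has_derivative_ident] assms(2)[THEN has_field_derivative_imp_has_derivative]])
  ultimately have "((\<lambda>z. f (fst z) * g (snd z)) has_derivative (\<lambda>h. fst h * (f' * g (snd x)) + snd h * (f (fst x) * g'))) (at x)"
    by (rule has_derivative_eq_rhs[OF has_derivative_mult]) (auto simp: fun_eq_iff algebra_simps)
  from frechet_derivative_at[OF this] show ?thesis by simp
qed

lemma smooth_k_derivative_continuous: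
  assumes f: "smooth_k (Suc 0) f" and f': "\<And>x. (f has_real_derivative f' x) (at x)"
  shows "continuous_on UNIV f'"
proof -
  from f obtain f'' where "\<forall>x. (f has_real_derivative f'' x) (at x)" "continuous_on UNIV f''" by auto
  moreover have "f'' = f'" using DERIV_unique calculation(1) f' by blast
  ultimately show ?thesis by simp
qed

section \<open>From weak partial derivatives to the integrated form\<close>

lemma integral_lborel_swap:
  fixes f :: "plane \<Rightarrow> complex"
  assumes "f \<in> BM"
  shows "(LINT z|lborel. f (snd z, fst z)) = (LINT z|lborel. f z)"
proof -
  have "f \<in> borel_measurable (lborel \<Otimes>\<^sub>M lborel)" using assms by (simp add: lborel_prod)
  from lborel_pair.integral_product_swap[OF this]
  show ?thesis by (simp add: lborel_prod split_beta')
qed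

lemma swap_measurable:
  assumes f: "f \<in> BM"
  shows "(\<lambda>z::plane. f (snd z, fst z)) \<in> BM"
  by (rule measurable_compose[OF _ f]) (intro borel_measurable_continuous_onI continuous_intros)

lemma rint_swap:
  assumes "u \<in> BM"
  shows "rint (\<lambda>z. u (snd z, fst z)) p q c d = rint u c d p q"
proof -
  have "rint (\<lambda>z. u (snd z, fst z)) p q c d = (LINT z|lborel. ind ({c<..<d} \<times> {p<..<q}) (snd z, fst z) *\<^sub>R u (snd z, fst z))"
    unfolding rint_def by (intro Bochner_Integration.integral_cong) (auto simp: indicator_times mult.commute)
  also have "\<dots> = rint u c d p q"
    unfolding rint_def by (rule integral_lborel_swap[of "\<lambda>z. ind ({c<..<d} \<times> {p<..<q}) z *\<^sub>R u z"])
      (intro borel_measurable_scaleR borel_measurable_indicator rect_borel assms)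
  finally show ?thesis .
qed

text \<open>Membership in \<open>W12\<close> supplies a witness for the choice in
  \<open>weak_partial\<close>, so the chosen functions satisfy the weak identity, and product test
  functions feed it to \<open>weak_derivative_rint\<close>. The second partial derivative is treated
  by the same lemma after an exchange of the coordinates.\<close>

lemma W12_rect_weak_grad:
  assumes u: "u \<in> W12 (strip a)"
  obtains u' g1 g2 where "rect_weak_grad a u' g1 g2"
    "\<And>z. z \<notin> strip a \<Longrightarrow> u' z = 0 \<and> g1 z = 0 \<and> g2 z = 0"
    "AE z in lborel. z \<in> strip a \<longrightarrow> u z = u' z"
    "AE z in lborel. z \<in> strip a \<longrightarrow> weak_partial (strip a) (1, 0) u z = g1 z"
    "AE z in lborel. z \<in> strip a \<longrightarrow> weak_partial (strip a) (0, 1) u z = g2 z"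
    "weak_partial (strip a) (1, 0) u \<in> L2 (strip a)" "weak_partial (strip a) (0, 1) u \<in> L2 (strip a)"
proof -
  let ?S = "strip a"
  have S: "?S \<in> sets borel" by (rule borel_open[OF open_strip])
  have uL: "u \<in> L2 ?S" using u by (simp add: W12_def)
  have B: "(1, 0) \<in> (Basis :: (plane) set)" "(0, 1) \<in> (Basis :: (plane) set)" by (simp_all add: Basis_prod_def)
  have wp: "weak_partial ?S e u \<in> L2 ?S \<and> has_weak_partial ?S e u (weak_partial ?S e u)" if "e \<in> Basis" for e
  proof -
    have "\<exists>g. g \<in> L2 ?S \<and> has_weak_partial ?S e u g" using u that unfolding W12_def by blast
    then show ?thesis unfolding weak_partial_def by (rule someI_ex)
  qed
  obtain u' where u': "u' \<in> BM" "\<And>x. x \<notin> ?S \<Longrightarrow> u' x = 0" "AE x in lborel. x \<in> ?S \<longrightarrow> u x = u' x"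
    "sq_int u'" by (rule L2_representative[OF uL S]) (rule that)
  obtain g1 where g1: "g1 \<in> BM" "\<And>x. x \<notin> ?S \<Longrightarrow> g1 x = 0" "AE x in lborel. x \<in> ?S \<longrightarrow> weak_partial ?S (1, 0) u x = g1 x"
    "sq_int g1" by (rule L2_representative[OF wp[OF B(1), THEN conjunct1] S]) (rule that)
  obtain g2 where g2: "g2 \<in> BM" "\<And>x. x \<notin> ?S \<Longrightarrow> g2 x = 0" "AE x in lborel. x \<in> ?S \<longrightarrow> weak_partial ?S (0, 1) u x = g2 x"
    "sq_int g2" by (rule L2_representative[OF wp[OF B(2), THEN conjunct1] S]) (rule that)
  have conv: "(\<integral>x. v x * of_real (\<psi> x) \<partial>lebesgue_on ?S) = (LINT x|lborel. v' x * of_real (\<psi> x))"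
    if v: "v \<in> L2 ?S" "v' \<in> BM" "\<And>x. x \<notin> ?S \<Longrightarrow> v' x = 0" "AE x in lborel. x \<in> ?S \<longrightarrow> v x = v' x"
      and \<psi>: "\<psi> \<in> BM" for v v' \<psi>
  proof -
    have \<psi>c: "(\<lambda>x. complex_of_real (\<psi> x)) \<in> BM" by (rule measurable_compose[OF \<psi> borel_measurable_of_real])
    have "(\<lambda>x. complex_of_real (\<psi> x)) \<in> borel_measurable (lebesgue_on ?S)"
      by (intro measurable_restrict_space1 measurable_completion) (simp add: \<psi>c)
    then have "(\<integral>x. v x * of_real (\<psi> x) \<partial>lebesgue_on ?S) = (sint ?S (\<lambda>x. (v' x * of_real (\<psi> x))))"
      using v \<psi>c by (intro integral_lebesgue_on_AE S borel_measurable_times) (auto simp: L2_def)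
    also have "\<dots> = (LINT x|lborel. v' x * of_real (\<psi> x))"
      using v(3) by (intro Bochner_Integration.integral_cong) (auto simp: indicator_def)
    finally show ?thesis .
  qed
  have weak: "(LINT x|lborel. u' x * of_real (frechet_derivative \<phi> (at x) e)) = - (LINT x|lborel. g' x * of_real (\<phi> x))"
    if e: "e \<in> Basis" and g': "g' \<in> BM" "\<And>x. x \<notin> ?S \<Longrightarrow> g' x = 0" "AE x in lborel. x \<in> ?S \<longrightarrow> weak_partial ?S e u x = g' x"
      and \<phi>: "\<phi> \<in> test_functions ?S" "\<phi> \<in> BM" "(\<lambda>x. frechet_derivative \<phi> (at x) e) \<in> BM" for e g' \<phi>
  proof -
    have "(\<integral>x. u x * of_real (frechet_derivative \<phi> (at x) e) \<partial>lebesgue_on ?S) = - (\<integral>x. weak_partial ?S e u x * of_real (\<phi> x) \<partial>lebesgue_on ?S)"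
      using wp[OF e] \<phi>(1) unfolding has_weak_partial_def by blast
    moreover have "(\<integral>x. u x * of_real (frechet_derivative \<phi> (at x) e) \<partial>lebesgue_on ?S) = (LINT x|lborel. u' x * of_real (frechet_derivative \<phi> (at x) e))"
      by (rule conv[OF uL u'(1-3) \<phi>(3)])
    moreover have "(\<integral>x. weak_partial ?S e u x * of_real (\<phi> x) \<partial>lebesgue_on ?S) = (LINT x|lborel. g' x * of_real (\<phi> x))"
      by (rule conv[OF wp[OF e, THEN conjunct1] g' \<phi>(2)])
    ultimately show ?thesis by (simp only:)
  qed
  have prod: "(LINT z|lborel. u' z * of_real (f' (fst z) * g (snd z))) = - (LINT z|lborel. g1 z * of_real (f (fst z) * g (snd z))) \<and>
      (LINT z|lborel. u' z * of_real (f (fst z) * g' (snd z))) = - (LINT z|lborel. g2 z * of_real (f (fst z) * g (snd z)))"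
    if f: "\<And>n. smooth_k n f" "\<And>x. x \<notin> {p..q} \<Longrightarrow> f x = 0" "\<And>x. (f has_real_derivative f' x) (at x)"
      and g: "\<And>n. smooth_k n g" "\<And>x. x \<notin> {c..d} \<Longrightarrow> g x = 0" "\<And>x. (g has_real_derivative g' x) (at x)"
      and cd: "0 < c" "d < a" for f f' g g' p q c d
  proof -
    let ?\<phi> = "\<lambda>z::plane. f (fst z) * g (snd z)"
    have tf: "?\<phi> \<in> test_functions ?S" by (rule product_test_function[OF f(1,2) g(1,2) cd])
    have fd: "frechet_derivative ?\<phi> (at x) = (\<lambda>h. fst h * (f' (fst x) * g (snd x)) + snd h * (f (fst x) * g' (snd x)))" for x
      by (rule frechet_derivative_product[OF f(3) g(3)])
    have m: "f \<in> BM" "g \<in> BM" "f' \<in> BM" "g' \<in> BM"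
      by (intro borel_measurable_continuous_onI smooth_k_continuous[OF f(1)] smooth_k_continuous[OF g(1)]
          smooth_k_derivative_continuous[OF f(1) f(3)] smooth_k_derivative_continuous[OF g(1) g(3)])+
    have m\<phi>: "?\<phi> \<in> BM"
      by (intro borel_measurable_times measurable_compose[OF fst_borel_measurable] measurable_compose[OF snd_borel_measurable] m)
    have d1: "(\<lambda>x. frechet_derivative ?\<phi> (at x) (1, 0)) = (\<lambda>x. f' (fst x) * g (snd x))" by (simp add: fd)
    have d2: "(\<lambda>x. frechet_derivative ?\<phi> (at x) (0, 1)) = (\<lambda>x. f (fst x) * g' (snd x))" by (simp add: fd)
    have md1: "(\<lambda>x. frechet_derivative ?\<phi> (at x) (1, 0)) \<in> BM"
      unfolding d1 by (intro borel_measurable_times measurable_compose[OF fst_borel_measurable] measurable_compose[OF snd_borel_measurable] m)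
    have md2: "(\<lambda>x. frechet_derivative ?\<phi> (at x) (0, 1)) \<in> BM"
      unfolding d2 by (intro borel_measurable_times measurable_compose[OF fst_borel_measurable] measurable_compose[OF snd_borel_measurable] m)
    show ?thesis
      using weak[OF B(1) g1(1-3) tf m\<phi> md1] weak[OF B(2) g2(1-3) tf m\<phi> md2] by (simp add: fd)
  qed
  have "rect_weak_grad a u' g1 g2"
    unfolding rect_weak_grad_def
  proof (intro conjI allI impI)
    fix s t h c d :: real assume st: "s \<le> t" "0 < h" "0 \<le> c" "d \<le> a"
    show "rint u' t (t + h) c d - rint u' s (s + h) c d = (sint {s<..<t} (\<lambda>r. rint g1 r (r + h) c d))"
    proof (rule weak_derivative_rint[OF u'(1) g1(1) integrable_rect_L2[OF u'(1,4)] integrable_rect_L2[OF g1(1,4)] st(1,2)])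
      fix \<alpha> \<alpha>' \<beta> and \<epsilon> :: real
      assume A: "\<And>n. smooth_k n \<alpha>" "\<And>n. smooth_k n \<beta>" "\<epsilon> > 0" "\<And>x. (\<alpha> has_real_derivative \<alpha>' x) (at x)"
        "\<And>x. x \<notin> {s + \<epsilon>..t + h - \<epsilon>} \<Longrightarrow> \<alpha> x = 0" "\<And>x. x \<notin> {c + \<epsilon>..d - \<epsilon>} \<Longrightarrow> \<beta> x = 0"
      from A(2)[of "Suc 0"] obtain \<beta>' where \<beta>': "\<And>x. (\<beta> has_real_derivative \<beta>' x) (at x)" by auto
      \<comment> \<open>The margin places the support in a compact subset of the open strip even for
        \<open>c = 0\<close> and \<open>d = a\<close>.\<close>
      have cd: "0 < c + \<epsilon>" "d - \<epsilon> < a" using st A(3) by auto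
      show "(LINT x|lborel. u' x * of_real (\<alpha>' (fst x) * \<beta> (snd x))) = - (LINT x|lborel. g1 x * of_real (\<alpha> (fst x) * \<beta> (snd x)))"
        using prod[OF A(1,5,4) A(2,6) \<beta>' cd] by (rule conjunct1)
    qed
  next
    fix s t h p q :: real assume st: "s \<le> t" "0 < h" "0 \<le> s" "t + h \<le> a"
    let ?u = "\<lambda>z. u' (snd z, fst z)" and ?g = "\<lambda>z. g2 (snd z, fst z)"
    have i: "integrable lborel (\<lambda>z. nsq (v (snd z, fst z)))" if "v \<in> BM" "sq_int v" for v :: "plane \<Rightarrow> complex"
    proof -
      have "integrable (lborel \<Otimes>\<^sub>M lborel) (\<lambda>z. nsq (v z))" using that by (simp add: lborel_prod)
      from lborel_pair.integrable_product_swap[OF this] show ?thesis by (simp add: lborel_prod split_beta')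
    qed
    have um: "?u \<in> BM" "?g \<in> BM" by (intro swap_measurable u'(1) g2(1))+
    have "rint ?u t (t + h) p q - rint ?u s (s + h) p q = (sint {s<..<t} (\<lambda>r. rint ?g r (r + h) p q))"
    proof (rule weak_derivative_rint[OF um integrable_rect_L2[OF um(1) i[OF u'(1,4)]] integrable_rect_L2[OF um(2) i[OF g2(1,4)]] st(1,2)])
      fix \<alpha> \<alpha>' \<beta> and \<epsilon> :: real
      assume A: "\<And>n. smooth_k n \<alpha>" "\<And>n. smooth_k n \<beta>" "\<epsilon> > 0" "\<And>x. (\<alpha> has_real_derivative \<alpha>' x) (at x)"
        "\<And>x. x \<notin> {s + \<epsilon>..t + h - \<epsilon>} \<Longrightarrow> \<alpha> x = 0" "\<And>x. x \<notin> {p + \<epsilon>..q - \<epsilon>} \<Longrightarrow> \<beta> x = 0"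
      from A(2)[of "Suc 0"] obtain \<beta>' where \<beta>': "\<And>x. (\<beta> has_real_derivative \<beta>' x) (at x)" by auto
      have cd: "0 < s + \<epsilon>" "t + h - \<epsilon> < a" using st A(3) by auto
      have P: "(LINT z|lborel. u' z * of_real (\<beta> (fst z) * \<alpha>' (snd z))) = - (LINT z|lborel. g2 z * of_real (\<beta> (fst z) * \<alpha> (snd z)))"
        using prod[OF A(2,6) \<beta>' A(1,5,4) cd] by (rule conjunct2)
      have m: "\<alpha> \<in> BM" "\<beta> \<in> BM" "\<alpha>' \<in> BM"
        by (intro borel_measurable_continuous_onI smooth_k_continuous[OF A(1)] smooth_k_continuous[OF A(2)]
            smooth_k_derivative_continuous[OF A(1) A(4)])+
      have sw: "(LINT x|lborel. v (snd x, fst x) * of_real (\<gamma> (fst x) * \<beta> (snd x))) = (LINT z|lborel. v z * of_real (\<beta> (fst z) * \<gamma> (snd z)))"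
        if "v \<in> BM" "\<gamma> \<in> BM" for v :: "plane \<Rightarrow> complex" and \<gamma>
      proof -
        have "(\<lambda>z. v z * of_real (\<beta> (fst z) * \<gamma> (snd z))) \<in> BM"
          by (intro borel_measurable_times measurable_compose[OF _ borel_measurable_of_real] measurable_compose[OF fst_borel_measurable]
            measurable_compose[OF snd_borel_measurable] m that)
        from integral_lborel_swap[OF this] show ?thesis by (simp add: mult.commute)
      qed
      show "(LINT x|lborel. ?u x * of_real (\<alpha>' (fst x) * \<beta> (snd x))) = - (LINT x|lborel. ?g x * of_real (\<alpha> (fst x) * \<beta> (snd x)))"
        unfolding sw[OF u'(1) m(3)] sw[OF g2(1) m(1)] by (rule P)
    qed
    then show "rint u' p q t (t + h) - rint u' p q s (s + h) = (sint {s<..<t} (\<lambda>r. rint g2 p q r (r + h)))"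
      unfolding rint_swap[OF u'(1)] rint_swap[OF g2(1)] .
  qed (use u' g1 g2 in simp_all)
  then show ?thesis
    using u' g1 g2 wp[OF B(1)] wp[OF B(2)] by (intro that) auto
qed

lemma measurable_lebesgue_on_AE:
  fixes f f' :: "'a::euclidean_space \<Rightarrow> real"
  assumes S: "S \<in> sets borel" and f': "f' \<in> BM" and eq: "AE x in lborel. x \<in> S \<longrightarrow> f x = f' x"
  shows "f \<in> borel_measurable (lebesgue_on S)"
proof -
  have "(\<lambda>x. ind S x *\<^sub>R f x) \<in> borel_measurable lebesgue"
  proof (rule borel_measurable_AE)
    show "(\<lambda>x. ind S x *\<^sub>R f' x) \<in> borel_measurable lebesgue"
      using f' S by (intro measurable_completion) simp
    show "AE x in lebesgue. ind S x *\<^sub>R f' x = ind S x *\<^sub>R f x"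
      using eq unfolding AE_lebesgue_iff by eventually_elim (auto simp: indicator_def)
  qed
  then show ?thesis using S by (subst borel_measurable_restrict_space_iff) auto
qed

section \<open>Borel versions of the potential and of the quantities \<open>G\<close> and
  \<open>D\<close>\<close>

lemma potential_representative:
  assumes V: "\<And>x. x \<in> strip a \<Longrightarrow> 0 \<le> V x" and int: "integrable_on_bounded_subsets (strip a) V"
  obtains W where "W \<in> BM" "\<And>z. 0 \<le> W z" "\<And>z. z \<notin> strip a \<Longrightarrow> W z = 0"
    "AE z in lborel. z \<in> strip a \<longrightarrow> V z = W z"
    "\<And>B. B \<in> sets borel \<Longrightarrow> bounded B \<Longrightarrow> (NN z. ind B z * ennreal (W z)) < \<infinity>"
proof -
  let ?S = "strip a"
  have S: "?S \<in> sets borel" by (rule borel_open[OF open_strip])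
  have piece: "integrable (lebesgue_on (B \<inter> ?S)) V" if "B \<in> sets borel" "bounded B" for B
  proof -
    have "B \<inter> ?S \<in> sets lebesgue" using that(1) S by (intro sets.Int sets_completionI_sets) simp_all
    moreover have "bounded (B \<inter> ?S)" by (rule bounded_subset[OF that(2) Int_lower1])
    ultimately show ?thesis using int unfolding integrable_on_bounded_subsets_def by blast
  qed
  let ?B = "\<lambda>k::nat. ball (0 :: plane) (real k) \<inter> ?S"
  have Bm: "?B k \<in> sets borel" for k using S by simp
  \<comment> \<open>Integrability gives measurability of \<open>V\<close> on bounded pieces only;
    the strip is exhausted by balls.\<close>
  have "(\<lambda>x. ind ?S x *\<^sub>R V x) \<in> borel_measurable lebesgue"
  proof (rule borel_measurable_LIMSEQ_metric)
    fix k :: nat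
    have "V \<in> borel_measurable (lebesgue_on (?B k))"
      by (rule borel_measurable_integrable[OF piece]) auto
    then show "(\<lambda>x. ind (?B k) x *\<^sub>R V x) \<in> borel_measurable lebesgue"
      using Bm[of k] by (subst (asm) borel_measurable_restrict_space_iff) auto
  next
    fix x :: "plane"
    obtain k0 :: nat where k0: "norm x < k0" using reals_Archimedean2 by blast
    have "\<forall>\<^sub>F k in sequentially. ind (?B k) x *\<^sub>R V x = ind ?S x *\<^sub>R V x"
      using eventually_ge_at_top[of k0] by eventually_elim (use k0 in \<open>auto simp: indicator_def\<close>)
    then show "(\<lambda>k. ind (?B k) x *\<^sub>R V x) \<longlonglongrightarrow> ind ?S x *\<^sub>R V x" by (rule tendsto_eventually)
  qed
  from completion_ex_borel_measurable_real[OF this]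
  obtain p where p: "p \<in> borel_measurable lborel" "AE x in lborel. ind ?S x *\<^sub>R V x = p x" by blast
  \<comment> \<open>The maximum with 0 repairs the null set of points of the strip where the Borel
    version \<open>p\<close> is negative although \<open>V\<close> is not.\<close>
  define W where "W z = ind ?S z * max 0 (p z)" for z
  have Wm: "W \<in> BM" unfolding W_def[abs_def] using p(1) S by simp
  have W0: "0 \<le> W z" for z by (simp add: W_def)
  have WV: "AE z in lborel. z \<in> ?S \<longrightarrow> V z = W z"
    using p(2) 
  proof eventually_elim
    case (elim z)
    then show ?case using V[of z] by (auto simp: W_def)
  qed
  have fin: "(NN z. ind B z * ennreal (W z)) < \<infinity>" if B: "B \<in> sets borel" "bounded B" for B
  proof -
    have "(NN z. ind B z * ennreal (W z)) = (NN z. ind (B \<inter> ?S) z * ennreal (W z))"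
      by (intro nn_integral_cong) (auto simp: W_def indicator_def)
    also have "\<dots> = (\<integral>\<^sup>+z. ennreal (V z) \<partial>lebesgue_on (B \<inter> ?S))"
    proof (rule nn_integral_lebesgue_on_AE[symmetric])
      show "AE z in lborel. z \<in> B \<inter> ?S \<longrightarrow> ennreal (V z) = ennreal (W z)" using WV by eventually_elim auto
    qed (use B S Wm in auto)
    also have "\<dots> \<le> (\<integral>\<^sup>+z. ennreal (norm (V z)) \<partial>lebesgue_on (B \<inter> ?S))"
      by (intro nn_integral_mono ennreal_leI) simp
    also have "\<dots> < \<infinity>" using piece[OF B] by (simp add: integrable_iff_bounded)
    finally show ?thesis .
  qed
  show ?thesis by (rule that[OF Wm W0 _ WV fin]) (simp_all add: W_def)
qed

text \<open>Valued in \<open>ennreal\<close>, since a null set of columns may carry infinite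
  mass.\<close>

definition column_weight :: "real \<Rightarrow> (plane \<Rightarrow> real) \<Rightarrow> real \<Rightarrow> ennreal" where
  "column_weight a W x = (NN y. ind {0<..<a} y * ennreal (W (x, y)))"

lemma column_weight_measurable:
  assumes W: "W \<in> BM"
  shows "column_weight a W \<in> BM"
proof -
  have "(\<lambda>z::plane. ind {0<..<a} (snd z) * ennreal (W z)) \<in> BM"
    by (intro borel_measurable_times_ennreal measurable_compose[OF snd_borel_measurable borel_measurable_indicator]
        measurable_compose[OF W measurable_ennreal]) simp
  then have "(\<lambda>(x, y). ind {0<..<a} y * ennreal (W (x, y))) \<in> borel_measurable (lborel \<Otimes>\<^sub>M lborel)"
    by (simp only: lborel_prod measurable_lborel2 split_beta' prod.collapse)
  then have "(\<lambda>(x, y). ind {0<..<a} y * ennreal (W (x, y))) \<in> borel_measurable (borel \<Otimes>\<^sub>M lborel)"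
    by (simp cong: measurable_cong_sets)
  from lborel.borel_measurable_nn_integral[OF this] show ?thesis by (simp only: column_weight_def[abs_def])
qed

text \<open>Fubini on bounded rectangles over \<open>[-k, k]\<close>, which exhaust the strip
  countably.\<close>

lemma column_weight_finite:
  assumes W: "W \<in> BM" and a: "0 < a"
    and fin: "\<And>B. B \<in> sets borel \<Longrightarrow> bounded B \<Longrightarrow> (NN z. ind B z * ennreal (W z)) < \<infinity>"
  shows "AE x in lborel. column_weight a W x < \<infinity>"
proof -
  have "AE x in lborel. x \<in> {- real k..real k} \<longrightarrow> column_weight a W x < \<infinity>" for k :: nat
  proof -
    let ?B = "{- real k..real k} \<times> {0<..<a}"
    have B: "?B \<in> sets borel" "bounded ?B" by (auto intro!: borel_Times bounded_Times)
    have m: "(\<lambda>z. ind ?B z * ennreal (W z)) \<in> BM"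
      by (intro borel_measurable_times_ennreal borel_measurable_indicator B(1) measurable_compose[OF W measurable_ennreal])
    have "(NN x. ind {- real k..real k} x * column_weight a W x) = (NN x. NN y. ind ?B (x, y) * ennreal (W (x, y)))"
      by (intro nn_integral_cong) (auto simp: column_weight_def indicator_def intro!: nn_integral_cong)
    also have "\<dots> = (NN z. ind ?B z * ennreal (W z))"
      by (rule nn_integral_lborel2(1)[OF m, symmetric])
    also have "\<dots> < \<infinity>" by (rule fin[OF B])
    finally have "(NN x. ind {- real k..real k} x * column_weight a W x) \<noteq> \<infinity>" by simp
    then have "AE x in lborel. ind {- real k..real k} x * column_weight a W x \<noteq> \<infinity>"
      by (intro nn_integral_PInf_AE) (use column_weight_measurable[OF W, of a] in simp)
    then show ?thesis by eventually_elim (auto simp: less_top)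
  qed
  then have "AE x in lborel. \<forall>k::nat. x \<in> {- real k..real k} \<longrightarrow> column_weight a W x < \<infinity>"
    by (subst AE_all_countable) blast
  then show ?thesis
  proof eventually_elim
    case (elim x)
    obtain k :: nat where "\<bar>x\<bar> < k" using reals_Archimedean2 by blast
    then show ?case using elim by (metis abs_le_iff atLeastAtMost_iff less_imp_le minus_le_iff)
  qed
qed

lemma AE_sections:
  assumes "AE z in lborel. z \<in> strip a \<longrightarrow> V z = W z"
  shows "AE x in lborel. AE y in lborel. y \<in> {0<..<a} \<longrightarrow> V (x, y) = W (x, y)"
proof -
  have "AE z in lborel \<Otimes>\<^sub>M lborel. z \<in> strip a \<longrightarrow> V z = W z" unfolding lborel_prod by (rule assms)
  from lborel_pair.AE_pair[OF this] show ?thesis by (simp add: strip_def)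
qed

lemma norm_B_cong_AE:
  assumes f': "f' \<in> BM" and I: "I \<in> sets borel" and eq: "AE x in lborel. x \<in> I \<longrightarrow> f x = f' x"
  shows "norm_B I f' = norm_B I f"
proof -
  have "f' \<in> borel_measurable (lebesgue_on I)" "f \<in> borel_measurable (lebesgue_on I)"
    by (rule measurable_lebesgue_on_AE[OF I f'], use eq in auto)+
  moreover have "AE x in lebesgue_on I. f x = f' x"
    using eq I by (subst AE_restrict_space_iff) (auto simp: AE_lebesgue_iff)
  ultimately have "(\<integral>x. f' x * g x \<partial>lebesgue_on I) = (\<integral>x. f x * g x \<partial>lebesgue_on I)" if "g \<in> borel_measurable (lebesgue_on I)" for g
    by (intro integral_cong_AE) (use that in auto)
  then show ?thesis unfolding norm_B_def by (intro SUP_cong) auto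
qed

text \<open>\<open>G\<close> is an iterated Bochner integral, which would be 0 by convention without
  integrability. Finite mass on bounded sets makes the outer integral genuine; for a column of
  infinite mass both the inner integral and \<open>enn2real\<close> give 0, so the integrands still
  agree.\<close>

lemma G_eq_column_weight:
  assumes W: "W \<in> BM" "\<And>z. 0 \<le> W z" and VW: "AE z in lborel. z \<in> strip a \<longrightarrow> V z = W z"
    and a: "0 < a"
    and fin: "\<And>B. B \<in> sets borel \<Longrightarrow> bounded B \<Longrightarrow> (NN z. ind B z * ennreal (W z)) < \<infinity>"
  shows "ennreal (G a V n) =
      (NN x. ind (I_int n) x * ennreal ((if n = 0 then 1 else \<bar>x\<bar>) * enn2real (column_weight a W x)))"
    and "0 \<le> G a V n"
proof -
  define k where "k x = (if n = 0 then 1 else \<bar>x\<bar>)" for x :: real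
  have k0: "0 \<le> k x" for x by (simp add: k_def)
  have km: "k \<in> BM" by (simp add: k_def[abs_def])
  define f where "f x = k x * enn2real (column_weight a W x)" for x
  have fm: "f \<in> BM" unfolding f_def[abs_def] using km column_weight_measurable[OF W(1), of a] by simp
  have f0: "0 \<le> f x" for x by (simp add: f_def k0)
  have I: "I_int n \<in> sets borel" by (simp add: I_int_def)
  have G: "G a V n = (\<integral>x1. (\<integral>x2. k x1 * V (x1, x2) \<partial>lebesgue_on {0<..<a}) \<partial>lebesgue_on (I_int n))"
    by (auto simp: G_def k_def)
  have eq: "AE x in lborel. (\<integral>y. k x * V (x, y) \<partial>lebesgue_on {0<..<a}) = f x"
    using AE_sections[OF VW]
  proof eventually_elim
    case (elim x)
    have Wx: "(\<lambda>y. W (x, y)) \<in> BM"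
      by (rule measurable_compose[OF _ W(1)]) (intro borel_measurable_continuous_onI continuous_intros)
    have kW: "(\<lambda>y. k x * W (x, y)) \<in> BM" using Wx by simp
    have e: "AE y in lborel. y \<in> {0<..<a} \<longrightarrow> k x * V (x, y) = k x * W (x, y)" using elim by eventually_elim auto
    have "(\<integral>y. k x * V (x, y) \<partial>lebesgue_on {0<..<a}) = (sint {0<..<a} (\<lambda>y. (k x * W (x, y))))"
      by (rule integral_lebesgue_on_AE[OF measurable_lebesgue_on_AE[OF _ kW e] _ kW e]) auto
    also have "\<dots> = k x * (LINT y|lborel. ind {0<..<a} y * W (x, y))"
      by (subst integral_mult_right_zero[symmetric]) (intro Bochner_Integration.integral_cong, auto)
    also have "(LINT y|lborel. ind {0<..<a} y * W (x, y)) = enn2real (NN y. ennreal (ind {0<..<a} y * W (x, y)))"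
      by (rule integral_eq_nn_integral) (use Wx W(2) in auto)
    also have "(NN y. ennreal (ind {0<..<a} y * W (x, y))) = column_weight a W x"
      unfolding column_weight_def by (intro nn_integral_cong) (simp add: indicator_def)
    finally show ?case by (simp add: f_def)
  qed
  then have eqI: "AE x in lborel. x \<in> I_int n \<longrightarrow> (\<integral>y. k x * V (x, y) \<partial>lebesgue_on {0<..<a}) = f x" by eventually_elim simp
  have "G a V n = (sint (I_int n) f)"
    unfolding G by (rule integral_lebesgue_on_AE[OF measurable_lebesgue_on_AE[OF I fm eqI] I fm eqI])
  also have "\<dots> = enn2real (NN x. ennreal (ind (I_int n) x *\<^sub>R f x))"
    by (rule integral_eq_nn_integral) (use fm I f0 in auto)
  also have "(NN x. ennreal (ind (I_int n) x *\<^sub>R f x)) = (NN x. ind (I_int n) x * ennreal (f x))"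
    by (intro nn_integral_cong) (simp add: indicator_def)
  finally have Ge: "G a V n = enn2real (NN x. ind (I_int n) x * ennreal (f x))" .
  show "0 \<le> G a V n" by (simp add: Ge)
  obtain K where K: "0 < K" "\<And>x. x \<in> I_int n \<Longrightarrow> k x \<le> K"
  proof -
    have "bounded (I_int n)" by (simp add: I_int_def)
    then obtain b where "\<forall>x\<in>I_int n. norm x \<le> b" by (auto simp: bounded_iff)
    then show ?thesis by (intro that[of "1 + \<bar>b\<bar>"]) (auto simp: k_def intro: order_trans)
  qed
  let ?B = "I_int n \<times> {0<..<a}"
  have B: "?B \<in> sets borel" "bounded ?B" using I by (auto intro!: borel_Times bounded_Times simp: I_int_def)
  have m: "(\<lambda>z. ind ?B z * ennreal (W z)) \<in> BM"
    by (intro borel_measurable_times_ennreal borel_measurable_indicator B(1) measurable_compose[OF W(1) measurable_ennreal])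
  have "(NN x. ind (I_int n) x * ennreal (f x)) \<le> (NN x. ennreal K * (ind (I_int n) x * column_weight a W x))"
  proof (rule nn_integral_mono)
    fix x
    have "ennreal (f x) \<le> ennreal K * column_weight a W x" if "x \<in> I_int n"
    proof -
      have "ennreal (f x) = ennreal (k x) * ennreal (enn2real (column_weight a W x))"
        unfolding f_def by (rule ennreal_mult[OF k0]) simp
      also have "\<dots> \<le> ennreal K * column_weight a W x"
        by (intro mult_mono ennreal_leI K(2) that) (auto simp: ennreal_enn2real_if)
      finally show ?thesis .
    qed
    then show "ind (I_int n) x * ennreal (f x) \<le> ennreal K * (ind (I_int n) x * column_weight a W x)"
      by (simp add: indicator_def)
  qed
  also have "\<dots> = ennreal K * (NN x. ind (I_int n) x * column_weight a W x)"
    by (rule nn_integral_cmult) (use column_weight_measurable[OF W(1), of a] I in simp)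
  also have "(NN x. ind (I_int n) x * column_weight a W x) = (NN x. NN y. ind ?B (x, y) * ennreal (W (x, y)))"
    by (intro nn_integral_cong) (auto simp: column_weight_def indicator_def intro!: nn_integral_cong)
  also have "\<dots> = (NN z. ind ?B z * ennreal (W z))"
    by (rule nn_integral_lborel2(1)[OF m, symmetric])
  also have "ennreal K * \<dots> < \<infinity>" using fin[OF B] by (simp add: ennreal_mult_less_top)
  finally have "(NN x. ind (I_int n) x * ennreal (f x)) < \<infinity>" .
  then show "ennreal (G a V n) = (NN x. ind (I_int n) x * ennreal ((if n = 0 then 1 else \<bar>x\<bar>) * enn2real (column_weight a W x)))"
    unfolding Ge by (simp add: f_def[abs_def] k_def[abs_def])
qed

subsection \<open>Counting negative directions\<close>

text \<open>A square integrable function is integrable on bounded sets, so the functionals used in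
  the count are linear on the domain of the form.\<close>

lemma integrable_lebesgue_on_indicator_L2:
  fixes u :: "'a::euclidean_space \<Rightarrow> complex"
  assumes u: "u \<in> L2 S" and S: "S \<in> sets borel" and E: "E \<in> sets borel" "bounded E"
  shows "integrable (lebesgue_on S) (\<lambda>x. ind E x *\<^sub>R u x)"
proof -
  have um: "u \<in> borel_measurable (lebesgue_on S)" and ui: "integrable (lebesgue_on S) (\<lambda>x. nsq (u x))"
    using u by (auto simp: L2_def)
  have SE: "S \<inter> E \<in> sets borel" using S E(1) by (rule sets.Int)
  have Em: "(\<lambda>x. ind E x :: real) \<in> borel_measurable (lebesgue_on S)"
    by (intro measurable_restrict_space1 measurable_completion) (use E in simp)
  have "emeasure lborel (S \<inter> E) < \<infinity>"
    by (rule emeasure_bounded_finite) (rule bounded_subset[OF E(2) Int_lower2])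
  then have "emeasure lebesgue (S \<inter> E) < \<infinity>" using SE by simp
  then have "integrable lebesgue (\<lambda>x. ind (S \<inter> E) x :: real)"
    using SE by (intro integrable_real_indicator) simp_all
  then have "integrable lebesgue (\<lambda>x. ind S x *\<^sub>R (ind E x :: real))"
    by (simp only: indicator_inter_arith real_scaleR_def)
  then have Ei: "integrable (lebesgue_on S) (\<lambda>x. ind E x :: real)"
    using S by (subst integrable_restrict_space) simp_all
  show ?thesis
  proof (rule Bochner_Integration.integrable_bound)
    show "integrable (lebesgue_on S) (\<lambda>x. ind E x + nsq (u x))" using Ei ui by (rule Bochner_Integration.integrable_add)
    show "(\<lambda>x. ind E x *\<^sub>R u x) \<in> borel_measurable (lebesgue_on S)" using Em um by (rule borel_measurable_scaleR)
    show "AE x in lebesgue_on S. norm (ind E x *\<^sub>R u x) \<le> norm (ind E x + nsq (u x))"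
    proof (rule AE_I2)
      fix x
      have "cmod (u x) \<le> 1 + nsq (u x)"
        using zero_le_power2[of "cmod (u x) - 1"] norm_ge_zero[of "u x"] unfolding power2_diff power_one mult_1_right by linarith
      then show "norm (ind E x *\<^sub>R u x) \<le> norm (ind E x + nsq (u x))" by (simp add: indicator_def)
    qed
  qed
qed

lemma subspace_combination:
  assumes L: "cfun.subspace L" and F: "finite F" "F \<subseteq> L"
  shows "(\<lambda>x. \<Sum>u\<in>F. c u * u x) \<in> L"
  using F
proof (induction F rule: finite_induct)
  case empty
  then show ?case using cfun.subspace_0[OF L] by (simp add: zero_fun_def)
next
  case (insert v F)
  have "(\<lambda>x. c v * v x) + (\<lambda>x. \<Sum>u\<in>F. c u * u x) \<in> L"
    using insert by (intro cfun.subspace_add[OF L] cfun.subspace_scale[OF L]) auto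
  then show ?case using insert.hyps by (simp add: plus_fun_def)
qed

text \<open>If a negative subspace contained more independent functions than there are sets in
  \<open>\<E>\<close>, a nontrivial combination would have zero integral over all of them, so the
  form would be nonnegative on it. The combination would then vanish almost everywhere, against
  \<open>ae_independent\<close>.\<close>

lemma N_minus_le_card:
  assumes S: "S \<in> sets borel" and fin: "finite \<E>" and E: "\<And>E. E \<in> \<E> \<Longrightarrow> E \<in> sets borel \<and> bounded E"
    and pos: "\<And>u. u \<in> q_dom V S \<Longrightarrow> (\<And>E. E \<in> \<E> \<Longrightarrow> (\<integral>x. ind E x *\<^sub>R u x \<partial>lebesgue_on S) = 0) \<Longrightarrow> 0 \<le> q_form V S u"
  shows "N_minus V S \<le> enat (card \<E>)"
  unfolding N_minus_def
proof (rule SUP_least)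
  fix L assume "L \<in> {L. cfun.subspace L \<and> L \<subseteq> q_dom V S \<and> (\<forall>u\<in>L. \<not> (AE x in lebesgue_on S. u x = 0) \<longrightarrow> q_form V S u < 0)}"
  then have L: "cfun.subspace L" "L \<subseteq> q_dom V S" "\<And>u. u \<in> L \<Longrightarrow> \<not> (AE x in lebesgue_on S. u x = 0) \<Longrightarrow> q_form V S u < 0" by auto
  show "ae_dim S L \<le> enat (card \<E>)"
    unfolding ae_dim_def
  proof (rule SUP_least)
    fix F assume "F \<in> {F. finite F \<and> F \<subseteq> L \<and> ae_independent S F}"
    then have F: "finite F" "F \<subseteq> L" "ae_independent S F" by auto
    show "enat (card F) \<le> enat (card \<E>)"
    proof (rule ccontr)
      assume "\<not> ?thesis"
      then have "card \<E> < card F" by simp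
      from homogeneous_solution[OF fin F(1) this, of "\<lambda>E u. \<integral>x. ind E x *\<^sub>R u x \<partial>lebesgue_on S"]
      obtain c where c: "\<exists>u\<in>F. c u \<noteq> 0" "\<forall>E\<in>\<E>. (\<Sum>u\<in>F. c u * (\<integral>x. ind E x *\<^sub>R u x \<partial>lebesgue_on S)) = 0" by blast
      define v where "v x = (\<Sum>u\<in>F. c u * u x)" for x
      have vL: "v \<in> L" unfolding v_def[abs_def] by (rule subspace_combination[OF L(1) F(1,2)])
      have FL2: "u \<in> L2 S" if "u \<in> F" for u using that F(2) L(2) by (auto simp: q_dom_def W12_def)
      have "(\<integral>x. ind E x *\<^sub>R v x \<partial>lebesgue_on S) = 0" if "E \<in> \<E>" for E
      proof -
        have i: "integrable (lebesgue_on S) (\<lambda>x. ind E x *\<^sub>R u x)" if "u \<in> F" for u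
          using integrable_lebesgue_on_indicator_L2[OF FL2[OF that] S] E[OF \<open>E \<in> \<E>\<close>] by simp
        have "(\<integral>x. ind E x *\<^sub>R v x \<partial>lebesgue_on S) = (\<integral>x. (\<Sum>u\<in>F. c u * (ind E x *\<^sub>R u x)) \<partial>lebesgue_on S)"
          by (simp only: v_def scaleR_sum_right mult_scaleR_right)
        also have "\<dots> = (\<Sum>u\<in>F. \<integral>x. c u * (ind E x *\<^sub>R u x) \<partial>lebesgue_on S)"
          by (intro Bochner_Integration.integral_sum integrable_mult_right i)
        also have "\<dots> = (\<Sum>u\<in>F. c u * (\<integral>x. ind E x *\<^sub>R u x \<partial>lebesgue_on S))"
          by (intro sum.cong refl integral_mult_right_zero)
        also have "\<dots> = 0" using c(2) that by blast
        finally show ?thesis .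
      qed
      then have "0 \<le> q_form V S v" using vL L(2) by (intro pos) auto
      with L(3)[OF vL] have "AE x in lebesgue_on S. (\<Sum>u\<in>F. c u * u x) = 0" unfolding v_def by force
      with F(3) c(1) show False unfolding ae_independent_def by blast
    qed
  qed
qed

text \<open>Every summand is at least \<open>d\<close>, so a finite total bounds their number.
  Applied to the sums over terms above the threshold, it shows that either a sum is infinite and the
  theorem trivial, or only finitely many intervals and cells are large.\<close>

lemma infsum_ennreal_finite:
  fixes f :: "'i \<Rightarrow> ennreal"
  assumes d: "0 < d" "\<And>n. n \<in> A \<Longrightarrow> ennreal d \<le> f n" and fin: "infsum f A \<noteq> \<infinity>"
  shows "finite A" "\<And>n. n \<in> A \<Longrightarrow> f n < \<infinity>"
proof -
  have le: "sum f F \<le> infsum f A" if "finite F" "F \<subseteq> A" for F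
    using that by (subst nonneg_infsum_complete) (auto intro!: SUP_upper)
  show "f n < \<infinity>" if "n \<in> A" for n
    using le[of "{n}"] that fin by (simp add: less_top order_le_less_trans)
  show "finite A"
  proof (rule ccontr)
    assume "infinite A"
    obtain r where r: "infsum f A = ennreal r" "0 \<le> r" using fin by (cases "infsum f A") auto
    obtain k :: nat where k: "r / d < k" using reals_Archimedean2 by blast
    obtain F where F: "finite F" "card F = k" "F \<subseteq> A" using infinite_arbitrarily_large[OF \<open>infinite A\<close>, of k] by blast
    have "ennreal (real k * d) = (\<Sum>n\<in>F. ennreal d)" using F d by (simp add: ennreal_mult ennreal_of_nat_eq_real_of_nat)
    also have "\<dots> \<le> sum f F" using F d by (intro sum_mono) auto
    also have "\<dots> \<le> ennreal r" using le[OF F(1,3)] r by simp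
    finally have "real k * d \<le> r" using r by (simp add: ennreal_le_iff)
    with k d show False by (simp add: field_simps)
  qed
qed

subsection \<open>The oscillating part\<close>

text \<open>Half-open columns partition the strip and differ from the closed cells by null sets.
  Summation over the integers is written as integration over \<open>count_space\<close>, so that sum
  and integral can be interchanged.\<close>

lemma nn_integral_le_columns:
  fixes f g :: "plane \<Rightarrow> ennreal"
  assumes f: "f \<in> BM" "\<And>z. z \<notin> strip a \<Longrightarrow> f z = 0" and g: "g \<in> BM"
    and le: "\<And>n::int. (NN z. ind (cell a n) z * f z) \<le>
      k * (NN z. ind (cell a n) z * g z)"
  shows "(NN z. f z) \<le> k * (NN z. g z)"
proof -
  define I where "I n = {real_of_int n..<real_of_int n + 1}" for n
  define Q where "Q n = cell a n" for n
  define R where "R n = I n \<times> {0..a}" for n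
  have Rm: "R n \<in> sets borel" for n unfolding R_def I_def by (intro borel_Times) auto
  have QR: "(NN z. ind (Q n) z * h z) = (NN z. ind (R n) z * h z)" for n and h :: "plane \<Rightarrow> ennreal"
  proof (rule nn_integral_cong_AE)
    show "AE z in lborel. ind (Q n) z * h z = ind (R n) z * h z"
      using AE_lborel_fst_neq[of "real_of_int n + 1"] by eventually_elim (auto simp: Q_def R_def I_def indicator_def)
  qed
  have I_iff: "x \<in> I n \<longleftrightarrow> n = \<lfloor>x\<rfloor>" for n x
    by (metis I_def atLeastLessThan_iff floor_eq_iff)
  have part: "(\<integral>\<^sup>+n. ind (R n) z * h \<partial>count_space UNIV) = ind {0..a} (snd z) * h" for z and h :: ennreal
  proof -
    have "(\<integral>\<^sup>+n. ind (R n) z * h \<partial>count_space UNIV) = (\<integral>\<^sup>+n. (ind {0..a} (snd z) * h) * ind {\<lfloor>fst z\<rfloor>} n \<partial>count_space UNIV)"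
      by (intro nn_integral_cong) (cases z, auto simp: R_def I_iff indicator_def)
    also have "\<dots> = ind {0..a} (snd z) * h"
      by (subst nn_integral_cmult_indicator) auto
    finally show ?thesis .
  qed
  have swap: "(\<integral>\<^sup>+n. \<integral>\<^sup>+z. ind (R n) z * h z \<partial>lborel \<partial>count_space UNIV) = (NN z. ind {0..a} (snd z) * h z)"
    if h: "h \<in> BM" for h
  proof -
    have "(NN z. \<integral>\<^sup>+n. ind (R n) z * h z \<partial>count_space UNIV) = (\<integral>\<^sup>+n. \<integral>\<^sup>+z. ind (R n) z * h z \<partial>lborel \<partial>count_space UNIV)"
      by (rule nn_integral_count_space_nn_integral) (use h Rm in simp_all)
    then show ?thesis unfolding part by simp
  qed
  have "(NN z. f z) = (NN z. ind {0..a} (snd z) * f z)"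
    using f(2) by (intro nn_integral_cong) (force simp: indicator_def strip_def)
  also have "\<dots> = (\<integral>\<^sup>+n. \<integral>\<^sup>+z. ind (R n) z * f z \<partial>lborel \<partial>count_space UNIV)" by (rule swap[OF f(1), symmetric])
  also have "\<dots> \<le> (\<integral>\<^sup>+n. k * (NN z. ind (R n) z * g z) \<partial>count_space UNIV)"
    using le unfolding Q_def[symmetric] QR by (intro nn_integral_mono)
  also have "\<dots> = k * (\<integral>\<^sup>+n. \<integral>\<^sup>+z. ind (R n) z * g z \<partial>lborel \<partial>count_space UNIV)"
    by (rule nn_integral_cmult) simp
  also have "\<dots> = k * (NN z. ind {0..a} (snd z) * g z)" by (simp only: swap[OF g])
  also have "\<dots> \<le> k * (NN z. g z)"
    by (intro mult_left_mono nn_integral_mono) (auto simp: indicator_def)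
  finally show ?thesis .
qed

text \<open>The numbers come from \<open>rect_log_inequality\<close> (\<open>27648 = 12 * 2304\<close>) and from \<open>local_functionals\<close>
  (\<open>5308416 = 2 * 2654208\<close>); the halves make both parts of \<open>u\<close> fit into the gradient.\<close>

definition osc_threshold :: "real \<Rightarrow> real" where
  "osc_threshold a = min 1 (1 / a) / (27648 * (max a (1 / a)) ^ 5)"

definition osc_factor :: "real \<Rightarrow> real \<Rightarrow> real" where
  "osc_factor a c = 36 * 5308416 * (3 / min 1 (1 / a) + a / (5308416 * (min 1 a / 2)\<^sup>2) / c)"

text \<open>A cell with small \<open>D\<close> is treated as one rectangle, on which the mean of
  \<open>u\<close> vanishes by assumption; this adds no functional and is where
  \<open>c \<le> osc_threshold a\<close> enters. In a large cell \<open>\<delta>\<close> is a fixed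
  number, so the number of squares is bounded by a multiple of the mass of \<open>lpot\<close>,
  hence of \<open>D\<close>.\<close>

lemma oscillation_functionals:
  fixes V W :: "plane \<Rightarrow> real"
  assumes a: "0 < a" and W: "W \<in> BM" "\<And>z. 0 \<le> W z" "\<And>z. z \<notin> strip a \<Longrightarrow> W z = 0"
    and colfin: "AE x in lborel. column_weight a W x < \<infinity>"
    and VW: "AE x in lborel. norm_B {0<..<a} (\<lambda>y. W (x, y)) = norm_B {0<..<a} (\<lambda>y. V (x, y))"
    and c: "0 < c" "c \<le> osc_threshold a" and Dfin: "\<And>n. D a V n < \<infinity>" and fin: "finite {n. ennreal c < D a V n}"
  obtains S :: "(plane) set set" where "finite S"
    "real (card S) \<le> osc_factor a c * (\<Sum>n | ennreal c < D a V n. enn2real (D a V n))"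
    "\<And>E. E \<in> S \<Longrightarrow> \<exists>p1 q1 p2 q2. E = {p1..q1} \<times> {p2..q2} \<and> 0 \<le> p2 \<and> q2 \<le> a"
    "\<And>u g1 g2. rect_weak_grad a u g1 g2 \<Longrightarrow> (\<And>E. E \<in> S \<Longrightarrow> (sint E u) = 0) \<Longrightarrow>
      (\<And>n::int. (sint (cell a n) u) = 0) \<Longrightarrow>
      (NN z. ennreal (W z * nsq (u z))) \<le> ennreal (1 / 2) * (NN z. ennreal (nsq (g1 z) + nsq (g2 z)))"
proof -
  define \<theta> where "\<theta> = min 1 (1 / a)"
  define A where "A = max a (1 / a)"
  define B where "B = {n. ennreal c < D a V n}"
  define Q where "Q n = cell a n" for n
  define \<phi> where "\<phi> \<eta> = (\<lambda>x. enn2real (NN y. ind {0<..<a} y * ennreal (W (x, y))) / a + \<eta>)" for \<eta>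
  have \<theta>: "0 < \<theta>" using a by (simp add: \<theta>_def)
  have A: "1 \<le> A" using a by (cases "1 \<le> a") (auto simp: A_def le_max_iff_disj field_simps)
  have A2: "a \<le> A" "1 / a \<le> A" by (simp_all add: A_def)
  have lfin: "AE x in lborel. x \<in> {real_of_int n<..<real_of_int n + 1} \<longrightarrow> (NN y. ind {0<..<a} y * ennreal (W (x, y))) < \<infinity>" for n
    using colfin unfolding column_weight_def by eventually_elim simp
  have \<mu>: "(NN z. ind (Q n) z * ennreal (lpot W (\<phi> \<eta>) z)) \<le> ennreal (3 / \<theta> * enn2real (D a V n) + a * \<eta>)"
    and \<phi>m: "\<phi> \<eta> \<in> BM" and \<phi>0: "\<And>x. \<eta> \<le> \<phi> \<eta> x" "\<And>x. 0 < \<phi> \<eta> x" if \<eta>: "0 < \<eta>" for n \<eta>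
  proof -
    note H = lpot_le_D[OF a \<eta> W(1,2) lfin[of n] VW, folded \<phi>_def \<theta>_def]
    show "\<phi> \<eta> \<in> BM" by (rule H(2))
    show "0 < \<phi> \<eta> x" for x using a \<eta> by (simp add: \<phi>_def add_nonneg_pos)
    show "\<eta> \<le> \<phi> \<eta> x" for x using a by (simp add: \<phi>_def)
    have "D a V n = ennreal (enn2real (D a V n))" using Dfin[of n] by (simp add: less_top)
    then have "ennreal (3 / \<theta>) * D a V n + ennreal (a * \<eta>) = ennreal (3 / \<theta> * enn2real (D a V n) + a * \<eta>)"
      using a \<eta> \<theta> by (metis ennreal_mult' ennreal_plus enn2real_nonneg divide_nonneg_nonneg less_imp_le mult_nonneg_nonneg zero_le_numeral)
    with H(1) show "(NN z. ind (Q n) z * ennreal (lpot W (\<phi> \<eta>) z)) \<le> ennreal (3 / \<theta> * enn2real (D a V n) + a * \<eta>)"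
      by (simp only: Q_def)
  qed
  define ctrl where "ctrl n T \<longleftrightarrow> (\<forall>u g1 g2. rect_weak_grad a u g1 g2 \<longrightarrow> (\<forall>E\<in>T. (sint E u) = 0) \<longrightarrow>
      (NN z. ind (Q n) z * ennreal (W z * nsq (u z))) \<le> ennreal (1 / 2) * (NN z. ind (Q n) z * ennreal (nsq (g1 z) + nsq (g2 z))))" for n T
  have good: "ctrl n {Q n}" if n: "n \<notin> B" for n
    unfolding ctrl_def
  proof (intro allI impI)
    fix u g1 g2 assume u: "rect_weak_grad a u g1 g2" and z: "\<forall>E\<in>{Q n}. (sint E u) = 0"
    \<comment> \<open>Makes \<open>2304 * A^5 * m = 1 / 2\<close>. One half of \<open>m\<close> is
      granted to \<open>3 / \<theta> * D\<close>, which is the condition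
      \<open>c \<le> \<theta> * m / 6\<close>, the other half to \<open>a * \<eta>\<close>.\<close>
    define m where "m = 1 / (4608 * A ^ 5)"
    have m: "0 < m" using A by (simp add: m_def)
    define \<eta> where "\<eta> = m / (2 * a)"
    have \<eta>: "0 < \<eta>" using m a by (simp add: \<eta>_def)
    have "D a V n \<le> ennreal c" using n by (simp add: B_def)
    then have "enn2real (D a V n) \<le> c" using c by (intro enn2real_leI) auto
    also have "c \<le> \<theta> * m / 6" using c(2) by (simp add: osc_threshold_def \<theta>_def m_def A_def)
    finally have "3 / \<theta> * enn2real (D a V n) \<le> m / 2" using \<theta> by (simp add: field_simps)
    moreover have "a * \<eta> = m / 2" using a by (simp add: \<eta>_def)
    ultimately have le: "3 / \<theta> * enn2real (D a V n) + a * \<eta> \<le> m" by simp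
    have M: "(NN z. ind (Q n) z * ennreal (lpot W (\<phi> \<eta>) z)) \<le> ennreal m"
      by (rule order_trans[OF \<mu>[OF \<eta>] ennreal_leI[OF le]])
    have sides: "real_of_int n + 1 - real_of_int n \<le> A * (a - 0)" "a - 0 \<le> A * (real_of_int n + 1 - real_of_int n)"
      using A2 a by (simp_all add: field_simps)
    have "(NN z. ind (Q n) z * ennreal (W z * nsq (u z))) \<le>
        ennreal (2304 * A ^ 5 * m) * (NN z. ind (Q n) z * ennreal (nsq (g1 z) + nsq (g2 z)))"
      unfolding Q_def
      by (rule rect_log_inequality[OF u _ a _ _ A sides W(1,2) \<phi>m[OF \<eta>] \<phi>0(2)[OF \<eta>] less_imp_le[OF m]])
        (use M z in \<open>simp_all only: Q_def, simp_all\<close>)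
    also have "2304 * A ^ 5 * m = 1 / 2" using A by (simp add: m_def)
    finally show "(NN z. ind (Q n) z * ennreal (W z * nsq (u z))) \<le>
        ennreal (1 / 2) * (NN z. ind (Q n) z * ennreal (nsq (g1 z) + nsq (g2 z)))" .
  qed
  have bad: "\<exists>T. finite T \<and> real (card T) \<le> osc_factor a c * enn2real (D a V n) \<and>
      (\<forall>E\<in>T. \<exists>p1 q1 p2 q2. E = {p1..q1} \<times> {p2..q2} \<and> 0 \<le> p2 \<and> q2 \<le> a) \<and> ctrl n T" if n: "n \<in> B" for n
  proof -
    \<comment> \<open>Makes \<open>2654208 * \<delta> = 1 / 2\<close>; \<open>\<eta>\<close> below
      is the least value that \<open>local_functionals\<close> admits for this
      \<open>\<delta>\<close>.\<close>
    define \<delta> :: real where "\<delta> = 1 / 5308416"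
    have \<delta>: "0 < \<delta>" by (simp add: \<delta>_def)
    define \<eta> where "\<eta> = \<delta> / (min 1 a / 2)\<^sup>2"
    have k0: "0 < (min 1 a / 2)\<^sup>2" using a by simp
    have \<eta>: "0 < \<eta>" using \<delta> k0 unfolding \<eta>_def by (rule divide_pos_pos)
    define m where "m = 3 / \<theta> * enn2real (D a V n) + a * \<eta>"
    have m: "0 \<le> m" using \<theta> a \<eta> by (simp add: m_def)
    have \<delta>\<eta>: "\<delta> \<le> \<eta> * (min 1 a / 2)\<^sup>2" using k0 by (simp add: \<eta>_def)
    have cD: "c \<le> enn2real (D a V n)"
    proof -
      have "ennreal c \<le> ennreal (enn2real (D a V n))" using n Dfin[of n] by (simp add: B_def less_top)
      then show ?thesis by (simp add: ennreal_le_iff)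
    qed
    have mle: "36 * m / \<delta> \<le> osc_factor a c * enn2real (D a V n)"
    proof -
      \<comment> \<open>The additive term does not scale with \<open>D\<close>; it is absorbed
        because \<open>D\<close> is at least \<open>c\<close> in a large cell.\<close>
      have "a * \<eta> = a * \<eta> / c * c" using c by simp
      also have "\<dots> \<le> a * \<eta> / c * enn2real (D a V n)" using a \<eta> c by (intro mult_left_mono cD) simp
      finally have "m \<le> (3 / \<theta> + a * \<eta> / c) * enn2real (D a V n)" by (simp add: m_def distrib_right)
      then have "36 * m / \<delta> \<le> 36 * ((3 / \<theta> + a * \<eta> / c) * enn2real (D a V n)) / \<delta>" using \<delta> by (intro divide_right_mono) auto
      also have "\<dots> = osc_factor a c * enn2real (D a V n)"
        by (simp add: osc_factor_def \<delta>_def \<eta>_def \<theta>_def)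
      finally show ?thesis .
    qed
    have \<mu>m: "(NN z. ind (cell a n) z * ennreal (lpot W (\<phi> \<eta>) z)) \<le> ennreal m"
      using \<mu>[OF \<eta>, of n] unfolding Q_def m_def .
    show ?thesis
    proof (rule local_functionals[OF a W(1,2) \<phi>m[OF \<eta>] \<phi>0(1)[OF \<eta>] \<eta> m \<mu>m \<delta> \<delta>\<eta>])
      fix T :: "(plane) set set" assume T: "finite T" "real (card T) \<le> 36 * m / \<delta>"
        "\<And>E. E \<in> T \<Longrightarrow> \<exists>p1 q1 p2 q2. E = {p1..q1} \<times> {p2..q2} \<and> 0 \<le> p2 \<and> q2 \<le> a"
        "\<And>u g1 g2. rect_weak_grad a u g1 g2 \<Longrightarrow> (\<And>E. E \<in> T \<Longrightarrow> (sint E u) = 0) \<Longrightarrow>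
          (NN z. ind (cell a n) z * ennreal (W z * nsq (u z))) \<le>
          ennreal (2654208 * \<delta>) * (NN z. ind (cell a n) z * ennreal (nsq (g1 z) + nsq (g2 z)))"
      have d2: "2654208 * \<delta> = 1 / 2" by (simp add: \<delta>_def)
      show ?thesis
      proof (rule exI[of _ T], unfold ctrl_def Q_def, intro conjI ballI T(1,3) order_trans[OF T(2) mle] allI impI)
        fix u g1 g2 assume u: "rect_weak_grad a u g1 g2" "\<forall>E\<in>T. (sint E u) = 0"
        show "(NN z. ind (cell a n) z * ennreal (W z * nsq (u z))) \<le>
          ennreal (1 / 2) * (NN z. ind (cell a n) z * ennreal (nsq (g1 z) + nsq (g2 z)))"
          using T(4)[OF u(1) bspec[OF u(2)]] unfolding d2 .
      qed
    qed
  qed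
  have "\<exists>T. \<forall>n\<in>B. finite (T n) \<and> real (card (T n)) \<le> osc_factor a c * enn2real (D a V n) \<and>
      (\<forall>E\<in>T n. \<exists>p1 q1 p2 q2. E = {p1..q1} \<times> {p2..q2} \<and> 0 \<le> p2 \<and> q2 \<le> a) \<and> ctrl n (T n)" by (rule bchoice[OF ballI[OF bad]])
  then obtain T where T: "\<forall>n\<in>B. finite (T n) \<and> real (card (T n)) \<le> osc_factor a c * enn2real (D a V n) \<and>
      (\<forall>E\<in>T n. \<exists>p1 q1 p2 q2. E = {p1..q1} \<times> {p2..q2} \<and> 0 \<le> p2 \<and> q2 \<le> a) \<and> ctrl n (T n)" by (rule exE)
  have T1: "finite (T n)" and T2: "real (card (T n)) \<le> osc_factor a c * enn2real (D a V n)"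
    and T3: "\<And>E. E \<in> T n \<Longrightarrow> \<exists>p1 q1 p2 q2. E = {p1..q1} \<times> {p2..q2} \<and> 0 \<le> p2 \<and> q2 \<le> a" and T4: "ctrl n (T n)" if "n \<in> B" for n
    using bspec[OF T that] by blast+
  have finB: "finite B" using fin by (simp add: B_def)
  show ?thesis
  proof (rule that[of "\<Union>n\<in>B. T n"])
    show "finite (\<Union>n\<in>B. T n)" using finB T1 by blast
    have "real (card (\<Union>n\<in>B. T n)) \<le> real (\<Sum>n\<in>B. card (T n))" by (intro of_nat_mono card_UN_le finB)
    also have "\<dots> = (\<Sum>n\<in>B. real (card (T n)))" by simp
    also have "\<dots> \<le> (\<Sum>n\<in>B. osc_factor a c * enn2real (D a V n))" by (intro sum_mono T2)
    finally show "real (card (\<Union>n\<in>B. T n)) \<le> osc_factor a c * (\<Sum>n | ennreal c < D a V n. enn2real (D a V n))"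
      by (simp add: sum_distrib_left B_def)
    show "\<exists>p1 q1 p2 q2. E = {p1..q1} \<times> {p2..q2} \<and> 0 \<le> p2 \<and> q2 \<le> a" if E: "E \<in> (\<Union>n\<in>B. T n)" for E
    proof -
      from E obtain n where "n \<in> B" "E \<in> T n" by blast
      then show ?thesis by (rule T3)
    qed
    fix u g1 g2 assume u: "rect_weak_grad a u g1 g2" and z1: "\<And>E. E \<in> (\<Union>n\<in>B. T n) \<Longrightarrow> (sint E u) = 0"
      and z2: "\<And>n::int. (sint (cell a n) u) = 0"
    have m: "u \<in> BM" "g1 \<in> BM" "g2 \<in> BM"
      using u unfolding rect_weak_grad_def by blast+
    show "(NN z. ennreal (W z * nsq (u z))) \<le> ennreal (1 / 2) * (NN z. ennreal (nsq (g1 z) + nsq (g2 z)))"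
    proof (rule nn_integral_le_columns)
      show "(\<lambda>z. ennreal (W z * nsq (u z))) \<in> BM" using W(1) m(1) by simp
      show "(\<lambda>z. ennreal (nsq (g1 z) + nsq (g2 z))) \<in> BM" using m(2,3) by simp
      show "ennreal (W z * nsq (u z)) = 0" if "z \<notin> strip a" for z using W(3)[OF that] by simp
      show "(NN z. ind (cell a n) z * ennreal (W z * nsq (u z))) \<le>
        ennreal (1 / 2) * (NN z. ind (cell a n) z * ennreal (nsq (g1 z) + nsq (g2 z)))" for n
      proof (cases "n \<in> B")
        case True
        have "\<forall>E\<in>T n. (sint E u) = 0" using z1 True by blast
        with T4[OF True] u show ?thesis unfolding ctrl_def Q_def[symmetric] by blast
      next
        case False
        have "\<forall>E\<in>{Q n}. (sint E u) = 0" using z2[of n] by (simp add: Q_def)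
        with good[OF False] u show ?thesis unfolding ctrl_def Q_def[symmetric] by blast
      qed
    qed
  qed
qed

subsection \<open>Nonnegativity of the form\<close>

text \<open>Mean and remainder satisfy their bounds with factor 1/2 each. This compensates the 2 in
  the bound for the square of a sum, and orthogonality adds the two energies to exactly that of
  \<open>u\<close>.\<close>

lemma potential_bound:
  fixes W :: "plane \<Rightarrow> real"
  assumes a: "0 < a" and W: "W \<in> BM" "\<And>z. 0 \<le> W z"
    and colfin: "AE x in lborel. column_weight a W x < \<infinity>"
    and u: "rect_weak_grad a u g1 g2" "\<And>z. z \<notin> strip a \<Longrightarrow> u z = 0 \<and> g1 z = 0"
    and col: "\<And>U gr. ae_primitive U gr \<Longrightarrow> (\<And>c d. (c, d) \<in> S1 \<Longrightarrow> (sint {c..d} U) = 0) \<Longrightarrow>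
      (NN x. ennreal (enn2real (column_weight a W x)) * esq (U x)) \<le> ennreal (a / 2) * (NN x. esq (gr x))"
    and osc: "\<And>u g1 g2. rect_weak_grad a u g1 g2 \<Longrightarrow> (\<And>E. E \<in> S2 \<Longrightarrow> (sint E u) = 0) \<Longrightarrow>
      (\<And>n::int. (sint (cell a n) u) = 0) \<Longrightarrow>
      (NN z. ennreal (W z * nsq (u z))) \<le> ennreal (1 / 2) * (NN z. ennreal (nsq (g1 z) + nsq (g2 z)))"
    and S2: "\<And>E. E \<in> S2 \<Longrightarrow> \<exists>p1 q1 p2 q2. E = {p1..q1} \<times> {p2..q2} \<and> 0 \<le> p2 \<and> q2 \<le> a"
    and z1: "\<And>c d. (c, d) \<in> S1 \<Longrightarrow> (sint ({c..d} \<times> {0<..<a}) u) = 0"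
    and z2: "\<And>E. E \<in> S2 \<Longrightarrow> (sint E u) = 0"
    and z3: "\<And>E. E \<in> S2 \<Longrightarrow> (sint ((fst ` E) \<times> {0<..<a}) u) = 0"
  shows "(NN z. ennreal (W z * nsq (u z))) \<le> (NN z. ennreal (nsq (g1 z) + nsq (g2 z)))"
proof -
  have um: "u \<in> BM" "sq_int u"
    and gm: "g1 \<in> BM" "sq_int g1"
    and hm: "g2 \<in> BM"
    using u(1) unfolding rect_weak_grad_def by blast+
  have g0: "g1 z = 0" if "z \<notin> strip a" for z using u(2)[OF that] by blast
  have orth: "(NN z. esq (column_mean a g1 z)) + (NN z. esq (g1 z - column_mean a g1 z)) =
      (NN z. esq (g1 z))"
    by (rule column_mean_orthogonal[OF gm _ a]) (rule g0)
  let ?v = "\<lambda>z. u z - column_mean a u z" and ?h = "\<lambda>z. g1 z - column_mean a g1 z"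
  note cm = column_mean_measurable[OF um(1), of a] column_mean_L2[OF um a]
  have vm: "?v \<in> BM" and hhm: "?h \<in> BM"
    using um(1) gm(1) cm(1) column_mean_measurable[OF gm(1), of a] by simp_all
  \<comment> \<open>The column mean has vertical derivative 0, so all of \<open>g2\<close> stays
    with the remainder.\<close>
  have v: "rect_weak_grad a ?v ?h g2"
    using rect_weak_grad_diff[OF u(1) rect_weak_grad_column_mean[OF u(1) a]] by simp
  have Wm: "(\<lambda>z. ennreal (W z)) \<in> BM" by (rule measurable_compose[OF W(1) measurable_ennreal])
  have fin: "emeasure lborel {p..q} < \<infinity>" for p q :: real by (cases "p \<le> q") auto
  have bor: "{p..q} \<in> sets borel" for p q :: real by simp
  have ys: "(sint {p..q} (ysum a u)) = (sint ({p..q} \<times> {0<..<a}) u)" for p q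
    by (rule integral_rect_ysum[OF um bor fin a, symmetric])
  have rect_int: "integrable lborel (\<lambda>z. ind ({p..q} \<times> {c..d}) z *\<^sub>R f z)"
    if "f \<in> BM" "sq_int f" for p q c d and f :: "plane \<Rightarrow> complex"
  proof (rule integrable_indicator_L2[OF that])
    show "{p..q} \<times> {c..d} \<in> sets borel" by (intro borel_Times bor)
    show "emeasure lborel ({p..q} \<times> {c..d}) < \<infinity>" by (intro emeasure_bounded_finite bounded_Times) auto
  qed
  \<comment> \<open>An integral of the remainder over a rectangle combines two integrals of
    \<open>u\<close>, over the rectangle and over the full height above its base; this is why each
    rectangle costs two conditions.\<close>
  have osc_int: "(sint ({p..q} \<times> {c..d}) ?v) = (sint ({p..q} \<times> {c..d}) u) -
      (measure lborel ({c..d} \<inter> {0<..<a}) / a) *\<^sub>R (sint ({p..q} \<times> {0<..<a}) u)" for p q c d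
    unfolding scaleR_right_diff_distrib Bochner_Integration.integral_diff[OF rect_int[OF um] rect_int[OF cm]]
      integral_column_mean[OF um bor fin bor fin a] ys ..
  have mean: "(NN z. ennreal (W z) * esq (column_mean a u z)) \<le> ennreal (1 / 2) * (NN z. esq (column_mean a g1 z))"
  proof -
    have "(NN z. ennreal (W z) * esq (column_mean a u z)) =
        ennreal (1 / a\<^sup>2) * (NN x. column_weight a W x * esq (ysum a u x))"
      unfolding nn_integral_column_mean[OF um(1) Wm a] column_weight_def ..
    also have "(NN x. column_weight a W x * esq (ysum a u x)) =
        (NN x. ennreal (enn2real (column_weight a W x)) * esq (ysum a u x))"
      by (rule nn_integral_cong_AE) (use colfin in \<open>eventually_elim, simp\<close>)
    also have "\<dots> \<le> ennreal (a / 2) * (NN x. esq (ysum a g1 x))"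
      by (rule col[OF ysum_ae_primitive[OF u(1) a]]) (simp only: ys z1)
    also have "ennreal (1 / a\<^sup>2) * (ennreal (a / 2) * (NN x. esq (ysum a g1 x))) =
        ennreal (1 / 2) * (ennreal (1 / a) * (NN x. esq (ysum a g1 x)))"
    proof -
      have e: "1 / a\<^sup>2 * (a / 2) = 1 / 2 * (1 / a)" using a by (simp add: power2_eq_square)
      have "ennreal (1 / a\<^sup>2) * ennreal (a / 2) = ennreal (1 / a\<^sup>2 * (a / 2))" by (rule ennreal_mult'[symmetric]) simp
      also have "\<dots> = ennreal (1 / 2) * ennreal (1 / a)" unfolding e by (rule ennreal_mult') simp
      finally show ?thesis by (simp only: mult.assoc[symmetric])
    qed
    also have "\<dots> = ennreal (1 / 2) * (NN z. esq (column_mean a g1 z))"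
      by (simp only: nn_integral_column_mean_square[OF gm(1) a])
    finally show ?thesis by (simp add: mult_left_mono)
  qed
  have "(NN z. ennreal (W z * nsq (?v z))) \<le> ennreal (1 / 2) * (NN z. ennreal (nsq (?h z) + nsq (g2 z)))"
  proof (rule osc[OF v])
    fix E assume E: "E \<in> S2"
    then obtain p1 q1 p2 q2 where e: "E = {p1..q1} \<times> {p2..q2}" using S2 by blast
    show "(sint E ?v) = 0"
    \<comment> \<open>For an empty vertical side the projection of \<open>E\<close> is empty and may
      differ from \<open>{p1..q1}\<close>; the integral over \<open>E\<close> is then 0
      anyway.\<close>
    proof (cases "p2 \<le> q2")
      case True
      then have "fst ` E = {p1..q1}" by (simp add: e)
      then show ?thesis using z2[OF E] z3[OF E] unfolding e osc_int by simp
    next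
      case False
      then show ?thesis by (simp add: e)
    qed
  next
    fix n :: int
    \<comment> \<open>The remainder has mean zero on full-height cells automatically; closing the
      cell adds only points outside the strip, where \<open>u\<close> is 0.\<close>
    have "(sint (cell a n) u) = (sint ({real_of_int n..real_of_int n + 1} \<times> {0<..<a}) u)"
    proof (rule Bochner_Integration.integral_cong[OF refl])
      fix z
      show "ind (cell a n) z *\<^sub>R u z = ind ({real_of_int n..real_of_int n + 1} \<times> {0<..<a}) z *\<^sub>R u z"
      proof (cases "z \<in> strip a")
        case True
        then show ?thesis by (cases z) (auto simp: indicator_def strip_def)
      next
        case False
        then show ?thesis using u(2)[of z] by simp
      qed
    qed
    moreover have "measure lborel ({0..a} \<inter> {0<..<a}) = a"
    proof -
      have "{0..a} \<inter> {0<..<a} = {0<..<a}" by auto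
      then show ?thesis using a by simp
    qed
    ultimately show "(sint (cell a n) ?v) = 0"
      unfolding osc_int using a by simp
  qed
  also have "(NN z. ennreal (nsq (?h z) + nsq (g2 z))) = (NN z. esq (?h z)) + (NN z. esq (g2 z))"
    by (subst nn_integral_add[symmetric]) (use hhm hm in \<open>simp_all add: ennreal_plus\<close>)
  finally have osc': "(NN z. ennreal (W z * nsq (?v z))) \<le> ennreal (1 / 2) * ((NN z. esq (?h z)) + (NN z. esq (g2 z)))" .
  have two: "ennreal 2 * (ennreal (1 / 2) * X) = X" for X
  proof -
    have "ennreal 2 * ennreal (1 / 2) = 1" by (subst ennreal_mult'[symmetric]) auto
    then show ?thesis by (simp only: mult.assoc[symmetric] mult_1)
  qed
  have "(NN z. ennreal (W z * nsq (u z))) \<le>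
      (NN z. ennreal 2 * (ennreal (W z) * esq (column_mean a u z)) + ennreal 2 * ennreal (W z * nsq (?v z)))"
  proof (rule nn_integral_mono)
    fix z
    have "cmod (u z) \<le> cmod (column_mean a u z) + cmod (?v z)"
      using norm_triangle_ineq[of "column_mean a u z" "?v z"] by simp
    then have "nsq (u z) \<le> (cmod (column_mean a u z) + cmod (?v z))\<^sup>2" by (intro power_mono) auto
    also have "\<dots> \<le> 2 * nsq (column_mean a u z) + 2 * nsq (?v z)"
      using zero_le_power2[of "cmod (column_mean a u z) - cmod (?v z)"] unfolding power2_diff power2_sum by linarith
    finally have "W z * nsq (u z) \<le> W z * (2 * nsq (column_mean a u z) + 2 * nsq (?v z))"
      by (intro mult_left_mono W(2))
    also have "\<dots> = 2 * (W z * nsq (column_mean a u z)) + 2 * (W z * nsq (?v z))" by (simp only: distrib_left mult.left_commute)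
    finally have "ennreal (W z * nsq (u z)) \<le> ennreal (2 * (W z * nsq (column_mean a u z)) + 2 * (W z * nsq (?v z)))" by (rule ennreal_leI)
    also have "\<dots> = ennreal (2 * (W z * nsq (column_mean a u z))) + ennreal (2 * (W z * nsq (?v z)))"
      by (rule ennreal_plus) (simp_all add: W(2))
    also have "\<dots> = ennreal 2 * (ennreal (W z) * esq (column_mean a u z)) + ennreal 2 * ennreal (W z * nsq (?v z))"
      by (simp only: ennreal_mult'[OF zero_le_numeral] ennreal_mult'[OF W(2)])
    finally show "ennreal (W z * nsq (u z)) \<le> ennreal 2 * (ennreal (W z) * esq (column_mean a u z)) + ennreal 2 * ennreal (W z * nsq (?v z))" .
  qed
  also have "\<dots> = (NN z. ennreal 2 * (ennreal (W z) * esq (column_mean a u z))) + (NN z. ennreal 2 * ennreal (W z * nsq (?v z)))"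
    by (rule nn_integral_add) (use W(1) cm(1) vm in simp_all)
  also have "\<dots> = ennreal 2 * (NN z. ennreal (W z) * esq (column_mean a u z)) + ennreal 2 * (NN z. ennreal (W z * nsq (?v z)))"
    using W(1) cm(1) vm by (intro arg_cong2[where f = "(+)"] nn_integral_cmult) simp_all
  also have "\<dots> \<le> ennreal 2 * (ennreal (1 / 2) * (NN z. esq (column_mean a g1 z))) +
      ennreal 2 * (ennreal (1 / 2) * ((NN z. esq (?h z)) + (NN z. esq (g2 z))))"
    by (intro add_mono mult_left_mono mean osc') simp_all
  also have "\<dots> = (NN z. esq (g1 z)) + (NN z. esq (g2 z))"
    unfolding two add.assoc[symmetric] orth ..
  also have "\<dots> = (NN z. ennreal (nsq (g1 z) + nsq (g2 z)))"
    by (subst nn_integral_add[symmetric]) (use gm hm in \<open>simp_all add: ennreal_plus\<close>)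
  finally show ?thesis .
qed

text \<open>Passes from the representatives back to the Bochner integrals of \<open>q_form\<close>.
  Finiteness of the gradient integral matters, since \<open>enn2real\<close> sends infinity to 0 and
  is monotone only below a finite bound.\<close>

lemma q_form_nonneg:
  fixes V W :: "plane \<Rightarrow> real"
  assumes W: "W \<in> BM" "\<And>z. 0 \<le> W z" and VW: "AE z in lborel. z \<in> strip a \<longrightarrow> V z = W z"
    and u: "u \<in> q_dom V (strip a)" and r: "rect_weak_grad a u' g1 g2"
    and zero: "\<And>z. z \<notin> strip a \<Longrightarrow> u' z = 0 \<and> g1 z = 0 \<and> g2 z = 0"
    and uu': "AE z in lborel. z \<in> strip a \<longrightarrow> u z = u' z"
    and p1: "AE z in lborel. z \<in> strip a \<longrightarrow> weak_partial (strip a) (1, 0) u z = g1 z"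
    and p2: "AE z in lborel. z \<in> strip a \<longrightarrow> weak_partial (strip a) (0, 1) u z = g2 z"
    and L: "weak_partial (strip a) (1, 0) u \<in> L2 (strip a)" "weak_partial (strip a) (0, 1) u \<in> L2 (strip a)"
    and le: "(NN z. ennreal (W z * nsq (u' z))) \<le> (NN z. ennreal (nsq (g1 z) + nsq (g2 z)))"
  shows "0 \<le> q_form V (strip a) u"
proof -
  let ?S = "strip a"
  have S: "?S \<in> sets borel" by (rule borel_open[OF open_strip])
  have m: "u' \<in> BM" "g1 \<in> BM" "g2 \<in> BM"
    and gi: "sq_int g1" "sq_int g2"
    using r unfolding rect_weak_grad_def by blast+
  have B: "(Basis :: (plane) set) = {(1, 0), (0, 1)}" by (auto simp: Basis_prod_def)
  have Bsum: "(\<Sum>e\<in>Basis. nsq (weak_partial ?S e u x)) = nsq (weak_partial ?S (1, 0) u x) + nsq (weak_partial ?S (0, 1) u x)" for x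
    by (simp add: B)
  have "(\<integral>x. nsq (weak_partial ?S (1, 0) u x) + nsq (weak_partial ?S (0, 1) u x) \<partial>lebesgue_on ?S) =
      (sint ?S (\<lambda>x. (nsq (g1 x) + nsq (g2 x))))"
  proof (rule integral_lebesgue_on_AE[OF _ S])
    show "(\<lambda>x. nsq (weak_partial ?S (1, 0) u x) + nsq (weak_partial ?S (0, 1) u x)) \<in> borel_measurable (lebesgue_on ?S)"
      using L unfolding L2_def mem_Collect_eq by (intro borel_measurable_add) (blast dest: borel_measurable_integrable)+
    show "(\<lambda>x. nsq (g1 x) + nsq (g2 x)) \<in> BM" using m by simp
    show "AE x in lborel. x \<in> ?S \<longrightarrow> (cmod (weak_partial ?S (1, 0) u x))\<^sup>2 + nsq (weak_partial ?S (0, 1) u x) = nsq (g1 x) + nsq (g2 x)"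
      using p1 p2 by eventually_elim simp
  qed
  also have "\<dots> = (LINT x|lborel. nsq (g1 x) + nsq (g2 x))"
    using zero by (intro Bochner_Integration.integral_cong) (auto simp: indicator_def)
  also have "\<dots> = enn2real (NN z. ennreal (nsq (g1 z) + nsq (g2 z)))"
    by (rule integral_eq_nn_integral) (use m in simp_all)
  finally have K: "(\<integral>x. (\<Sum>e\<in>Basis. nsq (weak_partial ?S e u x)) \<partial>lebesgue_on ?S) = enn2real (NN z. ennreal (nsq (g1 z) + nsq (g2 z)))"
    unfolding Bsum .
  have "(\<integral>x. V x * nsq (u x) \<partial>lebesgue_on ?S) = (sint ?S (\<lambda>x. (W x * nsq (u' x))))"
  proof (rule integral_lebesgue_on_AE[OF _ S])
    show "(\<lambda>x. V x * nsq (u x)) \<in> borel_measurable (lebesgue_on ?S)"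
      using u unfolding q_dom_def by (blast dest: borel_measurable_integrable)
    show "(\<lambda>x. W x * nsq (u' x)) \<in> BM" using m W by simp
    show "AE x in lborel. x \<in> ?S \<longrightarrow> V x * nsq (u x) = W x * nsq (u' x)"
      using VW uu' by eventually_elim simp
  qed
  also have "\<dots> = (LINT x|lborel. W x * nsq (u' x))"
    using zero by (intro Bochner_Integration.integral_cong) (auto simp: indicator_def)
  also have "\<dots> = enn2real (NN z. ennreal (W z * nsq (u' z)))"
    by (rule integral_eq_nn_integral) (use m W in simp_all)
  also have "\<dots> \<le> enn2real (NN z. ennreal (nsq (g1 z) + nsq (g2 z)))"
  proof (rule enn2real_mono[OF le])
    have "integrable lborel (\<lambda>z. nsq (g1 z) + nsq (g2 z))" using gi by (rule Bochner_Integration.integrable_add)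
    then show "(NN z. ennreal (nsq (g1 z) + nsq (g2 z))) < top"
      by (simp add: integrable_iff_bounded)
  qed
  finally show ?thesis unfolding q_form_def K by simp
qed

text \<open>All conditions become vanishing integrals of \<open>u\<close> over bounded sets:
  full-height rectangles for the mean, and for the remainder each rectangle together with the
  full-height one over its base, whence the factor 2.\<close>

lemma N_minus_bound:
  fixes V :: "plane \<Rightarrow> real"
  assumes a: "0 < a" and V: "\<And>x. x \<in> strip a \<Longrightarrow> 0 \<le> V x" and int: "integrable_on_bounded_subsets (strip a) V"
    and c: "0 < c" "c \<le> osc_threshold a" "c \<le> a / 272"
    and Gfin: "finite {n. c < G a V n}" and Dfin: "\<And>n. D a V n < \<infinity>" "finite {n. ennreal c < D a V n}"
  obtains k :: nat where "N_minus V (strip a) \<le> enat k"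
    "real k \<le> 1 + (sqrt (32 / a) + 1 / sqrt c) * (\<Sum>n | c < G a V n. sqrt (G a V n)) +
      2 * (osc_factor a c * (\<Sum>n | ennreal c < D a V n. enn2real (D a V n)))"
proof -
  let ?S = "strip a"
  have S: "?S \<in> sets borel" by (rule borel_open[OF open_strip])
  obtain W where W: "W \<in> BM" "\<And>z. 0 \<le> W z" "\<And>z. z \<notin> ?S \<Longrightarrow> W z = 0"
    "AE z in lborel. z \<in> ?S \<longrightarrow> V z = W z"
    "\<And>B. B \<in> sets borel \<Longrightarrow> bounded B \<Longrightarrow> (NN z. ind B z * ennreal (W z)) < \<infinity>"
    by (rule potential_representative[OF _ int]) (rule V, assumption, rule that)
  have cf: "AE x in lborel. column_weight a W x < \<infinity>"
    by (rule column_weight_finite[OF W(1) a]) (rule W(5))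
  define w where "w x = enn2real (column_weight a W x)" for x
  have wm: "w \<in> BM" using column_weight_measurable[OF W(1), of a] by (simp add: w_def[abs_def])
  have w0: "0 \<le> w x" for x by (simp add: w_def)
  have \<gamma>: "(NN x. ind (I_int n) x * ennreal (dyad_weight n x * w x)) = ennreal (G a V n)" for n
    unfolding w_def dyad_weight_def by (rule G_eq_column_weight(1)[OF W(1,2,4) a, symmetric]) (rule W(5))
  have G0: "0 \<le> G a V n" for n by (rule G_eq_column_weight(2)[OF W(1,2,4) a]) (rule W(5))
  have VW: "AE x in lborel. norm_B {0<..<a} (\<lambda>y. W (x, y)) = norm_B {0<..<a} (\<lambda>y. V (x, y))"
    using AE_sections[OF W(4)]
  proof eventually_elim
    case (elim x)
    have "(\<lambda>y. W (x, y)) \<in> BM"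
      by (rule measurable_compose[OF _ W(1)]) (intro borel_measurable_continuous_onI continuous_intros)
    then show ?case by (rule norm_B_cong_AE) (use elim in simp_all)
  qed
  show ?thesis
  proof (rule column_functionals[OF wm w0 \<gamma> G0 c(1,3) a Gfin])
    fix S1 :: "(plane) set"
    assume S1: "finite S1" "real (card S1) \<le> 1 + (sqrt (32 / a) + 1 / sqrt c) * (\<Sum>n | c < G a V n. sqrt (G a V n))"
      and col: "\<And>U gr. ae_primitive U gr \<Longrightarrow> (\<And>c d. (c, d) \<in> S1 \<Longrightarrow> (sint {c..d} U) = 0) \<Longrightarrow>
        (NN x. ennreal (w x) * esq (U x)) \<le> ennreal (a / 2) * (NN x. esq (gr x))"
    show ?thesis
    proof (rule oscillation_functionals[OF a W(1,2,3) cf VW c(1,2) Dfin])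
      fix S2 :: "(plane) set set"
      assume S2: "finite S2" "real (card S2) \<le> osc_factor a c * (\<Sum>n | ennreal c < D a V n. enn2real (D a V n))"
        "\<And>E. E \<in> S2 \<Longrightarrow> \<exists>p1 q1 p2 q2. E = {p1..q1} \<times> {p2..q2} \<and> 0 \<le> p2 \<and> q2 \<le> a"
        and osc: "\<And>u g1 g2. rect_weak_grad a u g1 g2 \<Longrightarrow> (\<And>E. E \<in> S2 \<Longrightarrow> (sint E u) = 0) \<Longrightarrow>
          (\<And>n::int. (sint (cell a n) u) = 0) \<Longrightarrow>
          (NN z. ennreal (W z * nsq (u z))) \<le> ennreal (1 / 2) * (NN z. ennreal (nsq (g1 z) + nsq (g2 z)))"
      define \<E> where "\<E> = (\<lambda>(p, q). {p..q} \<times> {0<..<a}) ` S1 \<union> (S2 \<union> (\<lambda>E. fst ` E \<times> {0<..<a}) ` S2)"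
      have fin\<E>: "finite \<E>" using S1 S2 by (simp add: \<E>_def)
      have "card \<E> \<le> card S1 + (card S2 + card S2)"
        unfolding \<E>_def by (intro order_trans[OF card_Un_le] add_mono card_image_le S1 S2 order_refl)
      then have "real (card \<E>) \<le> real (card S1) + 2 * real (card S2)" by linarith
      with S1(2) S2(2) have card: "real (card \<E>) \<le> 1 + (sqrt (32 / a) + 1 / sqrt c) * (\<Sum>n | c < G a V n. sqrt (G a V n)) +
          2 * (osc_factor a c * (\<Sum>n | ennreal c < D a V n. enn2real (D a V n)))" by linarith
      have E1: "E \<in> sets borel \<and> bounded E" if "E \<in> \<E>" for E
      proof -
        have b: "{p..q} \<times> {0<..<a} \<in> sets borel \<and> bounded ({p..q} \<times> {0<..<a})" for p q :: real
          by (auto intro!: borel_Times bounded_Times)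
        have b2: "E \<in> sets borel \<and> bounded E \<and> fst ` E \<times> {0<..<a} \<in> sets borel \<and> bounded (fst ` E \<times> {0<..<a})" if "E \<in> S2" for E
        proof -
          from S2(3)[OF that] obtain p1 q1 p2 q2 where e: "E = {p1..q1} \<times> {p2..q2}" by blast
          have "E \<in> sets borel \<and> bounded E" unfolding e by (auto intro!: borel_Times bounded_Times)
          moreover have "fst ` E = {p1..q1} \<or> fst ` E = {}" unfolding e by auto
          ultimately show ?thesis using b[of p1 q1] by auto
        qed
        from that show ?thesis unfolding \<E>_def using b b2 by auto
      qed
      have "N_minus V ?S \<le> enat (card \<E>)"
      proof (rule N_minus_le_card[OF S fin\<E> E1])
        fix u assume u: "u \<in> q_dom V ?S" and z: "\<And>E. E \<in> \<E> \<Longrightarrow> (\<integral>x. ind E x *\<^sub>R u x \<partial>lebesgue_on ?S) = 0"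
        have uW: "u \<in> W12 ?S" using u by (simp add: q_dom_def)
        obtain u' g1 g2 where r: "rect_weak_grad a u' g1 g2" and zero: "\<And>z. z \<notin> ?S \<Longrightarrow> u' z = 0 \<and> g1 z = 0 \<and> g2 z = 0"
          and uu': "AE z in lborel. z \<in> ?S \<longrightarrow> u z = u' z"
          and p1: "AE z in lborel. z \<in> ?S \<longrightarrow> weak_partial ?S (1, 0) u z = g1 z"
          and p2: "AE z in lborel. z \<in> ?S \<longrightarrow> weak_partial ?S (0, 1) u z = g2 z"
          and L: "weak_partial ?S (1, 0) u \<in> L2 ?S" "weak_partial ?S (0, 1) u \<in> L2 ?S"
          by (rule W12_rect_weak_grad[OF uW]) (rule that)
        have um: "u' \<in> BM" using r unfolding rect_weak_grad_def by blast
        have Z: "(sint E u') = 0" if "E \<in> \<E>" for E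
        proof -
          have Em: "E \<in> sets borel" and Eb: "bounded E" using E1[OF that] by auto
          have "u \<in> L2 ?S" using uW by (simp add: W12_def)
          have uE: "AE x in lborel. x \<in> ?S \<longrightarrow> ind E x *\<^sub>R u x = ind E x *\<^sub>R u' x"
            using uu' by eventually_elim simp
          have mE: "(\<lambda>x. ind E x *\<^sub>R u' x) \<in> BM" using um Em by simp
          from \<open>u \<in> L2 ?S\<close> have i: "integrable (lebesgue_on ?S) (\<lambda>x. ind E x *\<^sub>R u x)"
            by (rule integrable_lebesgue_on_indicator_L2[OF _ S Em Eb])
          have "(\<integral>x. ind E x *\<^sub>R u x \<partial>lebesgue_on ?S) = (sint ?S (\<lambda>x. (ind E x *\<^sub>R u' x)))"
            by (rule integral_lebesgue_on_AE[OF borel_measurable_integrable[OF i] S mE uE])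
          also have "\<dots> = (sint E u')"
            using zero by (intro Bochner_Integration.integral_cong) (auto simp: indicator_def)
          finally show ?thesis using z[OF that] by simp
        qed
        have "(NN z. ennreal (W z * nsq (u' z))) \<le> (NN z. ennreal (nsq (g1 z) + nsq (g2 z)))"
        proof (rule potential_bound[OF a W(1,2) cf r _ col[unfolded w_def] osc S2(3)])
          show "u' z = 0 \<and> g1 z = 0" if "z \<notin> ?S" for z using zero[OF that] by blast
          show "(sint ({p..q} \<times> {0<..<a}) u') = 0" if "(p, q) \<in> S1" for p q
            by (rule Z) (use that in \<open>force simp: \<E>_def\<close>)
          show "(sint E u') = 0" if "E \<in> S2" for E
            by (rule Z) (use that in \<open>simp add: \<E>_def\<close>)
          show "(sint (fst ` E \<times> {0<..<a}) u') = 0" if "E \<in> S2" for E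
            by (rule Z) (use that in \<open>simp add: \<E>_def\<close>)
        qed
        from q_form_nonneg[OF W(1,2,4) u r _ uu' p1 p2 L this] show "0 \<le> q_form V ?S u" using zero by blast
      qed
      then show ?thesis using card by (rule that)
    qed
  qed
qed

theorem theorem3p1:
  fixes a :: real
  assumes "a > 0"
  shows "\<exists>c>0. \<exists>C>0. \<forall>V :: real \<times> real \<Rightarrow> real.
           (\<forall>x\<in>strip a. V x \<ge> 0) \<longrightarrow> integrable_on_bounded_subsets (strip a) V \<longrightarrow>
           ennreal_of_enat (N_minus V (strip a)) \<le>
             1 + ennreal C * ((\<Sum>\<^sub>\<infinity>n\<in>{n. G a V n > c}. ennreal (sqrt (G a V n)))
                            + (\<Sum>\<^sub>\<infinity>n\<in>{n. D a V n > ennreal c}. D a V n))"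
proof -
  \<comment> \<open>One threshold for both sums: the first bound serves the remainder, the second
    the mean.\<close>
  define c where "c = min (osc_threshold a) (a / 272)"
  have "0 < osc_threshold a" using assms by (simp add: osc_threshold_def)
  then have c: "0 < c" "c \<le> osc_threshold a" "c \<le> a / 272" using assms by (simp_all add: c_def)
  define C1 where "C1 = sqrt (32 / a) + 1 / sqrt c"
  define C2 where "C2 = 2 * osc_factor a c"
  have C1: "0 < C1" using assms c unfolding C1_def by (intro add_pos_pos) simp_all
  have C2: "0 \<le> C2" using assms c unfolding C2_def osc_factor_def by (intro mult_nonneg_nonneg add_nonneg_nonneg divide_nonneg_nonneg) auto
  \<comment> \<open>The single constant \<open>C1 + C2\<close> dominates the coefficients of both
    sums.\<close>
  have "ennreal_of_enat (N_minus V (strip a)) \<le> 1 + ennreal (C1 + C2) * ((\<Sum>\<^sub>\<infinity>n\<in>{n. G a V n > c}. ennreal (sqrt (G a V n))) + (\<Sum>\<^sub>\<infinity>n\<in>{n. D a V n > ennreal c}. D a V n))"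
    if V: "\<forall>x\<in>strip a. V x \<ge> 0" "integrable_on_bounded_subsets (strip a) V" for V :: "plane \<Rightarrow> real"
  proof (cases "(\<Sum>\<^sub>\<infinity>n\<in>{n. G a V n > c}. ennreal (sqrt (G a V n))) = \<infinity> \<or> (\<Sum>\<^sub>\<infinity>n\<in>{n. D a V n > ennreal c}. D a V n) = \<infinity>")
    \<comment> \<open>With an infinite sum and \<open>C1 + C2\<close> positive, the right side is
      infinite.\<close>
    case True
    then have inf: "(\<Sum>\<^sub>\<infinity>n\<in>{n. G a V n > c}. ennreal (sqrt (G a V n))) + (\<Sum>\<^sub>\<infinity>n\<in>{n. D a V n > ennreal c}. D a V n) = \<infinity>" by auto
    show ?thesis unfolding inf using C1 C2 by (simp add: ennreal_mult_top del: ennreal_plus)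
  next
    case False
    let ?G = "{n. G a V n > c}" and ?D = "{n. D a V n > ennreal c}"
    have fG: "finite ?G"
    proof (rule infsum_ennreal_finite(1))
      show "0 < sqrt c" using c by simp
      show "ennreal (sqrt c) \<le> ennreal (sqrt (G a V n))" if "n \<in> ?G" for n
        using that by (intro ennreal_leI real_sqrt_le_mono) simp
    qed (use False in blast)
    have dD: "ennreal c \<le> D a V n" if "n \<in> ?D" for n using that by simp
    have nD: "(\<Sum>\<^sub>\<infinity>n\<in>?D. D a V n) \<noteq> \<infinity>" using False by blast
    have fD: "finite ?D" by (rule infsum_ennreal_finite(1)[OF c(1) _ nD]) (rule dD)
    have D1: "D a V n < \<infinity>" if "n \<in> ?D" for n by (rule infsum_ennreal_finite(2)[OF c(1) _ nD that]) (rule dD)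
    \<comment> \<open>Cells left out of the sum have \<open>D\<close> at most \<open>c\<close>, so
      \<open>D\<close> is finite in every cell.\<close>
    have D2: "D a V n < \<infinity>" for n
      using D1[of n] by (cases "ennreal c < D a V n") (auto simp: not_less order_le_less_trans)
    obtain k where k: "N_minus V (strip a) \<le> enat k"
      "real k \<le> 1 + C1 * (\<Sum>n\<in>?G. sqrt (G a V n)) + 2 * (osc_factor a c * (\<Sum>n\<in>?D. enn2real (D a V n)))"
      by (rule N_minus_bound[OF assms _ V(2) c fG D2 fD]) (rule bspec[OF V(1)], assumption, rule that, assumption, simp only: C1_def)
    let ?x = "\<Sum>n\<in>?G. sqrt (G a V n)" and ?y = "\<Sum>n\<in>?D. enn2real (D a V n)"
    have xy: "0 \<le> ?x" "0 \<le> ?y" using c by (auto intro!: sum_nonneg)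
    have X: "(\<Sum>\<^sub>\<infinity>n\<in>?G. ennreal (sqrt (G a V n))) = ennreal ?x"
      unfolding infsum_finite[OF fG] using c by (intro sum_ennreal) auto
    have "(\<Sum>\<^sub>\<infinity>n\<in>?D. D a V n) = (\<Sum>n\<in>?D. ennreal (enn2real (D a V n)))"
      unfolding infsum_finite[OF fD] using D2 by (intro sum.cong) (simp_all add: less_top)
    then have Y: "(\<Sum>\<^sub>\<infinity>n\<in>?D. D a V n) = ennreal ?y" by (simp add: sum_ennreal)
    obtain j where j: "N_minus V (strip a) = enat j" "j \<le> k" using k(1) by (cases "N_minus V (strip a)") auto
    then have "ennreal_of_enat (N_minus V (strip a)) \<le> ennreal (real k)" by (simp add: ennreal_of_nat_eq_real_of_nat)
    also have "\<dots> \<le> ennreal (1 + (C1 + C2) * (?x + ?y))"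
    proof (rule ennreal_leI)
      have "0 \<le> C1 * ?y" "0 \<le> C2 * ?x" using xy C1 C2 by simp_all
      then show "real k \<le> 1 + (C1 + C2) * (?x + ?y)" using k(2) by (simp add: C2_def algebra_simps)
    qed
    also have "\<dots> = 1 + ennreal (C1 + C2) * (ennreal ?x + ennreal ?y)"
    proof -
      have "ennreal (1 + C * (x + y)) = 1 + ennreal C * (ennreal x + ennreal y)" if "0 \<le> C" "0 \<le> x" "0 \<le> y" for C x y
        using that by (simp add: ennreal_mult')
      from this[OF _ xy] C1 C2 show ?thesis by simp
    qed
    finally show ?thesis unfolding X Y .
  qed
  moreover have "0 < C1 + C2" using C1 C2 by simp
  ultimately show ?thesis using c(1) by blast
qed

end
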